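(* Let $d\ge 1$, $\sigma>0$, $W>0$, $p\in(2,\infty]$ and $r\in\left(\frac{dp}{p-2},\infty\right]$. Let $f_0\in L^{r^*}(\mathbb R^d)$, $u\in \mathcal U=L^p([0,1],L^r(\mathbb R^d))$ and $v\in\mathcal V=L^p([0,1],V)$. Then there is a unique mild solution $f\in C^0([0,1],L^{r^*}(\mathbb R^d))\cap C^0((0,1],W^{1,r^*}(\mathbb R^d))$ of $$\partial_t f(t,x)=\frac{\sigma^2}{2}\Delta f(t,x)+I(f(t,x))+u(t,x)|\nabla f(t,x)|-v(t,x)^T\nabla f(t,x),\quad (t,x)\in[0,1]\times\mathbb R^d,$$ that is, a unique $f$ in this space satisfying, for $t\in[0,1]$, the integral equation $$f(t)=\eta_{\sigma\sqrt t}\star f_0+\int_0^t\eta_{\sigma\sqrt{t-s}}\star\left(I(f(s))+u(s)|\nabla f(s)|-v(s)^T\nabla f(s)\right)ds,$$ and such that $$\|f\|_P=\max\left(\sup_{t\in[0,1]}\|f(t)\|_{L^{r^*}},\ \sup_{t\in(0,1]}\sqrt t\,\|f(t)\|_{W^{1,r^*}}\right)<\infty.$$ Moreover, $\lim_{t\to0}f(t)=f_0$ in $L^{r^*}(\mathbb R^d)$.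
   Context: $r^*=r/(r-1)$ is the conjugate exponent of $r$, so $1/r+1/r^*=1$ (with $r^*=1$ if $r=\infty$). For $p=\infty$, $\frac{dp}{p-2}$ is read as $d$. $L^p([0,1],B)$ is the Bochner space of $p$-integrable functions with values in the Banach space $B$. $W^{1,q}(\mathbb R^d)$ is the usual Sobolev space. $V$ is a fixed Hilbert space of vector fields on $\mathbb R^d$ continuously embedded in $C^1(\mathbb R^d,\mathbb R^d)$, the Banach space of continuously differentiable vector fields that are bounded together with their first derivatives, with the sup norm of the fields and their first derivatives. The function $I:\mathbb R\to\mathbb R$ is $I(\xi)=W\xi^2(\xi-1)^2(\xi-1/2)\,\mathbf 1_{[0,1]}(\xi)$. For $\tau>0$, $\eta_\tau(x)=\frac{\exp(-|x|^2/2\tau^2)}{(2\pi)^{d/2}\tau^d}$ is the Gaussian on $\mathbb R^d$, $\star$ denotes convolution on $\mathbb R^d$, and $\eta_0\star h=h$. $|\cdot|$ is the Euclidean norm and $\nabla$ is the gradient in $x$. *)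

theory Defs
  imports "HOL-Analysis.Analysis" "HOL-Probability.Essential_Supremum"
begin

section \<open>Lebesgue spaces\<close>

text \<open>
  Elements of an \<open>L\<^sup>p\<close> space are represented by functions; two functions represent the same
  element iff they agree almost everywhere. The value of \<open>Lp_norm\<close> is meaningful only on
  \<open>Lp_space\<close>. Exponents range over \<open>(0,\<infinity>]\<close>.
\<close>

definition Lp_space :: "'t measure \<Rightarrow> ennreal \<Rightarrow> ('t \<Rightarrow> 'b::euclidean_space) set" where
  "Lp_space M p = {h \<in> borel_measurable M.
     if p = \<infinity> then esssup M (\<lambda>x. ereal (norm (h x))) < \<infinity>
     else integrable M (\<lambda>x. norm (h x) powr enn2real p)}"

definition Lp_norm :: "'t measure \<Rightarrow> ennreal \<Rightarrow> ('t \<Rightarrow> 'b::euclidean_space) \<Rightarrow> real" where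
  "Lp_norm M p h =
     (if p = \<infinity> then real_of_ereal (esssup M (\<lambda>x. ereal (norm (h x))))
      else (\<integral>x. norm (h x) powr enn2real p \<partial>M) powr (1 / enn2real p))"

definition conj_exponent :: "ennreal \<Rightarrow> ennreal" where
  "conj_exponent r = (if r = \<infinity> then 1 else r / (r - 1))"

section \<open>Functions with values in a seminormed space\<close>

text \<open>
  A seminormed space is given by a carrier \<open>X\<close> and a seminorm \<open>N\<close>, where \<open>N h = 0\<close> identifies
  representatives of the same element. It is instantiated with \<open>Lp_space\<close>, Sobolev spaces and
  (with \<open>X = UNIV\<close>, \<open>N = norm\<close>) with types.
\<close>

definition strongly_measurable_in ::
    "'t measure \<Rightarrow> 'b::minus set \<Rightarrow> ('b \<Rightarrow> real) \<Rightarrow> ('t \<Rightarrow> 'b) \<Rightarrow> bool" where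
  "strongly_measurable_in M X N F \<longleftrightarrow>
     (AE t in M. F t \<in> X) \<and>
     (\<exists>S. (\<forall>i::nat. simple_function M (S i) \<and> S i ` space M \<subseteq> X) \<and>
          (AE t in M. (\<lambda>i. N (S i t - F t)) \<longlonglongrightarrow> 0))"

text \<open>
  The measure \<open>M\<close> is meant to be complete, so that \<open>\<lambda>t. N (F t)\<close> is measurable for strongly
  measurable \<open>F\<close>.
\<close>

definition bochner_Lp ::
    "'t measure \<Rightarrow> ennreal \<Rightarrow> 'b::minus set \<Rightarrow> ('b \<Rightarrow> real) \<Rightarrow> ('t \<Rightarrow> 'b) set" where
  "bochner_Lp M p X N =
     {F. strongly_measurable_in M X N F \<and> (\<lambda>t. N (F t)) \<in> Lp_space M p}"

definition continuous_on_in ::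
    "real set \<Rightarrow> 'b::minus set \<Rightarrow> ('b \<Rightarrow> real) \<Rightarrow> (real \<Rightarrow> 'b) \<Rightarrow> bool" where
  "continuous_on_in T X N F \<longleftrightarrow>
     (\<forall>t\<in>T. F t \<in> X) \<and> (\<forall>t\<in>T. ((\<lambda>s. N (F s - F t)) \<longlongrightarrow> 0) (at t within T))"

text \<open>
  Bochner integral of an \<open>L\<^sup>q\<close>-valued function over a complete finite measure space, as the limit
  of integrals of simple functions (compare the library's \<^const>\<open>has_bochner_integral\<close>, which
  requires the values to lie in a Banach space given by a type).
\<close>

definition simple_integral_fun :: "'t measure \<Rightarrow> ('t \<Rightarrow> 'a \<Rightarrow> real) \<Rightarrow> 'a \<Rightarrow> real" where
  "simple_integral_fun M S = (\<lambda>x. \<Sum>h\<in>S ` space M. measure M {t \<in> space M. S t = h} * h x)"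

definition has_Lq_integral ::
    "'t measure \<Rightarrow> ennreal \<Rightarrow> ('t \<Rightarrow> 'a::euclidean_space \<Rightarrow> real) \<Rightarrow> ('a \<Rightarrow> real) \<Rightarrow> bool" where
  "has_Lq_integral M q F g \<longleftrightarrow>
     g \<in> Lp_space lebesgue q \<and>
     strongly_measurable_in M (Lp_space lebesgue q) (Lp_norm lebesgue q) F \<and>
     (\<exists>S. (\<forall>i::nat. simple_function M (S i) \<and> S i ` space M \<subseteq> Lp_space lebesgue q) \<and>
          (\<lambda>i. \<integral>\<^sup>+t. ennreal (Lp_norm lebesgue q (S i t - F t)) \<partial>M) \<longlonglongrightarrow> 0 \<and>
          (\<lambda>i. Lp_norm lebesgue q (simple_integral_fun M (S i) - g)) \<longlonglongrightarrow> 0)"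

section \<open>Differentiable functions and Sobolev spaces\<close>

primrec Ck :: "nat \<Rightarrow> ('a::euclidean_space \<Rightarrow> 'b::real_normed_vector) \<Rightarrow> bool" where
  "Ck 0 h \<longleftrightarrow> continuous_on UNIV h"
| "Ck (Suc k) h \<longleftrightarrow>
     (\<exists>D. (\<forall>x. (h has_derivative D x) (at x)) \<and> (\<forall>e. Ck k (\<lambda>x. D x e)))"

definition test_function :: "('a::euclidean_space \<Rightarrow> real) \<Rightarrow> bool" where
  "test_function \<phi> \<longleftrightarrow> (\<forall>k. Ck k \<phi>) \<and> compact (closure {x. \<phi> x \<noteq> 0})"

definition weak_gradient :: "('a::euclidean_space \<Rightarrow> real) \<Rightarrow> ('a \<Rightarrow> 'a) \<Rightarrow> bool" where
  "weak_gradient h g \<longleftrightarrow>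
     (\<forall>K. compact K \<longrightarrow> h absolutely_integrable_on K \<and> g absolutely_integrable_on K) \<and>
     (\<forall>\<phi>. test_function \<phi> \<longrightarrow> (\<forall>b\<in>Basis.
        (\<integral>x. h x * frechet_derivative \<phi> (at x) b \<partial>lebesgue) =
        - (\<integral>x. (g x \<bullet> b) * \<phi> x \<partial>lebesgue)))"

text \<open>A weak gradient is unique up to null sets; \<open>grad h\<close> is one representative.\<close>

definition grad :: "('a::euclidean_space \<Rightarrow> real) \<Rightarrow> 'a \<Rightarrow> 'a" where
  "grad h = (SOME g. weak_gradient h g)"

definition W1_space :: "ennreal \<Rightarrow> ('a::euclidean_space \<Rightarrow> real) set" where
  "W1_space q = {h \<in> Lp_space lebesgue q. \<exists>g \<in> Lp_space lebesgue q. weak_gradient h g}"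

definition W1_norm :: "ennreal \<Rightarrow> ('a::euclidean_space \<Rightarrow> real) \<Rightarrow> real" where
  "W1_norm q h = Lp_norm lebesgue q h + Lp_norm lebesgue q (grad h)"

definition C1_fields :: "('a::euclidean_space \<Rightarrow> 'a) set" where
  "C1_fields = {w. Ck 1 w \<and> bounded (range w) \<and>
                   bounded (range (\<lambda>x. onorm (frechet_derivative w (at x))))}"

definition C1_norm :: "('a::euclidean_space \<Rightarrow> 'a) \<Rightarrow> real" where
  "C1_norm w = max (SUP x. norm (w x)) (SUP x. onorm (frechet_derivative w (at x)))"

text \<open>
  A Hilbert space of vector fields is a Hilbert space \<open>'v\<close> together with the map \<open>emb\<close> that sends
  each of its elements injectively and linearly to a vector field.
\<close>

definition continuously_embedded_in_C1 ::
    "('v::{real_inner,banach} \<Rightarrow> 'a::euclidean_space \<Rightarrow> 'a) \<Rightarrow> bool" where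
  "continuously_embedded_in_C1 emb \<longleftrightarrow>
     inj emb \<and> (\<forall>x. linear (\<lambda>w. emb w x)) \<and> range emb \<subseteq> C1_fields \<and>
     (\<exists>C. \<forall>w. C1_norm (emb w) \<le> C * norm w)"

section \<open>The equation\<close>

definition reaction :: "real \<Rightarrow> real \<Rightarrow> real" where
  "reaction W \<xi> = W * \<xi>\<^sup>2 * (\<xi> - 1)\<^sup>2 * (\<xi> - 1/2) * indicator {0..1} \<xi>"

definition gaussian :: "real \<Rightarrow> 'a::euclidean_space \<Rightarrow> real" where
  "gaussian \<tau> x = exp (- (norm x)\<^sup>2 / (2 * \<tau>\<^sup>2)) / ((2 * pi) powr (DIM('a) / 2) * \<tau> ^ DIM('a))"

definition gauss_conv :: "real \<Rightarrow> ('a::euclidean_space \<Rightarrow> real) \<Rightarrow> 'a \<Rightarrow> real" where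
  "gauss_conv \<tau> h =
     (if \<tau> = 0 then h else (\<lambda>x. \<integral>y. gaussian \<tau> (x - y) * h y \<partial>lebesgue))"

definition nonlinearity ::
    "real \<Rightarrow> (real \<Rightarrow> 'a::euclidean_space \<Rightarrow> real) \<Rightarrow> (real \<Rightarrow> 'a \<Rightarrow> 'a) \<Rightarrow>
     (real \<Rightarrow> 'a \<Rightarrow> real) \<Rightarrow> real \<Rightarrow> 'a \<Rightarrow> real" where
  "nonlinearity W u v f s =
     (\<lambda>x. reaction W (f s x) + u s x * norm (grad (f s) x) - v s x \<bullet> grad (f s) x)"

text \<open>
  The integrand is a Bochner integrable function of \<open>s\<close> with values in \<open>L\<^sup>q\<close>, and the integral
  equation is an identity in \<open>L\<^sup>q\<close>, i.e. almost everywhere in \<open>x\<close>.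
\<close>

definition mild_solution ::
    "real \<Rightarrow> real \<Rightarrow> ennreal \<Rightarrow> ('a::euclidean_space \<Rightarrow> real) \<Rightarrow>
     (real \<Rightarrow> 'a \<Rightarrow> real) \<Rightarrow> (real \<Rightarrow> 'a \<Rightarrow> 'a) \<Rightarrow> (real \<Rightarrow> 'a \<Rightarrow> real) \<Rightarrow> bool" where
  "mild_solution \<sigma> W q f0 u v f \<longleftrightarrow>
     continuous_on_in {0..1} (Lp_space lebesgue q) (Lp_norm lebesgue q) f \<and>
     continuous_on_in {0<..1} (W1_space q) (W1_norm q) f \<and>
     (\<forall>t\<in>{0..1}. \<exists>g.
        has_Lq_integral (lebesgue_on {0..t}) q
          (\<lambda>s. gauss_conv (\<sigma> * sqrt (t - s)) (nonlinearity W u v f s)) g \<and>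
        (AE x in lebesgue. f t x = gauss_conv (\<sigma> * sqrt t) f0 x + g x))"

definition P_norm :: "ennreal \<Rightarrow> (real \<Rightarrow> 'a::euclidean_space \<Rightarrow> real) \<Rightarrow> ennreal" where
  "P_norm q f = max (SUP t\<in>{0..1}. ennreal (Lp_norm lebesgue q (f t)))
                    (SUP t\<in>{0<..1}. ennreal (sqrt t * W1_norm q (f t)))"

end

theory Submission
  imports Defs "HOL-Library.Function_Algebras" "HOL-Probability.Distributions"
begin

text \<open>
  Let \<open>q = r\<^sup>*\<close>. By Hoelder, \<open>u |\<nabla>f|\<close> lies in \<open>L\<^sup>1\<close> with norm at most \<open>\<parallel>u\<parallel>\<^sub>r \<parallel>\<nabla>f\<parallel>\<^sub>q\<close>, while \<open>I(f) - v\<^sup>T \<nabla>f\<close>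
  lies in \<open>L\<^sup>q\<close>. By Young, convolution with the heat kernel and its gradient at time \<open>t\<close> maps \<open>L\<^sup>1\<close>
  into \<open>W\<^sup>1\<^sup>,\<^sup>q\<close> with norm of order \<open>t powr - a\<close>, where \<open>a = 1/2 + d (1 - 1/q) / 2 = 1/2 + d / (2 r)\<close>. For
  \<open>\<parallel>f(s)\<parallel>\<close> of order \<open>s powr - 1/2\<close> in \<open>W\<^sup>1\<^sup>,\<^sup>q\<close> the Duhamel integral is thus controlled by the integral of
  \<open>(t - s) powr - a * s powr - 1/2 * w s\<close> with \<open>w \<in> L\<^sup>p\<close>, which is of order \<open>t powr - 1/2\<close> because
  \<open>a < 1 - 1/p\<close>, that is, \<open>r > d p / (p - 2)\<close>. The inequality is strict, so \<open>a\<close> may be replaced by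
  \<open>a + \<theta>\<close>; the surplus makes the fixed point map a contraction for the norm weighted with
  \<open>sqrt t * exp (- \<mu> t)\<close>, \<open>\<mu>\<close> large. The heat kernel itself is less singular than its gradient by
  a factor \<open>sqrt t\<close>, so the Duhamel integral tends to 0 in \<open>L\<^sup>q\<close> as \<open>t\<close> tends to 0.
\<close>

section \<open>Integration with values in a seminormed space\<close>

text \<open>\<open>grad\<close> picks an arbitrary representative and need not be additive, and
  \<open>f0\<close> need not have a gradient. The fixed point problem is therefore posed for pairs
  of a function and a weak gradient, on \<open>(0,1]\<close> only, and sources are convolved with
  the pair of the Gaussian and its gradient. These pairs form a complete space, so a Bochner
  integral taken there is again such a pair: differentiation under the Duhamel integral comes for
  free, and the projection to the first component returns the integral equation in
  \<open>L^q\<close>. Time 0 is a null set for the integral; its value is filled in at the end. The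
  singular time integral is handled without the Beta function:
  \<open>sqrt t \<le> sqrt (t - s) + sqrt s\<close> separates the two singularities, and Young's
  inequality with exponents \<open>P / (P - 1)\<close> and \<open>P\<close> separates the kernel
  from \<open>w\<close>, which is where \<open>a * (P / (P - 1)) < 1\<close> enters. All estimates
  are for seminorms on representatives, so fixed points exist and are unique up to seminorm 0;
  uniqueness of the mild solution is the same contraction applied to two solutions.\<close>

instantiation "fun" :: (type, real_vector) real_vector
begin

definition "c *\<^sub>R f = (\<lambda>x. c *\<^sub>R f x)"

instance
  by standard (auto simp: scaleR_fun_def fun_eq_iff scaleR_add_right scaleR_add_left)

end

lemma scaleR_fun_apply [simp]: "(c *\<^sub>R f) x = c *\<^sub>R f x"
  by (simp add: scaleR_fun_def)

lemma sum_fun_apply: "(\<Sum>i\<in>A. f i) x = (\<Sum>i\<in>A. f i x)"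
  by (induction A rule: infinite_finite_induct) auto

lemma simple_integral_fun_eq:
  fixes S :: "'t \<Rightarrow> 'a \<Rightarrow> real"
  shows "simple_integral_fun M S = Bochner_Integration.simple_bochner_integral M S"
  by (simp add: fun_eq_iff simple_integral_fun_def simple_bochner_integral_def sum_fun_apply)

lemma LIMSEQ_0_le:
  fixes f g :: "nat \<Rightarrow> real"
  assumes "g \<longlonglongrightarrow> 0" "\<And>i. 0 \<le> f i" "\<And>i. f i \<le> g i"
  shows "f \<longlonglongrightarrow> 0"
  by (rule Lim_null_comparison[OF _ assms(1)]) (use assms in simp)

text \<open>Preimages under \<open>f\<close> and \<open>g\<close> agree up to a null set, and
  completeness makes such sets measurable together.\<close>

lemma (in complete_measure) borel_measurable_AE_eq:
  fixes f g :: "'a \<Rightarrow> 'c::topological_space"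
  assumes f: "f \<in> borel_measurable M" and ae: "AE t in M. f t = g t"
  shows "g \<in> borel_measurable M"
proof (rule measurableI)
  fix A :: "'c set" assume "A \<in> sets borel"
  then have 1: "f -` A \<inter> space M \<in> sets M"
    using f by (rule measurable_sets[rotated])
  have 2: "AE t in M. t \<in> f -` A \<inter> space M \<longleftrightarrow> t \<in> g -` A \<inter> space M"
    using ae by eventually_elim auto
  show "g -` A \<inter> space M \<in> sets M"
    by (rule in_sets_AE[OF 2 1]) auto
qed auto

lemma (in complete_measure) borel_measurable_AE_LIMSEQ:
  fixes g :: "'a \<Rightarrow> 'c::metric_space"
  assumes f: "\<And>i. f i \<in> borel_measurable M" and ae: "AE t in M. (\<lambda>i. f i t) \<longlonglongrightarrow> g t"
  shows "g \<in> borel_measurable M"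
proof -
  obtain Z where Z: "Z \<in> null_sets M" "{t \<in> space M. \<not> (\<lambda>i. f i t) \<longlonglongrightarrow> g t} \<subseteq> Z"
    using ae by (auto simp: eventually_ae_filter)
  \<comment> \<open>On the exceptional set all functions are given one common value, which turns the
    convergence into convergence everywhere.\<close>
  have "(\<lambda>t. if t \<in> Z then undefined else g t) \<in> borel_measurable M"
  proof (rule borel_measurable_LIMSEQ_metric)
    show "(\<lambda>t. if t \<in> Z then undefined else f i t) \<in> borel_measurable M" for i
      using f Z by (intro measurable_If_set) auto
    show "(\<lambda>i. if t \<in> Z then undefined else f i t) \<longlonglongrightarrow> (if t \<in> Z then undefined else g t)"
      if "t \<in> space M" for t
      using that Z by auto
  qed
  then show ?thesis
    by (rule borel_measurable_AE_eq) (use AE_not_in[OF Z(1)] in eventually_elim, auto)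
qed

section \<open>Seminorms on spaces of representatives\<close>

locale seminormed_space =
  fixes X :: "'b::real_vector set" and N :: "'b \<Rightarrow> real"
  assumes subspace: "subspace X"
    and triangle: "x \<in> X \<Longrightarrow> y \<in> X \<Longrightarrow> N (x + y) \<le> N x + N y"
    and scale: "x \<in> X \<Longrightarrow> N (c *\<^sub>R x) = \<bar>c\<bar> * N x"
begin

lemmas zero_mem [simp, intro] = subspace_0[OF subspace]
lemmas add_mem = subspace_add[OF subspace]
lemmas diff_mem = subspace_diff[OF subspace]
lemmas scale_mem = subspace_scale[OF subspace]
lemmas sum_mem = subspace_sum[OF subspace]

lemma N_zero [simp]: "N 0 = 0"
  using scale[of 0 0] by simp

lemma N_minus: "x \<in> X \<Longrightarrow> N (- x) = N x"
  using scale[of x "-1"] by simp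

text \<open>The triangle inequality for \<open>x\<close> and \<open>- x\<close> gives
  \<open>0 = N 0 \<le> 2 * N x\<close>.\<close>

lemma N_nonneg: assumes "x \<in> X" shows "0 \<le> N x"
  using triangle[of x "-x"] N_minus[of x] scale_mem[of x "-1"] assms by simp

lemma N_diff_commute: "x \<in> X \<Longrightarrow> y \<in> X \<Longrightarrow> N (x - y) = N (y - x)"
  using N_minus[of "x - y"] diff_mem[of x y] by simp

lemma N_diff_triangle: "x \<in> X \<Longrightarrow> y \<in> X \<Longrightarrow> z \<in> X \<Longrightarrow> N (x - z) \<le> N (x - y) + N (y - z)"
  using triangle[of "x - y" "y - z"] diff_mem[of x y] diff_mem[of y z] by simp

lemma N_le_add_diff: "x \<in> X \<Longrightarrow> y \<in> X \<Longrightarrow> N x \<le> N y + N (x - y)"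
  using triangle[of y "x - y"] diff_mem[of x y] by simp

lemma N_diff_le: "x \<in> X \<Longrightarrow> y \<in> X \<Longrightarrow> N (x - y) \<le> N x + N y"
  using triangle[of x "- y"] N_minus[of y] scale_mem[of y "-1"] by simp

lemma N_abs_diff_le: "x \<in> X \<Longrightarrow> y \<in> X \<Longrightarrow> \<bar>N x - N y\<bar> \<le> N (x - y)"
  using N_le_add_diff[of x y] N_le_add_diff[of y x] N_diff_commute[of x y] by linarith

lemma N_sum_le: "(\<And>i. i \<in> I \<Longrightarrow> f i \<in> X) \<Longrightarrow> N (\<Sum>i\<in>I. f i) \<le> (\<Sum>i\<in>I. N (f i))"
proof (induction I rule: infinite_finite_induct)
  case (insert i I)
  then show ?case
    using triangle[of "f i" "\<Sum>i\<in>I. f i"] sum_mem[of I f] by force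
qed auto

lemma N_cong: "x \<in> X \<Longrightarrow> y \<in> X \<Longrightarrow> N (x - y) = 0 \<Longrightarrow> N x = N y"
  using N_abs_diff_le[of x y] by simp

lemma N_LIMSEQ:
  assumes "\<And>i. f i \<in> X" "x \<in> X" "(\<lambda>i. N (f i - x)) \<longlonglongrightarrow> 0"
  shows "(\<lambda>i. N (f i)) \<longlonglongrightarrow> N x"
proof -
  have "(\<lambda>i. N (f i) - N x) \<longlonglongrightarrow> 0"
    using assms by (intro Lim_null_comparison[OF _ assms(3)] always_eventually allI) (simp add: N_abs_diff_le)
  then show ?thesis
    by (simp add: LIM_zero_iff)
qed

end

section \<open>Strong measurability and the Bochner integral\<close>

definition complete_seminorm :: "'b::real_vector set \<Rightarrow> ('b \<Rightarrow> real) \<Rightarrow> bool" where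
  "complete_seminorm X N \<longleftrightarrow>
     (\<forall>S. (\<forall>i::nat. S i \<in> X) \<and> (\<forall>e>0. \<exists>k. \<forall>m\<ge>k. \<forall>n\<ge>k. N (S m - S n) < e) \<longrightarrow>
          (\<exists>x\<in>X. (\<lambda>i. N (S i - x)) \<longlonglongrightarrow> 0))"

text \<open>\<open>has_Lq_integral\<close> with the space as a parameter: the fixed point problem
  integrates in the space of Sobolev pairs, the final equation in \<open>L^Q\<close>.\<close>

definition has_integral_in ::
    "'t measure \<Rightarrow> 'b::real_vector set \<Rightarrow> ('b \<Rightarrow> real) \<Rightarrow> ('t \<Rightarrow> 'b) \<Rightarrow> 'b \<Rightarrow> bool" where
  "has_integral_in M X N F g \<longleftrightarrow>
     g \<in> X \<and> strongly_measurable_in M X N F \<and>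
     (\<exists>S. (\<forall>i::nat. simple_function M (S i) \<and> S i ` space M \<subseteq> X) \<and>
          (\<lambda>i. \<integral>\<^sup>+t. ennreal (N (S i t - F t)) \<partial>M) \<longlonglongrightarrow> 0 \<and>
          (\<lambda>i. N (Bochner_Integration.simple_bochner_integral M (S i) - g)) \<longlonglongrightarrow> 0)"

lemma has_Lq_integral_eq:
  "has_Lq_integral M q F g \<longleftrightarrow>
     has_integral_in M (Lp_space lebesgue q) (Lp_norm lebesgue q) F g"
  by (simp add: has_Lq_integral_def has_integral_in_def simple_integral_fun_eq)

lemma strongly_measurable_inE:
  assumes "strongly_measurable_in M X N F"
  obtains S where "\<And>i::nat. simple_function M (S i)" "\<And>i t. t \<in> space M \<Longrightarrow> S i t \<in> X"
    "AE t in M. (\<lambda>i. N (S i t - F t)) \<longlonglongrightarrow> 0" "AE t in M. F t \<in> X"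
  using assms unfolding strongly_measurable_in_def by blast

lemma strongly_measurable_inI:
  assumes "\<And>i::nat. simple_function M (S i)" "\<And>i t. t \<in> space M \<Longrightarrow> S i t \<in> X"
    "AE t in M. (\<lambda>i. N (S i t - F t)) \<longlonglongrightarrow> 0" "AE t in M. F t \<in> X"
  shows "strongly_measurable_in M X N F"
  using assms unfolding strongly_measurable_in_def by blast

text \<open>A function of two simple functions is simple, so joint sequential continuity of
  \<open>\<beta>\<close> is all that has to be known about it.\<close>

lemma strongly_measurable_in_compose2:
  assumes A: "strongly_measurable_in M X NX A" and B: "strongly_measurable_in M Y NY B"
    and mem: "\<And>a b. a \<in> X \<Longrightarrow> b \<in> Y \<Longrightarrow> \<beta> a b \<in> Z"
    and cont: "\<And>a b a' b'. \<lbrakk>\<And>i::nat. a i \<in> X; a' \<in> X; (\<lambda>i. NX (a i - a')) \<longlonglongrightarrow> 0;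
        \<And>i::nat. b i \<in> Y; b' \<in> Y; (\<lambda>i. NY (b i - b')) \<longlonglongrightarrow> 0\<rbrakk>
        \<Longrightarrow> (\<lambda>i. NZ (\<beta> (a i) (b i) - \<beta> a' b')) \<longlonglongrightarrow> 0"
  shows "strongly_measurable_in M Z NZ (\<lambda>t. \<beta> (A t) (B t))"
proof -
  obtain S where S: "\<And>i::nat. simple_function M (S i)" "\<And>i t. t \<in> space M \<Longrightarrow> S i t \<in> X"
    "AE t in M. (\<lambda>i. NX (S i t - A t)) \<longlonglongrightarrow> 0" "AE t in M. A t \<in> X"
    by (rule strongly_measurable_inE[OF A]) (rule that)
  obtain T where T: "\<And>i::nat. simple_function M (T i)" "\<And>i t. t \<in> space M \<Longrightarrow> T i t \<in> Y"
    "AE t in M. (\<lambda>i. NY (T i t - B t)) \<longlonglongrightarrow> 0" "AE t in M. B t \<in> Y"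
    by (rule strongly_measurable_inE[OF B]) (rule that)
  show ?thesis
  proof (rule strongly_measurable_inI)
    show "simple_function M (\<lambda>t. \<beta> (S i t) (T i t))" for i
      using S(1) T(1) by (rule simple_function_compose2)
    show "\<beta> (S i t) (T i t) \<in> Z" if "t \<in> space M" for i t
      using S(2) T(2) that by (auto intro: mem)
    show "AE t in M. (\<lambda>i. NZ (\<beta> (S i t) (T i t) - \<beta> (A t) (B t))) \<longlonglongrightarrow> 0"
      using S(3,4) T(3,4) AE_space by eventually_elim (auto intro!: cont S T)
    show "AE t in M. \<beta> (A t) (B t) \<in> Z"
      using S(4) T(4) by eventually_elim (auto intro: mem)
  qed
qed

lemma strongly_measurable_in_AE_cong:
  assumes F: "strongly_measurable_in M X N F" and X: "seminormed_space X N"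
    and G: "AE t in M. G t \<in> X \<and> N (F t - G t) = 0"
  shows "strongly_measurable_in M X N G"
proof -
  interpret seminormed_space X N by fact
  obtain S where S: "\<And>i::nat. simple_function M (S i)" "\<And>i t. t \<in> space M \<Longrightarrow> S i t \<in> X"
    "AE t in M. (\<lambda>i. N (S i t - F t)) \<longlonglongrightarrow> 0" "AE t in M. F t \<in> X"
    by (rule strongly_measurable_inE[OF F]) (rule that)
  show ?thesis
  proof (rule strongly_measurable_inI[OF S(1,2)])
    show "AE t in M. (\<lambda>i. N (S i t - G t)) \<longlonglongrightarrow> 0"
      using S(3,4) G AE_space
    proof eventually_elim
      case (elim t)
      have "N (S i t - G t) = N (S i t - F t)" for i
        using elim S(2)[of t i] diff_mem[of "S i t" "F t"] diff_mem[of "S i t" "G t"]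
        by (intro N_cong) (auto simp: algebra_simps intro: diff_mem)
      with elim show ?case by simp
    qed
  qed (use G in auto)
qed

text \<open>A finite measure makes every simple function integrable; completeness makes
  \<open>N\<close> of a strongly measurable function measurable, although it is a limit of simple
  functions only almost everywhere.\<close>

locale seminormed_integration = seminormed_space X N + finite_measure M + complete_measure M
  for X :: "'b::real_vector set" and N :: "'b \<Rightarrow> real" and M :: "'t measure"
begin

abbreviation "sm \<equiv> strongly_measurable_in M X N"

lemma sm_AE_mem: "sm F \<Longrightarrow> AE t in M. F t \<in> X"
  by (auto simp: strongly_measurable_in_def)

lemma sm_diff:
  assumes "sm F" "sm G" shows "sm (\<lambda>t. F t - G t)"
  using assms
proof (rule strongly_measurable_in_compose2)
  fix a b :: "nat \<Rightarrow> 'b" and a' b'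
  assume *: "\<And>i. a i \<in> X" "a' \<in> X" "(\<lambda>i. N (a i - a')) \<longlonglongrightarrow> 0"
     "\<And>i. b i \<in> X" "b' \<in> X" "(\<lambda>i. N (b i - b')) \<longlonglongrightarrow> 0"
  have "(\<lambda>i. N (a i - a') + N (b i - b')) \<longlonglongrightarrow> 0"
    using tendsto_add[OF *(3) *(6)] by simp
  then show "(\<lambda>i. N (a i - b i - (a' - b'))) \<longlonglongrightarrow> 0"
  proof (rule LIMSEQ_0_le)
    fix i
    show "0 \<le> N (a i - b i - (a' - b'))"
      by (intro N_nonneg diff_mem *)
    have "a i - b i - (a' - b') = (a i - a') - (b i - b')"
      by simp
    then show "N (a i - b i - (a' - b')) \<le> N (a i - a') + N (b i - b')"
      by (simp only: N_diff_le[OF diff_mem[OF *(1)[of i] *(2)] diff_mem[OF *(4)[of i] *(5)]])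
  qed
qed (auto intro: diff_mem)

lemma sm_simple: "simple_function M S \<Longrightarrow> S ` space M \<subseteq> X \<Longrightarrow> sm S"
  by (rule strongly_measurable_inI[of _ "\<lambda>i. S"]) (auto simp: image_subset_iff)

lemma sm_measurable:
  assumes "sm F" shows "(\<lambda>t. N (F t)) \<in> borel_measurable M"
proof -
  obtain S where S: "\<And>i::nat. simple_function M (S i)" "\<And>i t. t \<in> space M \<Longrightarrow> S i t \<in> X"
    "AE t in M. (\<lambda>i. N (S i t - F t)) \<longlonglongrightarrow> 0" "AE t in M. F t \<in> X"
    by (rule strongly_measurable_inE[OF assms]) (rule that)
  show ?thesis
  proof (rule borel_measurable_AE_LIMSEQ)
    show "(\<lambda>t. N (S i t)) \<in> borel_measurable M" for i
      using simple_function_compose1[OF S(1)] by (rule borel_measurable_simple_function)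
    show "AE t in M. (\<lambda>i. N (S i t)) \<longlonglongrightarrow> N (F t)"
      using S(3,4) AE_space by eventually_elim (auto intro!: N_LIMSEQ S)
  qed
qed

lemma simple_integrable: "simple_function M S \<Longrightarrow> Bochner_Integration.simple_bochner_integrable M S"
  by (auto simp: simple_bochner_integrable.simps)

lemma simple_bochner_integral_mem:
  assumes "S ` space M \<subseteq> X"
  shows "Bochner_Integration.simple_bochner_integral M S \<in> X"
  unfolding simple_bochner_integral_def using assms by (intro sum_mem scale_mem) auto

text \<open>The triangle inequality for the finite sum over the values of \<open>S\<close>,
  regrouped as the integral of the real simple function \<open>N (S x)\<close>.\<close>

lemma simple_bochner_integral_bound:
  assumes S: "simple_function M S" "S ` space M \<subseteq> X"
  shows "ennreal (N (Bochner_Integration.simple_bochner_integral M S)) \<le> (\<integral>\<^sup>+t. ennreal (N (S t)) \<partial>M)"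
proof -
  have "N (Bochner_Integration.simple_bochner_integral M S) \<le>
      (\<Sum>y\<in>S ` space M. N (measure M {x \<in> space M. S x = y} *\<^sub>R y))"
    unfolding simple_bochner_integral_def using S by (intro N_sum_le scale_mem) auto
  \<comment> \<open>\<open>N\<close> is nonnegative only on \<open>X\<close>; the absolute value
    gives an integrand that is nonnegative everywhere, as the passage to the nonnegative integral
    demands.\<close>
  also have "\<dots> = (\<Sum>y\<in>S ` space M. measure M {x \<in> space M. S x = y} *\<^sub>R \<bar>N y\<bar>)"
    using S N_nonneg by (intro sum.cong refl) (auto simp: scale)
  also have "\<dots> = Bochner_Integration.simple_bochner_integral M (\<lambda>x. \<bar>N (S x)\<bar>)"
    using simple_bochner_integral_partition[OF simple_integrable[OF simple_function_compose1[OF S(1), of "\<lambda>y. \<bar>N y\<bar>"]] S(1),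
        of "\<lambda>y. \<bar>N y\<bar>"] by simp
  finally have "ennreal (N (Bochner_Integration.simple_bochner_integral M S)) \<le> ennreal (Bochner_Integration.simple_bochner_integral M (\<lambda>x. \<bar>N (S x)\<bar>))"
    by (rule ennreal_leI)
  also have "\<dots> = (\<integral>\<^sup>+t. ennreal \<bar>N (S t)\<bar> \<partial>M)"
    by (rule simple_bochner_integral_eq_nn_integral[OF simple_integrable[OF simple_function_compose1[OF S(1), of "\<lambda>y. \<bar>N y\<bar>"]]]) simp
  also have "\<dots> = (\<integral>\<^sup>+t. ennreal (N (S t)) \<partial>M)"
    using S N_nonneg by (intro nn_integral_cong) (auto simp: image_subset_iff)
  finally show ?thesis .
qed

lemma nn_integral_N_add:
  assumes F: "sm F" and G: "sm G" and H: "sm H"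
  shows "(\<integral>\<^sup>+t. ennreal (N (F t - H t)) \<partial>M) \<le>
    (\<integral>\<^sup>+t. ennreal (N (F t - G t)) \<partial>M) + (\<integral>\<^sup>+t. ennreal (N (G t - H t)) \<partial>M)"
proof -
  note [measurable] = sm_measurable[OF sm_diff[OF F G]] sm_measurable[OF sm_diff[OF G H]]
  have "(\<integral>\<^sup>+t. ennreal (N (F t - H t)) \<partial>M) \<le>
      (\<integral>\<^sup>+t. ennreal (N (F t - G t)) + ennreal (N (G t - H t)) \<partial>M)"
  proof (rule nn_integral_mono_AE)
    show "AE t in M. ennreal (N (F t - H t)) \<le> ennreal (N (F t - G t)) + ennreal (N (G t - H t))"
      using sm_AE_mem[OF F] sm_AE_mem[OF G] sm_AE_mem[OF H]
    proof eventually_elim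
      case (elim t)
      then show ?case
        by (subst ennreal_plus[symmetric]) (auto intro!: ennreal_leI N_diff_triangle N_nonneg diff_mem)
    qed
  qed
  also have "\<dots> = (\<integral>\<^sup>+t. ennreal (N (F t - G t)) \<partial>M) + (\<integral>\<^sup>+t. ennreal (N (G t - H t)) \<partial>M)"
    by (intro nn_integral_add) measurable
  finally show ?thesis .
qed

lemma nn_integral_N_commute:
  assumes F: "sm F" and G: "sm G"
  shows "(\<integral>\<^sup>+t. ennreal (N (F t - G t)) \<partial>M) = (\<integral>\<^sup>+t. ennreal (N (G t - F t)) \<partial>M)"
  by (intro nn_integral_cong_AE) (use sm_AE_mem[OF F] sm_AE_mem[OF G] in eventually_elim, simp add: N_diff_commute)

lemma simple_bochner_integral_dist:
  assumes S: "simple_function M S" "S ` space M \<subseteq> X" and T: "simple_function M T" "T ` space M \<subseteq> X"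
  shows "ennreal (N (Bochner_Integration.simple_bochner_integral M S - Bochner_Integration.simple_bochner_integral M T)) \<le>
    (\<integral>\<^sup>+t. ennreal (N (S t - T t)) \<partial>M)"
proof -
  have "Bochner_Integration.simple_bochner_integral M S - Bochner_Integration.simple_bochner_integral M T = Bochner_Integration.simple_bochner_integral M (\<lambda>t. S t - T t)"
    using S T by (simp add: simple_bochner_integral_diff simple_integrable)
  then show ?thesis
    using simple_bochner_integral_bound[of "\<lambda>t. S t - T t"] S T
    by (auto simp: image_subset_iff intro: diff_mem simple_function_compose2)
qed

text \<open>Strong measurability gives convergence almost everywhere; convergence in mean needs a
  dominated sequence, which a cut-off supplies.\<close>

lemma has_integral_in_approx:
  assumes F: "sm F" and fin: "(\<integral>\<^sup>+t. ennreal (N (F t)) \<partial>M) < \<infinity>"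
  obtains S where "\<And>i::nat. simple_function M (S i)" "\<And>i. S i ` space M \<subseteq> X"
    "(\<lambda>i. \<integral>\<^sup>+t. ennreal (N (S i t - F t)) \<partial>M) \<longlonglongrightarrow> 0"
proof -
  obtain S where S: "\<And>i::nat. simple_function M (S i)" "\<And>i t. t \<in> space M \<Longrightarrow> S i t \<in> X"
    "AE t in M. (\<lambda>i. N (S i t - F t)) \<longlonglongrightarrow> 0" "AE t in M. F t \<in> X"
    by (rule strongly_measurable_inE[OF F]) (rule that)
  have smS: "sm (S i)" for i
    using S by (intro sm_simple) auto
  note mS = sm_measurable[OF sm_diff[OF smS F]]
  \<comment> \<open>Where \<open>S i\<close> is further than 1 from \<open>F\<close> it is replaced
    by 0. The error is then at most \<open>1 + N (F t)\<close>, integrable because the measure is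
    finite, and at almost every point the cut-off is inactive for large \<open>i\<close>.\<close>
  define A where "A i = {t \<in> space M. N (S i t - F t) \<le> 1}" for i
  have A: "A i \<in> sets M" for i
    unfolding A_def using mS[of i] by measurable
  define T where "T i t = (if t \<in> A i then S i t else 0)" for i t
  have T: "simple_function M (T i)" "T i ` space M \<subseteq> X" for i
    unfolding T_def using S A sets.sets_into_space[OF A]
    by (auto simp: image_subset_iff subset_iff intro!: simple_function_If_set)
  have smT: "sm (T i)" for i
    using T by (intro sm_simple) auto
  have "(\<lambda>i. \<integral>\<^sup>+t. ennreal (N (T i t - F t)) \<partial>M) \<longlonglongrightarrow> (\<integral>\<^sup>+t. 0 \<partial>M)"
  proof (rule nn_integral_dominated_convergence)
    show "(\<lambda>t. ennreal (N (T i t - F t))) \<in> borel_measurable M" for i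
      using sm_measurable[OF sm_diff[OF smT F]] by measurable
    show "(\<lambda>t. 1 + ennreal (N (F t))) \<in> borel_measurable M"
      using sm_measurable[OF F] by measurable
    show "(\<integral>\<^sup>+t. 1 + ennreal (N (F t)) \<partial>M) < \<infinity>"
      using sm_measurable[OF F] fin emeasure_finite[of "space M"]
      by (subst nn_integral_add) (auto simp: ennreal_add_less_top less_top[symmetric])
    show "AE t in M. ennreal (N (T i t - F t)) \<le> 1 + ennreal (N (F t))" for i
      using S(4) AE_space
    proof eventually_elim
      case (elim t)
      then have "N (T i t - F t) \<le> 1 + N (F t)"
        using N_nonneg[of "F t"] N_minus[of "F t"] by (auto simp: T_def A_def)
      then have "ennreal (N (T i t - F t)) \<le> ennreal (1 + N (F t))"
        by (rule ennreal_leI)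
      with N_nonneg[of "F t"] elim show ?case by simp
    qed
    show "AE t in M. (\<lambda>i. ennreal (N (T i t - F t))) \<longlonglongrightarrow> 0"
      using S(3,4) AE_space
    proof eventually_elim
      case (elim t)
      then have "eventually (\<lambda>i. N (S i t - F t) < 1) sequentially"
        by (intro order_tendstoD) auto
      then have "eventually (\<lambda>i. N (S i t - F t) = N (T i t - F t)) sequentially"
        by eventually_elim (use elim in \<open>auto simp: T_def A_def\<close>)
      with elim have "(\<lambda>i. N (T i t - F t)) \<longlonglongrightarrow> 0"
        by (blast intro: Lim_transform_eventually)
      then show ?case
        by (metis ennreal_0 tendsto_ennrealI)
    qed
  qed auto
  then show thesis
    using that[of T] T by simp
qed

text \<open>The integrals of simple functions converging in mean form a Cauchy sequence, because the
  distance of two simple integrals is at most the integral of the distance.\<close>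

lemma has_integral_in_exists:
  assumes F: "sm F" and fin: "(\<integral>\<^sup>+t. ennreal (N (F t)) \<partial>M) < \<infinity>"
    and comp: "complete_seminorm X N"
  shows "\<exists>g. has_integral_in M X N F g"
proof -
  obtain S where S: "\<And>i::nat. simple_function M (S i)" "\<And>i. S i ` space M \<subseteq> X"
    and lim: "(\<lambda>i. \<integral>\<^sup>+t. ennreal (N (S i t - F t)) \<partial>M) \<longlonglongrightarrow> 0"
    by (rule has_integral_in_approx[OF F fin]) (rule that)
  have smS: "sm (S i)" for i
    using S by (intro sm_simple) auto
  let ?I = "\<lambda>i. Bochner_Integration.simple_bochner_integral M (S i)"
  have "\<exists>k. \<forall>m\<ge>k. \<forall>n\<ge>k. N (?I m - ?I n) < e" if "e > 0" for e
  proof -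
    have "eventually (\<lambda>i. (\<integral>\<^sup>+t. ennreal (N (S i t - F t)) \<partial>M) < ennreal (e/2)) sequentially"
      using lim that by (intro order_tendstoD) auto
    then obtain k where k: "\<And>i. i \<ge> k \<Longrightarrow> (\<integral>\<^sup>+t. ennreal (N (S i t - F t)) \<partial>M) < ennreal (e/2)"
      by (auto simp: eventually_sequentially)
    have "N (?I m - ?I n) < e" if mn: "m \<ge> k" "n \<ge> k" for m n
    proof -
      have "ennreal (N (?I m - ?I n)) \<le> (\<integral>\<^sup>+t. ennreal (N (S m t - S n t)) \<partial>M)"
        by (intro simple_bochner_integral_dist S)
      also have "\<dots> \<le> (\<integral>\<^sup>+t. ennreal (N (S m t - F t)) \<partial>M) + (\<integral>\<^sup>+t. ennreal (N (S n t - F t)) \<partial>M)"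
        using nn_integral_N_add[OF smS[of m] F smS[of n]] nn_integral_N_commute[OF smS[of n] F] by simp
      also have "\<dots> < ennreal (e/2) + ennreal (e/2)"
        by (intro add_strict_mono k mn)
      finally show ?thesis
        using \<open>e > 0\<close> by (simp add: ennreal_plus[symmetric] ennreal_less_iff N_nonneg diff_mem
            simple_bochner_integral_mem S del: ennreal_plus)
    qed
    then show ?thesis by blast
  qed
  moreover have "?I i \<in> X" for i
    by (intro simple_bochner_integral_mem S)
  ultimately obtain g where "g \<in> X" "(\<lambda>i. N (?I i - g)) \<longlonglongrightarrow> 0"
    using comp[unfolded complete_seminorm_def, rule_format, of ?I] by blast
  then show ?thesis
    using S lim F unfolding has_integral_in_def by blast
qed

text \<open>Comparing the two approximating sequences costs five error terms, four of which vanish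
  in the limit. This one inequality serves as uniqueness of the integral, as its norm bound (against
  the zero function) and as the Lipschitz estimate for the Duhamel operator.\<close>

lemma has_integral_in_bound_diff:
  assumes F: "has_integral_in M X N F g" and G: "has_integral_in M X N G h"
  shows "ennreal (N (g - h)) \<le> (\<integral>\<^sup>+t. ennreal (N (F t - G t)) \<partial>M)"
proof -
  obtain S where S: "\<And>i::nat. simple_function M (S i)" "\<And>i. S i ` space M \<subseteq> X"
      "(\<lambda>i. \<integral>\<^sup>+t. ennreal (N (S i t - F t)) \<partial>M) \<longlonglongrightarrow> 0"
      "(\<lambda>i. N (Bochner_Integration.simple_bochner_integral M (S i) - g)) \<longlonglongrightarrow> 0"
    using F unfolding has_integral_in_def by blast
  obtain T where T: "\<And>i::nat. simple_function M (T i)" "\<And>i. T i ` space M \<subseteq> X"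
      "(\<lambda>i. \<integral>\<^sup>+t. ennreal (N (T i t - G t)) \<partial>M) \<longlonglongrightarrow> 0"
      "(\<lambda>i. N (Bochner_Integration.simple_bochner_integral M (T i) - h)) \<longlonglongrightarrow> 0"
    using G unfolding has_integral_in_def by blast
  have mem: "g \<in> X" "h \<in> X" "sm F" "sm G"
    using F G by (auto simp: has_integral_in_def)
  have smS: "sm (S i)" "sm (T i)" for i
    by (intro sm_simple S T)+
  let ?I = "\<lambda>i. Bochner_Integration.simple_bochner_integral M (S i)" and ?J = "\<lambda>i. Bochner_Integration.simple_bochner_integral M (T i)"
  have IJ: "?I i \<in> X" "?J i \<in> X" for i
    by (intro simple_bochner_integral_mem S T)+
  let ?f = "\<lambda>i. (\<integral>\<^sup>+t. ennreal (N (S i t - F t)) \<partial>M) + (\<integral>\<^sup>+t. ennreal (N (F t - G t)) \<partial>M)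
      + (\<integral>\<^sup>+t. ennreal (N (T i t - G t)) \<partial>M) + ennreal (N (?I i - g)) + ennreal (N (?J i - h))"
  have "ennreal (N (g - h)) \<le> ?f i" for i
  proof -
    have "N (g - h) \<le> N (?I i - g) + N (?I i - ?J i) + N (?J i - h)"
      using N_diff_triangle[of g "?I i" h] N_diff_triangle[of "?I i" "?J i" h] IJ[of i] mem
        N_diff_commute[of g "?I i"] by simp
    then have "ennreal (N (g - h)) \<le> ennreal (N (?I i - g)) + ennreal (N (?I i - ?J i)) + ennreal (N (?J i - h))"
      using IJ[of i] mem by (simp add: N_nonneg diff_mem ennreal_leI flip: ennreal_plus)
    also have "ennreal (N (?I i - ?J i)) \<le> (\<integral>\<^sup>+t. ennreal (N (S i t - T i t)) \<partial>M)"
      by (intro simple_bochner_integral_dist S T)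
    also have "\<dots> \<le> (\<integral>\<^sup>+t. ennreal (N (S i t - F t)) \<partial>M) + (\<integral>\<^sup>+t. ennreal (N (F t - T i t)) \<partial>M)"
      by (intro nn_integral_N_add smS mem)
    also have "(\<integral>\<^sup>+t. ennreal (N (F t - T i t)) \<partial>M) \<le>
        (\<integral>\<^sup>+t. ennreal (N (F t - G t)) \<partial>M) + (\<integral>\<^sup>+t. ennreal (N (G t - T i t)) \<partial>M)"
      by (intro nn_integral_N_add smS mem)
    also have "(\<integral>\<^sup>+t. ennreal (N (G t - T i t)) \<partial>M) = (\<integral>\<^sup>+t. ennreal (N (T i t - G t)) \<partial>M)"
      by (intro nn_integral_N_commute smS mem)
    finally show ?thesis
      by (simp add: ac_simps)
  qed
  moreover have "?f \<longlonglongrightarrow> 0 + (\<integral>\<^sup>+t. ennreal (N (F t - G t)) \<partial>M) + 0 + ennreal 0 + ennreal 0"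
    by (intro tendsto_add tendsto_const S T tendsto_ennrealI)
  ultimately show ?thesis
    by (auto intro: LIMSEQ_le_const)
qed

lemma has_integral_in_zero: "has_integral_in M X N (\<lambda>t. 0) 0"
proof -
  have "sm (\<lambda>t. 0)"
    by (intro sm_simple) auto
  moreover have "Bochner_Integration.simple_bochner_integral M (\<lambda>t. 0 :: 'b) = 0"
    unfolding simple_bochner_integral_def by (intro sum.neutral) auto
  ultimately show ?thesis
    unfolding has_integral_in_def by (intro conjI exI[of _ "\<lambda>i t. 0"]) auto
qed

lemma has_integral_in_bound:
  "has_integral_in M X N F g \<Longrightarrow> ennreal (N g) \<le> (\<integral>\<^sup>+t. ennreal (N (F t)) \<partial>M)"
  using has_integral_in_bound_diff[OF _ has_integral_in_zero] by simp

lemma has_integral_in_cong: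
  assumes F: "has_integral_in M X N F g" and G: "AE t in M. G t \<in> X \<and> N (F t - G t) = 0"
  shows "has_integral_in M X N G g"
proof -
  obtain S where S: "\<And>i::nat. simple_function M (S i)" "\<And>i. S i ` space M \<subseteq> X"
      "(\<lambda>i. \<integral>\<^sup>+t. ennreal (N (S i t - F t)) \<partial>M) \<longlonglongrightarrow> 0"
      "(\<lambda>i. N (Bochner_Integration.simple_bochner_integral M (S i) - g)) \<longlonglongrightarrow> 0"
    using F unfolding has_integral_in_def by blast
  have gX: "g \<in> X" and smF: "sm F"
    using F by (auto simp: has_integral_in_def)
  have smG: "sm G"
    using strongly_measurable_in_AE_cong[OF smF seminormed_space_axioms G] .
  have "(\<integral>\<^sup>+t. ennreal (N (S i t - G t)) \<partial>M) = (\<integral>\<^sup>+t. ennreal (N (S i t - F t)) \<partial>M)" for i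
  proof (rule nn_integral_cong_AE)
    show "AE t in M. ennreal (N (S i t - G t)) = ennreal (N (S i t - F t))"
      using sm_AE_mem[OF smF] G AE_space
    proof eventually_elim
      case (elim t)
      then have "S i t \<in> X"
        using S(2)[of i] by auto
      then have "N (S i t - G t) = N (S i t - F t)"
        using elim by (intro N_cong diff_mem) auto
      then show ?case by simp
    qed
  qed
  then show ?thesis
    unfolding has_integral_in_def using gX smG S by (intro conjI exI[of _ S]) auto
qed

text \<open>A linear contraction maps an approximating sequence to one. It is applied to the
  projection of a Sobolev pair to its first component.\<close>

lemma has_integral_in_linear:
  assumes F: "has_integral_in M X N F g" and Y: "seminormed_space Y N'"
    and T: "linear T" "\<And>x. x \<in> X \<Longrightarrow> T x \<in> Y" "\<And>x. x \<in> X \<Longrightarrow> N' (T x) \<le> N x"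
  shows "has_integral_in M Y N' (\<lambda>t. T (F t)) (T g)"
proof -
  interpret Y: seminormed_space Y N' by fact
  obtain S where S: "\<And>i::nat. simple_function M (S i)" "\<And>i. S i ` space M \<subseteq> X"
      "(\<lambda>i. \<integral>\<^sup>+t. ennreal (N (S i t - F t)) \<partial>M) \<longlonglongrightarrow> 0"
      "(\<lambda>i. N (Bochner_Integration.simple_bochner_integral M (S i) - g)) \<longlonglongrightarrow> 0"
    using F unfolding has_integral_in_def by blast
  have gX: "g \<in> X" and smF: "sm F"
    using F by (auto simp: has_integral_in_def)
  obtain S' where S': "\<And>i::nat. simple_function M (S' i)" "\<And>i t. t \<in> space M \<Longrightarrow> S' i t \<in> X"
    "AE t in M. (\<lambda>i. N (S' i t - F t)) \<longlonglongrightarrow> 0" "AE t in M. F t \<in> X"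
    by (rule strongly_measurable_inE[OF smF]) (rule that)
  have Tle: "N' (T x - T y) \<le> N (x - y)" if "x \<in> X" "y \<in> X" for x y
    using that T(2)[of "x - y"] T(3)[of "x - y"] by (simp add: linear_diff[OF T(1)] diff_mem)
  have "strongly_measurable_in M Y N' (\<lambda>t. T (F t))"
  proof (rule strongly_measurable_inI)
    show "simple_function M (\<lambda>t. T (S' i t))" for i
      using S'(1) by (rule simple_function_compose1)
    show "AE t in M. (\<lambda>i. N' (T (S' i t) - T (F t))) \<longlonglongrightarrow> 0"
      using S'(3,4) AE_space
    proof eventually_elim
      case (elim t)
      then show ?case
        using Tle S'(2) by (intro LIMSEQ_0_le[OF elim(1)]) (auto simp: Y.N_nonneg Y.diff_mem T)
    qed
    show "AE t in M. T (F t) \<in> Y"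
      using S'(4) by eventually_elim (rule T)
  qed (use S' T in auto)
  moreover have "(\<lambda>i. \<integral>\<^sup>+t. ennreal (N' (T (S i t) - T (F t))) \<partial>M) \<longlonglongrightarrow> 0"
  proof (rule tendsto_sandwich[OF _ _ tendsto_const S(3)])
    show "\<forall>\<^sub>F i in sequentially. (\<integral>\<^sup>+t. ennreal (N' (T (S i t) - T (F t))) \<partial>M)
        \<le> (\<integral>\<^sup>+t. ennreal (N (S i t - F t)) \<partial>M)"
    proof (rule always_eventually, rule allI, rule nn_integral_mono_AE)
      fix i
      show "AE t in M. ennreal (N' (T (S i t) - T (F t))) \<le> ennreal (N (S i t - F t))"
        using S'(4) AE_space
      proof eventually_elim
        case (elim t)
        then show ?case
          using S(2)[of i] by (intro ennreal_leI Tle) auto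
      qed
    qed
  qed auto
  moreover have "(\<lambda>i. N' (Bochner_Integration.simple_bochner_integral M (\<lambda>t. T (S i t)) - T g)) \<longlonglongrightarrow> 0"
  proof -
    have "N' (Bochner_Integration.simple_bochner_integral M (\<lambda>t. T (S i t)) - T g) \<le> N (Bochner_Integration.simple_bochner_integral M (S i) - g)" for i
      using Tle[OF simple_bochner_integral_mem[OF S(2)] gX]
      by (simp add: simple_bochner_integral_linear[OF T(1)] simple_integrable S)
    then show ?thesis
      using S(2) gX T(2) by (intro LIMSEQ_0_le[OF S(4)])
        (auto simp: simple_bochner_integral_linear[OF T(1)] simple_integrable S Y.N_nonneg Y.diff_mem
          simple_bochner_integral_mem)
  qed
  ultimately show ?thesis
    unfolding has_integral_in_def using S T gX
    by (intro conjI exI[of _ "\<lambda>i t. T (S i t)"]) (auto intro: simple_function_compose1)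
qed

end

section \<open>Lebesgue spaces\<close>

text \<open>If one argument is 0, the inequality reduces to \<open>w powr Q \<le> w\<close> for
  weights \<open>w\<close> in the unit interval; positive arguments are a case of convexity.\<close>

lemma powr_convex_comb:
  fixes x y u v Q :: real
  assumes "Q \<ge> 1" "x \<ge> 0" "y \<ge> 0" "u \<ge> 0" "v \<ge> 0" "u + v = 1"
  shows "(u * x + v * y) powr Q \<le> u * x powr Q + v * y powr Q"
proof -
  have le: "w powr Q \<le> w" if "0 \<le> w" "w \<le> 1" for w :: real
    using powr_mono'[of 1 Q w] that assms by (cases "w = 0") auto
  have u: "u = 1 - v"
    using assms by simp
  consider "x = 0" | "y = 0" | "x > 0" "y > 0"
    using assms by force
  then show ?thesis
  proof cases
    case 1
    then show ?thesis
      using assms le[of v] by (simp add: powr_mult mult_right_mono)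
  next
    case 2
    then show ?thesis
      using assms le[of u] by (simp add: powr_mult mult_right_mono)
  next
    case 3
    then show ?thesis
      using convex_onD[OF powr_convex[OF assms(1)], of v x y] assms
      by (simp add: u)
  qed
qed

lemma Lp_space_ennreal:
  "0 \<le> Q \<Longrightarrow> Lp_space M (ennreal Q) = {h \<in> borel_measurable M. integrable M (\<lambda>x. norm (h x) powr Q)}"
  by (simp add: Lp_space_def)

lemma Lp_norm_ennreal:
  "0 \<le> Q \<Longrightarrow> Lp_norm M (ennreal Q) h = (\<integral>x. norm (h x) powr Q \<partial>M) powr (1 / Q)"
  by (simp add: Lp_norm_def)

lemma Lp_space_measurable: "h \<in> Lp_space M p \<Longrightarrow> h \<in> borel_measurable M"
  by (simp add: Lp_space_def)

lemma Lp_norm_powr: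
  "0 < Q \<Longrightarrow> Lp_norm M (ennreal Q) h powr Q = (\<integral>x. norm (h x) powr Q \<partial>M)"
  by (simp add: Lp_norm_ennreal powr_powr)

lemma Lp_norm_ennreal_nonneg [simp]: "0 \<le> Q \<Longrightarrow> 0 \<le> Lp_norm M (ennreal Q) h"
  by (simp add: Lp_norm_ennreal)

lemma Lp_norm_leI:
  assumes "0 < Q" "0 \<le> c" "(\<integral>x. norm (h x) powr Q \<partial>M) \<le> c powr Q"
  shows "Lp_norm M (ennreal Q) h \<le> c"
proof -
  have "(\<integral>x. norm (h x) powr Q \<partial>M) powr (1 / Q) \<le> (c powr Q) powr (1 / Q)"
    using assms by (intro powr_mono2) auto
  then show ?thesis
    using assms by (simp add: Lp_norm_ennreal powr_powr)
qed

lemma Lp_norm_1: "Lp_norm M 1 h = (\<integral>x. norm (h x) \<partial>M)"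
  using Lp_norm_ennreal[of 1 M h] by simp

lemma Lp_space_1: "h \<in> Lp_space M 1 \<longleftrightarrow> integrable M h"
proof -
  have "h \<in> Lp_space M 1 \<longleftrightarrow> h \<in> borel_measurable M \<and> integrable M (\<lambda>x. norm (h x))"
    by (simp add: Lp_space_def)
  also have "\<dots> \<longleftrightarrow> integrable M h"
    using integrable_norm_iff borel_measurable_integrable by blast
  finally show ?thesis .
qed

lemma Lp_space_dominated_finite:
  assumes f: "f \<in> Lp_space M (ennreal Q)" and g: "g \<in> borel_measurable M" and Q: "Q > 0"
    and le: "AE x in M. norm (g x) \<le> c * norm (f x)" and c: "c \<ge> 0"
  shows "g \<in> Lp_space M (ennreal Q)" "Lp_norm M (ennreal Q) g \<le> c * Lp_norm M (ennreal Q) f"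
proof -
  have int: "integrable M (\<lambda>x. norm (f x) powr Q)" and [measurable]: "f \<in> borel_measurable M"
    using f Q by (auto simp: Lp_space_ennreal)
  note [measurable] = g
  have le': "AE x in M. norm (g x) powr Q \<le> c powr Q * norm (f x) powr Q"
    using le by eventually_elim (use c Q in \<open>auto simp: powr_mult[symmetric] intro!: powr_mono2\<close>)
  have int': "integrable M (\<lambda>x. norm (g x) powr Q)"
    by (rule Bochner_Integration.integrable_bound[OF integrable_mult_right[OF int, of "c powr Q"]])
      (use le' in auto)
  then show "g \<in> Lp_space M (ennreal Q)"
    using g Q by (simp add: Lp_space_ennreal)
  have "(\<integral>x. norm (g x) powr Q \<partial>M) \<le> (\<integral>x. c powr Q * norm (f x) powr Q \<partial>M)"
    by (intro integral_mono_AE int' integrable_mult_right int le')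
  also have "\<dots> = (c * Lp_norm M (ennreal Q) f) powr Q"
    using c Q by (simp add: powr_mult Lp_norm_powr)
  finally show "Lp_norm M (ennreal Q) g \<le> c * Lp_norm M (ennreal Q) f"
    using c Q by (intro Lp_norm_leI) auto
qed

text \<open>On a space of positive measure the essential supremum of a norm is at least 0, and
  membership makes it finite, so \<open>real_of_ereal\<close> loses nothing.\<close>

lemma Lp_infinity_AE:
  assumes f: "f \<in> Lp_space M \<infinity>" and M: "emeasure M (space M) \<noteq> 0"
  shows "0 \<le> Lp_norm M \<infinity> f" "AE x in M. norm (f x) \<le> Lp_norm M \<infinity> f"
proof -
  let ?e = "esssup M (\<lambda>x. ereal (norm (f x)))"
  have [measurable]: "f \<in> borel_measurable M" and fin: "?e < \<infinity>"
    using f by (auto simp: Lp_space_def)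
  have "esssup M (\<lambda>x. 0 :: ereal) \<le> ?e"
    by (rule esssup_mono) auto
  then have nn: "0 \<le> ?e"
    using esssup_const[OF M, of "0::ereal"] by simp
  then have e: "?e = ereal (Lp_norm M \<infinity> f)"
    using fin by (cases ?e) (auto simp: Lp_norm_def)
  show "0 \<le> Lp_norm M \<infinity> f"
    using nn e by simp
  show "AE x in M. norm (f x) \<le> Lp_norm M \<infinity> f"
    using esssup_AE[of "\<lambda>x. ereal (norm (f x))" M] unfolding e by simp
qed

lemma Lp_infinity_leI:
  assumes f: "f \<in> borel_measurable M" and c: "AE x in M. norm (f x) \<le> c" and M: "emeasure M (space M) \<noteq> 0"
  shows "f \<in> Lp_space M \<infinity>" "Lp_norm M \<infinity> f \<le> c"
proof -
  let ?e = "esssup M (\<lambda>x. ereal (norm (f x)))"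
  have e: "?e \<le> ereal c"
    using f c by (intro esssup_I) auto
  then have fin: "?e < \<infinity>" by auto
  then show *: "f \<in> Lp_space M \<infinity>"
    using f by (simp add: Lp_space_def)
  have "0 \<le> c"
  proof -
    have "esssup M (\<lambda>x. 0 :: ereal) \<le> ?e"
      using f by (intro esssup_mono) auto
    with e esssup_const[OF M, of "0::ereal"] show ?thesis
      by (metis dual_order.trans ereal_less_eq(5))
  qed
  then show "Lp_norm M \<infinity> f \<le> c"
    using e fin by (cases ?e) (auto simp: Lp_norm_def)
qed

lemma Lp_space_dominated:
  assumes f: "f \<in> Lp_space M p" and g: "g \<in> borel_measurable M" and p: "p > 0"
    and M: "emeasure M (space M) \<noteq> 0"
    and le: "AE x in M. norm (g x) \<le> c * norm (f x)" and c: "c \<ge> 0"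
  shows "g \<in> Lp_space M p" "Lp_norm M p g \<le> c * Lp_norm M p f"
proof -
  have "g \<in> Lp_space M p \<and> Lp_norm M p g \<le> c * Lp_norm M p f"
  proof (cases p)
    case (real Q)
    then show ?thesis
      using Lp_space_dominated_finite[OF f[unfolded real(2)] g _ le c] p by auto
  next
    case top
    have "AE x in M. norm (g x) \<le> c * Lp_norm M \<infinity> f"
      using Lp_infinity_AE(2)[of f M] f M le top
      by (auto elim!: eventually_elim2 intro: order_trans mult_left_mono c simp: infinity_ennreal_def)
    from Lp_infinity_leI[OF g this M] show ?thesis
      using top by (simp add: infinity_ennreal_def)
  qed
  then show "g \<in> Lp_space M p" "Lp_norm M p g \<le> c * Lp_norm M p f"
    by auto
qed

text \<open>Minkowski's inequality by convexity: \<open>norm (f x) + norm (g x)\<close> is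
  \<open>a + b\<close> times the convex combination of \<open>norm (f x) / a\<close> and
  \<open>norm (g x) / b\<close> with weights \<open>a / (a + b)\<close> and
  \<open>b / (a + b)\<close>. If \<open>a\<close> and \<open>b\<close> exceed the norms, the
  integral of the \<open>Q\<close>-th power is at most \<open>(a + b) powr Q\<close>.\<close>

lemma Lp_space_add:
  assumes p: "1 \<le> p" and M: "emeasure M (space M) \<noteq> 0"
    and f: "f \<in> Lp_space M p" and g: "g \<in> Lp_space M p"
  shows "f + g \<in> Lp_space M p" "Lp_norm M p (f + g) \<le> Lp_norm M p f + Lp_norm M p g"
proof -
  note [measurable] = Lp_space_measurable[OF f] Lp_space_measurable[OF g]
  have fg [measurable]: "f + g \<in> borel_measurable M"
    unfolding plus_fun_def by measurable
  have "f + g \<in> Lp_space M p \<and> Lp_norm M p (f + g) \<le> Lp_norm M p f + Lp_norm M p g"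
  proof (cases p)
    case (real Q)
    then have Q: "Q \<ge> 1"
      using p by (metis ennreal_1 ennreal_le_iff)
    have intf: "integrable M (\<lambda>x. norm (f x) powr Q)" and intg: "integrable M (\<lambda>x. norm (g x) powr Q)"
      using f g Q real by (auto simp: Lp_space_ennreal)
    have cv: "norm (f x + g x) powr Q \<le> (a + b) powr Q * (a / (a + b) * (norm (f x) powr Q / a powr Q)
        + b / (a + b) * (norm (g x) powr Q / b powr Q))" if "a > 0" "b > 0" for a b x
    proof -
      have "norm (f x + g x) powr Q \<le> (norm (f x) + norm (g x)) powr Q"
        using Q by (intro powr_mono2 norm_triangle_ineq) auto
      also have "norm (f x) + norm (g x) =
          (a + b) * (a / (a + b) * (norm (f x) / a) + b / (a + b) * (norm (g x) / b))"
      proof -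
        have "a / (a + b) * (norm (f x) / a) = norm (f x) / (a + b)"
          "b / (a + b) * (norm (g x) / b) = norm (g x) / (a + b)"
          using that by simp_all
        then show ?thesis
          using that by (simp add: add_divide_distrib[symmetric])
      qed
      also have "\<dots> powr Q = (a + b) powr Q *
          (a / (a + b) * (norm (f x) / a) + b / (a + b) * (norm (g x) / b)) powr Q"
        by (rule powr_mult)
      also have "\<dots> \<le> (a + b) powr Q * (a / (a + b) * (norm (f x) / a) powr Q
        + b / (a + b) * (norm (g x) / b) powr Q)"
      proof -
        have "a / (a + b) + b / (a + b) = 1"
          using that by (metis add_divide_distrib add_pos_pos divide_self less_irrefl)
        then show ?thesis
          using that Q by (intro mult_left_mono powr_convex_comb) auto
      qed
      finally show ?thesis by (simp add: powr_divide)
    qed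
    have intr: "integrable M (\<lambda>x. (a + b) powr Q * (a / (a + b) * (norm (f x) powr Q / a powr Q)
        + b / (a + b) * (norm (g x) powr Q / b powr Q)))" for a b
      using intf intg by simp
    have intfg: "integrable M (\<lambda>x. norm (f x + g x) powr Q)"
      by (rule Bochner_Integration.integrable_bound[OF intr[of 1 1]]) (use cv[of 1 1] in auto)
    \<comment> \<open>Strict inequalities keep \<open>a\<close> and \<open>b\<close> positive even
      when a norm vanishes; they are lowered to the norms afterwards.\<close>
    have le: "Lp_norm M p (f + g) \<le> a + b" if a: "a > Lp_norm M p f" and b: "b > Lp_norm M p g" for a b
    proof -
      have ab: "a > 0" "b > 0"
      proof -
        have "0 \<le> Lp_norm M p f" "0 \<le> Lp_norm M p g"
          using Q real by auto
        with a b show "a > 0" "b > 0" by linarith+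
      qed
      have A: "(\<integral>x. norm (f x) powr Q \<partial>M) / a powr Q \<le> 1" and B: "(\<integral>x. norm (g x) powr Q \<partial>M) / b powr Q \<le> 1"
        using a b ab Q real powr_mono2[of Q "Lp_norm M p f" a] powr_mono2[of Q "Lp_norm M p g" b]
        by (auto simp: Lp_norm_powr)
      have "(\<integral>x. norm (f x + g x) powr Q \<partial>M) \<le> (\<integral>x. (a + b) powr Q * (a / (a + b) * (norm (f x) powr Q / a powr Q)
        + b / (a + b) * (norm (g x) powr Q / b powr Q)) \<partial>M)"
        by (intro integral_mono intr intfg cv ab)
      also have "\<dots> = (a + b) powr Q * (a / (a + b) * ((\<integral>x. norm (f x) powr Q \<partial>M) / a powr Q)
        + b / (a + b) * ((\<integral>x. norm (g x) powr Q \<partial>M) / b powr Q))"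
        using intf intg by simp
      also have "\<dots> \<le> (a + b) powr Q * (a / (a + b) * 1 + b / (a + b) * 1)"
        using ab A B by (intro mult_left_mono add_mono) auto
      also have "\<dots> = (a + b) powr Q"
      proof -
        have "a / (a + b) + b / (a + b) = 1"
          using ab by (metis add_divide_distrib add_pos_pos divide_self less_irrefl)
        then show ?thesis by simp
      qed
      finally show ?thesis
        using Q ab unfolding real(2) by (intro Lp_norm_leI) auto
    qed
    have "Lp_norm M p (f + g) \<le> Lp_norm M p f + Lp_norm M p g + e" if "e > 0" for e
      using le[of "Lp_norm M p f + e / 2" "Lp_norm M p g + e / 2"] that by simp
    then have "Lp_norm M p (f + g) \<le> Lp_norm M p f + Lp_norm M p g"
      by (rule field_le_epsilon)
    moreover have "f + g \<in> Lp_space M p"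
      using intfg fg Q unfolding real(2) by (simp add: Lp_space_ennreal)
    ultimately show ?thesis by simp
  next
    case top
    have "AE x in M. norm ((f + g) x) \<le> Lp_norm M \<infinity> f + Lp_norm M \<infinity> g"
      using Lp_infinity_AE(2)[of f M] Lp_infinity_AE(2)[of g M] f g M top
      by (auto elim!: eventually_elim2 intro!: norm_triangle_mono simp: infinity_ennreal_def)
    from Lp_infinity_leI[OF fg this M] show ?thesis
      using top by (simp add: infinity_ennreal_def plus_fun_def)
  qed
  then show "f + g \<in> Lp_space M p" "Lp_norm M p (f + g) \<le> Lp_norm M p f + Lp_norm M p g"
    by auto
qed

lemma seminormed_space_Lp:
  assumes p: "1 \<le> p" and M: "emeasure M (space M) \<noteq> 0"
  shows "seminormed_space (Lp_space M p :: ('a \<Rightarrow> 'b::euclidean_space) set) (Lp_norm M p)"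
proof -
  have p0: "0 < p"
    using p by (metis less_le_trans zero_less_one)
  have sc: "c *\<^sub>R f \<in> Lp_space M p \<and> Lp_norm M p (c *\<^sub>R f) \<le> \<bar>c\<bar> * Lp_norm M p f"
    if f: "f \<in> Lp_space M p" for c and f :: "'a \<Rightarrow> 'b"
  proof -
    have "c *\<^sub>R f \<in> borel_measurable M"
      unfolding scaleR_fun_def using Lp_space_measurable[OF f] by measurable
    from Lp_space_dominated[OF f this p0 M, of "\<bar>c\<bar>"] show ?thesis by simp
  qed
  have zero: "(0 :: 'a \<Rightarrow> 'b) \<in> Lp_space M p"
  proof (cases p)
    case (real Q)
    then show ?thesis
      by (simp add: Lp_space_ennreal zero_fun_def)
  next
    case top
    then show ?thesis
      using Lp_infinity_leI(1)[of "0 :: 'a \<Rightarrow> 'b" M 0] M by (simp add: infinity_ennreal_def zero_fun_def)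
  qed
  then have sub: "subspace (Lp_space M p :: ('a \<Rightarrow> 'b) set)"
    using zero sc Lp_space_add[OF p M] by (auto simp: subspace_def)
  show ?thesis
  proof
    show "Lp_norm M p (c *\<^sub>R f) = \<bar>c\<bar> * Lp_norm M p f" if f: "f \<in> Lp_space M p" for f :: "'a \<Rightarrow> 'b" and c
    proof (cases "c = 0")
      case True
      have "0 \<le> Lp_norm M p (0 :: 'a \<Rightarrow> 'b)"
      proof (cases p)
        case top
        then show ?thesis
          using Lp_infinity_AE(1)[of "0 :: 'a \<Rightarrow> 'b" M] M zero by (simp add: infinity_ennreal_def)
      qed (auto simp: Lp_norm_ennreal)
      with sc[OF f, of 0] True show ?thesis by simp
    next
      case False
      \<comment> \<open>The upper bound applied to scaling back by \<open>inverse c\<close> is the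
        missing lower bound.\<close>
      have "Lp_norm M p f = Lp_norm M p (inverse c *\<^sub>R (c *\<^sub>R f))"
        using False by simp
      also have "\<dots> \<le> \<bar>inverse c\<bar> * Lp_norm M p (c *\<^sub>R f)"
        using sc sc[OF f, of c] by blast
      finally have "\<bar>c\<bar> * Lp_norm M p f \<le> Lp_norm M p (c *\<^sub>R f)"
        using False by (simp add: field_simps)
      with sc[OF f, of c] show ?thesis by simp
    qed
  qed (use sub Lp_space_add[OF p M] in auto)
qed

lemma Lp_norm_eq_0_iff:
  assumes f: "f \<in> Lp_space M (ennreal Q)" and Q: "Q > 0"
  shows "Lp_norm M (ennreal Q) f = 0 \<longleftrightarrow> (AE x in M. f x = 0)"
proof -
  have "Lp_norm M (ennreal Q) f = 0 \<longleftrightarrow> (\<integral>x. norm (f x) powr Q \<partial>M) = 0"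
    using Q by (simp add: Lp_norm_ennreal)
  also have "\<dots> \<longleftrightarrow> (AE x in M. norm (f x) powr Q = 0)"
    using f Q by (intro integral_nonneg_eq_0_iff_AE) (auto simp: Lp_space_ennreal)
  finally show ?thesis by simp
qed

lemma Lp_norm_cong_AE:
  assumes "f \<in> borel_measurable M" "g \<in> borel_measurable M" "AE x in M. f x = g x" "0 \<le> Q"
  shows "Lp_norm M (ennreal Q) f = Lp_norm M (ennreal Q) g"
proof -
  have "(\<integral>x. norm (f x) powr Q \<partial>M) = (\<integral>x. norm (g x) powr Q \<partial>M)"
    using assms by (intro integral_cong_AE) auto
  then show ?thesis
    using assms by (simp add: Lp_norm_ennreal)
qed

lemma Lp_space_AE_eq:
  fixes f g :: "'a::euclidean_space \<Rightarrow> 'b::euclidean_space"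
  assumes f: "f \<in> Lp_space lebesgue (ennreal Q)" and ae: "AE x in lebesgue. f x = g x" and Q: "0 < Q"
  shows "g \<in> Lp_space lebesgue (ennreal Q)" "Lp_norm lebesgue (ennreal Q) g = Lp_norm lebesgue (ennreal Q) f"
proof -
  have g: "g \<in> borel_measurable lebesgue"
    using borel_measurable_AE[OF Lp_space_measurable[OF f] ae] .
  show "g \<in> Lp_space lebesgue (ennreal Q)"
    by (rule Lp_space_dominated_finite(1)[OF f g Q, of 1]) (use ae in auto)
  show "Lp_norm lebesgue (ennreal Q) g = Lp_norm lebesgue (ennreal Q) f"
    using Lp_space_measurable[OF f] g ae Q by (intro Lp_norm_cong_AE) auto
qed

lemma conj_exponent_ennreal:
  assumes "R > 1"
  shows "conj_exponent (ennreal R) = ennreal (R / (R - 1))"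
  using assms by (simp add: conj_exponent_def divide_ennreal ennreal_minus flip: ennreal_1)

text \<open>For finite \<open>r\<close>, Young's inequality applied to \<open>norm (f x) / a\<close>
  and \<open>norm (g x) / b\<close> and integrated gives the bound \<open>a * b\<close> for all
  \<open>a\<close>, \<open>b\<close> above the two norms. For \<open>r = \<infinity>\<close> the
  essential bound of \<open>f\<close> is pulled out. The second factor is vector-valued because it
  will be a gradient.\<close>

lemma Lp_Holder:
  fixes f :: "'a \<Rightarrow> real" and g :: "'a \<Rightarrow> 'b::euclidean_space"
  assumes r: "r > 1" and M: "emeasure M (space M) \<noteq> 0"
    and f: "f \<in> Lp_space M r" and g: "g \<in> Lp_space M (conj_exponent r)"
  shows "(\<lambda>x. f x * norm (g x)) \<in> Lp_space M 1"
    "Lp_norm M 1 (\<lambda>x. f x * norm (g x)) \<le> Lp_norm M r f * Lp_norm M (conj_exponent r) g"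
proof -
  note [measurable] = Lp_space_measurable[OF f] Lp_space_measurable[OF g]
  have "(\<lambda>x. f x * norm (g x)) \<in> Lp_space M 1 \<and>
    Lp_norm M 1 (\<lambda>x. f x * norm (g x)) \<le> Lp_norm M r f * Lp_norm M (conj_exponent r) g"
  proof (cases r)
    case top
    then have q: "conj_exponent r = 1"
      by (simp add: conj_exponent_def infinity_ennreal_def)
    have "AE x in M. norm (f x * norm (g x)) \<le> Lp_norm M r f * norm (g x)"
    proof -
      have "AE x in M. norm (f x) \<le> Lp_norm M r f"
        using Lp_infinity_AE(2)[of f M] f M top by (auto simp: infinity_ennreal_def)
      then show ?thesis
        by eventually_elim (auto simp: abs_mult intro: mult_right_mono)
    qed
    moreover have "0 \<le> Lp_norm M r f"
      using Lp_infinity_AE(1)[of f M] f M top by (auto simp: infinity_ennreal_def)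
    ultimately show ?thesis
      using Lp_space_dominated_finite[of g M 1 "\<lambda>x. f x * norm (g x)" "Lp_norm M r f"] g unfolding q
      by auto
  next
    case (real R)
    then have R: "R > 1"
      using r by (metis ennreal_1 ennreal_less_iff zero_le_one)
    define Q where "Q = R / (R - 1)"
    have q: "conj_exponent r = ennreal Q"
      using R real by (simp add: conj_exponent_ennreal Q_def)
    have Q: "Q > 1" "1 / R + 1 / Q = 1"
      using R by (auto simp: Q_def field_simps)
    let ?F = "Lp_norm M r f" and ?G = "Lp_norm M (ennreal Q) g"
    have nn: "0 \<le> ?F" "0 \<le> ?G"
      using real R Q by auto
    have intf: "integrable M (\<lambda>x. norm (f x) powr R)" and intg: "integrable M (\<lambda>x. norm (g x) powr Q)"
      using f g[unfolded q] R Q real by (auto simp: Lp_space_ennreal)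
    have cv: "norm (f x * norm (g x)) \<le> a * b * (norm (f x) powr R / a powr R / R + norm (g x) powr Q / b powr Q / Q)"
      if "a > 0" "b > 0" for a b x
    proof -
      have "norm (f x) / a * (norm (g x) / b) \<le> (norm (f x) / a) powr R / R + (norm (g x) / b) powr Q / Q"
        using that R Q by (intro Youngs_inequality) auto
      then show ?thesis
        using that by (simp add: abs_mult powr_divide field_simps)
    qed
    have intr: "integrable M (\<lambda>x. a * b * (norm (f x) powr R / a powr R / R + norm (g x) powr Q / b powr Q / Q))" for a b
      using intf intg by simp
    have int: "integrable M (\<lambda>x. f x * norm (g x))"
      by (rule Bochner_Integration.integrable_bound[OF intr[of 1 1]])
        (use cv[of 1 1] in \<open>auto intro: order_trans[OF _ abs_ge_self]\<close>)
    have bd: "(\<integral>x. norm (f x * norm (g x)) \<partial>M) \<le> a * b" if a: "a > ?F" and b: "b > ?G" for a b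
    proof -
      have ab: "a > 0" "b > 0"
        using a b nn by linarith+
      have A: "(\<integral>x. norm (f x) powr R \<partial>M) / a powr R \<le> 1" and B: "(\<integral>x. norm (g x) powr Q \<partial>M) / b powr Q \<le> 1"
      proof -
        have "?F powr R \<le> a powr R" "?G powr Q \<le> b powr Q"
          using a b R Q nn by (auto intro!: powr_mono2)
        then show "(\<integral>x. norm (f x) powr R \<partial>M) / a powr R \<le> 1" "(\<integral>x. norm (g x) powr Q \<partial>M) / b powr Q \<le> 1"
          using ab R Q real by (simp_all add: Lp_norm_powr divide_le_eq_1)
      qed
      have "(\<integral>x. norm (f x * norm (g x)) \<partial>M) \<le>
          (\<integral>x. a * b * (norm (f x) powr R / a powr R / R + norm (g x) powr Q / b powr Q / Q) \<partial>M)"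
        by (intro integral_mono intr integrable_norm int cv ab)
      also have "\<dots> = a * b * ((\<integral>x. norm (f x) powr R \<partial>M) / a powr R / R
          + (\<integral>x. norm (g x) powr Q \<partial>M) / b powr Q / Q)"
        using intf intg by simp
      also have "\<dots> \<le> a * b * (1 / R + 1 / Q)"
        using ab A B R Q by (intro mult_left_mono add_mono divide_right_mono) auto
      finally show ?thesis using Q by simp
    qed
    \<comment> \<open>The admissible \<open>a\<close> and \<open>b\<close> decrease to the norms;
      the detour avoids dividing by a norm that may be 0.\<close>
    have "(\<lambda>n. (?F + 1 / real (Suc n)) * (?G + 1 / real (Suc n))) \<longlonglongrightarrow> (?F + 0) * (?G + 0)"
      by (intro tendsto_intros LIMSEQ_Suc[OF lim_1_over_n])
    moreover have "(\<integral>x. norm (f x * norm (g x)) \<partial>M) \<le> (?F + 1 / real (Suc n)) * (?G + 1 / real (Suc n))" for n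
      by (intro bd) auto
    ultimately have "(\<integral>x. norm (f x * norm (g x)) \<partial>M) \<le> ?F * ?G"
      by (intro LIMSEQ_le_const[where X="\<lambda>n. (?F + 1 / real (Suc n)) * (?G + 1 / real (Suc n))"]) auto
    with int show ?thesis
      by (simp add: Lp_space_1 Lp_norm_1 q)
  qed
  then show "(\<lambda>x. f x * norm (g x)) \<in> Lp_space M 1"
    "Lp_norm M 1 (\<lambda>x. f x * norm (g x)) \<le> Lp_norm M r f * Lp_norm M (conj_exponent r) g"
    by auto
qed

lemma nn_integral_Lp_norm:
  assumes "h \<in> Lp_space M (ennreal Q)" "Q > 0"
  shows "(\<integral>\<^sup>+x. ennreal (norm (h x) powr Q) \<partial>M) = ennreal (Lp_norm M (ennreal Q) h powr Q)"
  using assms by (simp add: Lp_norm_powr Lp_space_ennreal nn_integral_eq_integral)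

lemma Lp_space_nn_integralI:
  assumes h: "h \<in> borel_measurable M" and Q: "Q > 0" and c: "0 \<le> c"
    and le: "(\<integral>\<^sup>+x. ennreal (norm (h x) powr Q) \<partial>M) \<le> ennreal (c powr Q)"
  shows "h \<in> Lp_space M (ennreal Q)" "Lp_norm M (ennreal Q) h \<le> c"
proof -
  note [measurable] = h
  have int: "integrable M (\<lambda>x. norm (h x) powr Q)"
    using le by (intro integrableI_bounded) (auto simp: less_top[symmetric] top_unique)
  then show "h \<in> Lp_space M (ennreal Q)"
    using h Q by (simp add: Lp_space_ennreal)
  have "ennreal (\<integral>x. norm (h x) powr Q \<partial>M) \<le> ennreal (c powr Q)"
    using le int by (simp add: nn_integral_eq_integral)
  then show "Lp_norm M (ennreal Q) h \<le> c"
    using Q c by (intro Lp_norm_leI) auto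
qed

text \<open>Riesz-Fischer: a subsequence with increments of norm at most \<open>(1/2)^j\<close>
  converges almost everywhere, and Fatou's lemma upgrades this to convergence in norm of the whole
  sequence.\<close>

lemma complete_Lp:
  assumes Q: "Q \<ge> 1" and M: "emeasure M (space M) \<noteq> 0"
  shows "complete_seminorm (Lp_space M (ennreal Q) :: ('a \<Rightarrow> 'b::euclidean_space) set) (Lp_norm M (ennreal Q))"
  unfolding complete_seminorm_def
proof safe
  let ?N = "Lp_norm M (ennreal Q) :: ('a \<Rightarrow> 'b) \<Rightarrow> real"
  let ?X = "Lp_space M (ennreal Q) :: ('a \<Rightarrow> 'b) set"
  fix S :: "nat \<Rightarrow> 'a \<Rightarrow> 'b"
  assume S: "\<forall>i. S i \<in> ?X" and cau: "\<forall>e>0. \<exists>k. \<forall>m\<ge>k. \<forall>n\<ge>k. ?N (S m - S n) < e"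
  interpret seminormed_space ?X ?N
    using Q M by (intro seminormed_space_Lp) auto
  have Q0: "Q > 0" using Q by simp
  have [measurable]: "S i \<in> borel_measurable M" for i
    using S Lp_space_measurable[of "S i" M "ennreal Q"] by simp
  define K where "K j = (SOME k. \<forall>m\<ge>k. \<forall>n\<ge>k. ?N (S m - S n) < (1/2)^j)" for j :: nat
  have K: "\<forall>m\<ge>K j. \<forall>n\<ge>K j. ?N (S m - S n) < (1/2)^j" for j
    unfolding K_def by (rule someI_ex, rule cau[rule_format]) simp
  \<comment> \<open>The sum makes \<open>L\<close> monotone and at least \<open>K j\<close>; the
    summand \<open>j\<close> makes it tend to infinity.\<close>
  define L where "L j = j + (\<Sum>i\<le>j. K i)" for j
  have LK: "K j \<le> L j" for j
    unfolding L_def by (intro trans_le_add2 member_le_sum) auto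
  have Lmono: "L j \<le> L (Suc j)" for j
    by (simp add: L_def)
  define D where "D j = S (L (Suc j)) - S (L j)" for j
  have D: "D j \<in> ?X" "?N (D j) \<le> (1/2)^j" for j
    using S K[of j] LK[of j] Lmono[of j] by (auto simp: D_def diff_mem less_imp_le)
  have [measurable]: "D j \<in> borel_measurable M" for j
    using Lp_space_measurable[OF D(1)] .
  have absD: "(\<lambda>x. norm (D j x)) \<in> Lp_space M (ennreal Q)"
    "Lp_norm M (ennreal Q) (\<lambda>x. norm (D j x)) \<le> (1/2)^j" for j
  proof -
    show "(\<lambda>x. norm (D j x)) \<in> Lp_space M (ennreal Q)"
      by (rule Lp_space_dominated_finite[OF D(1)[of j] _ Q0, of _ 1]) auto
    show "Lp_norm M (ennreal Q) (\<lambda>x. norm (D j x)) \<le> (1/2)^j"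
      using D(2)[of j] Q0 by (simp add: Lp_norm_ennreal)
  qed
  interpret R: seminormed_space "Lp_space M (ennreal Q) :: ('a \<Rightarrow> real) set" "Lp_norm M (ennreal Q)"
    using Q M by (intro seminormed_space_Lp) auto
  define G where "G n x = (\<Sum>j<n. norm (D j x))" for n x
  have G_eq: "G n = (\<Sum>j<n. (\<lambda>x. norm (D j x)))" for n
    by (simp add: fun_eq_iff G_def sum_fun_apply)
  have GX: "G n \<in> Lp_space M (ennreal Q)" for n
    unfolding G_eq by (intro R.sum_mem absD)
  have "Lp_norm M (ennreal Q) (G n) \<le> (\<Sum>j<n. (1/2)^j)" for n
    unfolding G_eq by (intro order_trans[OF R.N_sum_le] sum_mono absD)
  also have "(\<Sum>j<n. (1/2::real)^j) \<le> 2" for n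
    by (simp add: sum_gp_strict)
  finally have GN: "Lp_norm M (ennreal Q) (G n) \<le> 2" for n .
  have [measurable]: "G n \<in> borel_measurable M" for n
    using Lp_space_measurable[OF GX] .
  have Gnn: "0 \<le> G n x" for n x
    by (simp add: G_def sum_nonneg)
  \<comment> \<open>Monotone convergence: the partial sums of the increments have norm at most 2, so
    their supremum is finite almost everywhere.\<close>
  have "AE x in M. (SUP n. ennreal (G n x powr Q)) \<noteq> \<infinity>"
  proof (rule nn_integral_PInf_AE)
    have "(\<integral>\<^sup>+x. (SUP n. ennreal (G n x powr Q)) \<partial>M) = (SUP n. \<integral>\<^sup>+x. ennreal (G n x powr Q) \<partial>M)"
      using Q0 by (intro nn_integral_monotone_convergence_SUP)
        (auto simp: incseq_def le_fun_def G_def intro!: ennreal_leI powr_mono2 sum_mono2 sum_nonneg)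
    also have "\<dots> \<le> ennreal (2 powr Q)"
    proof (rule SUP_least)
      fix n
      show "(\<integral>\<^sup>+x. ennreal (G n x powr Q) \<partial>M) \<le> ennreal (2 powr Q)"
        using nn_integral_Lp_norm[OF GX[of n] Q0] GN[of n] Q0 Gnn
        by (auto intro!: ennreal_leI powr_mono2)
    qed
    finally show "(\<integral>\<^sup>+x. (SUP n. ennreal (G n x powr Q)) \<partial>M) \<noteq> \<infinity>"
      by (auto simp: top_unique infinity_ennreal_def)
  qed measurable
  then have conv: "AE x in M. convergent (\<lambda>j. S (L j) x)"
  proof eventually_elim
    case (elim x)
    then obtain c where c: "c \<ge> 0" "(SUP n. ennreal (G n x powr Q)) = ennreal c"
      by (cases "SUP n. ennreal (G n x powr Q)") (auto simp: infinity_ennreal_def)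
    have "G n x \<le> c powr (1/Q)" for n
    proof -
      have "ennreal (G n x powr Q) \<le> ennreal c"
        unfolding c(2)[symmetric] by (rule SUP_upper) simp
      then have "(G n x powr Q) powr (1/Q) \<le> c powr (1/Q)"
        using c Q0 by (intro powr_mono2) auto
      then show ?thesis using Q0 Gnn by (simp add: powr_powr)
    qed
    then have "summable (\<lambda>j. norm (D j x))"
      by (intro summableI_nonneg_bounded[of _ "c powr (1/Q)"]) (auto simp: G_def)
    then have "convergent (\<lambda>n. S (L 0) x + (\<Sum>j<n. D j x))"
      by (intro convergent_add convergent_const) (simp add: summable_iff_convergent[symmetric] summable_norm_cancel)
    also have "(\<lambda>n. S (L 0) x + (\<Sum>j<n. D j x)) = (\<lambda>n. S (L n) x)"
      by (simp add: D_def fun_diff_def sum_lessThan_telescope[of "\<lambda>j. S (L j) x"])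
    finally show ?case .
  qed
  define f where "f x = lim (\<lambda>j. S (L j) x)" for x
  have f [measurable]: "f \<in> borel_measurable M"
    unfolding f_def by (intro borel_measurable_lim_metric) measurable
  have flim: "AE x in M. (\<lambda>j. S (L j) x) \<longlonglongrightarrow> f x"
    using conv by eventually_elim (simp add: f_def convergent_LIMSEQ_iff)
  \<comment> \<open>Fatou along the subsequence with \<open>n\<close> fixed. Membership of
    \<open>S n - f\<close> comes out of the same bound, so \<open>f\<close> itself is in the
    space.\<close>
  have key: "S n - f \<in> ?X \<and> ?N (S n - f) \<le> e" if e: "e > 0" and n: "\<forall>m\<ge>n. ?N (S m - S n) \<le> e" for e n
  proof -
    have "(\<integral>\<^sup>+x. ennreal (norm (S n x - f x) powr Q) \<partial>M) =
        (\<integral>\<^sup>+x. liminf (\<lambda>j. ennreal (norm (S n x - S (L j) x) powr Q)) \<partial>M)"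
    proof (rule nn_integral_cong_AE)
      show "AE x in M. ennreal (norm (S n x - f x) powr Q) = liminf (\<lambda>j. ennreal (norm (S n x - S (L j) x) powr Q))"
        using flim
      proof eventually_elim
        case (elim x)
        have "(\<lambda>j. ennreal (norm (S n x - S (L j) x) powr Q)) \<longlonglongrightarrow> ennreal (norm (S n x - f x) powr Q)"
          using Q0 by (intro tendsto_ennrealI tendsto_powr' tendsto_intros elim) auto
        then show ?case
          by (rule lim_imp_Liminf[OF trivial_limit_sequentially, symmetric])
      qed
    qed
    also have "\<dots> \<le> liminf (\<lambda>j. \<integral>\<^sup>+x. ennreal (norm (S n x - S (L j) x) powr Q) \<partial>M)"
      by (intro nn_integral_liminf) measurable
    also have "\<dots> \<le> ennreal (e powr Q)"
    proof (rule Liminf_le)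
      have "eventually (\<lambda>j. n \<le> L j) sequentially"
        using eventually_ge_at_top[of n] by eventually_elim (simp add: L_def)
      then show "\<forall>\<^sub>F j in sequentially. (\<integral>\<^sup>+x. ennreal (norm (S n x - S (L j) x) powr Q) \<partial>M) \<le> ennreal (e powr Q)"
      proof eventually_elim
        case (elim j)
        have "?N (S n - S (L j)) \<le> e"
          using n elim S N_diff_commute by metis
        then show ?case
          using nn_integral_Lp_norm[OF diff_mem, of "S n" "S (L j)"] S Q0 e
          by (auto intro!: ennreal_leI powr_mono2)
      qed
    qed simp
    finally show ?thesis
      using Lp_space_nn_integralI[of "S n - f" M Q e] Q0 e by (auto simp: fun_diff_def)
  qed
  have tail: "\<exists>k. \<forall>n\<ge>k. S n - f \<in> ?X \<and> ?N (S n - f) \<le> e" if e: "e > 0" for e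
  proof -
    obtain k where "\<forall>m\<ge>k. \<forall>n\<ge>k. ?N (S m - S n) < e"
      using cau e by blast
    then have "\<forall>n\<ge>k. S n - f \<in> ?X \<and> ?N (S n - f) \<le> e"
      using key[OF e] by (meson less_imp_le order_trans)
    then show ?thesis by blast
  qed
  obtain k where "S k - f \<in> ?X"
    using tail[of 1] by auto
  then have "S k - (S k - f) \<in> ?X"
    using S diff_mem[of "S k" "S k - f"] by blast
  then have fX: "f \<in> ?X" by simp
  moreover have "(\<lambda>i. ?N (S i - f)) \<longlonglongrightarrow> 0"
  proof (rule LIMSEQ_I)
    fix e :: real assume "e > 0"
    then obtain k where k: "\<forall>n\<ge>k. ?N (S n - f) \<le> e / 2"
      using tail[of "e / 2"] by auto
    have "norm (?N (S n - f) - 0) < e" if "n \<ge> k" for n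
    proof -
      have "?N (S n - f) \<le> e / 2"
        using k that by blast
      with \<open>e > 0\<close> show ?thesis
        using N_nonneg[OF diff_mem, of "S n" f] S fX by simp
    qed
    then show "\<exists>no. \<forall>n\<ge>no. norm (?N (S n - f) - 0) < e"
      by blast
  qed
  ultimately show "\<exists>x\<in>?X. (\<lambda>i. ?N (S i - x)) \<longlonglongrightarrow> 0"
    by blast
qed

section \<open>Test functions\<close>

lemma Ck_Suc_imp: "Ck (Suc k) h \<Longrightarrow> Ck k h"
proof (induction k arbitrary: h)
  case 0
  then obtain D where "\<And>x. (h has_derivative D x) (at x)"
    by auto
  then show ?case
    by (auto intro!: continuous_at_imp_continuous_on has_derivative_continuous)
next
  case (Suc k)
  then obtain D where "\<forall>x. (h has_derivative D x) (at x)" "\<forall>e. Ck (Suc k) (\<lambda>x. D x e)"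
    by auto
  with Suc.IH show ?case by auto
qed

lemma Ck_SucI:
  "(\<And>x. (h has_derivative D x) (at x)) \<Longrightarrow> (\<And>e. Ck k (\<lambda>x. D x e)) \<Longrightarrow> Ck (Suc k) h"
  by auto

lemma Ck_SucE:
  assumes "Ck (Suc k) h"
  obtains D where "\<And>x. (h has_derivative D x) (at x)" "\<And>e. Ck k (\<lambda>x. D x e)"
  using assms by auto

lemma Ck_const: "Ck k (\<lambda>x. c)"
proof (induction k arbitrary: c)
  case (Suc k)
  show ?case
    by (rule Ck_SucI[of _ "\<lambda>x e. 0"]) (auto intro: Suc)
qed simp

lemma Ck_add: "Ck k f \<Longrightarrow> Ck k g \<Longrightarrow> Ck k (\<lambda>x. f x + g x)"
proof (induction k arbitrary: f g)
  case 0
  then show ?case by (auto intro: continuous_on_add)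
next
  case (Suc k)
  obtain D where D: "\<And>x. (f has_derivative D x) (at x)" "\<And>e. Ck k (\<lambda>x. D x e)"
    by (rule Ck_SucE[OF Suc.prems(1)]) (rule that)
  obtain E where E: "\<And>x. (g has_derivative E x) (at x)" "\<And>e. Ck k (\<lambda>x. E x e)"
    by (rule Ck_SucE[OF Suc.prems(2)]) (rule that)
  show ?case
    by (rule Ck_SucI[of _ "\<lambda>x e. D x e + E x e"]) (auto intro!: has_derivative_add D E Suc.IH)
qed

lemma Ck_mult:
  fixes f g :: "'a::euclidean_space \<Rightarrow> real"
  shows "Ck k f \<Longrightarrow> Ck k g \<Longrightarrow> Ck k (\<lambda>x. f x * g x)"
proof (induction k arbitrary: f g)
  case 0
  then show ?case by (auto intro: continuous_on_mult)
next
  case (Suc k)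
  obtain D where D: "\<And>x. (f has_derivative D x) (at x)" "\<And>e. Ck k (\<lambda>x. D x e)"
    by (rule Ck_SucE[OF Suc.prems(1)]) (rule that)
  obtain E where E: "\<And>x. (g has_derivative E x) (at x)" "\<And>e. Ck k (\<lambda>x. E x e)"
    by (rule Ck_SucE[OF Suc.prems(2)]) (rule that)
  have fg: "Ck k f" "Ck k g"
    using Suc.prems by (blast intro: Ck_Suc_imp)+
  show ?case
    by (rule Ck_SucI[of _ "\<lambda>x e. f x * E x e + D x e * g x"])
      (auto intro!: has_derivative_mult D E Suc.IH Ck_add fg)
qed

lemma Ck_prod:
  fixes f :: "'i \<Rightarrow> 'a::euclidean_space \<Rightarrow> real"
  shows "(\<And>i. i \<in> I \<Longrightarrow> Ck k (f i)) \<Longrightarrow> Ck k (\<lambda>x. \<Prod>i\<in>I. f i x)"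
  by (induction I rule: infinite_finite_induct) (auto intro: Ck_const Ck_mult)

lemma Ck_compose_inner:
  fixes h :: "real \<Rightarrow> real" and b :: "'a::euclidean_space"
  shows "Ck k h \<Longrightarrow> Ck k (\<lambda>x. h (c * (x \<bullet> b) + a))"
proof (induction k arbitrary: h)
  case 0
  then show ?case
    by (auto intro!: continuous_intros continuous_on_compose2[of UNIV h])
next
  case (Suc k)
  obtain D where D: "\<And>x. (h has_derivative D x) (at x)" "\<And>e. Ck k (\<lambda>x. D x e)"
    by (rule Ck_SucE[OF Suc.prems(1)]) (rule that)
  show ?case
  proof (rule Ck_SucI)
    fix x :: 'a
    have "((\<lambda>x. c * (x \<bullet> b) + a) has_derivative (\<lambda>e. c * (e \<bullet> b))) (at x)"
      by (auto intro!: derivative_eq_intros)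
    from has_derivative_compose[OF this D(1)]
    show "((\<lambda>x. h (c * (x \<bullet> b) + a)) has_derivative (\<lambda>e. D (c * (x \<bullet> b) + a) (c * (e \<bullet> b)))) (at x)" .
  qed (rule Suc.IH, rule D)
qed

section \<open>Smooth bumps approximating the indicator of a box\<close>

text \<open>The classical flat function \<open>exp (- (c / x))\<close> with powers of
  \<open>1 / x\<close> in front. The powers close the family under differentiation, so smoothness is
  an induction over all \<open>m\<close> at once; letting \<open>c\<close> tend to 0 turns the case
  \<open>m = 0\<close> into the indicator of the positive half-line.\<close>

definition flat_exp :: "real \<Rightarrow> nat \<Rightarrow> real \<Rightarrow> real" where
  "flat_exp c m x = (if x > 0 then (1 / x) ^ m * exp (- (c / x)) else 0)"

text \<open>With \<open>y = c / x\<close> the right-hand limit is the decay of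
  \<open>y ^ m / exp y\<close> at infinity.\<close>

lemma flat_exp_tendsto_0:
  assumes c: "c > 0"
  shows "(flat_exp c m \<longlongrightarrow> 0) (at 0)"
proof -
  have "((\<lambda>x. (1 / c) ^ m * ((c * inverse x) ^ m / exp (c * inverse x))) \<longlongrightarrow> (1 / c) ^ m * 0) (at_right 0)"
    using c by (intro tendsto_mult tendsto_const filterlim_compose[OF tendsto_power_div_exp_0]
      filterlim_tendsto_pos_mult_at_top[OF tendsto_const _ filterlim_inverse_at_top_right]) auto
  moreover have "eventually (\<lambda>x. (1 / c) ^ m * ((c * inverse x) ^ m / exp (c * inverse x)) = flat_exp c m x) (at_right 0)"
    unfolding eventually_at_right_field
    using c by (intro exI[of _ 1])
      (auto simp: flat_exp_def exp_minus power_mult_distrib[symmetric] field_simps)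
  ultimately have "(flat_exp c m \<longlongrightarrow> 0) (at_right 0)"
    by (simp add: filterlim_cong)
  moreover have "(flat_exp c m \<longlongrightarrow> 0) (at_left 0)"
    by (rule tendsto_eventually) (auto simp: flat_exp_def eventually_at_left_field intro!: exI[of _ "-1"])
  ultimately show ?thesis
    by (simp add: filterlim_split_at)
qed

lemma flat_exp_has_derivative:
  assumes c: "c > 0"
  shows "(flat_exp c m has_field_derivative (- real m * flat_exp c (m + 1) x + c * flat_exp c (m + 2) x)) (at x)"
proof -
  consider "x < 0" | "x = 0" | "x > 0" by linarith
  then show ?thesis
  proof cases
    case 1
    have "((\<lambda>x. 0 :: real) has_field_derivative 0) (at x)" by simp
    then have "(flat_exp c m has_field_derivative 0) (at x)"
      by (rule has_field_derivative_transform_within_open[of _ _ _ "{..<0}"])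
        (use 1 in \<open>auto simp: flat_exp_def\<close>)
    then show ?thesis using 1 by (simp add: flat_exp_def)
  next
    case 2
    \<comment> \<open>The difference quotient at 0 is the member of the family with
      \<open>m + 1\<close>, which tends to 0.\<close>
    have "((\<lambda>h. (flat_exp c m (0 + h) - flat_exp c m 0) / h) \<longlongrightarrow> 0) (at 0)"
    proof (rule Lim_transform_eventually[OF flat_exp_tendsto_0[OF c, of "m + 1"]])
      show "eventually (\<lambda>h. flat_exp c (m + 1) h = (flat_exp c m (0 + h) - flat_exp c m 0) / h) (at 0)"
        by (rule always_eventually) (auto simp: flat_exp_def)
    qed
    then show ?thesis
      using 2 by (simp add: DERIV_def flat_exp_def)
  next
    case 3
    have "((\<lambda>x. (1 / x) ^ m * exp (- (c / x))) has_field_derivative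
        (- real m * (1 / x) ^ (m + 1) * exp (- (c / x)) + (1 / x) ^ m * (exp (- (c / x)) * (c / x\<^sup>2)))) (at x)"
    proof -
      have "real m * (1 / x) ^ (m - 1) * (- (1 / x\<^sup>2)) = - real m * (1 / x) ^ (m + 1)"
        using 3 by (cases m) (auto simp: field_simps power2_eq_square)
      then have 1: "((\<lambda>x. (1 / x) ^ m) has_field_derivative - real m * (1 / x) ^ (m + 1)) (at x)"
        using 3 by (auto intro!: derivative_eq_intros simp: power2_eq_square)
      have 2: "((\<lambda>x. exp (- (c / x))) has_field_derivative exp (- (c / x)) * (c / x\<^sup>2)) (at x)"
        using 3 by (auto intro!: derivative_eq_intros simp: power2_eq_square field_simps)
      show ?thesis
        by (rule DERIV_cong[OF DERIV_mult[OF 1 2]]) (simp add: algebra_simps)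
    qed
    then have "(flat_exp c m has_field_derivative
        (- real m * (1 / x) ^ (m + 1) * exp (- (c / x)) + (1 / x) ^ m * (exp (- (c / x)) * (c / x\<^sup>2)))) (at x)"
      by (rule has_field_derivative_transform_within_open[of _ _ _ "{0<..}"])
        (use 3 in \<open>auto simp: flat_exp_def\<close>)
    then show ?thesis
      using 3 by (simp add: flat_exp_def field_simps power2_eq_square)
  qed
qed

lemma Ck_flat_exp: "c > 0 \<Longrightarrow> Ck k (flat_exp c m)"
proof (induction k arbitrary: m)
  case 0
  then show ?case
    using flat_exp_has_derivative[OF \<open>c > 0\<close>] by (auto intro!: continuous_at_imp_continuous_on DERIV_isCont)
next
  case (Suc k)
  show ?case
  proof (rule Ck_SucI)
    show "(flat_exp c m has_derivative (\<lambda>e. (- real m * flat_exp c (m + 1) x + c * flat_exp c (m + 2) x) * e)) (at x)" for x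
      using flat_exp_has_derivative[OF \<open>c > 0\<close>] by (simp add: has_field_derivative_def)
    show "Ck k (\<lambda>x. (- real m * flat_exp c (m + 1) x + c * flat_exp c (m + 2) x) * e)" for e
      by (intro Ck_mult Ck_add Ck_const Suc.IH Suc.prems)
  qed
qed

text \<open>For each coordinate one factor vanishes below \<open>l\<close> and one above
  \<open>u\<close>. As \<open>n\<close> grows the bumps tend pointwise to the indicator of the open
  box. The affine arguments are written in the shape expected by
  \<open>Ck_compose_inner\<close>.\<close>

definition box_bump :: "nat \<Rightarrow> 'a::euclidean_space \<Rightarrow> 'a \<Rightarrow> 'a \<Rightarrow> real" where
  "box_bump n l u x =
     (\<Prod>b\<in>Basis. flat_exp (1 / Suc n) 0 (1 * (x \<bullet> b) + (- (l \<bullet> b))) *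
                 flat_exp (1 / Suc n) 0 ((- 1) * (x \<bullet> b) + (u \<bullet> b)))"

lemma box_bump_bounds: "0 \<le> box_bump n l u x" "box_bump n l u x \<le> 1"
  unfolding box_bump_def by (auto intro!: prod_nonneg prod_le_1 mult_nonneg_nonneg mult_le_one simp: flat_exp_def)

lemma box_bump_outside:
  assumes "x \<notin> box l u"
  shows "box_bump n l u x = 0"
proof -
  obtain b where "b \<in> Basis" "x \<bullet> b \<le> l \<bullet> b \<or> u \<bullet> b \<le> x \<bullet> b"
    using assms by (auto simp: mem_box not_less)
  then show ?thesis
    unfolding box_bump_def by (intro prod_zero) (auto simp: flat_exp_def intro!: bexI[of _ b])
qed

lemma test_function_box_bump: "test_function (box_bump n l u)"
proof -
  have "closure {x. box_bump n l u x \<noteq> 0} \<subseteq> cbox l u"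
    using box_bump_outside[of _ l u n] box_subset_cbox[of l u] by (intro closure_minimal) auto
  then have "compact (closure {x. box_bump n l u x \<noteq> 0})"
    by (meson bounded_cbox bounded_subset closed_closure compact_eq_bounded_closed)
  moreover have "Ck k (box_bump n l u)" for k
    unfolding box_bump_def by (intro Ck_prod Ck_mult Ck_compose_inner Ck_flat_exp) auto
  ultimately show ?thesis
    by (simp add: test_function_def)
qed

lemma box_bump_tendsto: "(\<lambda>n. box_bump n l u x) \<longlonglongrightarrow> indicator (box l u) x"
proof (cases "x \<in> box l u")
  case True
  have 1: "(\<lambda>n. flat_exp (1 / Suc n) 0 z) \<longlonglongrightarrow> 1" if "z > 0" for z
  proof -
    have "(\<lambda>n. exp (- (1 / real (Suc n) / z))) \<longlonglongrightarrow> exp (- (0 / z))"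
      using that by (intro tendsto_intros LIMSEQ_Suc[OF lim_1_over_n]) auto
    then show ?thesis using that by (simp add: flat_exp_def)
  qed
  have "(\<lambda>n. box_bump n l u x) \<longlonglongrightarrow> (\<Prod>b\<in>(Basis :: 'a set). 1 * 1)"
    unfolding box_bump_def using True
    by (intro tendsto_prod tendsto_mult 1) (auto simp: mem_box)
  with True show ?thesis by simp
next
  case False
  then show ?thesis by (simp add: box_bump_outside)
qed

text \<open>Lebesgue differentiation along the cubes with lower corner \<open>x\<close>: almost
  every value of \<open>g\<close> is a limit of averages, and all averages are 0.\<close>

lemma AE_zero_if_box_integrals:
  fixes g :: "'a::euclidean_space \<Rightarrow> real"
  assumes loc: "\<And>K. compact K \<Longrightarrow> g absolutely_integrable_on K"
    and zero: "\<And>l u. (\<integral>x. g x * indicator (box l u) x \<partial>lebesgue) = 0"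
  shows "AE x in lebesgue. g x = 0"
proof -
  have cb: "integral (cbox l u) g = 0" for l u
  proof -
    have "integral (cbox l u) g = integral (box l u) g"
      by (simp add: integral_open_interval)
    also have "\<dots> = (LINT x:box l u|lebesgue. g x)"
      using set_integrable_subset[OF loc[OF compact_cbox[of l u]], of "box l u"] box_subset_cbox[of l u]
      by (intro set_lebesgue_integral_eq_integral(2)[symmetric]) auto
    also have "\<dots> = 0"
      using zero[of l u] by (simp add: set_lebesgue_integral_def mult.commute)
    finally show ?thesis .
  qed
  obtain N where N: "negligible N"
    "\<And>x e. \<lbrakk>x \<notin> N; 0 < e\<rbrakk> \<Longrightarrow> \<exists>d>0. \<forall>h. 0 < h \<and> h < d \<longrightarrow>
       norm (integral (cbox x (x + h *\<^sub>R One)) g /\<^sub>R h ^ DIM('a) - g x) < e"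
    by (rule integrable_ccontinuous_explicit[of g])
      (use loc in \<open>auto intro: set_lebesgue_integral_eq_integral\<close>)
  have "g x = 0" if x: "x \<notin> N" for x
  proof (rule ccontr)
    assume "g x \<noteq> 0"
    then obtain d where "d > 0" "\<And>h. 0 < h \<and> h < d \<Longrightarrow>
       norm (integral (cbox x (x + h *\<^sub>R One)) g /\<^sub>R h ^ DIM('a) - g x) < \<bar>g x\<bar>"
      using N(2)[OF x, of "\<bar>g x\<bar>"] by auto
    from this(2)[of "d/2"] \<open>d > 0\<close> show False
      by (simp add: cb)
  qed
  moreover have "N \<in> null_sets lebesgue"
    using N(1) by (simp add: negligible_iff_null_sets)
  ultimately show ?thesis
    by (auto intro!: AE_I' [of N])
qed

lemma test_function_derivative:
  assumes "test_function \<phi>"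
  shows "(\<phi> has_derivative frechet_derivative \<phi> (at x)) (at x)"
    "continuous_on UNIV (\<lambda>x. frechet_derivative \<phi> (at x) b)"
proof -
  have "Ck 1 \<phi>"
    using assms by (simp add: test_function_def)
  then obtain D where D: "\<And>x. (\<phi> has_derivative D x) (at x)" "\<And>e. continuous_on UNIV (\<lambda>x. D x e)"
    by auto
  then have *: "frechet_derivative \<phi> (at x) = D x" for x
    using frechet_derivative_at by metis
  show "(\<phi> has_derivative frechet_derivative \<phi> (at x)) (at x)"
    "continuous_on UNIV (\<lambda>x. frechet_derivative \<phi> (at x) b)"
    unfolding * using D by auto
qed

lemma test_function_continuous: "test_function \<phi> \<Longrightarrow> continuous_on UNIV \<phi>"
  by (auto simp: test_function_def dest: spec[of _ 0])

text \<open>The compact set is named so that a test function and all its partial derivatives can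
  share it.\<close>

definition supported_in :: "('a::topological_space \<Rightarrow> 'b::real_normed_vector) \<Rightarrow> 'a set \<Rightarrow> bool" where
  "supported_in \<phi> K \<longleftrightarrow> compact K \<and> continuous_on UNIV \<phi> \<and> (\<forall>x. x \<notin> K \<longrightarrow> \<phi> x = 0)"

lemma test_function_supported:
  assumes "test_function \<phi>"
  obtains K where "supported_in \<phi> K" "\<And>b. supported_in (\<lambda>x. frechet_derivative \<phi> (at x) b) K"
proof
  let ?K = "closure {x. \<phi> x \<noteq> 0}"
  have K: "compact ?K"
    using assms by (simp add: test_function_def)
  have 0: "\<phi> x = 0" if "x \<notin> ?K" for x
    using that closure_subset[of "{x. \<phi> x \<noteq> 0}"] by auto
  show "supported_in \<phi> ?K"
    unfolding supported_in_def using K 0 test_function_continuous[OF assms] by blast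
  \<comment> \<open>Off its closed support \<open>\<phi>\<close> vanishes on a neighbourhood, so its
    derivative vanishes too.\<close>
  have "frechet_derivative \<phi> (at x) b = 0" if "x \<notin> ?K" for x b
  proof -
    have "((\<lambda>x. 0) has_derivative (\<lambda>x. 0)) (at x)" by simp
    then have "(\<phi> has_derivative (\<lambda>x. 0)) (at x)"
    proof (rule has_derivative_transform_within_open)
      show "open (- ?K)" "x \<in> - ?K"
        using that by (simp_all only: open_Compl closed_closure Compl_iff not_False_eq_True)
      show "0 = \<phi> y" if "y \<in> - ?K" for y
        using 0[of y] that by (metis Compl_iff)
    qed
    from fun_cong[OF frechet_derivative_at[OF this], of b] show ?thesis
      by simp
  qed
  then show "supported_in (\<lambda>x. frechet_derivative \<phi> (at x) b) ?K" for b
    unfolding supported_in_def using K test_function_derivative(2)[OF assms] by blast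
qed

lemma supported_in_bounded:
  assumes "supported_in \<phi> K"
  obtains B where "B \<ge> 0" "\<And>x. norm (\<phi> x) \<le> B * indicator K x"
proof -
  have "compact (\<phi> ` K)"
    using assms by (auto simp: supported_in_def intro!: compact_continuous_image intro: continuous_on_subset)
  then obtain B where "B > 0" "\<forall>y\<in>\<phi> ` K. norm y \<le> B"
    using compact_imp_bounded[of "\<phi> ` K"] by (auto simp: bounded_pos)
  then show thesis
    using assms by (intro that[of B]) (auto simp: indicator_def supported_in_def)
qed

lemma supported_in_measurable:
  fixes \<phi> :: "'a::euclidean_space \<Rightarrow> 'b::euclidean_space"
  assumes "supported_in \<phi> K" shows "\<phi> \<in> borel_measurable borel" "\<phi> \<in> borel_measurable lebesgue"
proof -
  show "\<phi> \<in> borel_measurable borel"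
    using assms by (auto simp: supported_in_def intro!: borel_measurable_continuous_onI)
  then show "\<phi> \<in> borel_measurable lebesgue"
    by (simp add: measurable_completion)
qed

lemma integrable_times_supported:
  fixes h :: "'a::euclidean_space \<Rightarrow> real"
  assumes \<phi>: "supported_in \<phi> K" and h: "h absolutely_integrable_on K"
  shows "integrable lebesgue (\<lambda>x. h x * \<phi> x)"
proof -
  obtain B where B: "B \<ge> 0" "\<And>x. norm (\<phi> x) \<le> B * indicator K x"
    using supported_in_bounded[OF \<phi>] by blast
  have int: "integrable lebesgue (\<lambda>x. indicator K x * h x)"
    using h by (simp add: set_integrable_def)
  note [measurable] = borel_measurable_integrable[OF int] supported_in_measurable[OF \<phi>]
  have *: "h x * \<phi> x = indicator K x * h x * \<phi> x" for x
    using \<phi> by (auto simp: indicator_def supported_in_def)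
  show ?thesis
    unfolding *
  proof (rule Bochner_Integration.integrable_bound[OF integrable_mult_right[OF int, of B]])
    have "norm (indicator K x * h x * \<phi> x) \<le> norm (B * (indicator K x * h x))" for x
      using B(2)[of x] B(1) by (auto simp: abs_mult indicator_def mult.commute mult_right_mono split: if_splits)
    then show "AE x in lebesgue. norm (indicator K x * h x * \<phi> x) \<le> norm (B * (indicator K x * h x))"
      by simp
  qed measurable
qed

section \<open>Weak gradients\<close>

lemma weak_gradientD:
  assumes "weak_gradient h g"
  shows "compact K \<Longrightarrow> h absolutely_integrable_on K" "compact K \<Longrightarrow> g absolutely_integrable_on K"
    "test_function \<phi> \<Longrightarrow> b \<in> Basis \<Longrightarrow> (\<integral>x. h x * frechet_derivative \<phi> (at x) b \<partial>lebesgue) =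
        - (\<integral>x. (g x \<bullet> b) * \<phi> x \<partial>lebesgue)"
  using assms by (auto simp: weak_gradient_def)

lemma weak_gradient_integrable:
  assumes "weak_gradient h g" "test_function \<phi>"
  shows "integrable lebesgue (\<lambda>x. h x * frechet_derivative \<phi> (at x) b)"
    "integrable lebesgue (\<lambda>x. (g x \<bullet> b) * \<phi> x)"
proof -
  obtain K where K: "supported_in \<phi> K" "\<And>b. supported_in (\<lambda>x. frechet_derivative \<phi> (at x) b) K"
    by (rule test_function_supported[OF assms(2)]) (rule that)
  then have "compact K" by (simp add: supported_in_def)
  then show "integrable lebesgue (\<lambda>x. h x * frechet_derivative \<phi> (at x) b)"
    "integrable lebesgue (\<lambda>x. (g x \<bullet> b) * \<phi> x)"
    using integrable_times_supported[OF K(2) weak_gradientD(1)[OF assms(1)]]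
      integrable_times_supported[OF K(1) absolutely_integrable_component[OF weak_gradientD(2)[OF assms(1)]]]
    by blast+
qed

text \<open>The fundamental lemma of the calculus of variations: the difference of two gradients
  integrates to 0 against every bump, hence, by dominated convergence, against the indicator of
  every box.\<close>

lemma weak_gradient_unique:
  fixes h :: "'a::euclidean_space \<Rightarrow> real"
  assumes g: "weak_gradient h g" and g': "weak_gradient h g'"
  shows "AE x in lebesgue. g x = g' x"
proof -
  have "AE x in lebesgue. g x \<bullet> b - g' x \<bullet> b = 0" if b: "b \<in> Basis" for b
  proof (rule AE_zero_if_box_integrals)
    fix K :: "'a set" assume "compact K"
    then show "(\<lambda>x. g x \<bullet> b - g' x \<bullet> b) absolutely_integrable_on K"
      using weak_gradientD(2)[OF g] weak_gradientD(2)[OF g'] by (auto intro!: set_integral_diff absolutely_integrable_component)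
  next
    fix l u :: 'a
    let ?d = "\<lambda>x. g x \<bullet> b - g' x \<bullet> b"
    have zero: "(\<integral>x. ?d x * box_bump n l u x \<partial>lebesgue) = 0" for n
      using weak_gradientD(3)[OF g test_function_box_bump b, of n l u]
        weak_gradientD(3)[OF g' test_function_box_bump b, of n l u]
        weak_gradient_integrable(2)[OF g test_function_box_bump, of b n l u]
        weak_gradient_integrable(2)[OF g' test_function_box_bump, of b n l u]
      by (simp add: left_diff_distrib)
    have "(\<lambda>x. ?d x) absolutely_integrable_on cbox l u"
      using weak_gradientD(2)[OF g compact_cbox] weak_gradientD(2)[OF g' compact_cbox]
      by (auto intro!: set_integral_diff absolutely_integrable_component)
    then have int: "integrable lebesgue (\<lambda>x. indicator (cbox l u) x * ?d x)"
      by (simp add: set_integrable_def)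
    have ae: "indicator (box l u) x * (indicator (cbox l u) x * ?d x) = ?d x * indicator (box l u) x" for x
      using box_subset_cbox[of l u] by (auto simp: indicator_def)
    have "(\<lambda>n. \<integral>x. ?d x * box_bump n l u x \<partial>lebesgue) \<longlonglongrightarrow> (\<integral>x. ?d x * indicator (box l u) x \<partial>lebesgue)"
    proof (rule integral_dominated_convergence[where w="\<lambda>x. \<bar>indicator (cbox l u) x * ?d x\<bar>"])
      have "(\<lambda>x. indicator (box l u) x * (indicator (cbox l u) x * ?d x)) \<in> borel_measurable lebesgue"
        by (intro borel_measurable_times borel_measurable_integrable[OF int] borel_measurable_indicator) auto
      then show "(\<lambda>x. ?d x * indicator (box l u) x) \<in> borel_measurable lebesgue"
        by (simp only: ae)
      show "(\<lambda>x. ?d x * box_bump n l u x) \<in> borel_measurable lebesgue" for n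
        using weak_gradient_integrable(2)[OF g test_function_box_bump, of b n l u]
          weak_gradient_integrable(2)[OF g' test_function_box_bump, of b n l u]
        by (simp add: left_diff_distrib borel_measurable_integrable)
      show "AE x in lebesgue. (\<lambda>n. ?d x * box_bump n l u x) \<longlonglongrightarrow> ?d x * indicator (box l u) x"
        by (intro AE_I2 tendsto_mult tendsto_const box_bump_tendsto)
      have "\<bar>?d x * box_bump n l u x\<bar> \<le> \<bar>indicator (cbox l u) x * ?d x\<bar>" for n x
      proof (cases "x \<in> box l u")
        case True
        then have "indicator (cbox l u) x = (1::real)"
          using box_subset_cbox[of l u] by auto
        then show ?thesis
          using box_bump_bounds[of n l u x] by (simp add: abs_mult mult_left_le)
      qed (simp add: box_bump_outside)
      then show "AE x in lebesgue. norm (?d x * box_bump n l u x) \<le> \<bar>indicator (cbox l u) x * ?d x\<bar>" for n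
        by simp
    qed (use int in auto)
    then show "(\<integral>x. ?d x * indicator (box l u) x \<partial>lebesgue) = 0"
      unfolding zero using LIMSEQ_unique tendsto_const by blast
  qed
  then have "AE x in lebesgue. \<forall>b\<in>Basis. g x \<bullet> b - g' x \<bullet> b = 0"
    by (intro AE_finite_allI) auto
  then show ?thesis
    by eventually_elim (auto intro: euclidean_eqI)
qed

lemma weak_gradient_grad: "weak_gradient h g \<Longrightarrow> weak_gradient h (grad h)"
  unfolding grad_def by (rule someI[of "weak_gradient h"])

lemma grad_AE_eq: "weak_gradient h g \<Longrightarrow> AE x in lebesgue. grad h x = g x"
  using weak_gradient_unique weak_gradient_grad by blast

lemma weak_gradient_zero: "weak_gradient (\<lambda>x. 0) (\<lambda>x. 0)"
  by (auto simp: weak_gradient_def)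

lemma weak_gradient_add:
  assumes "weak_gradient h g" "weak_gradient h' g'"
  shows "weak_gradient (\<lambda>x. h x + h' x) (\<lambda>x. g x + g' x)"
  unfolding weak_gradient_def
proof (intro conjI allI impI ballI)
  fix \<phi> :: "'a \<Rightarrow> real" and b :: 'a assume t: "test_function \<phi>" and b: "b \<in> Basis"
  show "(\<integral>x. (h x + h' x) * frechet_derivative \<phi> (at x) b \<partial>lebesgue) =
        - (\<integral>x. ((g x + g' x) \<bullet> b) * \<phi> x \<partial>lebesgue)"
    using weak_gradient_integrable[OF assms(1) t, of b] weak_gradient_integrable[OF assms(2) t, of b]
      weak_gradientD(3)[OF assms(1) t b] weak_gradientD(3)[OF assms(2) t b]
    by (simp add: distrib_right inner_add_left)
qed (use assms in \<open>auto intro!: set_integral_add dest: weak_gradientD\<close>)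

lemma weak_gradient_scaleR:
  assumes "weak_gradient h g"
  shows "weak_gradient (\<lambda>x. c *\<^sub>R h x) (\<lambda>x. c *\<^sub>R g x)"
  unfolding weak_gradient_def
proof (intro conjI allI impI ballI)
  fix \<phi> :: "'a \<Rightarrow> real" and b :: 'a assume t: "test_function \<phi>" and b: "b \<in> Basis"
  show "(\<integral>x. c *\<^sub>R h x * frechet_derivative \<phi> (at x) b \<partial>lebesgue) =
        - (\<integral>x. (c *\<^sub>R g x \<bullet> b) * \<phi> x \<partial>lebesgue)"
    using weak_gradientD(3)[OF assms(1) t b] by (simp add: mult.assoc)
qed (use assms in \<open>auto intro!: absolutely_integrable_scaleR_left dest: weak_gradientD\<close>)

section \<open>Sobolev pairs\<close>

text \<open>For every \<open>N > 0\<close>,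
  \<open>norm (h x) \<le> N + N powr (1 - Q) * norm (h x) powr Q\<close>, according to whether
  \<open>norm (h x)\<close> is below or above \<open>N\<close>. Integrating over \<open>K\<close>
  with \<open>N\<close> slightly above the norm of \<open>h\<close> gives the factor
  \<open>measure lebesgue K + 1\<close>, the same for all \<open>Q\<close>.\<close>

lemma set_integral_Lp_le:
  fixes h :: "'a::euclidean_space \<Rightarrow> 'b::euclidean_space"
  assumes h: "h \<in> Lp_space lebesgue (ennreal Q)" and Q: "1 \<le> Q" and K: "compact K"
  shows "h absolutely_integrable_on K"
    "(\<integral>x. indicator K x * norm (h x) \<partial>lebesgue) \<le> (measure lebesgue K + 1) * Lp_norm lebesgue (ennreal Q) h"
proof -
  have int: "integrable lebesgue (\<lambda>x. norm (h x) powr Q)" and [measurable]: "h \<in> borel_measurable lebesgue"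
    using h Q by (auto simp: Lp_space_ennreal)
  have Kl: "K \<in> lmeasurable"
    using K by (rule lmeasurable_compact)
  then have [measurable]: "K \<in> sets lebesgue" by auto
  have intK: "integrable lebesgue (\<lambda>x. indicator K x :: real)"
    using Kl by (simp add: integrable_indicator_iff fmeasurable_def)
  have le: "indicator K x * norm (h x) \<le> N * indicator K x + N powr (1 - Q) * norm (h x) powr Q"
    if "N > 0" for N x
  proof (cases "norm (h x) \<le> N")
    case True
    then show ?thesis
      using that by (cases "x \<in> K") (simp_all add: add_increasing2)
  next
    case False
    then have "norm (h x) = norm (h x) powr (1 - Q) * norm (h x) powr Q"
      using that by (simp flip: powr_add)
    also have "\<dots> \<le> N powr (1 - Q) * norm (h x) powr Q"
      using False that Q by (intro mult_right_mono powr_mono2') auto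
    finally show ?thesis using that by (auto simp: indicator_def)
  qed
  have rint: "integrable lebesgue (\<lambda>x. N * indicator K x + N powr (1 - Q) * norm (h x) powr Q)" for N
    using intK int by simp
  have intKh: "integrable lebesgue (\<lambda>x. indicator K x * norm (h x))"
    by (rule Bochner_Integration.integrable_bound[OF rint[of 1]])
      (use le[of 1] in \<open>auto intro: order_trans[OF _ abs_ge_self]\<close>)
  have "integrable lebesgue (\<lambda>x. indicator K x *\<^sub>R h x)"
    by (rule Bochner_Integration.integrable_bound[OF intKh]) auto
  then show "h absolutely_integrable_on K"
    by (simp add: set_integrable_def)
  let ?n = "Lp_norm lebesgue (ennreal Q) h" and ?J = "\<integral>x. indicator K x * norm (h x) \<partial>lebesgue"
  have bd: "?J \<le> (measure lebesgue K + 1) * N" if N: "N > ?n" for N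
  proof -
    have n0: "0 \<le> ?n" using Q by simp
    then have N0: "N > 0" using N by linarith
    have "?J \<le> (\<integral>x. N * indicator K x + N powr (1 - Q) * norm (h x) powr Q \<partial>lebesgue)"
      by (intro integral_mono intKh rint le N0)
    also have "\<dots> = N * measure lebesgue K + N powr (1 - Q) * ?n powr Q"
      using intK int Q by (simp add: Lp_norm_powr)
    also have "\<dots> \<le> N * measure lebesgue K + N powr (1 - Q) * N powr Q"
      using N n0 Q by (intro add_left_mono mult_left_mono powr_mono2) auto
    also have "N powr (1 - Q) * N powr Q = N"
      using N0 by (simp flip: powr_add)
    finally show ?thesis by (simp add: algebra_simps)
  qed
  have "(\<lambda>n. (measure lebesgue K + 1) * (?n + 1 / real (Suc n))) \<longlonglongrightarrow> (measure lebesgue K + 1) * (?n + 0)"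
    by (intro tendsto_intros LIMSEQ_Suc[OF lim_1_over_n])
  moreover have "?J \<le> (measure lebesgue K + 1) * (?n + 1 / real (Suc n))" for n
    by (intro bd) auto
  ultimately show "?J \<le> (measure lebesgue K + 1) * ?n"
    by (intro LIMSEQ_le_const[where X="\<lambda>n. (measure lebesgue K + 1) * (?n + 1 / real (Suc n))"]) auto
qed

lemma seminormed_space_Lp_lebesgue:
  assumes "1 \<le> p"
  shows "seminormed_space (Lp_space lebesgue p :: ('a::euclidean_space \<Rightarrow> 'b::euclidean_space) set) (Lp_norm lebesgue p)"
  using assms by (rule seminormed_space_Lp) simp

lemma norm_fst_snd_le: "norm (fst z) \<le> norm z" "norm (snd z) \<le> norm z"
  by (cases z; simp add: norm_fst_le norm_snd_le)+

lemma Lp_fst_snd: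
  fixes F :: "'a \<Rightarrow> 'b::euclidean_space \<times> 'c::euclidean_space"
  assumes F: "F \<in> Lp_space M (ennreal Q)" and Q: "0 < Q"
  shows "(\<lambda>x. fst (F x)) \<in> Lp_space M (ennreal Q)"
    "Lp_norm M (ennreal Q) (\<lambda>x. fst (F x)) \<le> Lp_norm M (ennreal Q) F"
    "(\<lambda>x. snd (F x)) \<in> Lp_space M (ennreal Q)"
    "Lp_norm M (ennreal Q) (\<lambda>x. snd (F x)) \<le> Lp_norm M (ennreal Q) F"
proof -
  have m: "(\<lambda>x. fst (F x)) \<in> borel_measurable M" "(\<lambda>x. snd (F x)) \<in> borel_measurable M"
    by (auto intro!: borel_measurable_continuous_on[OF _ Lp_space_measurable[OF F]] continuous_intros)
  have ae: "AE x in M. norm (fst (F x)) \<le> 1 * norm (F x)" "AE x in M. norm (snd (F x)) \<le> 1 * norm (F x)"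
    by (simp_all add: norm_fst_snd_le)
  show "(\<lambda>x. fst (F x)) \<in> Lp_space M (ennreal Q)"
    "Lp_norm M (ennreal Q) (\<lambda>x. fst (F x)) \<le> Lp_norm M (ennreal Q) F"
    using Lp_space_dominated_finite[OF F m(1) Q ae(1)] by auto
  show "(\<lambda>x. snd (F x)) \<in> Lp_space M (ennreal Q)"
    "Lp_norm M (ennreal Q) (\<lambda>x. snd (F x)) \<le> Lp_norm M (ennreal Q) F"
    using Lp_space_dominated_finite[OF F m(2) Q ae(2)] by auto
qed

text \<open>The pair is the sum of \<open>(f, 0)\<close> and \<open>(0, g)\<close>, whose norms are
  those of \<open>f\<close> and \<open>g\<close>.\<close>

lemma Lp_Pair:
  fixes f :: "'a::euclidean_space \<Rightarrow> 'b::euclidean_space" and g :: "'a \<Rightarrow> 'c::euclidean_space"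
  assumes f: "f \<in> Lp_space lebesgue (ennreal Q)" and g: "g \<in> Lp_space lebesgue (ennreal Q)" and Q: "1 \<le> Q"
  shows "(\<lambda>x. (f x, g x)) \<in> Lp_space lebesgue (ennreal Q)"
    "Lp_norm lebesgue (ennreal Q) (\<lambda>x. (f x, g x)) \<le> Lp_norm lebesgue (ennreal Q) f + Lp_norm lebesgue (ennreal Q) g"
proof -
  interpret seminormed_space "Lp_space lebesgue (ennreal Q) :: ('a \<Rightarrow> 'b \<times> 'c) set" "Lp_norm lebesgue (ennreal Q)"
    using Q by (intro seminormed_space_Lp_lebesgue) auto
  let ?F = "\<lambda>x. (f x, 0 :: 'c)" and ?G = "\<lambda>x. (0 :: 'b, g x)"
  have m: "?F \<in> borel_measurable lebesgue" "?G \<in> borel_measurable lebesgue"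
    using Lp_space_measurable[OF f] Lp_space_measurable[OF g]
    by (auto intro!: borel_measurable_continuous_on[where f="\<lambda>y. (y, 0)"]
      borel_measurable_continuous_on[where f="\<lambda>y. (0, y)"] continuous_intros)
  have F: "?F \<in> Lp_space lebesgue (ennreal Q)" "Lp_norm lebesgue (ennreal Q) ?F \<le> 1 * Lp_norm lebesgue (ennreal Q) f"
    by (rule Lp_space_dominated_finite[OF f m(1), of 1]; use Q in \<open>simp add: norm_Pair\<close>)+
  have G: "?G \<in> Lp_space lebesgue (ennreal Q)" "Lp_norm lebesgue (ennreal Q) ?G \<le> 1 * Lp_norm lebesgue (ennreal Q) g"
    by (rule Lp_space_dominated_finite[OF g m(2), of 1]; use Q in \<open>simp add: norm_Pair\<close>)+
  have eq: "(\<lambda>x. (f x, g x)) = ?F + ?G"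
    by (simp add: fun_eq_iff)
  show "(\<lambda>x. (f x, g x)) \<in> Lp_space lebesgue (ennreal Q)"
    unfolding eq by (intro add_mem F G)
  show "Lp_norm lebesgue (ennreal Q) (\<lambda>x. (f x, g x)) \<le> Lp_norm lebesgue (ennreal Q) f + Lp_norm lebesgue (ennreal Q) g"
    unfolding eq using triangle[OF F(1) G(1)] F(2) G(2) by simp
qed

text \<open>
  Carrying the weak gradient along turns the Sobolev norm into the \<open>L\<^sup>q\<close> norm of a single
  product-valued function, so that completeness and integration are inherited from \<open>L\<^sup>q\<close>.
\<close>

definition W1_pairs :: "ennreal \<Rightarrow> ('a::euclidean_space \<Rightarrow> real \<times> 'a) set" where
  "W1_pairs q = {F \<in> Lp_space lebesgue q. weak_gradient (\<lambda>x. fst (F x)) (\<lambda>x. snd (F x))}"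

lemma W1_pairsD:
  assumes "F \<in> W1_pairs q"
  shows "F \<in> Lp_space lebesgue q" "weak_gradient (\<lambda>x. fst (F x)) (\<lambda>x. snd (F x))"
  using assms by (auto simp: W1_pairs_def)

lemma seminormed_space_W1_pairs:
  assumes "1 \<le> p"
  shows "seminormed_space (W1_pairs p :: ('a::euclidean_space \<Rightarrow> real \<times> 'a) set) (Lp_norm lebesgue p)"
proof -
  interpret seminormed_space "Lp_space lebesgue p :: ('a \<Rightarrow> real \<times> 'a) set" "Lp_norm lebesgue p"
    using assms by (rule seminormed_space_Lp_lebesgue)
  have "subspace (W1_pairs p :: ('a \<Rightarrow> real \<times> 'a) set)"
    using weak_gradient_zero weak_gradient_add weak_gradient_scaleR
    unfolding subspace_def by (auto simp: W1_pairs_def add_mem scale_mem)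
  then show ?thesis
    by unfold_locales (auto simp: W1_pairs_def triangle scale)
qed

text \<open>For a fixed test function the weak gradient identity is the vanishing of a linear
  functional of the pair that is continuous for the \<open>L^Q\<close> norm, because only the values
  on a compact set matter.\<close>

lemma W1_pairs_closed:
  fixes F :: "nat \<Rightarrow> 'a::euclidean_space \<Rightarrow> real \<times> 'a"
  assumes Q: "1 \<le> Q" and F: "\<And>n. F n \<in> W1_pairs (ennreal Q)" and G: "G \<in> Lp_space lebesgue (ennreal Q)"
    and lim: "(\<lambda>n. Lp_norm lebesgue (ennreal Q) (F n - G)) \<longlonglongrightarrow> 0"
  shows "G \<in> W1_pairs (ennreal Q)"
proof -
  interpret seminormed_space "Lp_space lebesgue (ennreal Q) :: ('a \<Rightarrow> real \<times> 'a) set" "Lp_norm lebesgue (ennreal Q)"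
    using Q by (intro seminormed_space_Lp_lebesgue) auto
  have Q0: "0 < Q" using Q by simp
  have ai: "(\<lambda>x. fst (H x)) absolutely_integrable_on K" "(\<lambda>x. snd (H x)) absolutely_integrable_on K"
    if "H \<in> Lp_space lebesgue (ennreal Q)" "compact K" for H :: "'a \<Rightarrow> real \<times> 'a" and K
    using that Lp_fst_snd[OF that(1) Q0] Q by (auto intro!: set_integral_Lp_le)
  have "weak_gradient (\<lambda>x. fst (G x)) (\<lambda>x. snd (G x))"
    unfolding weak_gradient_def
  proof (intro conjI allI impI ballI)
    fix \<phi> :: "'a \<Rightarrow> real" and b :: 'a assume t: "test_function \<phi>" and b: "b \<in> Basis"
    obtain K where K: "supported_in \<phi> K" "\<And>b. supported_in (\<lambda>x. frechet_derivative \<phi> (at x) b) K"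
      by (rule test_function_supported[OF t]) (rule that)
    then have cK: "compact K" by (simp add: supported_in_def)
    let ?D = "\<lambda>x. frechet_derivative \<phi> (at x) b"
    obtain B where B: "B \<ge> 0" "\<And>x. norm (\<phi> x) \<le> B * indicator K x"
      by (rule supported_in_bounded[OF K(1)]) (rule that)
    obtain B' where B': "B' \<ge> 0" "\<And>x. norm (?D x) \<le> B' * indicator K x"
      by (rule supported_in_bounded[OF K(2)[of b]]) (rule that)
    \<comment> \<open>Both sides of the identity in one functional; its bound uses the suprema
      \<open>B\<close> and \<open>B'\<close> of \<open>\<phi>\<close> and of its derivative.\<close>
    define \<Lambda> where "\<Lambda> H = (\<integral>x. fst (H x) * ?D x + (snd (H x) \<bullet> b) * \<phi> x \<partial>lebesgue)" for H :: "'a \<Rightarrow> real \<times> 'a"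
    have int: "integrable lebesgue (\<lambda>x. fst (H x) * ?D x)" "integrable lebesgue (\<lambda>x. (snd (H x) \<bullet> b) * \<phi> x)"
      if "H \<in> Lp_space lebesgue (ennreal Q)" for H
      using ai[OF that cK] K by (auto intro!: integrable_times_supported absolutely_integrable_component)
    have bd: "\<bar>\<Lambda> H\<bar> \<le> (B' + B) * ((measure lebesgue K + 1) * Lp_norm lebesgue (ennreal Q) H)"
      if H: "H \<in> Lp_space lebesgue (ennreal Q)" for H
    proof -
      have intK: "integrable lebesgue (\<lambda>x. (B' + B) * (indicator K x * norm (H x)))"
        using set_integrable_norm[OF set_integral_Lp_le(1)[OF H Q cK]] by (simp add: set_integrable_def)
      have "\<bar>\<Lambda> H\<bar> \<le> (\<integral>x. \<bar>fst (H x) * ?D x + (snd (H x) \<bullet> b) * \<phi> x\<bar> \<partial>lebesgue)"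
        unfolding \<Lambda>_def by (rule integral_abs_bound)
      also have "\<dots> \<le> (\<integral>x. (B' + B) * (indicator K x * norm (H x)) \<partial>lebesgue)"
      proof (intro integral_mono intK integrable_abs Bochner_Integration.integrable_add int H)
        fix x
        have "\<bar>fst (H x) * ?D x\<bar> \<le> norm (H x) * (B' * indicator K x)"
          unfolding abs_mult using norm_fst_snd_le(1)[of "H x"] B'(2)[of x] by (intro mult_mono) auto
        moreover have "\<bar>snd (H x) \<bullet> b\<bar> \<le> norm (H x)"
          using Basis_le_norm[OF b, of "snd (H x)"] norm_fst_snd_le(2)[of "H x"] by linarith
        then have "\<bar>(snd (H x) \<bullet> b) * \<phi> x\<bar> \<le> norm (H x) * (B * indicator K x)"
          unfolding abs_mult using B(2)[of x] by (intro mult_mono) auto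
        ultimately show "\<bar>fst (H x) * ?D x + (snd (H x) \<bullet> b) * \<phi> x\<bar> \<le> (B' + B) * (indicator K x * norm (H x))"
          by (simp add: algebra_simps abs_triangle_ineq[THEN order_trans])
      qed
      also have "\<dots> \<le> (B' + B) * ((measure lebesgue K + 1) * Lp_norm lebesgue (ennreal Q) H)"
        using set_integral_Lp_le(2)[OF H Q cK] B(1) B'(1) by (simp add: mult_left_mono)
      finally show ?thesis .
    qed
    have FL: "F n \<in> Lp_space lebesgue (ennreal Q)" for n
      using F by (rule W1_pairsD)
    have \<Lambda>F: "\<Lambda> (F n) = 0" for n
      unfolding \<Lambda>_def using int[OF FL] weak_gradientD(3)[OF W1_pairsD(2)[OF F] t b] by simp
    have "\<Lambda> (F n - G) = \<Lambda> (F n) - \<Lambda> G" for n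
      unfolding \<Lambda>_def using int[OF FL[of n]] int[OF G]
      by (simp add: inner_diff_left left_diff_distrib)
    then have "\<bar>\<Lambda> G\<bar> \<le> (B' + B) * ((measure lebesgue K + 1) * Lp_norm lebesgue (ennreal Q) (F n - G))" for n
      using bd[OF diff_mem[OF FL G], of n] \<Lambda>F[of n] by simp
    moreover have "(\<lambda>n. (B' + B) * ((measure lebesgue K + 1) * Lp_norm lebesgue (ennreal Q) (F n - G))) \<longlonglongrightarrow> (B' + B) * ((measure lebesgue K + 1) * 0)"
      by (intro tendsto_mult tendsto_const lim)
    ultimately have "\<bar>\<Lambda> G\<bar> \<le> (B' + B) * ((measure lebesgue K + 1) * 0)"
      by (intro LIMSEQ_le_const) auto
    then show "(\<integral>x. fst (G x) * ?D x \<partial>lebesgue) = - (\<integral>x. (snd (G x) \<bullet> b) * \<phi> x \<partial>lebesgue)"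
      unfolding \<Lambda>_def using int[OF G] by simp
  qed (use ai[OF G] in auto)
  with G show ?thesis by (simp add: W1_pairs_def)
qed

lemma complete_W1_pairs:
  assumes Q: "1 \<le> Q"
  shows "complete_seminorm (W1_pairs (ennreal Q) :: ('a::euclidean_space \<Rightarrow> real \<times> 'a) set) (Lp_norm lebesgue (ennreal Q))"
  unfolding complete_seminorm_def
proof safe
  fix S :: "nat \<Rightarrow> 'a \<Rightarrow> real \<times> 'a"
  assume S: "\<forall>i. S i \<in> W1_pairs (ennreal Q)"
    and cau: "\<forall>e>0. \<exists>k. \<forall>m\<ge>k. \<forall>n\<ge>k. Lp_norm lebesgue (ennreal Q) (S m - S n) < e"
  have "complete_seminorm (Lp_space lebesgue (ennreal Q) :: ('a \<Rightarrow> real \<times> 'a) set) (Lp_norm lebesgue (ennreal Q))"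
    using Q by (intro complete_Lp) auto
  then obtain G where "G \<in> Lp_space lebesgue (ennreal Q)" "(\<lambda>i. Lp_norm lebesgue (ennreal Q) (S i - G)) \<longlonglongrightarrow> 0"
    using S cau W1_pairsD(1) unfolding complete_seminorm_def by blast
  then show "\<exists>x\<in>W1_pairs (ennreal Q). (\<lambda>i. Lp_norm lebesgue (ennreal Q) (S i - x)) \<longlonglongrightarrow> 0"
    using W1_pairs_closed[OF Q, of S G] S by blast
qed

lemma weak_gradient_AE_eq:
  fixes h h' :: "'a::euclidean_space \<Rightarrow> real"
  assumes w: "weak_gradient h g" and h: "AE x in lebesgue. h x = h' x" and g: "AE x in lebesgue. g x = g' x"
  shows "weak_gradient h' g'"
  unfolding weak_gradient_def
proof (intro conjI allI impI ballI)
  fix K :: "'a set" assume K: "compact K"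
  have N: "negligible {x. h x \<noteq> h' x}" "negligible {x. g x \<noteq> g' x}"
    using h g unfolding completion.AE_iff_null_sets negligible_iff_null_sets by auto
  show "h' absolutely_integrable_on K"
    by (rule absolutely_integrable_spike[OF weak_gradientD(1)[OF w K] N(1)]) auto
  show "g' absolutely_integrable_on K"
    by (rule absolutely_integrable_spike[OF weak_gradientD(2)[OF w K] N(2)]) auto
next
  fix \<phi> :: "'a \<Rightarrow> real" and b :: 'a assume t: "test_function \<phi>" and b: "b \<in> Basis"
  have 1: "AE x in lebesgue. h x * frechet_derivative \<phi> (at x) b = h' x * frechet_derivative \<phi> (at x) b"
    using h by eventually_elim simp
  have 2: "AE x in lebesgue. (g x \<bullet> b) * \<phi> x = (g' x \<bullet> b) * \<phi> x"
    using g by eventually_elim simp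
  note i = borel_measurable_integrable[OF weak_gradient_integrable(1)[OF w t]]
    borel_measurable_integrable[OF weak_gradient_integrable(2)[OF w t]]
  show "(\<integral>x. h' x * frechet_derivative \<phi> (at x) b \<partial>lebesgue) = - (\<integral>x. (g' x \<bullet> b) * \<phi> x \<partial>lebesgue)"
    using weak_gradientD(3)[OF w t b]
      integral_cong_AE[OF i(1) borel_measurable_AE[OF i(1) 1] 1]
      integral_cong_AE[OF i(2) borel_measurable_AE[OF i(2) 2] 2] by simp
qed

section \<open>Convolution\<close>

lemma lborel_distr_reflect: "distr lborel borel (\<lambda>y. x - y) = (lborel :: 'a::euclidean_space measure)"
  using lborel_affine[of "-1" x] by (simp add: density_1)

lemma lborel_distr_translate: "distr lborel borel (\<lambda>x. x - y) = (lborel :: 'a::euclidean_space measure)"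
  using lborel_affine[of 1 "- y"] by (simp add: density_1)

lemma lborel_integral_reflect:
  fixes f :: "'a::euclidean_space \<Rightarrow> 'b::{banach, second_countable_topology}"
  assumes f: "f \<in> borel_measurable borel"
  shows "(\<integral>y. f (x - y) \<partial>lborel) = (\<integral>y. f y \<partial>lborel)"
    "integrable lborel (\<lambda>y. f (x - y)) \<longleftrightarrow> integrable lborel f"
proof -
  have m: "(\<lambda>y. x - y) \<in> measurable lborel borel" by simp
  show "(\<integral>y. f (x - y) \<partial>lborel) = (\<integral>y. f y \<partial>lborel)"
    using integral_distr[OF m f] unfolding lborel_distr_reflect by simp
  show "integrable lborel (\<lambda>y. f (x - y)) \<longleftrightarrow> integrable lborel f"
    using integrable_distr_eq[OF m f] unfolding lborel_distr_reflect by simp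
qed

lemma lborel_integral_translate:
  fixes f :: "'a::euclidean_space \<Rightarrow> 'b::{banach, second_countable_topology}"
  assumes f: "f \<in> borel_measurable borel"
  shows "(\<integral>x. f (x - y) \<partial>lborel) = (\<integral>x. f x \<partial>lborel)"
    "integrable lborel (\<lambda>x. f (x - y)) \<longleftrightarrow> integrable lborel f"
proof -
  have m: "(\<lambda>x. x - y) \<in> measurable lborel borel" by simp
  show "(\<integral>x. f (x - y) \<partial>lborel) = (\<integral>x. f x \<partial>lborel)"
    using integral_distr[OF m f] unfolding lborel_distr_translate by simp
  show "integrable lborel (\<lambda>x. f (x - y)) \<longleftrightarrow> integrable lborel f"
    using integrable_distr_eq[OF m f] unfolding lborel_distr_translate by simp
qed

lemma le_one_plus_powr: "1 \<le> Q \<Longrightarrow> 0 \<le> z \<Longrightarrow> z \<le> 1 + z powr Q" for z Q :: real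
  using powr_mono[of 1 Q z] by (cases "z \<le> 1") (auto simp: add_increasing2)

section \<open>Young's convolution inequality\<close>

text \<open>Jensen's inequality for the unnormalised density \<open>a\<close>. For
  \<open>Q > 1\<close> it is Hoelder for \<open>a powr (1 / R)\<close> and
  \<open>a powr (1 / Q) * z\<close>; for \<open>Q = 1\<close> both sides coincide.\<close>

lemma Jensen_powr:
  fixes a z :: "'a \<Rightarrow> real"
  assumes Q: "1 \<le> Q" and M: "emeasure M (space M) \<noteq> 0" and a: "integrable M a" and z [measurable]: "z \<in> borel_measurable M"
    and nn: "\<And>y. 0 \<le> a y" "\<And>y. 0 \<le> z y" and az: "integrable M (\<lambda>y. a y * z y powr Q)"
  shows "integrable M (\<lambda>y. a y * z y)"
    "(\<integral>y. a y * z y \<partial>M) powr Q \<le> (\<integral>y. a y \<partial>M) powr (Q - 1) * (\<integral>y. a y * z y powr Q \<partial>M)"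
proof -
  note [measurable] = borel_measurable_integrable[OF a]
  show int: "integrable M (\<lambda>y. a y * z y)"
  proof (rule Bochner_Integration.integrable_bound[OF Bochner_Integration.integrable_add[OF a az]])
    have "a y * z y \<le> a y * (1 + z y powr Q)" for y
      using le_one_plus_powr[OF Q nn(2)] nn(1) by (rule mult_left_mono)
    then show "AE y in M. norm (a y * z y) \<le> norm (a y + a y * z y powr Q)"
      using nn by (auto simp: distrib_left)
  qed measurable
  show "(\<integral>y. a y * z y \<partial>M) powr Q \<le> (\<integral>y. a y \<partial>M) powr (Q - 1) * (\<integral>y. a y * z y powr Q \<partial>M)"
  proof (cases "Q = 1")
    case True
    show ?thesis
    \<comment> \<open>\<open>0 powr 0\<close> is 0, so a vanishing total mass has to be treated
      apart when the exponent \<open>Q - 1\<close> is 0.\<close>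
    proof (cases "(\<integral>y. a y \<partial>M) = 0")
      case True
      then have "AE y in M. a y = 0"
        using a nn by (simp add: integral_nonneg_eq_0_iff_AE)
      then have "(\<integral>y. a y * z y \<partial>M) = 0"
        by (intro integral_eq_zero_AE) (auto elim: eventually_mono)
      then show ?thesis
        using nn by simp
    next
      case False
      then have "(\<integral>y. a y \<partial>M) > 0"
        using nn by (simp add: integral_nonneg less_le)
      then show ?thesis
        using \<open>Q = 1\<close> nn by (simp add: integral_nonneg)
    qed
  next
    case False
    then have Q1: "Q > 1" using Q by simp
    define R where "R = Q / (Q - 1)"
    have R: "R > 1" "R / (R - 1) = Q" "1 / R = (Q - 1) / Q"
      using Q1 by (auto simp: R_def field_simps)
    let ?f = "\<lambda>y. a y powr (1 / R)" and ?g = "\<lambda>y. a y powr (1 / Q) * z y"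
    have f: "norm (?f y) powr R = a y" for y
      using R(1) nn by (simp add: powr_powr)
    have g: "norm (?g y) powr Q = a y * z y powr Q" for y
      using Q1 nn by (simp add: powr_powr powr_mult)
    have fg: "?f y * norm (?g y) = a y * z y" for y
    proof -
      have "a y powr (1 / R) * a y powr (1 / Q) = a y powr 1"
        using R Q1 by (simp flip: powr_add add: diff_divide_distrib)
      then show ?thesis using nn by (simp add: mult.assoc[symmetric])
    qed
    have c: "conj_exponent (ennreal R) = ennreal Q"
      using R by (simp add: conj_exponent_ennreal)
    have fL: "?f \<in> Lp_space M (ennreal R)"
      using R(1) f a by (auto simp: Lp_space_ennreal)
    have gL: "?g \<in> Lp_space M (ennreal Q)"
      using Q1 g az by (auto simp: Lp_space_ennreal)
    have "ennreal R > 1"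
      using R(1) by (metis ennreal_1 ennreal_less_iff zero_le_one)
    from Lp_Holder(2)[OF this M fL gL[folded c], unfolded c]
    have "(\<integral>y. \<bar>a y * z y\<bar> \<partial>M) \<le> (\<integral>y. a y \<partial>M) powr (1 / R) * (\<integral>y. a y * z y powr Q \<partial>M) powr (1 / Q)"
      unfolding fg using R(1) Q1 f g by (simp add: Lp_norm_1 Lp_norm_ennreal)
    then have "(\<integral>y. a y * z y \<partial>M) powr Q \<le> ((\<integral>y. a y \<partial>M) powr (1 / R) * (\<integral>y. a y * z y powr Q \<partial>M) powr (1 / Q)) powr Q"
      using nn Q by (intro powr_mono2) (auto intro!: integral_nonneg)
    also have "\<dots> = (\<integral>y. a y \<partial>M) powr (Q - 1) * (\<integral>y. a y * z y powr Q \<partial>M)"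
      using Q1 R nn by (simp add: powr_mult powr_powr integral_nonneg)
    finally show ?thesis .
  qed
qed

text \<open>Jensen in \<open>y\<close> bounds the \<open>Q\<close>-th power of the convolution by
  the convolution of \<open>a\<close> with \<open>b powr Q\<close>, whose integral is computed by
  Fubini and translation invariance.\<close>

lemma Young_real:
  fixes a b :: "'a::euclidean_space \<Rightarrow> real"
  assumes Q: "1 \<le> Q" and a: "integrable lborel a" and b: "integrable lborel (\<lambda>x. b x powr Q)"
    and m [measurable]: "b \<in> borel_measurable borel" and nn: "\<And>y. 0 \<le> a y" "\<And>y. 0 \<le> b y"
  shows "AE x in lborel. integrable lborel (\<lambda>y. a y * b (x - y))"
    "integrable lborel (\<lambda>x. (\<integral>y. a y * b (x - y) \<partial>lborel) powr Q)"
    "(\<integral>x. (\<integral>y. a y * b (x - y) \<partial>lborel) powr Q \<partial>lborel)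
      \<le> (\<integral>y. a y \<partial>lborel) powr Q * (\<integral>x. b x powr Q \<partial>lborel)"
proof -
  have [measurable]: "a \<in> borel_measurable borel"
    using borel_measurable_integrable[OF a] by simp
  let ?A = "\<integral>y. a y \<partial>lborel" and ?B = "\<integral>x. b x powr Q \<partial>lborel"
  let ?J = "\<lambda>x. \<integral>y. a y * b (x - y) \<partial>lborel" and ?I = "\<lambda>x. \<integral>y. a y * b (x - y) powr Q \<partial>lborel"
  have bt: "(\<integral>x. b (x - y) powr Q \<partial>lborel) = ?B" "integrable lborel (\<lambda>x. b (x - y) powr Q)" for y
    using lborel_integral_translate[of "\<lambda>x. b x powr Q" y] b by auto
  have prod: "integrable (lborel \<Otimes>\<^sub>M lborel) (\<lambda>(y, x). a y * b (x - y) powr Q)"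
  proof (rule lborel_pair.Fubini_integrable)
    have "(\<lambda>y. \<integral>x. norm (case (y, x) of (y, x) \<Rightarrow> a y * b (x - y) powr Q) \<partial>lborel) = (\<lambda>y. a y * ?B)"
      using nn bt by (simp add: abs_mult)
    then show "integrable lborel (\<lambda>y. \<integral>x. norm (case (y, x) of (y, x) \<Rightarrow> a y * b (x - y) powr Q) \<partial>lborel)"
      using a by simp
    show "AE y in lborel. integrable lborel (\<lambda>x. case (y, x) of (y, x) \<Rightarrow> a y * b (x - y) powr Q)"
      using bt by simp
  qed measurable
  have ae: "AE x in lborel. integrable lborel (\<lambda>y. a y * b (x - y) powr Q)"
    using lborel_pair.AE_integrable_snd[OF prod] .
  have intI: "integrable lborel ?I"
    using lborel_pair.integrable_snd[OF prod] .
  have I: "(\<integral>x. ?I x \<partial>lborel) = ?A * ?B"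
    using lborel_pair.Fubini_integral[OF prod] bt a by simp
  have M: "emeasure lborel (space (lborel :: 'a measure)) \<noteq> 0" by simp
  have J: "integrable lborel (\<lambda>y. a y * b (x - y))" "?J x powr Q \<le> ?A powr (Q - 1) * ?I x"
    if "integrable lborel (\<lambda>y. a y * b (x - y) powr Q)" for x
    using Jensen_powr[OF Q M a, of "\<lambda>y. b (x - y)"] nn that by auto
  show "AE x in lborel. integrable lborel (\<lambda>y. a y * b (x - y))"
    using ae by eventually_elim (rule J)
  have ae': "AE x in lborel. ?J x powr Q \<le> ?A powr (Q - 1) * ?I x"
    using ae by eventually_elim (rule J)
  have rint: "integrable lborel (\<lambda>x. ?A powr (Q - 1) * ?I x)"
    using intI by simp
  show int: "integrable lborel (\<lambda>x. ?J x powr Q)"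
  proof (rule Bochner_Integration.integrable_bound[OF rint])
    show "AE x in lborel. norm (?J x powr Q) \<le> norm (?A powr (Q - 1) * ?I x)"
      using ae' by eventually_elim (auto intro: order_trans[OF _ abs_ge_self])
  qed measurable
  have "(\<integral>x. ?J x powr Q \<partial>lborel) \<le> (\<integral>x. ?A powr (Q - 1) * ?I x \<partial>lborel)"
    by (intro integral_mono_AE int rint ae')
  also have "\<dots> = ?A powr (Q - 1) * (?A * ?B)"
    by (simp add: I)
  also have "\<dots> = ?A powr Q * ?B"
  proof (cases "?A = 0")
    case False
    then have "?A > 0"
      using nn by (simp add: integral_nonneg less_le)
    then have "?A powr (Q - 1) * ?A = ?A powr Q"
      by (simp add: powr_diff)
    then show ?thesis by (simp add: mult.assoc[symmetric])
  qed simp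
  finally show "(\<integral>x. ?J x powr Q \<partial>lborel) \<le> ?A powr Q * ?B" .
qed

section \<open>Convolution with vector-valued kernels\<close>

text \<open>Vector values allow a kernel and its gradient to be convolved in one stroke.\<close>

definition conv :: "('a::euclidean_space \<Rightarrow> 'b::euclidean_space) \<Rightarrow> ('a \<Rightarrow> real) \<Rightarrow> 'a \<Rightarrow> 'b" where
  "conv k h x = (\<integral>y. h y *\<^sub>R k (x - y) \<partial>lebesgue)"

text \<open>A divergent integral has the default value 0, so additivity of \<open>conv\<close> in
  the kernel and in \<open>h\<close> is available only at points of integrability; this predicate
  records that almost all points are such.\<close>

definition conv_ok :: "('a::euclidean_space \<Rightarrow> 'b::euclidean_space) \<Rightarrow> ('a \<Rightarrow> real) \<Rightarrow> bool" where
  "conv_ok k h \<longleftrightarrow> (AE x in lebesgue. integrable lebesgue (\<lambda>y. h y *\<^sub>R k (x - y)))"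

lemma Lp_lebesgue_borel:
  fixes h :: "'a::euclidean_space \<Rightarrow> 'b::euclidean_space"
  assumes h: "h \<in> borel_measurable borel" and Q: "0 < Q"
  shows "h \<in> Lp_space lebesgue (ennreal Q) \<longleftrightarrow> integrable lborel (\<lambda>x. norm (h x) powr Q)"
    "Lp_norm lebesgue (ennreal Q) h powr Q = (\<integral>x. norm (h x) powr Q \<partial>lborel)"
proof -
  have m: "(\<lambda>x. norm (h x) powr Q) \<in> borel_measurable lborel"
    using h by simp
  have hm: "h \<in> borel_measurable lebesgue"
    using h by (simp add: measurable_completion)
  show "h \<in> Lp_space lebesgue (ennreal Q) \<longleftrightarrow> integrable lborel (\<lambda>x. norm (h x) powr Q)"
    using Q hm by (simp add: Lp_space_ennreal integrable_completion[OF m])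
  show "Lp_norm lebesgue (ennreal Q) h powr Q = (\<integral>x. norm (h x) powr Q \<partial>lborel)"
    using Q integral_completion[OF m] by (simp add: Lp_norm_powr)
qed

text \<open>Fubini needs joint measurability of \<open>h y *\<^sub>R k (x - y)\<close>, which holds
  for a Borel representative of \<open>h\<close>; the convolution does not see the change.\<close>

lemma conv_borel:
  fixes k :: "'a::euclidean_space \<Rightarrow> 'b::euclidean_space"
  assumes k [measurable]: "k \<in> borel_measurable borel" and h: "h \<in> borel_measurable lebesgue"
  obtains h' where "h' \<in> borel_measurable borel" "AE x in lebesgue. h x = h' x"
    "\<And>x. conv k h x = (\<integral>y. h' y *\<^sub>R k (x - y) \<partial>lborel)"
    "\<And>x. integrable lebesgue (\<lambda>y. h y *\<^sub>R k (x - y)) \<longleftrightarrow> integrable lborel (\<lambda>y. h' y *\<^sub>R k (x - y))"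
proof -
  obtain h' where h' [measurable]: "h' \<in> borel_measurable borel" and ae: "AE x in lborel. h x = h' x"
    using completion_ex_borel_measurable_real[OF h] by auto
  have ae': "AE x in lebesgue. h x = h' x"
    using AE_completion[OF ae] .
  have m: "(\<lambda>y. h' y *\<^sub>R k (x - y)) \<in> borel_measurable lborel" for x by measurable
  have aex: "AE y in lebesgue. h' y *\<^sub>R k (x - y) = h y *\<^sub>R k (x - y)" for x
    using ae' by eventually_elim simp
  note m' = measurable_completion[OF m]
  note m'' = borel_measurable_AE[OF m' aex]
  have "conv k h x = (\<integral>y. h' y *\<^sub>R k (x - y) \<partial>lborel)" for x
    unfolding conv_def using integral_cong_AE[OF m' m'' aex, of x] integral_completion[OF m, of x] by simp
  moreover have "integrable lebesgue (\<lambda>y. h y *\<^sub>R k (x - y)) \<longleftrightarrow> integrable lborel (\<lambda>y. h' y *\<^sub>R k (x - y))" for x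
    using integrable_cong_AE[OF m' m'' aex, of x] integrable_completion[OF m, of x] by simp
  ultimately show thesis
    using that h' ae' by blast
qed

lemma conv_in_Lp:
  fixes k :: "'a::euclidean_space \<Rightarrow> 'b::euclidean_space"
  assumes k [measurable]: "k \<in> borel_measurable borel" and h' [measurable]: "h' \<in> borel_measurable borel"
    and c: "\<And>x. conv k h x = (\<integral>y. h' y *\<^sub>R k (x - y) \<partial>lborel)"
    and Q: "1 \<le> Q" and C: "0 \<le> C"
    and J: "integrable lborel (\<lambda>x. (\<integral>y. \<bar>h' y\<bar> * norm (k (x - y)) \<partial>lborel) powr Q)"
      "(\<integral>x. (\<integral>y. \<bar>h' y\<bar> * norm (k (x - y)) \<partial>lborel) powr Q \<partial>lborel) \<le> C powr Q"
  shows "conv k h \<in> borel_measurable borel" "conv k h \<in> Lp_space lebesgue (ennreal Q)"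
    "Lp_norm lebesgue (ennreal Q) (conv k h) \<le> C"
proof -
  have eq: "conv k h = (\<lambda>x. \<integral>y. h' y *\<^sub>R k (x - y) \<partial>lborel)"
    using c by (simp add: fun_eq_iff)
  show m [measurable]: "conv k h \<in> borel_measurable borel"
    unfolding eq by measurable
  have le: "norm (conv k h x) powr Q \<le> (\<integral>y. \<bar>h' y\<bar> * norm (k (x - y)) \<partial>lborel) powr Q" for x
    using Q integral_norm_bound[of lborel "\<lambda>y. h' y *\<^sub>R k (x - y)"] unfolding c
    by (intro powr_mono2) auto
  have int: "integrable lborel (\<lambda>x. norm (conv k h x) powr Q)"
    by (rule Bochner_Integration.integrable_bound[OF J(1)]) (use le in auto)
  then show "conv k h \<in> Lp_space lebesgue (ennreal Q)"
    using Q m by (simp add: Lp_lebesgue_borel)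
  have "Lp_norm lebesgue (ennreal Q) (conv k h) powr Q \<le> C powr Q"
    using Q integral_mono[OF int J(1) le] J(2) by (simp add: Lp_lebesgue_borel(2)[OF m])
  then show "Lp_norm lebesgue (ennreal Q) (conv k h) \<le> C"
    using powr_less_mono2[of Q C "Lp_norm lebesgue (ennreal Q) (conv k h)"] C Q by linarith
qed

lemma borel_rep_Lp:
  fixes h h' :: "'a::euclidean_space \<Rightarrow> 'b::euclidean_space"
  assumes h: "h \<in> Lp_space lebesgue (ennreal Q)" and Q: "0 < Q"
    and h': "h' \<in> borel_measurable borel" and ae: "AE x in lebesgue. h x = h' x"
  shows "integrable lborel (\<lambda>x. norm (h' x) powr Q)"
    "(\<integral>x. norm (h' x) powr Q \<partial>lborel) = Lp_norm lebesgue (ennreal Q) h powr Q"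
  using Lp_space_AE_eq[OF h ae Q] Lp_lebesgue_borel[OF h' Q] by auto

text \<open>The disjunction covers both uses: an \<open>L^1\<close> source with a kernel in
  \<open>L^Q\<close>, and an \<open>L^Q\<close> source with a kernel in \<open>L^1\<close>.
  \<open>C\<close> is the product of norms that belongs to the case at hand.\<close>

lemma conv_Young_aux:
  fixes k :: "'a::euclidean_space \<Rightarrow> 'b::euclidean_space"
  assumes Q: "1 \<le> Q" and k [measurable]: "k \<in> borel_measurable borel" and h: "h \<in> borel_measurable lebesgue"
    and alt: "k \<in> Lp_space lebesgue (ennreal Q) \<and> h \<in> Lp_space lebesgue 1 \<and> C = Lp_norm lebesgue (ennreal Q) k * Lp_norm lebesgue 1 h
      \<or> k \<in> Lp_space lebesgue 1 \<and> h \<in> Lp_space lebesgue (ennreal Q) \<and> C = Lp_norm lebesgue 1 k * Lp_norm lebesgue (ennreal Q) h"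
    and h' [measurable]: "h' \<in> borel_measurable borel" and ae: "AE x in lebesgue. h x = h' x"
  shows "AE x in lborel. integrable lborel (\<lambda>y. \<bar>h' y\<bar> * norm (k (x - y)))"
    "integrable lborel (\<lambda>x. (\<integral>y. \<bar>h' y\<bar> * norm (k (x - y)) \<partial>lborel) powr Q)"
    "(\<integral>x. (\<integral>y. \<bar>h' y\<bar> * norm (k (x - y)) \<partial>lborel) powr Q \<partial>lborel) \<le> C powr Q"
    "0 \<le> C"
proof -
  let ?n = "Lp_norm lebesgue"
  have aek: "AE x in lebesgue. k x = k x" by simp
  have nn: "0 \<le> ?n 1 k" "0 \<le> ?n 1 h"
    using Lp_norm_ennreal_nonneg[of 1 lebesgue k] Lp_norm_ennreal_nonneg[of 1 lebesgue h] by auto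
  have "(AE x in lborel. integrable lborel (\<lambda>y. \<bar>h' y\<bar> * norm (k (x - y)))) \<and>
    integrable lborel (\<lambda>x. (\<integral>y. \<bar>h' y\<bar> * norm (k (x - y)) \<partial>lborel) powr Q) \<and>
    (\<integral>x. (\<integral>y. \<bar>h' y\<bar> * norm (k (x - y)) \<partial>lborel) powr Q \<partial>lborel) \<le> C powr Q \<and> 0 \<le> C"
    using alt
  proof
    assume *: "k \<in> Lp_space lebesgue (ennreal Q) \<and> h \<in> Lp_space lebesgue 1 \<and> C = ?n (ennreal Q) k * ?n 1 h"
    have h1: "integrable lborel (\<lambda>x. \<bar>h' x\<bar>)" "(\<integral>x. \<bar>h' x\<bar> \<partial>lborel) = ?n 1 h"
      using borel_rep_Lp[of h 1, OF _ _ h' ae] * nn by auto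
    have kQ: "integrable lborel (\<lambda>x. norm (k x) powr Q)" "(\<integral>x. norm (k x) powr Q \<partial>lborel) = ?n (ennreal Q) k powr Q"
      using borel_rep_Lp[of k Q, OF _ _ k aek] * Q by auto
    show ?thesis
      using Young_real[of Q "\<lambda>y. \<bar>h' y\<bar>" "\<lambda>x. norm (k x)"] Q h1 kQ * nn by (simp add: powr_mult mult.commute)
  next
    assume *: "k \<in> Lp_space lebesgue 1 \<and> h \<in> Lp_space lebesgue (ennreal Q) \<and> C = ?n 1 k * ?n (ennreal Q) h"
    have hQ: "integrable lborel (\<lambda>x. \<bar>h' x\<bar> powr Q)" "(\<integral>x. \<bar>h' x\<bar> powr Q \<partial>lborel) = ?n (ennreal Q) h powr Q"
      using borel_rep_Lp[of h Q, OF _ _ h' ae] * Q by auto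
    have k1: "integrable lborel (\<lambda>x. norm (k x))" "(\<integral>x. norm (k x) \<partial>lborel) = ?n 1 k"
      using borel_rep_Lp[of k 1, OF _ _ k aek] * nn by auto
    \<comment> \<open>Reflection exchanges the two factors, so Young's inequality applies with the
      kernel as the integrable one.\<close>
    have refl: "(\<integral>y. norm (k y) * \<bar>h' (x - y)\<bar> \<partial>lborel) = (\<integral>y. \<bar>h' y\<bar> * norm (k (x - y)) \<partial>lborel)"
      "integrable lborel (\<lambda>y. norm (k y) * \<bar>h' (x - y)\<bar>) \<longleftrightarrow> integrable lborel (\<lambda>y. \<bar>h' y\<bar> * norm (k (x - y)))" for x
      using lborel_integral_reflect[of "\<lambda>y. \<bar>h' y\<bar> * norm (k (x - y))" x] by (simp_all add: mult.commute)
    show ?thesis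
      using Young_real[of Q "\<lambda>x. norm (k x)" "\<lambda>y. \<bar>h' y\<bar>"] Q hQ k1 * nn unfolding refl
      by (simp add: powr_mult mult.commute)
  qed
  then show "AE x in lborel. integrable lborel (\<lambda>y. \<bar>h' y\<bar> * norm (k (x - y)))"
    "integrable lborel (\<lambda>x. (\<integral>y. \<bar>h' y\<bar> * norm (k (x - y)) \<partial>lborel) powr Q)"
    "(\<integral>x. (\<integral>y. \<bar>h' y\<bar> * norm (k (x - y)) \<partial>lborel) powr Q \<partial>lborel) \<le> C powr Q"
    "0 \<le> C"
    by auto
qed

lemma conv_Young:
  fixes k :: "'a::euclidean_space \<Rightarrow> 'b::euclidean_space"
  assumes Q: "1 \<le> Q" and k [measurable]: "k \<in> borel_measurable borel"
    and alt: "k \<in> Lp_space lebesgue (ennreal Q) \<and> h \<in> Lp_space lebesgue 1 \<and> C = Lp_norm lebesgue (ennreal Q) k * Lp_norm lebesgue 1 h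
      \<or> k \<in> Lp_space lebesgue 1 \<and> h \<in> Lp_space lebesgue (ennreal Q) \<and> C = Lp_norm lebesgue 1 k * Lp_norm lebesgue (ennreal Q) h"
  shows "conv_ok k h" "conv k h \<in> Lp_space lebesgue (ennreal Q)" "Lp_norm lebesgue (ennreal Q) (conv k h) \<le> C"
proof -
  have h: "h \<in> borel_measurable lebesgue"
    using alt Lp_space_measurable by blast
  obtain h' where h' [measurable]: "h' \<in> borel_measurable borel" and ae: "AE x in lebesgue. h x = h' x"
    and c: "\<And>x. conv k h x = (\<integral>y. h' y *\<^sub>R k (x - y) \<partial>lborel)"
    and i: "\<And>x. integrable lebesgue (\<lambda>y. h y *\<^sub>R k (x - y)) \<longleftrightarrow> integrable lborel (\<lambda>y. h' y *\<^sub>R k (x - y))"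
    by (rule conv_borel[OF k h]) (rule that)
  note Y = conv_Young_aux[OF Q k h alt h' ae]
  have "AE x in lebesgue. integrable lborel (\<lambda>y. \<bar>h' y\<bar> * norm (k (x - y)))"
    using Y(1) by (rule AE_completion)
  then show "conv_ok k h"
    unfolding conv_ok_def i
  proof eventually_elim
    case (elim x)
    then show ?case
      by (rule Bochner_Integration.integrable_bound) auto
  qed
  show "conv k h \<in> Lp_space lebesgue (ennreal Q)" "Lp_norm lebesgue (ennreal Q) (conv k h) \<le> C"
    using conv_in_Lp[OF k h' c Q Y(4) Y(2,3)] by auto
qed

lemma conv_diff_left:
  "conv_ok k h \<Longrightarrow> conv_ok k' h \<Longrightarrow> AE x in lebesgue. conv (k - k') h x = conv k h x - conv k' h x"
  unfolding conv_ok_def conv_def by (erule (1) eventually_elim2, simp add: scaleR_diff_right)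

lemma conv_diff_right:
  "conv_ok k h \<Longrightarrow> conv_ok k h' \<Longrightarrow> AE x in lebesgue. conv k (h - h') x = conv k h x - conv k h' x"
  unfolding conv_ok_def conv_def by (erule (1) eventually_elim2, simp add: scaleR_diff_left)

lemma conv_add_right:
  "conv_ok k h \<Longrightarrow> conv_ok k h' \<Longrightarrow> AE x in lebesgue. conv k (h + h') x = conv k h x + conv k h' x"
  unfolding conv_ok_def conv_def by (erule (1) eventually_elim2, simp add: scaleR_add_left)

lemma conv_fst:
  "conv_ok k h \<Longrightarrow> AE x in lebesgue. fst (conv k h x) = (\<integral>y. h y * fst (k (x - y)) \<partial>lebesgue)"
  unfolding conv_ok_def conv_def by (elim eventually_mono) (simp add: integral_bounded_linear[OF bounded_linear_fst, symmetric])

lemma conv_cong_AE: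
  assumes "k \<in> borel_measurable borel" "h \<in> borel_measurable lebesgue" "AE x in lebesgue. h x = h' x"
  shows "conv k h = conv k h'"
proof
  fix x
  have h': "h' \<in> borel_measurable lebesgue"
    using borel_measurable_AE assms(2,3) by blast
  have "(\<lambda>y. k (x - y)) \<in> borel_measurable borel"
    using assms(1) by measurable
  then have [measurable]: "(\<lambda>y. k (x - y)) \<in> borel_measurable lebesgue"
    by (simp add: measurable_completion)
  note [measurable] = h' assms(2)
  show "conv k h x = conv k h' x"
    unfolding conv_def by (intro integral_cong_AE) (use assms(3) in \<open>auto elim: eventually_mono\<close>)
qed

lemma Ck_translate: "Ck k h \<Longrightarrow> Ck k (\<lambda>x. h (x + y))"
proof (induction k arbitrary: h)
  case 0
  then show ?case
    by (auto intro!: continuous_intros continuous_on_compose2[of UNIV h])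
next
  case (Suc k)
  obtain D where D: "\<And>x. (h has_derivative D x) (at x)" "\<And>e. Ck k (\<lambda>x. D x e)"
    by (rule Ck_SucE[OF Suc.prems(1)]) (rule that)
  show ?case
  proof (rule Ck_SucI)
    fix x :: 'a
    have "((\<lambda>x. x + y) has_derivative (\<lambda>e. e)) (at x)"
      by (auto intro!: derivative_eq_intros)
    from has_derivative_compose[OF this D(1)]
    show "((\<lambda>x. h (x + y)) has_derivative D (x + y)) (at x)" .
  qed (rule Suc.IH, rule D)
qed

lemma test_function_translate:
  fixes \<phi> :: "'a::euclidean_space \<Rightarrow> real"
  assumes t: "test_function \<phi>"
  shows "test_function (\<lambda>x. \<phi> (x + y))"
    "frechet_derivative (\<lambda>x. \<phi> (x + y)) (at x) = frechet_derivative \<phi> (at (x + y))"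
proof -
  obtain K where K: "supported_in \<phi> K"
    by (rule test_function_supported[OF t])
  have cK: "compact ((\<lambda>x. x - y) ` K)"
    using K by (intro compact_continuous_image continuous_intros) (auto simp: supported_in_def)
  have "{x. \<phi> (x + y) \<noteq> 0} \<subseteq> (\<lambda>x. x - y) ` K"
  proof
    fix x assume "x \<in> {x. \<phi> (x + y) \<noteq> 0}"
    then have "x + y \<in> K" using K by (auto simp: supported_in_def)
    then show "x \<in> (\<lambda>x. x - y) ` K" by (intro image_eqI[of _ _ "x + y"]) auto
  qed
  then have "compact (closure {x. \<phi> (x + y) \<noteq> 0})"
    unfolding compact_closure by (rule bounded_subset[OF compact_imp_bounded[OF cK]])
  then show "test_function (\<lambda>x. \<phi> (x + y))"
    using t Ck_translate unfolding test_function_def by blast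
  have "((\<lambda>x. x + y) has_derivative (\<lambda>e. e)) (at x)"
    by (auto intro!: derivative_eq_intros)
  from has_derivative_compose[OF this test_function_derivative(1)[OF t]]
  show "frechet_derivative (\<lambda>x. \<phi> (x + y)) (at x) = frechet_derivative \<phi> (at (x + y))"
    by (rule frechet_derivative_at[symmetric])
qed

text \<open>Fubini moves the test function onto the kernel: for fixed \<open>y\<close> the inner
  integral is the weak gradient identity of \<open>k\<close> tested with the translate
  \<open>\<phi> (x + y)\<close>, and it vanishes.\<close>

lemma conv_weak_gradient:
  fixes k :: "'a::euclidean_space \<Rightarrow> real \<times> 'a"
  assumes Q: "1 \<le> Q" and k [measurable]: "k \<in> borel_measurable borel" and w: "weak_gradient (\<lambda>x. fst (k x)) (\<lambda>x. snd (k x))"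
    and alt: "k \<in> Lp_space lebesgue (ennreal Q) \<and> h \<in> Lp_space lebesgue 1 \<and> C = Lp_norm lebesgue (ennreal Q) k * Lp_norm lebesgue 1 h
      \<or> k \<in> Lp_space lebesgue 1 \<and> h \<in> Lp_space lebesgue (ennreal Q) \<and> C = Lp_norm lebesgue 1 k * Lp_norm lebesgue (ennreal Q) h"
  shows "conv k h \<in> W1_pairs (ennreal Q)"
proof -
  have h: "h \<in> borel_measurable lebesgue"
    using alt Lp_space_measurable by blast
  obtain h' where h' [measurable]: "h' \<in> borel_measurable borel" and ae: "AE x in lebesgue. h x = h' x"
    and c: "\<And>x. conv k h x = (\<integral>y. h' y *\<^sub>R k (x - y) \<partial>lborel)"
    by (rule conv_borel[OF k h]) (rule that)
  note Y = conv_Young_aux[OF Q k h alt h' ae]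
  have [measurable]: "conv k h \<in> borel_measurable borel"
    by (rule conv_in_Lp[OF k h' c Q Y(4) Y(2,3)])
  have "(\<lambda>x. fst (conv k h x)) \<in> borel_measurable borel" "(\<lambda>x. snd (conv k h x)) \<in> borel_measurable borel"
    by (auto intro!: borel_measurable_continuous_on[OF _ \<open>conv k h \<in> borel_measurable borel\<close>] continuous_intros)
  note [measurable] = this
  have L: "conv k h \<in> Lp_space lebesgue (ennreal Q)"
    by (rule conv_Young[OF Q k alt])
  let ?J = "\<lambda>x. \<integral>y. \<bar>h' y\<bar> * norm (k (x - y)) \<partial>lborel"
  have JL: "?J \<in> Lp_space lebesgue (ennreal Q)"
    using Q Y(2) by (subst Lp_lebesgue_borel) (auto simp: integral_nonneg)
  have km: "(\<lambda>x. fst (k x)) \<in> borel_measurable borel" "(\<lambda>x. snd (k x)) \<in> borel_measurable borel"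
    by (auto intro!: borel_measurable_continuous_on[OF _ k] continuous_intros)
  note [measurable] = km
  have "weak_gradient (\<lambda>x. fst (conv k h x)) (\<lambda>x. snd (conv k h x))"
    unfolding weak_gradient_def
  proof (intro conjI allI impI ballI)
    fix \<phi> :: "'a \<Rightarrow> real" and b :: 'a assume t: "test_function \<phi>" and b: "b \<in> Basis"
    obtain K where K: "supported_in \<phi> K" "\<And>b. supported_in (\<lambda>x. frechet_derivative \<phi> (at x) b) K"
      by (rule test_function_supported[OF t]) (rule that)
    then have cK: "compact K" by (simp add: supported_in_def)
    let ?D = "\<lambda>x. frechet_derivative \<phi> (at x) b"
    have [measurable]: "\<phi> \<in> borel_measurable borel" "?D \<in> borel_measurable borel"
      by (rule supported_in_measurable, rule K)+
    \<comment> \<open>Linear in \<open>z\<close>: a pair satisfies the weak gradient identity for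
      \<open>\<phi>\<close> and \<open>b\<close> iff \<open>?G x\<close> applied to its values
      integrates to 0.\<close>
    let ?G = "\<lambda>x z. fst z * ?D x + (snd z \<bullet> b) * \<phi> x"
    let ?\<psi> = "\<lambda>x. \<bar>?D x\<bar> + \<bar>\<phi> x\<bar>"
    have Gm: "(\<lambda>x. ?G x z) \<in> borel_measurable borel" for z
      by measurable
    have G: "norm (?G x z) \<le> norm z * ?\<psi> x" for x z
    proof -
      have 1: "\<bar>fst z\<bar> \<le> norm z" "\<bar>snd z \<bullet> b\<bar> \<le> norm z"
        using norm_fst_snd_le(1)[of z] Basis_le_norm[OF b, of "snd z"] norm_fst_snd_le(2)[of z] by auto
      have "norm (?G x z) \<le> \<bar>fst z\<bar> * \<bar>?D x\<bar> + \<bar>snd z \<bullet> b\<bar> * \<bar>\<phi> x\<bar>"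
        by (simp add: abs_mult[symmetric])
      also have "\<dots> \<le> norm z * \<bar>?D x\<bar> + norm z * \<bar>\<phi> x\<bar>"
        using 1 by (intro add_mono mult_right_mono) auto
      finally show ?thesis by (simp add: distrib_left)
    qed
    \<comment> \<open>The dominating function for Fubini: \<open>?J\<close> is in
      \<open>L^Q\<close>, hence locally integrable, and \<open>?\<psi>\<close> has compact
      support.\<close>
    have J\<psi>: "integrable lborel (\<lambda>x. ?J x * ?\<psi> x)"
    proof -
      have "supported_in ?\<psi> K"
        using K(1) K(2)[of b] by (auto simp: supported_in_def intro!: continuous_intros)
      then have "integrable lebesgue (\<lambda>x. ?J x * ?\<psi> x)"
        using set_integral_Lp_le(1)[OF JL Q cK] by (rule integrable_times_supported)
      then show ?thesis
        by (subst (asm) integrable_completion) auto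
    qed
    have m2: "(\<lambda>(x, y). h' y * ?G x (k (x - y))) \<in> borel_measurable (lborel \<Otimes>\<^sub>M lborel)"
      by measurable
    have prod: "integrable (lborel \<Otimes>\<^sub>M lborel) (\<lambda>(x, y). h' y * ?G x (k (x - y)))"
    proof (rule lborel_pair.Fubini_integrable[OF m2])
      have le: "norm (h' y * ?G x (k (x - y))) \<le> \<bar>h' y\<bar> * norm (k (x - y)) * ?\<psi> x" for x y
        using mult_left_mono[OF G[where x=x and z="k (x - y)"], of "\<bar>h' y\<bar>"] by (simp add: abs_mult mult.assoc)
      have int: "integrable lborel (\<lambda>y. \<bar>h' y\<bar> * norm (k (x - y)) * ?\<psi> x)"
        if "integrable lborel (\<lambda>y. \<bar>h' y\<bar> * norm (k (x - y)))" for x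
        using that by (rule integrable_mult_left)
      have int': "integrable lborel (\<lambda>y. h' y * ?G x (k (x - y)))"
        if "integrable lborel (\<lambda>y. \<bar>h' y\<bar> * norm (k (x - y)))" for x
      proof (rule Bochner_Integration.integrable_bound[OF int[OF that]])
        show "AE y in lborel. norm (h' y * ?G x (k (x - y))) \<le> norm (\<bar>h' y\<bar> * norm (k (x - y)) * ?\<psi> x)"
          by (intro AE_I2 order_trans[OF le]) (simp add: abs_mult)
      qed measurable
      then show "AE x in lborel. integrable lborel (\<lambda>y. case (x, y) of (x, y) \<Rightarrow> h' y * ?G x (k (x - y)))"
        using Y(1) by (auto elim: eventually_mono)
      show "integrable lborel (\<lambda>x. \<integral>y. norm (case (x, y) of (x, y) \<Rightarrow> h' y * ?G x (k (x - y))) \<partial>lborel)"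
      proof (rule Bochner_Integration.integrable_bound[OF J\<psi>])
        show "AE x in lborel. norm (\<integral>y. norm (case (x, y) of (x, y) \<Rightarrow> h' y * ?G x (k (x - y))) \<partial>lborel) \<le> norm (?J x * ?\<psi> x)"
          using Y(1)
        proof eventually_elim
          case (elim x)
          have "(\<integral>y. norm (h' y * ?G x (k (x - y))) \<partial>lborel) \<le> (\<integral>y. \<bar>h' y\<bar> * norm (k (x - y)) * ?\<psi> x \<partial>lborel)"
            by (intro integral_mono integrable_norm int int' elim le)
          also have "\<dots> = ?J x * ?\<psi> x" by simp
          finally show ?case
            by (simp add: integral_nonneg)
        qed
      qed measurable
    qed
    have "(\<integral>x. ?G x (conv k h x) \<partial>lborel) = (\<integral>x. (\<integral>y. h' y * ?G x (k (x - y)) \<partial>lborel) \<partial>lborel)"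
    proof (rule integral_cong_AE)
      show "AE x in lborel. ?G x (conv k h x) = (\<integral>y. h' y * ?G x (k (x - y)) \<partial>lborel)"
        using Y(1)
      proof eventually_elim
        case (elim x)
        have i: "integrable lborel (\<lambda>y. h' y *\<^sub>R k (x - y))"
          by (rule Bochner_Integration.integrable_bound[OF elim]) auto
        have "bounded_linear (\<lambda>z. ?G x z)"
          by (intro bounded_linear_add bounded_linear_compose[OF bounded_linear_mult_left]
            bounded_linear_compose[OF bounded_linear_inner_left bounded_linear_snd] bounded_linear_fst)
        from integral_bounded_linear[OF this i]
        show ?case
          unfolding c by (simp add: algebra_simps)
      qed
      show "(\<lambda>x. \<integral>y. h' y * ?G x (k (x - y)) \<partial>lborel) \<in> borel_measurable lborel"
        using m2 by (intro lborel.borel_measurable_lebesgue_integral) simp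
    qed measurable
    also have "\<dots> = (\<integral>y. (\<integral>x. h' y * ?G x (k (x - y)) \<partial>lborel) \<partial>lborel)"
      using lborel_pair.Fubini_integral[OF prod] by simp
    also have "\<dots> = 0"
    proof -
      have "(\<integral>x. ?G x (k (x - y)) \<partial>lborel) = 0" for y
      proof -
        note t' = test_function_translate[OF t, of y]
        have m3: "(\<lambda>x. fst (k x) * ?D (x + y)) \<in> borel_measurable lborel"
          "(\<lambda>x. (snd (k x) \<bullet> b) * \<phi> (x + y)) \<in> borel_measurable lborel"
          by measurable
        have "(\<integral>x. ?G x (k (x - y)) \<partial>lborel) = (\<integral>x. ?G (x + y) (k x) \<partial>lborel)"
          using lborel_integral_translate(1)[of "\<lambda>x. ?G (x + y) (k x)" y] by simp
        also have "\<dots> = (\<integral>x. fst (k x) * ?D (x + y) \<partial>lborel) + (\<integral>x. (snd (k x) \<bullet> b) * \<phi> (x + y) \<partial>lborel)"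
          using weak_gradient_integrable[OF w t'(1), of b] m3
          by (intro Bochner_Integration.integral_add) (auto simp: t'(2) integrable_completion)
        also have "\<dots> = 0"
          using weak_gradientD(3)[OF w t'(1) b] m3 by (simp add: t'(2) integral_completion)
        finally show ?thesis .
      qed
      then show ?thesis by simp
    qed
    finally have "(\<integral>x. ?G x (conv k h x) \<partial>lebesgue) = 0"
      by (subst integral_completion) auto
    moreover have "integrable lebesgue (\<lambda>x. fst (conv k h x) * ?D x)"
      "integrable lebesgue (\<lambda>x. (snd (conv k h x) \<bullet> b) * \<phi> x)"
      using K Lp_fst_snd[OF L] Q cK
      by (auto intro!: integrable_times_supported absolutely_integrable_component set_integral_Lp_le(1)[of _ Q])
    ultimately show "(\<integral>x. fst (conv k h x) * ?D x \<partial>lebesgue) = - (\<integral>x. (snd (conv k h x) \<bullet> b) * \<phi> x \<partial>lebesgue)"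
      by simp
  qed (use Lp_fst_snd[OF L] Q in \<open>auto intro!: set_integral_Lp_le(1)[of _ Q]\<close>)
  with L show ?thesis by (simp add: W1_pairs_def)
qed

section \<open>The heat kernel\<close>

lemma Lp_dominated_convergence:
  fixes f :: "nat \<Rightarrow> 'a \<Rightarrow> 'b::euclidean_space"
  assumes Q: "0 < Q" and m [measurable]: "\<And>n. f n \<in> borel_measurable M" "g \<in> borel_measurable M"
    and lim: "AE x in M. (\<lambda>n. f n x) \<longlonglongrightarrow> g x" and le: "\<And>n. AE x in M. norm (f n x - g x) \<le> w x"
    and w: "integrable M (\<lambda>x. w x powr Q)"
  shows "(\<lambda>n. Lp_norm M (ennreal Q) (f n - g)) \<longlonglongrightarrow> 0"
proof -
  have "(\<lambda>n. \<integral>x. norm (f n x - g x) powr Q \<partial>M) \<longlonglongrightarrow> (\<integral>x. 0 \<partial>M)"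
  proof (rule integral_dominated_convergence[OF _ _ w])
    show "AE x in M. (\<lambda>n. norm (f n x - g x) powr Q) \<longlonglongrightarrow> 0"
      using lim
    proof eventually_elim
      case (elim x)
      then have "(\<lambda>n. norm (f n x - g x)) \<longlonglongrightarrow> 0"
        by (simp add: LIM_zero_iff tendsto_norm_zero)
      then have "(\<lambda>n. norm (f n x - g x) powr Q) \<longlonglongrightarrow> 0 powr Q"
        using Q by (intro tendsto_powr' tendsto_const) auto
      then show ?case by simp
    qed
    show "AE x in M. norm (norm (f n x - g x) powr Q) \<le> w x powr Q" for n
      using le[of n] by eventually_elim (use Q in \<open>auto intro: powr_mono2\<close>)
  qed measurable
  then have "(\<lambda>n. (\<integral>x. norm (f n x - g x) powr Q \<partial>M) powr (1 / Q)) \<longlonglongrightarrow> 0 powr (1 / Q)"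
    using Q by (intro tendsto_powr' tendsto_const) (auto simp: integral_nonneg)
  then show ?thesis
    using Q by (simp add: Lp_norm_ennreal)
qed

section \<open>Gaussians: scaling, mass and pointwise bounds\<close>

lemma lborel_integral_scale:
  fixes f :: "'a::euclidean_space \<Rightarrow> real"
  assumes f [measurable]: "f \<in> borel_measurable borel" and t: "t > 0"
  shows "(\<integral>x. f (x /\<^sub>R t) \<partial>lborel) = t ^ DIM('a) * (\<integral>x. f x \<partial>lborel)"
    "integrable lborel (\<lambda>x. f (x /\<^sub>R t)) \<longleftrightarrow> integrable lborel f"
proof -
  have eq: "(lborel :: 'a measure) = density (distr lborel borel (\<lambda>x. t *\<^sub>R x)) (\<lambda>_. ennreal (t ^ DIM('a)))"
    using lborel_affine[of t "0 :: 'a"] t by simp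
  have m: "(\<lambda>x :: 'a. t *\<^sub>R x) \<in> measurable lborel borel" by simp
  have "(\<integral>x. f (x /\<^sub>R t) \<partial>lborel) = (\<integral>x. t ^ DIM('a) *\<^sub>R f (x /\<^sub>R t) \<partial>distr lborel borel (\<lambda>x. t *\<^sub>R x))"
    using t by (subst eq, subst integral_density) auto
  also have "\<dots> = (\<integral>x. t ^ DIM('a) *\<^sub>R f x \<partial>lborel)"
    using t by (subst integral_distr[OF m]) auto
  finally show "(\<integral>x. f (x /\<^sub>R t) \<partial>lborel) = t ^ DIM('a) * (\<integral>x. f x \<partial>lborel)"
    by simp
  have "integrable lborel (\<lambda>x. f (x /\<^sub>R t)) \<longleftrightarrow> integrable (distr lborel borel (\<lambda>x. t *\<^sub>R x)) (\<lambda>x. t ^ DIM('a) *\<^sub>R f (x /\<^sub>R t))"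
    using t by (subst eq, subst integrable_density) auto
  also have "\<dots> \<longleftrightarrow> integrable lborel (\<lambda>x. t ^ DIM('a) *\<^sub>R f x)"
    using t by (subst integrable_distr_eq[OF m]) auto
  also have "\<dots> \<longleftrightarrow> integrable lborel f"
    using t by simp
  finally show "integrable lborel (\<lambda>x. f (x /\<^sub>R t)) \<longleftrightarrow> integrable lborel f" .
qed

lemma gaussian_nonneg: "\<tau> > 0 \<Longrightarrow> 0 \<le> gaussian \<tau> x"
  by (simp add: gaussian_def)

lemma gaussian_scale:
  fixes x :: "'a::euclidean_space"
  assumes "\<tau> > 0"
  shows "gaussian \<tau> x = gaussian 1 (x /\<^sub>R \<tau>) / \<tau> ^ DIM('a)"
proof -
  have n: "(norm (x /\<^sub>R \<tau>))\<^sup>2 = (norm x)\<^sup>2 / \<tau>\<^sup>2"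
    using assms by (simp add: power_mult_distrib divide_inverse power_inverse)
  show ?thesis
    unfolding gaussian_def n by simp
qed

lemma continuous_gaussian: "\<tau> > 0 \<Longrightarrow> continuous_on UNIV (gaussian \<tau> :: 'a::euclidean_space \<Rightarrow> real)"
  unfolding gaussian_def by (intro continuous_intros) auto

lemma gaussian_borel: "\<tau> > 0 \<Longrightarrow> (gaussian \<tau> :: 'a::euclidean_space \<Rightarrow> real) \<in> borel_measurable borel"
  by (intro borel_measurable_continuous_onI continuous_gaussian)

text \<open>The squared norm is the sum of the squared coordinates, which reduces the total mass to
  the one-dimensional normal density.\<close>

lemma gaussian_1_prod:
  fixes x :: "'a::euclidean_space"
  shows "gaussian 1 x = (\<Prod>b\<in>Basis. std_normal_density (x \<bullet> b))"
proof -
  have "(\<Prod>b\<in>(Basis::'a set). std_normal_density (x \<bullet> b)) = (\<Prod>b\<in>(Basis::'a set). 1 / sqrt (2 * pi)) * (\<Prod>b\<in>(Basis::'a set). exp (- (x \<bullet> b)\<^sup>2 / 2))"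
    unfolding std_normal_density_def by (rule prod.distrib)
  also have "(\<Prod>b\<in>(Basis::'a set). exp (- (x \<bullet> b)\<^sup>2 / 2)) = exp (- (norm x)\<^sup>2 / 2)"
  proof -
    have "(norm x)\<^sup>2 = (\<Sum>b\<in>Basis. (x \<bullet> b)\<^sup>2)"
      unfolding power2_norm_eq_inner by (subst euclidean_inner) (simp add: power2_eq_square)
    then show ?thesis
      by (simp add: exp_sum[symmetric] sum_negf sum_divide_distrib)
  qed
  also have "(\<Prod>b\<in>(Basis::'a set). 1 / sqrt (2 * pi)) = 1 / (2 * pi) powr (DIM('a) / 2)"
    by (simp add: power_one_over powr_half_sqrt[symmetric] powr_powr powr_realpow[symmetric])
  finally show ?thesis
    by (simp add: gaussian_def)
qed

lemma gaussian_1_integral: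
  "integrable lborel (gaussian 1 :: 'a::euclidean_space \<Rightarrow> real)" "(\<integral>x. gaussian 1 (x :: 'a) \<partial>lborel) = 1"
proof -
  have "(\<integral>\<^sup>+x. ennreal (gaussian 1 (x :: 'a)) \<partial>lborel) = (\<integral>\<^sup>+x. ennreal (\<Prod>b\<in>Basis. std_normal_density ((x :: 'a) \<bullet> b)) \<partial>lborel)"
    by (simp add: gaussian_1_prod)
  also have "\<dots> = (\<integral>\<^sup>+x. (\<Prod>b\<in>Basis. ennreal (std_normal_density ((x :: 'a) \<bullet> b))) \<partial>lborel)"
    by (simp add: prod_ennreal)
  also have "\<dots> = (\<Prod>b\<in>(Basis :: 'a set). \<integral>\<^sup>+x. ennreal (std_normal_density x) \<partial>lborel)"
    by (rule nn_integral_lborel_prod) auto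
  also have "(\<integral>\<^sup>+x. ennreal (std_normal_density x) \<partial>lborel) = 1"
    using integral_normal_density[of 1 0] integrable_normal_density[of 1 0]
    by (subst nn_integral_eq_integral) auto
  finally have *: "(\<integral>\<^sup>+x. ennreal (gaussian 1 (x :: 'a)) \<partial>lborel) = 1" by simp
  have nn: "AE x in lborel. 0 \<le> gaussian 1 (x :: 'a)"
    by (simp add: gaussian_nonneg)
  show int: "integrable lborel (gaussian 1 :: 'a \<Rightarrow> real)"
    using * nn gaussian_borel[of 1] by (intro integrableI_nonneg) auto
  show "(\<integral>x. gaussian 1 (x :: 'a) \<partial>lborel) = 1"
    using nn_integral_eq_integral[OF int nn] * by simp
qed

lemma gaussian_integral:
  assumes "\<tau> > 0"
  shows "integrable lborel (gaussian \<tau> :: 'a::euclidean_space \<Rightarrow> real)" "(\<integral>x. gaussian \<tau> (x :: 'a) \<partial>lborel) = 1"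
  unfolding gaussian_scale[OF assms]
  using lborel_integral_scale[OF gaussian_borel[of 1, where 'a='a] assms] gaussian_1_integral[where 'a='a] assms
  by simp_all

text \<open>Up to its normalising constant this is the Gaussian of width
  \<open>sqrt 2 * t\<close>.\<close>

lemma exp_quadratic_integral:
  fixes t :: real assumes t: "t > 0"
  shows "integrable lborel (\<lambda>x :: 'a::euclidean_space. exp (- ((norm x)\<^sup>2 / (4 * t\<^sup>2))))"
    "(\<integral>x. exp (- ((norm (x :: 'a))\<^sup>2 / (4 * t\<^sup>2))) \<partial>lborel) = (2 * pi) powr (DIM('a) / 2) * (sqrt 2 * t) ^ DIM('a)"
proof -
  have *: "exp (- ((norm x)\<^sup>2 / (4 * t\<^sup>2))) = (2 * pi) powr (DIM('a) / 2) * (sqrt 2 * t) ^ DIM('a) * gaussian (sqrt 2 * t) x" for x :: 'a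
    using t by (simp add: gaussian_def power_mult_distrib)
  show "integrable lborel (\<lambda>x :: 'a. exp (- ((norm x)\<^sup>2 / (4 * t\<^sup>2))))"
    "(\<integral>x. exp (- ((norm (x :: 'a))\<^sup>2 / (4 * t\<^sup>2))) \<partial>lborel) = (2 * pi) powr (DIM('a) / 2) * (sqrt 2 * t) ^ DIM('a)"
    unfolding * using gaussian_integral[of "sqrt 2 * t", where 'a='a] t by simp_all
qed

text \<open>The Gaussian together with its gradient.\<close>

definition heat_kernel :: "real \<Rightarrow> 'a::euclidean_space \<Rightarrow> real \<times> 'a" where
  "heat_kernel \<tau> x = (gaussian \<tau> x, - (gaussian \<tau> x / \<tau>\<^sup>2) *\<^sub>R x)"

lemma continuous_heat_kernel: "\<tau> > 0 \<Longrightarrow> continuous_on UNIV (heat_kernel \<tau> :: 'a::euclidean_space \<Rightarrow> real \<times> 'a)"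
  unfolding heat_kernel_def gaussian_def by (intro continuous_intros) auto

lemma heat_kernel_borel: "\<tau> > 0 \<Longrightarrow> (heat_kernel \<tau> :: 'a::euclidean_space \<Rightarrow> real \<times> 'a) \<in> borel_measurable borel"
  by (intro borel_measurable_continuous_onI continuous_heat_kernel)

text \<open>The normalising power of \<open>2 * pi\<close> is at least 1 and is dropped; half of the
  exponent is given away to match the bound for the gradient.\<close>

lemma gaussian_le:
  fixes x :: "'a::euclidean_space"
  assumes t: "\<tau> > 0"
  shows "gaussian \<tau> x \<le> 1 / \<tau> ^ DIM('a) * exp (- ((norm x)\<^sup>2 / (4 * \<tau>\<^sup>2)))"
proof -
  have "1 \<le> (2 * pi) powr (DIM('a) / 2)"
    using pi_gt3 by (intro ge_one_powr_ge_zero) auto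
  moreover have "exp (- (norm x)\<^sup>2 / (2 * \<tau>\<^sup>2)) \<le> exp (- ((norm x)\<^sup>2 / (4 * \<tau>\<^sup>2)))"
    using t by (simp add: field_simps)
  ultimately have "gaussian \<tau> x \<le> exp (- ((norm x)\<^sup>2 / (4 * \<tau>\<^sup>2))) / (1 * \<tau> ^ DIM('a))"
    unfolding gaussian_def using t by (intro frac_le mult_right_mono) auto
  then show ?thesis by simp
qed

text \<open>With \<open>s = norm x / \<tau>\<close> the polynomial factor of the gradient is
  absorbed by half of the Gaussian exponent: \<open>1 + s \<le> exp s\<close>, and
  \<open>s - s^2 / 4 \<le> 1\<close> is a square being nonnegative.\<close>

lemma norm_heat_kernel_le:
  fixes x :: "'a::euclidean_space"
  assumes t: "\<tau> > 0"
  shows "norm (heat_kernel \<tau> x) \<le> exp 1 * ((1 + 1 / \<tau>) / \<tau> ^ DIM('a)) * exp (- ((norm x)\<^sup>2 / (4 * \<tau>\<^sup>2)))"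
proof -
  define s where "s = norm x / \<tau>"
  have s: "0 \<le> s" using t by (simp add: s_def)
  have c: "1 \<le> (2 * pi) powr (DIM('a) / 2)"
    using pi_gt3 by (intro ge_one_powr_ge_zero) auto
  have g: "gaussian \<tau> x \<le> exp (- (s\<^sup>2 / 2)) / \<tau> ^ DIM('a)"
  proof -
    have eq: "- (norm x)\<^sup>2 / (2 * \<tau>\<^sup>2) = - (s\<^sup>2 / 2)"
      by (simp add: s_def power_divide)
    have "gaussian \<tau> x \<le> exp (- (s\<^sup>2 / 2)) / (1 * \<tau> ^ DIM('a))"
      unfolding gaussian_def eq using t c by (intro divide_left_mono mult_right_mono) auto
    then show ?thesis by simp
  qed
  have e: "(1 + s) * exp (- (s\<^sup>2 / 2)) \<le> exp 1 * exp (- (s\<^sup>2 / 4))"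
  proof -
    have "(1 + s) * exp (- (s\<^sup>2 / 2)) \<le> exp s * exp (- (s\<^sup>2 / 2))"
      using exp_ge_add_one_self[of s] by (intro mult_right_mono) auto
    also have "\<dots> = exp (s - s\<^sup>2 / 2)" by (simp add: exp_add[symmetric])
    also have "\<dots> \<le> exp (1 - s\<^sup>2 / 4)"
      using zero_le_power2[of "s / 2 - 1"] by (simp add: power2_eq_square algebra_simps)
    also have "\<dots> = exp 1 * exp (- (s\<^sup>2 / 4))" by (simp add: exp_add[symmetric])
    finally show ?thesis .
  qed
  have "norm (heat_kernel \<tau> x) \<le> gaussian \<tau> x + gaussian \<tau> x / \<tau>\<^sup>2 * norm x"
    unfolding heat_kernel_def using norm_Pair_le[of "gaussian \<tau> x" "- (gaussian \<tau> x / \<tau>\<^sup>2) *\<^sub>R x"] gaussian_nonneg[OF t, of x]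
    by simp
  also have "\<dots> = gaussian \<tau> x * (1 + s / \<tau>)"
    using t by (simp add: s_def field_simps power2_eq_square)
  also have "\<dots> \<le> gaussian \<tau> x * ((1 + 1 / \<tau>) * (1 + s))"
    using t s gaussian_nonneg[OF t, of x] by (intro mult_left_mono) (auto simp: algebra_simps add_divide_distrib)
  also have "\<dots> \<le> exp (- (s\<^sup>2 / 2)) / \<tau> ^ DIM('a) * ((1 + 1 / \<tau>) * (1 + s))"
    using g t s by (intro mult_right_mono) auto
  also have "\<dots> = (1 + 1 / \<tau>) / \<tau> ^ DIM('a) * ((1 + s) * exp (- (s\<^sup>2 / 2)))"
    by simp
  also have "\<dots> \<le> (1 + 1 / \<tau>) / \<tau> ^ DIM('a) * (exp 1 * exp (- (s\<^sup>2 / 4)))"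
    using e t by (intro mult_left_mono) auto
  also have "\<dots> = exp 1 * ((1 + 1 / \<tau>) / \<tau> ^ DIM('a)) * exp (- ((norm x)\<^sup>2 / (4 * \<tau>\<^sup>2)))"
    using t by (simp add: s_def power_divide mult.commute)
  finally show ?thesis .
qed

section \<open>Size and continuity of the kernels in Lebesgue spaces\<close>

text \<open>The exponential is at most 1, so its \<open>Q\<close>-th power may be replaced by itself
  and one Gaussian integral serves all \<open>Q\<close>. That integral contributes
  \<open>\<tau> powr (DIM('a) / Q)\<close> against the prefactor
  \<open>\<tau> powr (- DIM('a))\<close>.\<close>

lemma Lp_exp_quadratic_bound:
  fixes k :: "'a::euclidean_space \<Rightarrow> 'b::euclidean_space"
  assumes k: "k \<in> borel_measurable borel" and t: "\<tau> > 0" and Q: "1 \<le> Q" and A: "0 \<le> A"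
    and le: "\<And>x. norm (k x) \<le> A / \<tau> ^ DIM('a) * exp (- ((norm x)\<^sup>2 / (4 * \<tau>\<^sup>2)))"
  shows "k \<in> Lp_space lebesgue (ennreal Q)"
    "Lp_norm lebesgue (ennreal Q) k \<le>
      A * \<tau> powr (- (DIM('a) * (1 - 1 / Q))) * ((2 * pi) powr (DIM('a) / 2) * sqrt 2 ^ DIM('a)) powr (1 / Q)"
proof -
  let ?e = "\<lambda>x :: 'a. exp (- ((norm x)\<^sup>2 / (4 * \<tau>\<^sup>2)))"
  let ?c = "(2 * pi) powr (DIM('a) / 2) * sqrt 2 ^ DIM('a)"
  note [measurable] = k
  have le': "norm (k x) powr Q \<le> (A / \<tau> ^ DIM('a)) powr Q * ?e x" for x
  proof -
    have "norm (k x) powr Q \<le> (A / \<tau> ^ DIM('a) * ?e x) powr Q"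
      using le Q by (intro powr_mono2) auto
    also have "\<dots> = (A / \<tau> ^ DIM('a)) powr Q * ?e x powr Q"
      by (rule powr_mult)
    also have "\<dots> \<le> (A / \<tau> ^ DIM('a)) powr Q * ?e x powr 1"
      using Q by (intro mult_left_mono powr_mono') auto
    finally show ?thesis by simp
  qed
  have rint: "integrable lborel (\<lambda>x. (A / \<tau> ^ DIM('a)) powr Q * ?e x)"
    using exp_quadratic_integral(1)[OF t, where 'a='a] by simp
  have int: "integrable lborel (\<lambda>x. norm (k x) powr Q)"
    by (rule Bochner_Integration.integrable_bound[OF rint]) (use le' in auto)
  then show "k \<in> Lp_space lebesgue (ennreal Q)"
    using Q by (simp add: Lp_lebesgue_borel)
  have "Lp_norm lebesgue (ennreal Q) k powr Q \<le> (\<integral>x. (A / \<tau> ^ DIM('a)) powr Q * ?e x \<partial>lborel)"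
    using Q integral_mono[OF int rint le'] by (simp add: Lp_lebesgue_borel(2)[OF k])
  also have "\<dots> = (A / \<tau> ^ DIM('a)) powr Q * (\<tau> ^ DIM('a) * ?c)"
    using exp_quadratic_integral(2)[OF t, where 'a='a] by (simp add: power_mult_distrib)
  also have "\<dots> = (A * \<tau> powr (- (DIM('a) * (1 - 1 / Q))) * ?c powr (1 / Q)) powr Q"
  proof -
    have "(A / \<tau> ^ DIM('a)) powr Q * \<tau> ^ DIM('a) = A powr Q * (\<tau> powr (- (DIM('a) * Q)) * \<tau> powr DIM('a))"
    proof -
      have "(\<tau> ^ DIM('a)) powr Q = \<tau> powr (DIM('a) * Q)" "\<tau> ^ DIM('a) = \<tau> powr DIM('a)"
        using t by (simp_all add: powr_realpow[symmetric] powr_powr)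
      then show ?thesis
        by (simp add: powr_divide powr_minus_divide)
    qed
    also have "\<tau> powr (- (DIM('a) * Q)) * \<tau> powr DIM('a) = \<tau> powr (- (DIM('a) * (1 - 1 / Q)) * Q)"
      using Q by (simp add: powr_add[symmetric] algebra_simps)
    finally have "(A / \<tau> ^ DIM('a)) powr Q * \<tau> ^ DIM('a) = A powr Q * \<tau> powr (- (DIM('a) * (1 - 1 / Q)) * Q)" .
    then show ?thesis
      using Q by (simp add: powr_mult powr_powr mult.assoc[symmetric])
  qed
  finally have *: "Lp_norm lebesgue (ennreal Q) k powr Q \<le> (A * \<tau> powr (- (DIM('a) * (1 - 1 / Q))) * ?c powr (1 / Q)) powr Q" .
  have "0 \<le> A * \<tau> powr (- (DIM('a) * (1 - 1 / Q))) * ?c powr (1 / Q)"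
    using A by simp
  with * show "Lp_norm lebesgue (ennreal Q) k \<le> A * \<tau> powr (- (DIM('a) * (1 - 1 / Q))) * ?c powr (1 / Q)"
    using powr_less_mono2[of Q "A * \<tau> powr (- (DIM('a) * (1 - 1 / Q))) * ?c powr (1 / Q)" "Lp_norm lebesgue (ennreal Q) k"] Q
    by linarith
qed

lemma gaussian_Lp:
  assumes Q: "1 \<le> Q"
  obtains C where "C > 0" "\<And>\<tau>. \<tau> > 0 \<Longrightarrow> (gaussian \<tau> :: 'a::euclidean_space \<Rightarrow> real) \<in> Lp_space lebesgue (ennreal Q)"
    "\<And>\<tau>. \<tau> > 0 \<Longrightarrow> Lp_norm lebesgue (ennreal Q) (gaussian \<tau> :: 'a \<Rightarrow> real) \<le> C * \<tau> powr (- (DIM('a) * (1 - 1 / Q)))"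
proof
  let ?c = "((2 * pi) powr (DIM('a) / 2) * sqrt 2 ^ DIM('a)) powr (1 / Q)"
  show "?c > 0" by simp
  show "(gaussian \<tau> :: 'a \<Rightarrow> real) \<in> Lp_space lebesgue (ennreal Q)"
    "Lp_norm lebesgue (ennreal Q) (gaussian \<tau> :: 'a \<Rightarrow> real) \<le> ?c * \<tau> powr (- (DIM('a) * (1 - 1 / Q)))"
    if "\<tau> > 0" for \<tau>
    using Lp_exp_quadratic_bound[OF gaussian_borel[OF that, where 'a='a] that Q, of 1] gaussian_le[OF that, where 'a='a] gaussian_nonneg[OF that, where 'a='a]
    by (simp_all add: mult.commute)
qed

text \<open>The bound \<open>T\<close> on the width allows the lower order term to be absorbed:
  \<open>1 + 1 / \<tau> \<le> (T + 1) / \<tau>\<close>.\<close>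

lemma heat_kernel_Lp:
  assumes Q: "1 \<le> Q" and T: "T > 0"
  obtains C where "C > 0" "\<And>\<tau>. \<tau> > 0 \<Longrightarrow> (heat_kernel \<tau> :: 'a::euclidean_space \<Rightarrow> real \<times> 'a) \<in> Lp_space lebesgue (ennreal Q)"
    "\<And>\<tau>. \<tau> > 0 \<Longrightarrow> \<tau> \<le> T \<Longrightarrow> Lp_norm lebesgue (ennreal Q) (heat_kernel \<tau> :: 'a \<Rightarrow> real \<times> 'a) \<le> C * \<tau> powr (- 1 - DIM('a) * (1 - 1 / Q))"
proof
  let ?c = "((2 * pi) powr (DIM('a) / 2) * sqrt 2 ^ DIM('a)) powr (1 / Q)"
  show "exp 1 * (T + 1) * ?c > 0" using T by simp
  have *: "(heat_kernel \<tau> :: 'a \<Rightarrow> real \<times> 'a) \<in> Lp_space lebesgue (ennreal Q)"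
    "Lp_norm lebesgue (ennreal Q) (heat_kernel \<tau> :: 'a \<Rightarrow> real \<times> 'a) \<le> exp 1 * (1 + 1 / \<tau>) * \<tau> powr (- (DIM('a) * (1 - 1 / Q))) * ?c"
    if "\<tau> > 0" for \<tau>
    using Lp_exp_quadratic_bound[OF heat_kernel_borel[OF that, where 'a='a] that Q, of "exp 1 * (1 + 1 / \<tau>)"] that norm_heat_kernel_le[OF that, where 'a='a]
    by simp_all
  show "(heat_kernel \<tau> :: 'a \<Rightarrow> real \<times> 'a) \<in> Lp_space lebesgue (ennreal Q)" if "\<tau> > 0" for \<tau>
    using *(1)[OF that] .
  show "Lp_norm lebesgue (ennreal Q) (heat_kernel \<tau> :: 'a \<Rightarrow> real \<times> 'a) \<le> exp 1 * (T + 1) * ?c * \<tau> powr (- 1 - DIM('a) * (1 - 1 / Q))"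
    if t: "\<tau> > 0" "\<tau> \<le> T" for \<tau>
  proof -
    have "1 + 1 / \<tau> \<le> (T + 1) * \<tau> powr (- 1)"
      using t by (simp add: powr_minus_divide field_simps)
    then have "exp 1 * (1 + 1 / \<tau>) * \<tau> powr (- (DIM('a) * (1 - 1 / Q))) * ?c \<le>
       exp 1 * ((T + 1) * \<tau> powr (- 1)) * \<tau> powr (- (DIM('a) * (1 - 1 / Q))) * ?c"
      by (intro mult_right_mono mult_left_mono) auto
    also have "\<dots> = exp 1 * (T + 1) * ?c * (\<tau> powr (- 1) * \<tau> powr (- (DIM('a) * (1 - 1 / Q))))"
      by simp
    also have "\<tau> powr (- 1) * \<tau> powr (- (DIM('a) * (1 - 1 / Q))) = \<tau> powr (- 1 - DIM('a) * (1 - 1 / Q))"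
      unfolding powr_add[symmetric] by simp
    finally show ?thesis using *(2)[OF t(1)] by linarith
  qed
qed

text \<open>Widths between \<open>t / 2\<close> and \<open>2 * t\<close> share the majorant given by
  the smallest prefactor width and the largest Gaussian; dominated convergence does the rest. The
  first \<open>n0\<close> terms, where the width may be outside this range, are skipped.\<close>

lemma heat_kernel_continuous_Lp:
  fixes \<tau> :: "nat \<Rightarrow> real"
  assumes Q: "1 \<le> Q" and t: "t > 0" and lim: "\<tau> \<longlonglongrightarrow> t" and pos: "\<And>n. \<tau> n > 0"
  shows "(\<lambda>n. Lp_norm lebesgue (ennreal Q) (heat_kernel (\<tau> n) - heat_kernel t :: 'a::euclidean_space \<Rightarrow> real \<times> 'a)) \<longlonglongrightarrow> 0"
proof -
  have "eventually (\<lambda>n. t / 2 < \<tau> n \<and> \<tau> n < 2 * t) sequentially"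
    using t order_tendstoD(1)[OF lim, of "t / 2"] order_tendstoD(2)[OF lim, of "2 * t"]
    by (intro eventually_conj) auto
  then obtain n0 where n0: "\<And>n. n \<ge> n0 \<Longrightarrow> t / 2 < \<tau> n" "\<And>n. n \<ge> n0 \<Longrightarrow> \<tau> n < 2 * t"
    by (auto simp: eventually_sequentially)
  define C where "C = exp 1 * ((1 + 2 / t) / (t / 2) ^ DIM('a))"
  let ?e = "\<lambda>x :: 'a. exp (- ((norm x)\<^sup>2 / (4 * (2 * t)\<^sup>2)))"
  have C: "C > 0" using t by (simp add: C_def add_pos_pos)
  have bd: "norm (heat_kernel s x) \<le> C * ?e x" if s: "t / 2 \<le> s" "s \<le> 2 * t" for s and x :: 'a
  proof -
    have s0: "s > 0" using s t by linarith
    have "norm (heat_kernel s x) \<le> exp 1 * ((1 + 1 / s) / s ^ DIM('a)) * exp (- ((norm x)\<^sup>2 / (4 * s\<^sup>2)))"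
      by (rule norm_heat_kernel_le[OF s0])
    also have "\<dots> \<le> C * ?e x"
    proof (intro mult_mono)
      have "1 / s \<le> 2 / t"
        using s t s0 by (simp add: field_simps)
      then show "exp 1 * ((1 + 1 / s) / s ^ DIM('a)) \<le> C"
        unfolding C_def using s t s0 by (intro mult_left_mono frac_le power_mono) auto
      have "s\<^sup>2 \<le> (2 * t)\<^sup>2"
        using s s0 by (intro power_mono) auto
      then have "(norm x)\<^sup>2 / (4 * (2 * t)\<^sup>2) \<le> (norm x)\<^sup>2 / (4 * s\<^sup>2)"
        using s0 t by (intro divide_left_mono mult_left_mono mult_pos_pos zero_less_power) auto
      then show "exp (- ((norm x)\<^sup>2 / (4 * s\<^sup>2))) \<le> ?e x"
        by (simp only: exp_le_cancel_iff neg_le_iff_le)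
    qed (use C s0 in auto)
    finally show ?thesis .
  qed
  have "(\<lambda>n. Lp_norm lebesgue (ennreal Q) (heat_kernel (\<tau> (n + n0)) - heat_kernel t :: 'a \<Rightarrow> real \<times> 'a)) \<longlonglongrightarrow> 0"
  proof (rule Lp_dominated_convergence[where w="\<lambda>x. 2 * C * ?e x"])
    show "(heat_kernel (\<tau> (n + n0)) :: 'a \<Rightarrow> real \<times> 'a) \<in> borel_measurable lebesgue" for n
      using heat_kernel_borel[OF pos, of "n + n0", where 'a='a] by (simp add: measurable_completion)
    show "(heat_kernel t :: 'a \<Rightarrow> real \<times> 'a) \<in> borel_measurable lebesgue"
      using heat_kernel_borel[OF t, where 'a='a] by (simp add: measurable_completion)
    have "(\<lambda>n. heat_kernel (\<tau> n) x) \<longlonglongrightarrow> heat_kernel t x" for x :: 'a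
      unfolding heat_kernel_def gaussian_def using t by (intro tendsto_intros lim) auto
    then show "AE x in lebesgue. (\<lambda>n. heat_kernel (\<tau> (n + n0)) x) \<longlonglongrightarrow> heat_kernel t (x :: 'a)"
      by (intro AE_I2 LIMSEQ_ignore_initial_segment)
    show "AE x in lebesgue. norm (heat_kernel (\<tau> (n + n0)) (x :: 'a) - heat_kernel t x) \<le> 2 * C * ?e x" for n
    proof (rule AE_I2)
      fix x :: 'a
      have "norm (heat_kernel (\<tau> (n + n0)) x - heat_kernel t x) \<le> C * ?e x + C * ?e x"
        using n0[of "n + n0"] t by (intro norm_triangle_le_diff add_mono bd) auto
      then show "norm (heat_kernel (\<tau> (n + n0)) x - heat_kernel t x) \<le> 2 * C * ?e x" by simp
    qed
    have "integrable lborel (\<lambda>x :: 'a. (2 * C * ?e x) powr Q)"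
    proof (rule Bochner_Integration.integrable_bound)
      show "integrable lborel (\<lambda>x :: 'a. (2 * C) powr Q * ?e x)"
        using exp_quadratic_integral(1)[of "2 * t", where 'a='a] t by simp
      have "(2 * C * ?e x) powr Q \<le> (2 * C) powr Q * ?e x" for x
      proof -
        have "(2 * C * ?e x) powr Q = (2 * C) powr Q * ?e x powr Q"
          by (rule powr_mult)
        also have "\<dots> \<le> (2 * C) powr Q * ?e x powr 1"
          using Q by (intro mult_left_mono powr_mono') auto
        finally show ?thesis by simp
      qed
      then show "AE x in lborel. norm ((2 * C * ?e x) powr Q) \<le> norm ((2 * C) powr Q * ?e x)" by simp
    qed measurable
    then show "integrable lebesgue (\<lambda>x :: 'a. (2 * C * ?e x) powr Q)"
      by (subst integrable_completion) auto
  qed (use Q in auto)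
  then show ?thesis by (rule LIMSEQ_offset)
qed

section \<open>Integration by parts\<close>

text \<open>The difference quotients in direction \<open>b\<close> have integral 0 by translation
  invariance. The mean value theorem bounds them by the supremum of the derivative on a fixed
  compact set, so the integral of their limit is 0 as well.\<close>

lemma integral_derivative_zero:
  fixes \<psi> :: "'a::euclidean_space \<Rightarrow> real"
  assumes D: "\<And>x. (\<psi> has_derivative D x) (at x)" and cont: "continuous_on UNIV (\<lambda>x. D x b)" and K: "supported_in \<psi> K"
  shows "(\<integral>x. D x b \<partial>lborel) = 0"
proof -
  have cK: "compact K" and \<psi>0: "\<And>x. x \<notin> K \<Longrightarrow> \<psi> x = 0"
    using K by (auto simp: supported_in_def)
  have [measurable]: "\<psi> \<in> borel_measurable borel"
    using supported_in_measurable[OF K] by simp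
  have [measurable]: "(\<lambda>x. D x b) \<in> borel_measurable borel"
    using cont by (rule borel_measurable_continuous_onI)
  \<comment> \<open>All points from which a step of length parameter at most 1 in direction
    \<open>b\<close> reaches \<open>K\<close>; every difference quotient used vanishes
    outside.\<close>
  define K' where "K' = (\<lambda>(k, s). k - s *\<^sub>R b) ` (K \<times> {0..1 :: real})"
  have K': "compact K'"
    unfolding K'_def case_prod_unfold using cK by (intro compact_continuous_image compact_Times continuous_intros) auto
  have inK': "x \<in> K'" if "x + s *\<^sub>R b \<in> K" "0 \<le> s" "s \<le> 1" for x s
    unfolding K'_def using that by (intro image_eqI[of _ _ "(x + s *\<^sub>R b, s)"]) auto
  have D0: "D x b = 0" if "x \<notin> K" for x
  proof -
    have "((\<lambda>x. 0) has_derivative (\<lambda>x. 0)) (at x)" by simp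
    then have "(\<psi> has_derivative (\<lambda>x. 0)) (at x)"
    proof (rule has_derivative_transform_within_open)
      show "open (- K)" "x \<in> - K"
        using that cK by (auto simp: compact_imp_closed)
      show "0 = \<psi> y" if "y \<in> - K" for y
        using \<psi>0[of y] that by (metis Compl_iff)
    qed
    then show ?thesis
      using has_derivative_unique[OF D[of x]] by metis
  qed
  have "supported_in (\<lambda>x. D x b) K"
    using cont cK D0 by (simp add: supported_in_def)
  then obtain B where B: "B \<ge> 0" "\<And>x. norm (D x b) \<le> B * indicator K x"
    by (rule supported_in_bounded) (rule that)
  have B': "\<bar>D x b\<bar> \<le> B" for x
    using B(2)[of x] B(1) by (cases "x \<in> K") auto
  have deriv: "((\<lambda>t. \<psi> (x + t *\<^sub>R b)) has_real_derivative D (x + t *\<^sub>R b) b) (at t)" for x t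
  proof -
    have "((\<lambda>t. x + t *\<^sub>R b) has_derivative (\<lambda>t. t *\<^sub>R b)) (at t)"
      by (auto intro!: derivative_eq_intros)
    from has_derivative_compose[OF this D]
    have "((\<lambda>t. \<psi> (x + t *\<^sub>R b)) has_derivative (\<lambda>s. D (x + t *\<^sub>R b) (s *\<^sub>R b))) (at t)" .
    moreover have "D (x + t *\<^sub>R b) (s *\<^sub>R b) = D (x + t *\<^sub>R b) b * s" for s
      using linear_cmul[OF has_derivative_linear[OF D], of "x + t *\<^sub>R b" s b] by simp
    ultimately show ?thesis
      by (simp add: has_field_derivative_def)
  qed
  define f where "f n x = (\<psi> (x + (1 / real (Suc n)) *\<^sub>R b) - \<psi> x) * real (Suc n)" for n x
  have [measurable]: "f n \<in> borel_measurable borel" for n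
    unfolding f_def by measurable
  have int\<psi>: "integrable lborel \<psi>"
  proof -
    have "integrable lborel (\<lambda>x. indicator K x *\<^sub>R \<psi> x)"
      using K by (intro borel_integrable_compact) (auto simp: supported_in_def intro: continuous_on_subset)
    also have "(\<lambda>x. indicator K x *\<^sub>R \<psi> x) = \<psi>"
      using \<psi>0 by (auto simp: indicator_def fun_eq_iff)
    finally show ?thesis .
  qed
  have f0: "(\<integral>x. f n x \<partial>lborel) = 0" for n
    using lborel_integral_translate[of \<psi> "- (1 / real (Suc n)) *\<^sub>R b"] int\<psi> unfolding f_def by simp
  have "(\<lambda>n. \<integral>x. f n x \<partial>lborel) \<longlonglongrightarrow> (\<integral>x. D x b \<partial>lborel)"
  proof (rule integral_dominated_convergence[where w="\<lambda>x. B * indicator K' x"])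
    show "integrable lborel (\<lambda>x. B * indicator K' x)"
      using borel_integrable_compact[OF K', of "\<lambda>x. B"] by (simp add: mult.commute)
    show "AE x in lborel. (\<lambda>n. f n x) \<longlonglongrightarrow> D x b"
    proof (rule AE_I2)
      fix x
      have "((\<lambda>h. (\<psi> (x + (0 + h) *\<^sub>R b) - \<psi> (x + 0 *\<^sub>R b)) / h) \<longlongrightarrow> D x b) (at 0)"
        using deriv[of x 0] by (simp add: DERIV_def)
      moreover have "filterlim (\<lambda>n. 1 / real (Suc n)) (at 0) sequentially"
      proof -
        have "(\<lambda>n. 1 / real (Suc n)) \<longlonglongrightarrow> 0"
          by (rule LIMSEQ_Suc[OF lim_1_over_n])
        then show ?thesis by (simp add: filterlim_at)
      qed
      ultimately have "(\<lambda>n. (\<psi> (x + (0 + 1 / real (Suc n)) *\<^sub>R b) - \<psi> (x + 0 *\<^sub>R b)) / (1 / real (Suc n))) \<longlonglongrightarrow> D x b"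
        by (rule filterlim_compose)
      then show "(\<lambda>n. f n x) \<longlonglongrightarrow> D x b"
        by (simp add: f_def)
    qed
    show "AE x in lborel. norm (f n x) \<le> B * indicator K' x" for n
    proof (rule AE_I2)
      fix x
      let ?h = "1 / real (Suc n)"
      show "norm (f n x) \<le> B * indicator K' x"
      proof (cases "x \<in> K'")
        case True
        obtain z where "\<psi> (x + ?h *\<^sub>R b) - \<psi> (x + 0 *\<^sub>R b) = (?h - 0) * D (x + z *\<^sub>R b) b"
          using MVT2[of 0 ?h "\<lambda>t. \<psi> (x + t *\<^sub>R b)" "\<lambda>t. D (x + t *\<^sub>R b) b"] deriv by auto
        then have "f n x = D (x + z *\<^sub>R b) b"
          by (simp add: f_def)
        then show ?thesis using True B' by simp
      next
        case False
        then have "x + ?h *\<^sub>R b \<notin> K" "x \<notin> K"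
          using inK'[of x ?h] inK'[of x 0] by auto
        then show ?thesis
          using B(1) \<psi>0 by (simp add: f_def)
      qed
    qed
  qed measurable
  then show ?thesis
    unfolding f0 using LIMSEQ_unique tendsto_const by blast
qed

text \<open>The product rule for \<open>h x * \<phi> x\<close>, whose derivative in direction
  \<open>b\<close> integrates to 0.\<close>

lemma weak_gradient_C1:
  fixes h :: "'a::euclidean_space \<Rightarrow> real" and g :: "'a \<Rightarrow> 'a"
  assumes D: "\<And>x. (h has_derivative (\<lambda>e. g x \<bullet> e)) (at x)" and g: "continuous_on UNIV g"
  shows "weak_gradient h g"
  unfolding weak_gradient_def
proof (intro conjI allI impI ballI)
  have h: "continuous_on UNIV h"
    using D by (auto intro!: continuous_at_imp_continuous_on has_derivative_continuous)
  have loc: "f absolutely_integrable_on K" if "continuous_on UNIV f" "compact K" for f :: "'a \<Rightarrow> 'c::euclidean_space" and K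
  proof -
    have "integrable lborel (\<lambda>x. indicator K x *\<^sub>R f x)"
      using that by (intro borel_integrable_compact) (auto intro: continuous_on_subset)
    then show ?thesis
      unfolding set_integrable_def by (subst integrable_completion) (auto dest: borel_measurable_integrable)
  qed
  show "h absolutely_integrable_on K" "g absolutely_integrable_on K" if "compact K" for K
    using loc h g that by blast+
  fix \<phi> :: "'a \<Rightarrow> real" and b :: 'a assume t: "test_function \<phi>" and b: "b \<in> Basis"
  obtain K where K: "supported_in \<phi> K" "\<And>b. supported_in (\<lambda>x. frechet_derivative \<phi> (at x) b) K"
    by (rule test_function_supported[OF t]) (rule that)
  then have cK: "compact K" by (simp add: supported_in_def)
  let ?D = "\<lambda>x. frechet_derivative \<phi> (at x) b"
  have "((\<lambda>x. h x * \<phi> x) has_derivative (\<lambda>e. h x * frechet_derivative \<phi> (at x) e + (g x \<bullet> e) * \<phi> x)) (at x)" for x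
    by (intro has_derivative_mult D test_function_derivative[OF t])
  moreover have "continuous_on UNIV (\<lambda>x. h x * ?D x + (g x \<bullet> b) * \<phi> x)"
    by (intro continuous_intros h g test_function_derivative[OF t] test_function_continuous[OF t])
  moreover have "supported_in (\<lambda>x. h x * \<phi> x) K"
    using K h by (auto simp: supported_in_def intro!: continuous_on_mult)
  ultimately have "(\<integral>x. h x * ?D x + (g x \<bullet> b) * \<phi> x \<partial>lborel) = 0"
    by (rule integral_derivative_zero)
  then have "(\<integral>x. h x * ?D x + (g x \<bullet> b) * \<phi> x \<partial>lebesgue) = 0"
    using K K(2)[of b] supported_in_measurable h g
    by (subst integral_completion) (auto intro!: borel_measurable_continuous_onI continuous_intros simp: supported_in_def)
  moreover have "integrable lebesgue (\<lambda>x. h x * ?D x)" "integrable lebesgue (\<lambda>x. (g x \<bullet> b) * \<phi> x)"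
    using K cK loc[OF h cK] loc[OF g cK] by (auto intro!: integrable_times_supported absolutely_integrable_component)
  ultimately show "(\<integral>x. h x * ?D x \<partial>lebesgue) = - (\<integral>x. (g x \<bullet> b) * \<phi> x \<partial>lebesgue)"
    by simp
qed

lemma heat_kernel_weak_gradient:
  assumes t: "\<tau> > 0"
  shows "weak_gradient (\<lambda>x. fst (heat_kernel \<tau> x)) (\<lambda>x :: 'a::euclidean_space. snd (heat_kernel \<tau> x))"
proof (rule weak_gradient_C1)
  fix x :: 'a
  define c k where "c = 1 / ((2 * pi) powr (DIM('a) / 2) * \<tau> ^ DIM('a))" and "k = 1 / (2 * \<tau>\<^sup>2)"
  have g: "gaussian \<tau> x = exp (- k * (x \<bullet> x)) * c" for x :: 'a
    by (simp add: gaussian_def power2_norm_eq_inner c_def k_def)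
  have "((\<lambda>x. exp (- k * (x \<bullet> x)) * c) has_derivative (\<lambda>e. exp (- k * (x \<bullet> x)) * (- k * (x \<bullet> e + e \<bullet> x)) * c)) (at x)"
    by (auto intro!: derivative_eq_intros simp: algebra_simps)
  also have "(\<lambda>e. exp (- k * (x \<bullet> x)) * (- k * (x \<bullet> e + e \<bullet> x)) * c) = (\<lambda>e. snd (heat_kernel \<tau> x) \<bullet> e)"
    unfolding heat_kernel_def g by (simp add: k_def inner_commute fun_eq_iff)
  finally show "((\<lambda>x. fst (heat_kernel \<tau> x)) has_derivative (\<lambda>e. snd (heat_kernel \<tau> x) \<bullet> e)) (at x)"
    by (simp add: heat_kernel_def g)
next
  show "continuous_on UNIV (\<lambda>x :: 'a. snd (heat_kernel \<tau> x))"
    using continuous_on_snd[OF continuous_heat_kernel[OF t]] by simp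
qed

section \<open>Gaussians as an approximate identity\<close>

text \<open>Two approximations: first \<open>f\<close> is clamped to \<open>[-m, m]\<close> and
  multiplied by a cut-off, with error dominated by \<open>norm (f x)\<close>; then the clamped
  function is replaced by continuous ones treated in the same way, with error at most
  \<open>2 * m\<close> on a ball.\<close>

lemma Cc_dense_Lp:
  fixes f :: "'a::euclidean_space \<Rightarrow> real"
  assumes f: "f \<in> Lp_space lebesgue (ennreal Q)" and Q: "1 \<le> Q" and e: "e > 0"
  obtains g K where "supported_in g K" "Lp_norm lebesgue (ennreal Q) (f - g) < e"
proof -
  interpret seminormed_space "Lp_space lebesgue (ennreal Q) :: ('a \<Rightarrow> real) set" "Lp_norm lebesgue (ennreal Q)"
    using Q by (intro seminormed_space_Lp_lebesgue) auto
  have fm [measurable]: "f \<in> borel_measurable lebesgue"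
    using Lp_space_measurable[OF f] .
  define cl where "cl m y = max (- real m) (min (real m) y)" for m :: nat and y :: real
  define cut where "cut m x = max 0 (min 1 (real m + 1 - norm x))" for m :: nat and x :: 'a
  have cut: "0 \<le> cut m x" "cut m x \<le> 1" "norm x > real m + 1 \<Longrightarrow> cut m x = 0" for m x
    by (auto simp: cut_def)
  have cl: "\<bar>cl m y\<bar> \<le> real m" "\<bar>cl m y * c - y\<bar> \<le> \<bar>y\<bar>" if "0 \<le> c" "c \<le> 1" for m y c
  proof -
    show "\<bar>cl m y\<bar> \<le> real m" by (auto simp: cl_def)
    have "\<bar>cl m y\<bar> \<le> \<bar>y\<bar>" "0 \<le> cl m y \<longleftrightarrow> 0 \<le> y \<or> m = 0"
      by (auto simp: cl_def max_def min_def)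
    then show "\<bar>cl m y * c - y\<bar> \<le> \<bar>y\<bar>"
      using that mult_left_le[of c "\<bar>cl m y\<bar>"] mult_nonneg_nonneg[of "cl m y" c] mult_nonpos_nonneg[of "cl m y" c]
      by (cases "0 \<le> y"; cases "0 \<le> cl m y") (auto simp: cl_def abs_mult)
  qed
  define h where "h m x = cl m (f x) * cut m x" for m x
  have [measurable]: "cut m \<in> borel_measurable lebesgue" for m
  proof -
    have "cut m \<in> borel_measurable borel"
      unfolding cut_def by measurable
    then show ?thesis by (simp add: measurable_completion)
  qed
  have hm [measurable]: "h m \<in> borel_measurable lebesgue" for m
    unfolding h_def cl_def by measurable
  have "(\<lambda>m. Lp_norm lebesgue (ennreal Q) (h m - f)) \<longlonglongrightarrow> 0"
  proof (rule Lp_dominated_convergence[where w="\<lambda>x. norm (f x)"])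
    have "(\<lambda>m. h m x) \<longlonglongrightarrow> f x" for x
    proof (rule tendsto_eventually)
      obtain n :: nat where n: "\<bar>f x\<bar> + norm x \<le> real n"
        using real_arch_simple by blast
      show "eventually (\<lambda>m. h m x = f x) sequentially"
        using eventually_ge_at_top[of n]
      proof eventually_elim
        case (elim m)
        then have "\<bar>f x\<bar> + norm x \<le> real m" using n by linarith
        then have "\<bar>f x\<bar> \<le> real m" "norm x \<le> real m"
          using norm_ge_zero[of x] abs_ge_zero[of "f x"] by linarith+
        then show ?case by (auto simp: h_def cl_def cut_def max_def min_def)
      qed
    qed
    then show "AE x in lebesgue. (\<lambda>m. h m x) \<longlonglongrightarrow> f x" by simp
    show "AE x in lebesgue. norm (h m x - f x) \<le> norm (f x)" for m
      unfolding h_def using cl(2) cut by auto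
    show "integrable lebesgue (\<lambda>x. norm (f x) powr Q)"
      using f Q by (simp add: Lp_space_ennreal)
  qed (use Q in auto)
  then have "eventually (\<lambda>m. Lp_norm lebesgue (ennreal Q) (h m - f) < e / 2) sequentially"
    using e by (intro order_tendstoD) auto
  then obtain m where m: "Lp_norm lebesgue (ennreal Q) (h m - f) < e / 2"
    by (auto simp: eventually_sequentially)
  have "f measurable_on UNIV"
    using fm by (simp add: lebesgue_measurable_imp_measurable_on)
  \<comment> \<open>Gauge measurability supplies continuous functions converging to \<open>f\<close>
    off a negligible set.\<close>
  then obtain N G where N: "negligible N" and G: "\<And>n. continuous_on UNIV (G n)"
    and lim: "\<And>x. x \<notin> N \<Longrightarrow> (\<lambda>n. G n x) \<longlonglongrightarrow> f x"
    by (auto simp: measurable_on_def)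
  define g where "g n x = cl m (G n x) * cut m x" for n :: nat and x
  have supp: "supported_in (g n) (cball 0 (real m + 1))" for n
  proof -
    have "continuous_on UNIV (g n)"
      unfolding g_def cl_def cut_def by (intro continuous_intros G)
    then show ?thesis
      using cut(3) by (simp add: supported_in_def g_def)
  qed
  have gm: "g n \<in> borel_measurable lebesgue" for n
    using supported_in_measurable(2)[OF supp] .
  have "(\<lambda>n. Lp_norm lebesgue (ennreal Q) (g n - h m)) \<longlonglongrightarrow> 0"
  proof (rule Lp_dominated_convergence[where w="\<lambda>x. 2 * real m * indicator (cball 0 (real m + 1)) x"])
    have "(\<lambda>n. g n x) \<longlonglongrightarrow> h m x" if "x \<notin> N" for x
      unfolding g_def h_def cl_def by (intro tendsto_intros lim that)
    moreover have "N \<in> null_sets lebesgue"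
      using N by (simp add: negligible_iff_null_sets)
    ultimately show "AE x in lebesgue. (\<lambda>n. g n x) \<longlonglongrightarrow> h m x"
      by (auto intro!: AE_I'[of N])
    have "norm (g n x - h m x) \<le> 2 * real m * indicator (cball 0 (real m + 1)) x" for n x
    proof (cases "norm x \<le> real m + 1")
      case True
      have "\<bar>g n x\<bar> \<le> real m * 1" "\<bar>h m x\<bar> \<le> real m * 1"
        unfolding g_def h_def abs_mult using cl(1)[of 0] cut[of m x] by (intro mult_mono; simp)+
      with True show ?thesis by (simp add: indicator_def)
    next
      case False
      then show ?thesis using cut(3)[of m x] by (simp add: g_def h_def)
    qed
    then show "AE x in lebesgue. norm (g n x - h m x) \<le> 2 * real m * indicator (cball 0 (real m + 1)) x" for n
      by simp
    have "(2 * real m * indicator (cball 0 (real m + 1)) x) powr Q = (2 * real m) powr Q * indicator (cball 0 (real m + 1)) x" for x :: 'a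
      by (simp add: indicator_def)
    moreover have "integrable lebesgue (\<lambda>x :: 'a. indicator (cball 0 (real m + 1)) x :: real)"
      using lmeasurable_cball[of "0 :: 'a" "real m + 1"] by (simp add: integrable_indicator_iff fmeasurable_def)
    ultimately show "integrable lebesgue (\<lambda>x :: 'a. (2 * real m * indicator (cball 0 (real m + 1)) x) powr Q)"
      by simp
  qed (use Q gm in auto)
  then have "eventually (\<lambda>n. Lp_norm lebesgue (ennreal Q) (g n - h m) < e / 2) sequentially"
    using e by (intro order_tendstoD) auto
  then obtain n where n: "Lp_norm lebesgue (ennreal Q) (g n - h m) < e / 2"
    by (auto simp: eventually_sequentially)
  have hL: "h m \<in> Lp_space lebesgue (ennreal Q)"
  proof (rule Lp_space_dominated_finite(1)[OF f hm, of _ 2])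
    have "\<bar>h m x\<bar> \<le> 2 * \<bar>f x\<bar>" for x
      using cl(2)[of "cut m x" m "f x"] cut[of m x] unfolding h_def by linarith
    then show "AE x in lebesgue. norm (h m x) \<le> 2 * norm (f x)" by simp
  qed (use Q in auto)
  have gL: "g n \<in> Lp_space lebesgue (ennreal Q)"
  proof -
    obtain B where B: "B \<ge> 0" "\<And>x. norm (g n x) \<le> B * indicator (cball 0 (real m + 1)) x"
      by (rule supported_in_bounded[OF supp[of n]]) (rule that)
    have i: "integrable lebesgue (\<lambda>x :: 'a. B powr Q * indicator (cball 0 (real m + 1)) x)"
      using lmeasurable_cball[of "0 :: 'a" "real m + 1"] by (simp add: integrable_indicator_iff fmeasurable_def)
    have "integrable lebesgue (\<lambda>x. norm (g n x) powr Q)"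
    proof (rule Bochner_Integration.integrable_bound[OF i])
      have "norm (g n x) powr Q \<le> B powr Q * indicator (cball 0 (real m + 1)) x" for x
        using powr_mono2[of Q "norm (g n x)" B] B(2)[of x] Q by (auto simp: indicator_def split: if_splits)
      then show "AE x in lebesgue. norm (norm (g n x) powr Q) \<le> norm (B powr Q * indicator (cball 0 (real m + 1)) x)"
        by simp
    qed (use gm[of n] in measurable)
    then show ?thesis
      using gm Q by (simp add: Lp_space_ennreal)
  qed
  have "Lp_norm lebesgue (ennreal Q) (f - g n) < e"
    using N_diff_triangle[OF f hL gL] N_diff_commute[OF f hL] N_diff_commute[OF gL hL] m n by linarith
  with supp show thesis using that by blast
qed

text \<open>Rescaling the integration variable gives pointwise convergence. Since convolution does
  not increase the \<open>L^1\<close> norm, Scheffe's lemma gives convergence in \<open>L^1\<close>,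
  and the uniform bound \<open>2 * B\<close> on the difference upgrades it to
  \<open>L^Q\<close>.\<close>

lemma conv_gaussian_Cc:
  fixes g :: "'a::euclidean_space \<Rightarrow> real" and \<tau> :: "nat \<Rightarrow> real"
  assumes Q: "1 \<le> Q" and K: "supported_in g K" and pos: "\<And>n. \<tau> n > 0" and lim: "\<tau> \<longlonglongrightarrow> 0"
  shows "(\<lambda>n. Lp_norm lebesgue (ennreal Q) (conv (gaussian (\<tau> n)) g - g)) \<longlonglongrightarrow> 0"
proof -
  have g [measurable]: "g \<in> borel_measurable borel"
    using supported_in_measurable(1)[OF K] .
  obtain B0 where B0: "B0 \<ge> 0" "\<And>x. norm (g x) \<le> B0 * indicator K x"
    by (rule supported_in_bounded[OF K]) (rule that)
  define B where "B = B0 + 1"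
  have B: "B > 0" "\<bar>g x\<bar> \<le> B" for x
    using B0(1) B0(2)[of x] by (cases "x \<in> K"; simp add: B_def)+
  have gi: "integrable lborel g"
  proof -
    have "integrable lborel (\<lambda>x. indicator K x *\<^sub>R g x)"
      using K by (intro borel_integrable_compact) (auto simp: supported_in_def intro: continuous_on_subset)
    also have "(\<lambda>x. indicator K x *\<^sub>R g x) = g"
      using K by (auto simp: indicator_def fun_eq_iff supported_in_def)
    finally show ?thesis .
  qed
  have gL: "g \<in> Lp_space lebesgue 1"
    using Lp_lebesgue_borel(1)[OF g, of 1] gi by simp
  define F where "F n = conv (gaussian (\<tau> n)) g" for n
  note gb [measurable] = gaussian_borel[OF pos, where 'a='a]
  have F: "F n x = (\<integral>y. g y * gaussian (\<tau> n) (x - y) \<partial>lborel)" for n x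
    unfolding F_def conv_def by (subst integral_completion) (use gb[of n] in auto)
  have F': "F n x = (\<integral>w. gaussian 1 w * g (x - \<tau> n *\<^sub>R w) \<partial>lborel)" for n x
  proof -
    have "F n x = (\<integral>z. g (x - z) * gaussian (\<tau> n) z \<partial>lborel)"
      unfolding F using gb[of n] by (subst lborel_integral_reflect(1)[of _ x, symmetric]) auto
    also have "\<dots> = (\<integral>z. (\<lambda>w. gaussian 1 w * g (x - \<tau> n *\<^sub>R w) / \<tau> n ^ DIM('a)) (z /\<^sub>R \<tau> n) \<partial>lborel)"
      using pos[of n] by (simp add: gaussian_scale[OF pos[of n], where 'a='a] mult.commute)
    also have "\<dots> = \<tau> n ^ DIM('a) * (\<integral>w. gaussian 1 w * g (x - \<tau> n *\<^sub>R w) / \<tau> n ^ DIM('a) \<partial>lborel)"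
      using pos gaussian_borel[of 1, where 'a='a] by (intro lborel_integral_scale) auto
    finally show ?thesis
      using pos[of n] by simp
  qed
  have [measurable]: "F n \<in> borel_measurable borel" for n
    unfolding F[abs_def] by measurable
  have Fg: "(\<lambda>n. F n x) \<longlonglongrightarrow> g x" for x
  proof -
    have "(\<lambda>n. \<integral>w. gaussian 1 w * g (x - \<tau> n *\<^sub>R w) \<partial>lborel) \<longlonglongrightarrow> (\<integral>w. gaussian 1 w * g x \<partial>(lborel :: 'a measure))"
    proof (rule integral_dominated_convergence[where w="\<lambda>w. gaussian 1 w * B"])
      show "integrable lborel (\<lambda>w :: 'a. gaussian 1 w * B)"
        using gaussian_1_integral(1)[where 'a='a] by simp
      have "(\<lambda>n. gaussian 1 w * g (x - \<tau> n *\<^sub>R w)) \<longlonglongrightarrow> gaussian 1 w * g (x - 0 *\<^sub>R w)" for w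
      proof (intro tendsto_intros)
        have "isCont g (x - 0 *\<^sub>R w)"
          using K by (auto simp: supported_in_def continuous_on_eq_continuous_at)
        then show "(\<lambda>n. g (x - \<tau> n *\<^sub>R w)) \<longlonglongrightarrow> g (x - 0 *\<^sub>R w)"
          by (rule isCont_tendsto_compose) (intro tendsto_intros lim)
      qed
      then show "AE w in lborel. (\<lambda>n. gaussian 1 w * g (x - \<tau> n *\<^sub>R w)) \<longlonglongrightarrow> gaussian 1 w * g x" by simp
      show "AE w in lborel. norm (gaussian 1 w * g (x - \<tau> n *\<^sub>R w)) \<le> gaussian 1 w * B" for n
        using B gaussian_nonneg[of 1, where 'a='a] by (auto simp: abs_mult intro!: mult_left_mono)
    qed (use gaussian_borel[of 1, where 'a='a] in auto)
    then show ?thesis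
      using gaussian_1_integral(2)[where 'a='a] by (simp add: F')
  qed
  have FB: "\<bar>F n x\<bar> \<le> B" for n x
  proof -
    have i: "integrable lborel (\<lambda>w :: 'a. gaussian 1 w * B)"
      using gaussian_1_integral(1)[where 'a='a] by simp
    have "norm (F n x) \<le> (\<integral>w. gaussian 1 w * B \<partial>(lborel :: 'a measure))"
      unfolding F'
    proof (rule Bochner_Integration.integral_norm_bound_integral[OF _ i])
      show "integrable lborel (\<lambda>w. gaussian 1 w * g (x - \<tau> n *\<^sub>R w))"
        by (rule Bochner_Integration.integrable_bound[OF i])
          (use B gaussian_borel[of 1, where 'a='a] gaussian_nonneg[of 1, where 'a='a] in \<open>auto simp: abs_mult intro!: mult_left_mono\<close>)
      show "norm (gaussian 1 w * g (x - \<tau> n *\<^sub>R w)) \<le> gaussian 1 w * B" for w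
        using B gaussian_nonneg[of 1 w] by (auto simp: abs_mult intro!: mult_left_mono)
    qed
    then show ?thesis
      using gaussian_1_integral(2)[where 'a='a] by simp
  qed
  have gaussL1: "(gaussian (\<tau> n) :: 'a \<Rightarrow> real) \<in> Lp_space lebesgue 1" "Lp_norm lebesgue 1 (gaussian (\<tau> n) :: 'a \<Rightarrow> real) = 1" for n
    using Lp_lebesgue_borel[OF gb[of n], of 1] gaussian_integral[OF pos[of n], where 'a='a] gaussian_nonneg[OF pos[of n], where 'a='a] Lp_norm_ennreal_nonneg[of 1 lebesgue "gaussian (\<tau> n) :: 'a \<Rightarrow> real"]
    by auto
  have FY: "F n \<in> Lp_space lebesgue 1" "Lp_norm lebesgue 1 (F n) \<le> Lp_norm lebesgue 1 g" for n
    using conv_Young(2,3)[of 1 "gaussian (\<tau> n)" g "Lp_norm lebesgue 1 g", OF _ gb] gaussL1[of n] gL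
    by (auto simp: F_def)
  have Fi: "integrable lborel (F n)" for n
    using FY(1)[of n] unfolding Lp_space_1 by (simp add: integrable_completion)
  have "(\<lambda>n. \<integral>\<^sup>+x. norm (F n x - g x) \<partial>lborel) \<longlonglongrightarrow> 0"
  proof (rule Scheffe_lemma1[OF Fi gi])
    have 1: "(\<integral>\<^sup>+x. norm (F n x) \<partial>lborel) = ennreal (Lp_norm lebesgue 1 (F n))" for n
      using Fi[of n] by (simp add: Lp_norm_1 nn_integral_eq_integral integral_completion)
    have 2: "(\<integral>\<^sup>+x. norm (g x) \<partial>lborel) = ennreal (Lp_norm lebesgue 1 g)"
      using gi by (simp add: Lp_norm_1 nn_integral_eq_integral integral_completion)
    show "limsup (\<lambda>n. \<integral>\<^sup>+x. norm (F n x) \<partial>lborel) \<le> (\<integral>\<^sup>+x. norm (g x) \<partial>lborel)"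
      unfolding 1 2 by (intro Limsup_bounded always_eventually allI ennreal_leI FY)
  qed (use Fg in auto)
  then have "(\<lambda>n. ennreal (\<integral>x. \<bar>F n x - g x\<bar> \<partial>lborel)) \<longlonglongrightarrow> ennreal 0"
    using Fi gi by (simp add: nn_integral_eq_integral)
  then have L1: "(\<lambda>n. \<integral>x. \<bar>F n x - g x\<bar> \<partial>lborel) \<longlonglongrightarrow> 0"
    by (rule tendsto_ennrealD) (auto simp: integral_nonneg)
  have int1: "integrable lborel (\<lambda>x. \<bar>F n x - g x\<bar>)" for n
    using Fi gi by simp
  have le: "\<bar>F n x - g x\<bar> powr Q \<le> (2 * B) powr (Q - 1) * \<bar>F n x - g x\<bar>" for n x
  proof (cases "F n x = g x")
    case False
    have "\<bar>F n x - g x\<bar> powr Q = \<bar>F n x - g x\<bar> powr (Q - 1) * \<bar>F n x - g x\<bar>"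
      using False by (simp add: powr_diff)
    also have "\<dots> \<le> (2 * B) powr (Q - 1) * \<bar>F n x - g x\<bar>"
      using FB[of n x] B(2)[of x] Q by (intro mult_right_mono powr_mono2) auto
    finally show ?thesis .
  qed simp
  have rint: "integrable lborel (\<lambda>x. (2 * B) powr (Q - 1) * \<bar>F n x - g x\<bar>)" for n
    using int1 by simp
  have intQ: "integrable lborel (\<lambda>x. \<bar>F n x - g x\<bar> powr Q)" for n
    by (rule Bochner_Integration.integrable_bound[OF rint]) (use le B in auto)
  have "(\<lambda>n. \<integral>x. \<bar>F n x - g x\<bar> powr Q \<partial>lborel) \<longlonglongrightarrow> 0"
  proof (rule LIMSEQ_0_le)
    show "(\<lambda>n. (2 * B) powr (Q - 1) * (\<integral>x. \<bar>F n x - g x\<bar> \<partial>lborel)) \<longlonglongrightarrow> 0"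
      using tendsto_mult[OF tendsto_const L1] by simp
    show "(\<integral>x. \<bar>F n x - g x\<bar> powr Q \<partial>lborel) \<le> (2 * B) powr (Q - 1) * (\<integral>x. \<bar>F n x - g x\<bar> \<partial>lborel)" for n
      using integral_mono[OF intQ rint le, of n] by simp
  qed (auto simp: integral_nonneg)
  then have "(\<lambda>n. (\<integral>x. \<bar>F n x - g x\<bar> powr Q \<partial>lborel) powr (1 / Q)) \<longlonglongrightarrow> 0 powr (1 / Q)"
    using Q by (intro tendsto_powr' tendsto_const) (auto simp: integral_nonneg)
  moreover have "(\<integral>x. \<bar>F n x - g x\<bar> powr Q \<partial>lborel) powr (1 / Q) = Lp_norm lebesgue (ennreal Q) (F n - g)" for n
    using Q by (simp add: Lp_norm_ennreal integral_completion)
  ultimately show ?thesis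
    by (simp add: F_def)
qed

lemma gaussian_L1:
  assumes "\<tau> > 0"
  shows "(gaussian \<tau> :: 'a::euclidean_space \<Rightarrow> real) \<in> Lp_space lebesgue 1" "Lp_norm lebesgue 1 (gaussian \<tau> :: 'a \<Rightarrow> real) = 1"
  using Lp_lebesgue_borel[OF gaussian_borel[OF assms, where 'a='a], of 1] gaussian_integral[OF assms, where 'a='a]
    gaussian_nonneg[OF assms, where 'a='a] Lp_norm_ennreal_nonneg[of 1 lebesgue "gaussian \<tau> :: 'a \<Rightarrow> real"]
  by auto

text \<open>Density and equicontinuity: convolution with a Gaussian is a contraction of
  \<open>L^Q\<close>, so three errors of size \<open>e / 3\<close> suffice.\<close>

lemma conv_gaussian_tendsto:
  fixes f :: "'a::euclidean_space \<Rightarrow> real" and \<tau> :: "nat \<Rightarrow> real"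
  assumes Q: "1 \<le> Q" and f: "f \<in> Lp_space lebesgue (ennreal Q)" and pos: "\<And>n. \<tau> n > 0" and lim: "\<tau> \<longlonglongrightarrow> 0"
  shows "(\<lambda>n. Lp_norm lebesgue (ennreal Q) (conv (gaussian (\<tau> n)) f - f)) \<longlonglongrightarrow> 0"
proof (rule LIMSEQ_I)
  interpret seminormed_space "Lp_space lebesgue (ennreal Q) :: ('a \<Rightarrow> real) set" "Lp_norm lebesgue (ennreal Q)"
    using Q by (intro seminormed_space_Lp_lebesgue) auto
  let ?N = "Lp_norm lebesgue (ennreal Q) :: ('a \<Rightarrow> real) \<Rightarrow> real"
  fix e :: real assume e: "e > 0"
  obtain g K where g: "supported_in g K" "?N (f - g) < e / 3"
    by (rule Cc_dense_Lp[OF f Q, of "e / 3"]) (use e in auto)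
  have gL: "g \<in> Lp_space lebesgue (ennreal Q)"
  proof -
    obtain B where B: "B \<ge> 0" "\<And>x. norm (g x) \<le> B * indicator K x"
      by (rule supported_in_bounded[OF g(1)]) (rule that)
    have K: "compact K" using g(1) by (simp add: supported_in_def)
    have i: "integrable lborel (\<lambda>x. indicator K x *\<^sub>R B powr Q)"
      using K by (intro borel_integrable_compact) auto
    have [measurable]: "g \<in> borel_measurable borel"
      using supported_in_measurable(1)[OF g(1)] .
    have "integrable lborel (\<lambda>x. norm (g x) powr Q)"
    proof (rule Bochner_Integration.integrable_bound[OF i])
      have "norm (g x) powr Q \<le> indicator K x *\<^sub>R B powr Q" for x
        using powr_mono2[of Q "norm (g x)" B] B(2)[of x] Q by (cases "x \<in> K") auto
      then show "AE x in lborel. norm (norm (g x) powr Q) \<le> norm (indicator K x *\<^sub>R B powr Q)"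
        by simp
    qed measurable
    then show ?thesis
      using Q by (subst Lp_lebesgue_borel) auto
  qed
  have Y: "conv_ok (gaussian (\<tau> n)) h" "conv (gaussian (\<tau> n)) h \<in> Lp_space lebesgue (ennreal Q)"
    "?N (conv (gaussian (\<tau> n)) h) \<le> ?N h" if "h \<in> Lp_space lebesgue (ennreal Q)" for h n
    using conv_Young[OF Q gaussian_borel[OF pos[of n], where 'a='a], of h "?N h"] gaussian_L1[OF pos[of n], where 'a='a] that by auto
  have "eventually (\<lambda>n. ?N (conv (gaussian (\<tau> n)) g - g) < e / 3) sequentially"
    using conv_gaussian_Cc[OF Q g(1) pos lim] e by (intro order_tendstoD) auto
  then obtain n0 where n0: "\<And>n. n \<ge> n0 \<Longrightarrow> ?N (conv (gaussian (\<tau> n)) g - g) < e / 3"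
    by (auto simp: eventually_sequentially)
  have "norm (?N (conv (gaussian (\<tau> n)) f - f) - 0) < e" if "n \<ge> n0" for n
  proof -
    let ?S = "conv (gaussian (\<tau> n))"
    have fg: "f - g \<in> Lp_space lebesgue (ennreal Q)"
      by (rule diff_mem[OF f gL])
    have ae: "AE x in lebesgue. ?S (f - g) x = (?S f - ?S g) x"
      using conv_diff_right[OF Y(1)[OF f] Y(1)[OF gL], of n] by (simp add: fun_diff_def)
    have "?N (?S f - ?S g) = ?N (?S (f - g))"
      by (rule Lp_space_AE_eq(2)[OF Y(2)[OF fg, of n] ae]) (use Q in simp)
    also have "\<dots> < e / 3"
      using Y(3)[OF fg, of n] g(2) by linarith
    finally have 1: "?N (?S f - ?S g) < e / 3" .
    have "?N (?S f - f) \<le> ?N (?S f - ?S g) + ?N (?S g - f)"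
      by (intro N_diff_triangle Y f gL)
    also have "?N (?S g - f) \<le> ?N (?S g - g) + ?N (g - f)"
      by (intro N_diff_triangle Y f gL)
    finally have "?N (?S f - f) < e"
      using 1 n0[OF that] g(2) N_diff_commute[OF f gL] by linarith
    moreover have "0 \<le> ?N (?S f - f)"
      by (intro N_nonneg diff_mem Y f)
    ultimately show ?thesis by simp
  qed
  then show "\<exists>n0. \<forall>n\<ge>n0. norm (?N (conv (gaussian (\<tau> n)) f - f) - 0) < e" by blast
qed

section \<open>Weakly singular integrals\<close>

text \<open>The value 0 from time \<open>t\<close> on lets integrals over \<open>[0,t]\<close> be
  written over the fixed interval \<open>[0,1]\<close>.\<close>

definition sing :: "real \<Rightarrow> real \<Rightarrow> real \<Rightarrow> real" where
  "sing a t s = (if s < t then (t - s) powr (- a) else 0)"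

lemma sing_nonneg [simp]: "0 \<le> sing a t s"
  by (simp add: sing_def)

lemma sing_borel [measurable]: "sing a t \<in> borel_measurable borel"
  unfolding sing_def by measurable

lemma borel_measurable_lebesgue_onI:
  "f \<in> borel_measurable borel \<Longrightarrow> f \<in> borel_measurable (lebesgue_on S)" for f :: "'a::euclidean_space \<Rightarrow> 'b::topological_space"
  by (rule measurable_restrict_space1, rule measurable_completion) (simp add: measurable_lborel1)

lemma nn_integral_powr_Icc:
  fixes b :: real
  assumes "b < 1"
  shows "(\<integral>\<^sup>+s. ennreal (s powr (- b)) \<partial>lebesgue_on {0..1}) = ennreal (1 / (1 - b))"
proof -
  have "((\<lambda>x. x powr (- b)) has_integral (1 powr (- b + 1) / (- b + 1))) {0..1}"
    using assms by (intro has_integral_powr_from_0) auto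
  then have "(\<integral>\<^sup>+s. indicator {0..1} s * ennreal (s powr (- b)) \<partial>lborel) = ennreal (1 / (1 - b))"
    using nn_integral_has_integral_lebesgue[of "{0..1}" "\<lambda>x. x powr (- b)" "1 / (1 - b)"]
    by (simp add: nn_integral_completion ennreal_mult'' ennreal_indicator)
  then show ?thesis
    by (subst nn_integral_restrict_space) (auto simp: nn_integral_completion mult.commute)
qed

lemma nn_integral_sing_le:
  fixes b t :: real
  assumes b: "b < 1" and t: "t \<le> 1"
  shows "(\<integral>\<^sup>+s. ennreal (sing b t s) \<partial>lebesgue_on {0..1}) \<le> ennreal (1 / (1 - b))"
proof -
  have "(\<integral>\<^sup>+s. ennreal (sing b t s) \<partial>lebesgue_on {0..1}) = (\<integral>\<^sup>+s. ennreal (sing b t s) * indicator {0..1} s \<partial>lborel)"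
    by (subst nn_integral_restrict_space) (auto simp: nn_integral_completion)
  also have "\<dots> \<le> (\<integral>\<^sup>+s. ennreal ((t - s) powr (- b)) * indicator {0..1} (t - s) \<partial>lborel)"
    using t by (intro nn_integral_mono) (auto simp: sing_def indicator_def)
  also have "\<dots> = (\<integral>\<^sup>+y. ennreal (y powr (- b)) * indicator {0..1} y \<partial>distr lborel borel (\<lambda>s. t - s))"
    by (subst nn_integral_distr) auto
  also have "\<dots> = (\<integral>\<^sup>+y. ennreal (y powr (- b)) * indicator {0..1} y \<partial>lborel)"
    by (simp add: lborel_distr_reflect)
  also have "\<dots> = (\<integral>\<^sup>+s. ennreal (s powr (- b)) \<partial>lebesgue_on {0..1})"
    by (subst nn_integral_restrict_space) (auto simp: nn_integral_completion)
  finally show ?thesis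
    using nn_integral_powr_Icc[OF b] by simp
qed

text \<open>From \<open>sqrt t \<le> sqrt (t - s) + sqrt s\<close> one term is the kernel itself;
  the other is a product of powers of \<open>t - s\<close> and \<open>s\<close> of total exponent
  \<open>- a\<close>, at most that power of the smaller of the two. The product of two singularities
  thus becomes a sum.\<close>

lemma sing_weight_le:
  fixes a s t :: real
  assumes a: "1 / 2 \<le> a" and s: "0 \<le> s" and t: "0 < t"
  shows "sqrt t * (sing a t s * s powr (- 1 / 2)) \<le> 2 * sing a t s + s powr (- a)"
proof (cases "0 < s \<and> s < t")
  case True
  define x where "x = t - s"
  have x: "x > 0" "s > 0" "t = x + s" using True by (auto simp: x_def)
  have "sqrt t \<le> sqrt x + sqrt s"
    using x sqrt_add_le_add_sqrt[of x s] by simp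
  then have "sqrt t * (x powr (- a) * s powr (- 1 / 2)) \<le> (x powr (1 / 2) + s powr (1 / 2)) * (x powr (- a) * s powr (- 1 / 2))"
    using x by (intro mult_right_mono) (auto simp: powr_half_sqrt)
  also have "\<dots> = x powr (1 / 2) * x powr (- a) * s powr (- 1 / 2) + x powr (- a) * (s powr (1 / 2) * s powr (- 1 / 2))"
    by (simp add: algebra_simps)
  also have "\<dots> = x powr (- (a - 1 / 2)) * s powr (- 1 / 2) + x powr (- a)"
    using x by (simp add: powr_add[symmetric])
  also have "x powr (- (a - 1 / 2)) * s powr (- 1 / 2) \<le> x powr (- a) + s powr (- a)"
  proof (cases "x \<le> s")
    case True
    then have "x powr (- (a - 1 / 2)) * s powr (- 1 / 2) \<le> x powr (- (a - 1 / 2)) * x powr (- 1 / 2)"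
      using x by (intro mult_left_mono powr_mono2') auto
    also have "\<dots> = x powr (- a)" by (simp add: powr_add[symmetric])
    finally show ?thesis by (simp add: add_increasing2)
  next
    case False
    then have "x powr (- (a - 1 / 2)) * s powr (- 1 / 2) \<le> s powr (- (a - 1 / 2)) * s powr (- 1 / 2)"
      using x a by (intro mult_right_mono powr_mono2') auto
    also have "\<dots> = s powr (- a)" by (simp add: powr_add[symmetric])
    finally show ?thesis by (simp add: add_increasing)
  qed
  finally show ?thesis
    using True by (simp add: sing_def x_def)
next
  \<comment> \<open>At \<open>s = 0\<close> the factor \<open>s powr (- 1 / 2)\<close> is 0 by
    convention, and for \<open>s \<ge> t\<close> the kernel is 0.\<close>
  case False
  then show ?thesis
    using s by (cases "s = 0") (auto simp: sing_def)
qed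

text \<open>Once the singularities are separated, Young's inequality bounds each product of a power
  \<open>- a\<close> with \<open>w s\<close> by a power \<open>- b\<close> plus
  \<open>w s powr P\<close>, and all terms are integrable.\<close>

lemma singular_integral_bound:
  fixes w :: "real \<Rightarrow> real"
  assumes P: "P > 1" and a: "1 / 2 \<le> a" "a < 1 - 1 / P"
    and w: "w \<in> borel_measurable (lebesgue_on {0..1})" "AE s in lebesgue_on {0..1}. 0 \<le> w s"
    and wP: "(\<integral>\<^sup>+s. ennreal (w s powr P) \<partial>lebesgue_on {0..1}) < \<infinity>"
  obtains D where "D \<ge> 0" "\<And>t. 0 < t \<Longrightarrow> t \<le> 1 \<Longrightarrow>
    (\<integral>\<^sup>+s. ennreal (sing a t s * s powr (- 1 / 2) * w s) \<partial>lebesgue_on {0..1}) \<le> ennreal (D / sqrt t)"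
proof
  let ?M = "lebesgue_on {0..1 :: real}"
  \<comment> \<open>\<open>P / (P - 1)\<close> is the exponent conjugate to \<open>P\<close>; the
    assumption \<open>a < 1 - 1 / P\<close> says exactly \<open>b < 1\<close>.\<close>
  define b where "b = a * (P / (P - 1))"
  have b: "b < 1"
    using P a by (simp add: b_def field_simps)
  define I where "I = enn2real (\<integral>\<^sup>+s. ennreal (w s powr P) \<partial>?M)"
  have I: "(\<integral>\<^sup>+s. ennreal (w s powr P) \<partial>?M) = ennreal I" "0 \<le> I"
    using wP by (auto simp: I_def)
  note [measurable] = w(1) borel_measurable_lebesgue_onI[OF sing_borel]
  have pm [measurable]: "(\<lambda>s. s powr c) \<in> borel_measurable ?M" for c
    by (rule borel_measurable_lebesgue_onI) measurable
  \<comment> \<open>Two integrals of \<open>sing b t\<close> and one of \<open>s powr (- b)\<close>,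
    each at most \<open>1 / (1 - b)\<close>, and three of \<open>w s powr P\<close>.\<close>
  define D where "D = 3 / (1 - b) + 3 * I"
  show "D \<ge> 0"
    using b I by (simp add: D_def)
  fix t :: real assume t: "0 < t" "t \<le> 1"
  have young: "\<kappa> powr (- a) * y \<le> \<kappa> powr (- b) + y powr P" if "0 \<le> \<kappa>" "0 \<le> y" for \<kappa> y
  proof -
    have "\<kappa> powr (- a) * y \<le> (\<kappa> powr (- a)) powr (P / (P - 1)) / (P / (P - 1)) + y powr P / P"
      using P that by (intro Youngs_inequality) (auto simp: field_simps)
    also have "\<dots> \<le> (\<kappa> powr (- a)) powr (P / (P - 1)) + y powr P"
    proof -
      have *: "z / c \<le> z" if "0 \<le> z" "1 \<le> c" for z c :: real
        using that mult_left_mono[of 1 c z] by (simp add: divide_le_eq)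
      moreover have "1 \<le> P / (P - 1)"
        using P by simp
      ultimately show ?thesis
        using *[of "(\<kappa> powr (- a)) powr (P / (P - 1))" "P / (P - 1)"] *[of "y powr P" P] P
        by (intro add_mono) simp_all
    qed
    finally show ?thesis
      by (simp add: powr_powr b_def)
  qed
  have ys: "sing a t s * y \<le> sing b t s + y powr P" if "0 \<le> y" for s y
    using young[of "t - s" y] that by (auto simp: sing_def)
  have le: "sqrt t * (sing a t s * s powr (- 1 / 2) * w s) \<le> 2 * sing b t s + s powr (- b) + 3 * w s powr P"
    if "0 \<le> s" "0 \<le> w s" for s
  proof -
    have "sqrt t * (sing a t s * s powr (- 1 / 2) * w s) \<le> (2 * sing a t s + s powr (- a)) * w s"
      using mult_right_mono[OF sing_weight_le[OF a(1) that(1) t(1)] that(2)] by (simp add: mult.assoc)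
    also have "\<dots> = 2 * (sing a t s * w s) + s powr (- a) * w s"
      by (simp add: algebra_simps)
    also have "\<dots> \<le> 2 * (sing b t s + w s powr P) + (s powr (- b) + w s powr P)"
      using ys[OF that(2), of s] young[OF that] by (intro add_mono mult_left_mono) auto
    finally show ?thesis by simp
  qed
  have "ennreal (sqrt t) * (\<integral>\<^sup>+s. ennreal (sing a t s * s powr (- 1 / 2) * w s) \<partial>?M)
      = (\<integral>\<^sup>+s. ennreal (sqrt t) * ennreal (sing a t s * s powr (- 1 / 2) * w s) \<partial>?M)"
    by (rule nn_integral_cmult[symmetric]) measurable
  also have "\<dots> \<le> (\<integral>\<^sup>+s. 2 * ennreal (sing b t s) + ennreal (s powr (- b)) + 3 * ennreal (w s powr P) \<partial>?M)"
  proof (rule nn_integral_mono_AE)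
    show "AE s in ?M. ennreal (sqrt t) * ennreal (sing a t s * s powr (- 1 / 2) * w s) \<le>
        2 * ennreal (sing b t s) + ennreal (s powr (- b)) + 3 * ennreal (w s powr P)"
      using w(2) AE_space
    proof eventually_elim
      case (elim s)
      then have "ennreal (sqrt t * (sing a t s * s powr (- 1 / 2) * w s)) \<le> ennreal (2 * sing b t s + s powr (- b) + 3 * w s powr P)"
        using le[of s] by (intro ennreal_leI) auto
      then show ?case
        using t by (simp add: ennreal_mult' ennreal_plus)
    qed
  qed
  also have "\<dots> = 2 * (\<integral>\<^sup>+s. ennreal (sing b t s) \<partial>?M) + (\<integral>\<^sup>+s. ennreal (s powr (- b)) \<partial>?M) + 3 * (\<integral>\<^sup>+s. ennreal (w s powr P) \<partial>?M)"
    by (simp add: nn_integral_add nn_integral_cmult)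
  also have "\<dots> \<le> 2 * ennreal (1 / (1 - b)) + ennreal (1 / (1 - b)) + 3 * ennreal I"
    using nn_integral_sing_le[OF b t(2)] nn_integral_powr_Icc[OF b] I(1)
    by (intro add_mono mult_left_mono) auto
  also have "\<dots> = ennreal D"
  proof -
    have "2 * ennreal (1 / (1 - b)) = ennreal (2 * (1 / (1 - b)))" "3 * ennreal I = ennreal (3 * I)"
      using ennreal_mult[of 2 "1 / (1 - b)"] ennreal_mult[of 3 I] b I by (simp_all only: ennreal_numeral) auto
    then show ?thesis
      using b I by (simp add: D_def ennreal_plus[symmetric] del: ennreal_plus)
  qed
  finally have "ennreal (sqrt t) * (\<integral>\<^sup>+s. ennreal (sing a t s * s powr (- 1 / 2) * w s) \<partial>?M) \<le> ennreal D" .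
  then have "ennreal (1 / sqrt t) * (ennreal (sqrt t) * (\<integral>\<^sup>+s. ennreal (sing a t s * s powr (- 1 / 2) * w s) \<partial>?M))
      \<le> ennreal (1 / sqrt t) * ennreal D"
    by (rule mult_left_mono) simp
  then show "(\<integral>\<^sup>+s. ennreal (sing a t s * s powr (- 1 / 2) * w s) \<partial>?M) \<le> ennreal (D / sqrt t)"
    using t \<open>D \<ge> 0\<close> by (simp add: mult.assoc[symmetric] ennreal_mult'[symmetric])
qed

section \<open>Curves in seminormed spaces\<close>

lemma complete_measure_lebesgue_on:
  assumes "S \<in> sets lebesgue"
  shows "complete_measure (lebesgue_on S)"
proof
  fix A B assume B: "B \<subseteq> A" and A: "A \<in> null_sets (lebesgue_on S)"
  have "A \<in> null_sets lebesgue" "A \<subseteq> S"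
    using A assms by (auto simp: null_sets_restrict_space)
  then have "B \<in> null_sets lebesgue" "B \<subseteq> S"
    using B completion.complete2 by blast+
  then show "B \<in> sets (lebesgue_on S)"
    using assms by (auto simp: sets_restrict_space_iff)
qed

lemma seminormed_integration_lebesgue_on:
  fixes X :: "'b::real_vector set"
  assumes "seminormed_space X N"
  shows "seminormed_integration X N (lebesgue_on {s..t::real})"
proof -
  interpret seminormed_space X N by fact
  interpret finite_measure "lebesgue_on {s..t}"
    by (rule finite_measure_lebesgue_on) simp
  interpret complete_measure "lebesgue_on {s..t}"
    by (rule complete_measure_lebesgue_on) simp
  show ?thesis ..
qed

text \<open>The sequence may hit \<open>t\<close>, which the punctured limit in
  \<open>continuous_on_in\<close> does not see, and may be outside \<open>T\<close> for finitely
  many terms.\<close>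

lemma (in seminormed_space) continuous_on_in_sequentially:
  assumes F: "continuous_on_in T X N F" and t: "t \<in> T"
    and lim: "s \<longlonglongrightarrow> t" and ev: "eventually (\<lambda>n. s n \<in> T) sequentially"
  shows "(\<lambda>n. N (F (s n) - F t)) \<longlonglongrightarrow> 0"
proof (rule LIMSEQ_I)
  fix e :: real assume e: "e > 0"
  have "((\<lambda>s. N (F s - F t)) \<longlongrightarrow> 0) (at t within T)"
    using F t by (simp add: continuous_on_in_def)
  then have "eventually (\<lambda>s. dist (N (F s - F t)) 0 < e) (at t within T)"
    using e by (rule tendstoD)
  then obtain d where d: "d > 0" "\<And>s. s \<in> T \<Longrightarrow> s \<noteq> t \<Longrightarrow> dist s t < d \<Longrightarrow> dist (N (F s - F t)) 0 < e"
    by (auto simp: eventually_at)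
  have "eventually (\<lambda>n. dist (s n) t < d) sequentially"
    using lim d(1) by (rule tendstoD)
  with ev have "eventually (\<lambda>n. norm (N (F (s n) - F t) - 0) < e) sequentially"
  proof eventually_elim
    case (elim n)
    then show ?case
      using d(2)[of "s n"] e by (cases "s n = t") (auto simp: dist_real_def)
  qed
  then show "\<exists>n0. \<forall>n\<ge>n0. norm (N (F (s n) - F t) - 0) < e"
    by (simp add: eventually_sequentially)
qed

lemma (in seminormed_space) continuous_on_inI:
  assumes "\<And>t. t \<in> T \<Longrightarrow> F t \<in> X"
    and "\<And>t s. t \<in> T \<Longrightarrow> s \<longlonglongrightarrow> t \<Longrightarrow> (\<And>n. s n \<in> T) \<Longrightarrow> (\<lambda>n. N (F (s n) - F t)) \<longlonglongrightarrow> 0"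
  shows "continuous_on_in T X N F"
  unfolding continuous_on_in_def tendsto_at_iff_sequentially
  using assms by (auto simp: o_def)

text \<open>Right-continuous step functions on the grid of mesh \<open>1 / (i + 1)\<close> approximate the curve.\<close>

lemma strongly_measurable_in_continuous_AE:
  fixes X :: "'b::real_vector set"
  assumes F: "\<And>t. t \<in> {0..1} \<Longrightarrow> F t \<in> X"
    and cont: "AE t in lebesgue_on {0..1}. \<forall>s. (\<forall>n. s n \<in> {0..1}) \<and> s \<longlonglongrightarrow> t \<longrightarrow> (\<lambda>n. N (F (s n) - F t)) \<longlonglongrightarrow> 0"
  shows "strongly_measurable_in (lebesgue_on {0..1 :: real}) X N F"
proof -
  define g where "g i t = real_of_int \<lfloor>t * real (Suc i)\<rfloor> / real (Suc i)" for i and t :: real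
  have g: "g i t \<in> {0..1}" if "t \<in> {0..1}" for i t
  proof -
    have "real_of_int \<lfloor>t * real (Suc i)\<rfloor> \<le> t * real (Suc i)" by simp
    also have "\<dots> \<le> 1 * real (Suc i)" using that by (intro mult_right_mono) auto
    finally have "g i t \<le> 1" by (simp add: g_def divide_le_eq)
    moreover have "0 \<le> g i t" using that by (simp add: g_def)
    ultimately show ?thesis by simp
  qed
  have lim: "(\<lambda>i. g i t) \<longlonglongrightarrow> t" for t
  proof -
    have "\<bar>g i t - t\<bar> \<le> 1 / real (Suc i)" for i
    proof -
      have "g i t - t = (real_of_int \<lfloor>t * real (Suc i)\<rfloor> - t * real (Suc i)) / real (Suc i)"
        by (simp add: g_def diff_divide_distrib)
      moreover have "\<bar>real_of_int \<lfloor>t * real (Suc i)\<rfloor> - t * real (Suc i)\<bar> \<le> 1" by linarith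
      ultimately show ?thesis
        by (simp add: abs_divide divide_right_mono)
    qed
    then have "(\<lambda>i. \<bar>g i t - t\<bar>) \<longlonglongrightarrow> 0"
      by (intro LIMSEQ_0_le[OF LIMSEQ_Suc[OF lim_1_over_n]]) auto
    then show ?thesis
      by (simp add: tendsto_rabs_zero_iff LIM_zero_iff)
  qed
  show ?thesis
  proof (rule strongly_measurable_inI[of _ "\<lambda>i t. F (g i t)"])
    fix i
    have "simple_function (lebesgue_on {0..1}) (\<lambda>t. \<lfloor>t * real (Suc i)\<rfloor>)"
      unfolding simple_function_def
    proof safe
      have "(\<lambda>t. \<lfloor>t * real (Suc i)\<rfloor>) ` space (lebesgue_on {0..1}) \<subseteq> {0..int (Suc i)}"
      proof safe
        fix t :: real assume t: "t \<in> space (lebesgue_on {0..1})"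
        then have "t * real (Suc i) \<le> 1 * real (Suc i)" by (intro mult_right_mono) auto
        then have "\<lfloor>t * real (Suc i)\<rfloor> \<le> \<lfloor>real (Suc i)\<rfloor>" by (intro floor_mono) simp
        then have "\<lfloor>t * real (Suc i)\<rfloor> \<le> int (Suc i)" by simp
        moreover have "0 \<le> t * real (Suc i)" using t by (intro mult_nonneg_nonneg) auto
        ultimately show "\<lfloor>t * real (Suc i)\<rfloor> \<in> {0..int (Suc i)}" by simp
      qed
      then show "finite ((\<lambda>t. \<lfloor>t * real (Suc i)\<rfloor>) ` space (lebesgue_on {0..1}))"
        by (rule finite_subset) simp
      have "(\<lambda>t :: real. \<lfloor>t * real (Suc i)\<rfloor>) \<in> measurable borel (count_space UNIV)"
        by measurable
      then have "(\<lambda>t :: real. \<lfloor>t * real (Suc i)\<rfloor>) \<in> measurable (lebesgue_on {0..1}) (count_space UNIV)"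
        by (intro measurable_restrict_space1 measurable_completion) (simp add: measurable_lborel1)
      then show "(\<lambda>t. \<lfloor>t * real (Suc i)\<rfloor>) -` {y} \<inter> space (lebesgue_on {0..1}) \<in> sets (lebesgue_on {0..1})" for y
        by (rule measurable_sets) simp
    qed
    then show "simple_function (lebesgue_on {0..1}) (\<lambda>t. F (g i t))"
      unfolding g_def by (rule simple_function_compose1)
  next
    show "AE t in lebesgue_on {0..1}. (\<lambda>i. N (F (g i t) - F t)) \<longlonglongrightarrow> 0"
      using cont AE_space by eventually_elim (use g lim in auto)
    show "AE t in lebesgue_on {0..1}. F t \<in> X"
      using F by (intro AE_I2) auto
  qed (use F g in auto)
qed

text \<open>For \<open>L = 0\<close> the estimate is that of a bilinear map; the extra
  \<open>L\<close> admits the Lipschitz reaction term, which depends on the second argument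
  alone.\<close>

lemma strongly_measurable_in_bilinear:
  fixes X :: "'b::real_vector set" and Y :: "'c::real_vector set" and Z :: "'d::real_vector set"
  assumes A: "strongly_measurable_in M X NX A" and B: "strongly_measurable_in M Y NY B"
    and X: "seminormed_space X NX" and Y: "seminormed_space Y NY" and Z: "seminormed_space Z NZ"
    and mem: "\<And>a b. a \<in> X \<Longrightarrow> b \<in> Y \<Longrightarrow> \<beta> a b \<in> Z"
    and est: "\<And>a b a' b'. a \<in> X \<Longrightarrow> b \<in> Y \<Longrightarrow> a' \<in> X \<Longrightarrow> b' \<in> Y \<Longrightarrow>
      NZ (\<beta> a b - \<beta> a' b') \<le> NX (a - a') * NY b + (L + NX a') * NY (b - b')"
  shows "strongly_measurable_in M Z NZ (\<lambda>t. \<beta> (A t) (B t))"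
  using A B
proof (rule strongly_measurable_in_compose2)
  interpret Y: seminormed_space Y NY by fact
  interpret Z: seminormed_space Z NZ by fact
  fix a b a' b'
  assume *: "\<And>i::nat. a i \<in> X" "a' \<in> X" "(\<lambda>i. NX (a i - a')) \<longlonglongrightarrow> 0"
    "\<And>i::nat. b i \<in> Y" "b' \<in> Y" "(\<lambda>i. NY (b i - b')) \<longlonglongrightarrow> 0"
  have "(\<lambda>i. NX (a i - a') * NY (b i) + (L + NX a') * NY (b i - b')) \<longlonglongrightarrow> 0 * NY b' + (L + NX a') * 0"
    by (intro tendsto_intros Y.N_LIMSEQ *)
  then have lim: "(\<lambda>i. NX (a i - a') * NY (b i) + (L + NX a') * NY (b i - b')) \<longlonglongrightarrow> 0"
    by simp
  show "(\<lambda>i. NZ (\<beta> (a i) (b i) - \<beta> a' b')) \<longlonglongrightarrow> 0"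
    by (rule LIMSEQ_0_le[OF lim]) (intro est Z.N_nonneg Z.diff_mem mem *)+
qed (rule mem)

lemma seminormed_space_prod:
  assumes "seminormed_space X NX" "seminormed_space Y NY"
  shows "seminormed_space (X \<times> Y) (\<lambda>z. NX (fst z) + NY (snd z))"
proof -
  interpret X: seminormed_space X NX by fact
  interpret Y: seminormed_space Y NY by fact
  show ?thesis
  proof
    show "subspace (X \<times> Y)"
      by (intro subspace_Times X.subspace Y.subspace)
    fix x y assume "x \<in> X \<times> Y" "y \<in> X \<times> Y"
    then show "NX (fst (x + y)) + NY (snd (x + y)) \<le> NX (fst x) + NY (snd x) + (NX (fst y) + NY (snd y))"
      using X.triangle[of "fst x" "fst y"] Y.triangle[of "snd x" "snd y"] by auto
  next
    fix x c assume "x \<in> X \<times> Y"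
    then show "NX (fst (c *\<^sub>R x)) + NY (snd (c *\<^sub>R x)) = \<bar>c\<bar> * (NX (fst x) + NY (snd x))"
      using X.scale[of "fst x" c] Y.scale[of "snd x" c] by (auto simp: distrib_left)
  qed
qed

lemma strongly_measurable_in_Pair:
  assumes "strongly_measurable_in M X NX A" "strongly_measurable_in M Y NY B"
  shows "strongly_measurable_in M (X \<times> Y) (\<lambda>z. NX (fst z) + NY (snd z)) (\<lambda>t. (A t, B t))"
  using assms by (rule strongly_measurable_in_compose2) (auto intro!: tendsto_add_zero)

lemma has_integral_in_simple:
  assumes "seminormed_integration X N M" and S: "simple_function M S" "S ` space M \<subseteq> X"
  shows "has_integral_in M X N S (Bochner_Integration.simple_bochner_integral M S)"
proof -
  interpret seminormed_integration X N M by fact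
  show ?thesis
    unfolding has_integral_in_def
    using S sm_simple[OF S] simple_bochner_integral_mem[OF S(2)]
    by (intro conjI exI[of _ "\<lambda>i. S"]) auto
qed

text \<open>The simple functions are cut off at \<open>t\<close>, which does not change their integrals over \<open>[0, t]\<close>.\<close>

lemma has_integral_in_restrict:
  fixes F :: "real \<Rightarrow> 'b::real_vector"
  assumes X: "seminormed_space X N" and F: "has_integral_in (lebesgue_on {0..1}) X N F g"
    and t: "0 \<le> t" "t \<le> 1" and F0: "\<And>s. t < s \<Longrightarrow> s \<le> 1 \<Longrightarrow> F s = 0"
  shows "has_integral_in (lebesgue_on {0..t}) X N F g"
proof -
  let ?M = "lebesgue_on {0..1 :: real}" and ?Mt = "lebesgue_on {0..t}"
  interpret seminormed_integration X N ?M
    using X by (rule seminormed_integration_lebesgue_on)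
  obtain S where S: "\<And>i::nat. simple_function ?M (S i)" "\<And>i. S i ` space ?M \<subseteq> X"
      "(\<lambda>i. \<integral>\<^sup>+t. ennreal (N (S i t - F t)) \<partial>?M) \<longlonglongrightarrow> 0"
      "(\<lambda>i. N (Bochner_Integration.simple_bochner_integral ?M (S i) - g)) \<longlonglongrightarrow> 0"
    using F unfolding has_integral_in_def by blast
  have gX: "g \<in> X" and smF: "sm F"
    using F by (auto simp: has_integral_in_def)
  have restr: "?Mt = restrict_space ?M {0..t}"
    using t by (subst restrict_restrict_space) (auto simp: Int_absorb1 Int_absorb2)
  have t_sets: "{0..t} \<inter> space ?M \<in> sets ?M" "{0..t} \<in> sets ?M"
    using t by (auto simp: sets_restrict_space_iff)
  have AEr: "AE s in ?Mt. Pr s" if "AE s in ?M. Pr s" for Pr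
    unfolding restr using that t_sets by (subst AE_restrict_space_iff) auto
  have simple_t: "simple_function ?Mt T" if "simple_function ?M T" for T :: "real \<Rightarrow> 'b"
  proof -
    have "T -` {y} \<inter> space ?Mt \<in> sets ?Mt" if "y \<in> T ` space ?Mt" for y
    proof -
      have "T -` {y} \<inter> space ?M \<in> sets ?M"
        using that t \<open>simple_function ?M T\<close> by (auto simp: simple_function_def)
      then have "(T -` {y} \<inter> space ?M) \<inter> {0..t} \<in> sets ?Mt"
        unfolding restr using t_sets by (auto simp: sets_restrict_space)
      also have "(T -` {y} \<inter> space ?M) \<inter> {0..t} = T -` {y} \<inter> space ?Mt"
        using t by auto
      finally show ?thesis .
    qed
    moreover have "finite (T ` space ?Mt)"
      using that t by (intro finite_subset[of "T ` space ?Mt" "T ` space ?M"]) (auto simp: simple_function_def)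
    ultimately show ?thesis by (simp add: simple_function_def)
  qed
  define T where "T i s = (if s \<in> {0..t} then S i s else 0)" for i s
  have T: "simple_function ?M (T i)" "T i ` space ?M \<subseteq> X" for i
  proof -
    show "simple_function ?M (T i)"
      unfolding T_def by (rule simple_function_If_set[OF S(1) _ t_sets(1)]) simp
    show "T i ` space ?M \<subseteq> X"
      unfolding T_def using S(2) by (auto simp: image_subset_iff)
  qed
  have TF: "(\<lambda>i. \<integral>\<^sup>+s. ennreal (N (T i s - F s)) \<partial>?M) \<longlonglongrightarrow> 0"
  proof (rule tendsto_sandwich[OF _ _ tendsto_const S(3)])
    have "ennreal (N (T i s - F s)) \<le> ennreal (N (S i s - F s))" if "s \<in> space ?M" for i s
      using that F0[of s] by (auto simp: T_def not_le)
    then show "\<forall>\<^sub>F i in sequentially. (\<integral>\<^sup>+s. ennreal (N (T i s - F s)) \<partial>?M) \<le> (\<integral>\<^sup>+s. ennreal (N (S i s - F s)) \<partial>?M)"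
      by (intro always_eventually allI nn_integral_mono)
  qed auto
  have eqI: "Bochner_Integration.simple_bochner_integral ?Mt (T i) = Bochner_Integration.simple_bochner_integral ?M (T i)" for i
  proof -
    have fin: "finite (T i ` space ?M)"
      using T(1)[of i] by (simp add: simple_function_def)
    have sub: "T i ` space ?Mt \<subseteq> T i ` space ?M"
      using t by auto
    have zero: "y = 0" if "y \<in> T i ` space ?M - T i ` space ?Mt" for y
      using that by (auto simp: T_def)
    \<comment> \<open>A nonzero value of \<open>T i\<close> is taken only inside
      \<open>[0,t]\<close>, and the value 0 contributes nothing to a simple integral.\<close>
    have meas: "measure ?Mt {s \<in> space ?Mt. T i s = y} = measure ?M {s \<in> space ?M. T i s = y}" if "y \<noteq> 0" for y
    proof -
      have eq: "{s \<in> space ?M. T i s = y} = {s \<in> space ?Mt. T i s = y}"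
        using that t by (auto simp: T_def split: if_splits)
      have "measure (restrict_space ?M {0..t}) {s \<in> space ?Mt. T i s = y} = measure ?M {s \<in> space ?Mt. T i s = y}"
        by (rule measure_restrict_space[OF t_sets(1)]) auto
      then show ?thesis
        by (simp only: restr[symmetric] eq)
    qed
    have "Bochner_Integration.simple_bochner_integral ?M (T i) = (\<Sum>y\<in>T i ` space ?Mt. measure ?M {s \<in> space ?M. T i s = y} *\<^sub>R y)"
      unfolding Bochner_Integration.simple_bochner_integral_def
      by (rule sum.mono_neutral_right[OF fin sub]) (use zero in auto)
    also have "\<dots> = Bochner_Integration.simple_bochner_integral ?Mt (T i)"
      unfolding Bochner_Integration.simple_bochner_integral_def
    proof (rule sum.cong)
      show "measure ?M {s \<in> space ?M. T i s = y} *\<^sub>R y = measure ?Mt {s \<in> space ?Mt. T i s = y} *\<^sub>R y" for y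
        using meas[of y] by (cases "y = 0") simp_all
    qed simp
    finally show ?thesis by simp
  qed
  have bd: "ennreal (N (Bochner_Integration.simple_bochner_integral ?M (T i) - g)) \<le> (\<integral>\<^sup>+s. ennreal (N (T i s - F s)) \<partial>?M)" for i
    by (rule has_integral_in_bound_diff[OF has_integral_in_simple[OF seminormed_integration_axioms T] F])
  have "(\<lambda>i. ennreal (N (Bochner_Integration.simple_bochner_integral ?M (T i) - g))) \<longlonglongrightarrow> ennreal 0"
    unfolding ennreal_0
    by (rule tendsto_sandwich[OF _ always_eventually[OF allI[OF bd]] tendsto_const TF]) simp
  then have lim: "(\<lambda>i. N (Bochner_Integration.simple_bochner_integral ?Mt (T i) - g)) \<longlonglongrightarrow> 0"
    unfolding eqI
  proof (rule tendsto_ennrealD)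
    show "\<forall>\<^sub>F i in sequentially. 0 \<le> N (Bochner_Integration.simple_bochner_integral ?M (T i) - g)"
      by (intro always_eventually allI N_nonneg diff_mem simple_bochner_integral_mem T gX)
  qed simp
  have TFt: "(\<lambda>i. \<integral>\<^sup>+s. ennreal (N (T i s - F s)) \<partial>?Mt) \<longlonglongrightarrow> 0"
  proof (rule tendsto_sandwich[OF _ _ tendsto_const TF])
    have "(\<integral>\<^sup>+s. ennreal (N (T i s - F s)) \<partial>?Mt) \<le> (\<integral>\<^sup>+s. ennreal (N (T i s - F s)) \<partial>?M)" for i
      unfolding restr using t_sets
      by (subst nn_integral_restrict_space) (auto intro!: nn_integral_mono simp: indicator_def)
    then show "\<forall>\<^sub>F i in sequentially. (\<integral>\<^sup>+s. ennreal (N (T i s - F s)) \<partial>?Mt) \<le> (\<integral>\<^sup>+s. ennreal (N (T i s - F s)) \<partial>?M)"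
      by (intro always_eventually allI)
  qed auto
  obtain S' where S': "\<And>i::nat. simple_function ?M (S' i)" "\<And>i s. s \<in> space ?M \<Longrightarrow> S' i s \<in> X"
    "AE s in ?M. (\<lambda>i. N (S' i s - F s)) \<longlonglongrightarrow> 0" "AE s in ?M. F s \<in> X"
    by (rule strongly_measurable_inE[OF smF]) (rule that)
  have "strongly_measurable_in ?Mt X N F"
    by (rule strongly_measurable_inI[OF simple_t[OF S'(1)] _ AEr[OF S'(3)] AEr[OF S'(4)]]) (use S'(2) t in auto)
  then show ?thesis
    unfolding has_integral_in_def
    using gX simple_t[OF T(1)] T(2) TFt lim t by (intro conjI exI[of _ T]) (auto simp: image_subset_iff)
qed

section \<open>The nonlinearity and the heat semigroup as operators\<close>

text \<open>The polynomial vanishes at 0 and 1, so \<open>reaction W\<close> is the polynomial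
  composed with the projection to \<open>[0,1]\<close>; the former has bounded derivative there and
  the latter is 1-Lipschitz.\<close>

lemma reaction_lipschitz:
  obtains L where "L \<ge> 0" "\<And>x y. \<bar>reaction W x - reaction W y\<bar> \<le> L * \<bar>x - y\<bar>"
proof -
  define p where "p x = W * x\<^sup>2 * (x - 1)\<^sup>2 * (x - 1/2)" for x :: real
  define p' where "p' x = W * (2 * x * (x - 1)\<^sup>2 * (x - 1/2) + x\<^sup>2 * (2 * (x - 1)) * (x - 1/2) + x\<^sup>2 * (x - 1)\<^sup>2)" for x :: real
  have d: "(p has_field_derivative p' x) (at x within {0..1})" for x
    unfolding p_def p'_def by (auto intro!: derivative_eq_intros simp: field_simps power2_eq_square)
  have "compact (p' ` {0..1})"
    unfolding p'_def by (intro compact_continuous_image continuous_intros) auto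
  then obtain L where L: "L > 0" "\<forall>y\<in>p' ` {0..1}. norm y \<le> L"
    using compact_imp_bounded[of "p' ` {0..1}"] by (auto simp: bounded_pos)
  define c where "c x = max 0 (min 1 x)" for x :: real
  have c: "c x \<in> {0..1}" "\<bar>c x - c y\<bar> \<le> \<bar>x - y\<bar>" for x y
    by (auto simp: c_def)
  have r: "reaction W x = p (c x)" for x
    by (auto simp: reaction_def p_def c_def indicator_def max_def min_def)
  have "\<bar>reaction W x - reaction W y\<bar> \<le> L * \<bar>x - y\<bar>" for x y
  proof -
    have "norm (p (c x) - p (c y)) \<le> L * norm (c x - c y)"
      using d L(2) c(1) by (intro field_differentiable_bound[of "{0..1}" p p']) auto
    also have "\<dots> \<le> L * \<bar>x - y\<bar>"
      using c(2) L(1) by simp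
    finally show ?thesis by (simp add: r)
  qed
  with L(1) show thesis by (intro that[of L]) auto
qed

lemma reaction_zero [simp]: "reaction W 0 = 0"
  by (simp add: reaction_def)

text \<open>
  A source is represented as a pair of an \<open>L\<^sup>1\<close> part, which holds \<open>u |\<nabla>f|\<close>, and an \<open>L\<^sup>Q\<close> part, which
  holds the other terms.
\<close>

definition conv2 :: "('a::euclidean_space \<Rightarrow> 'b::euclidean_space) \<Rightarrow> ('a \<Rightarrow> real) \<times> ('a \<Rightarrow> real) \<Rightarrow> 'a \<Rightarrow> 'b" where
  "conv2 k h = conv k (fst h) + conv k (snd h)"

definition source_space :: "real \<Rightarrow> (('a::euclidean_space \<Rightarrow> real) \<times> ('a \<Rightarrow> real)) set" where
  "source_space Q = Lp_space lebesgue 1 \<times> Lp_space lebesgue (ennreal Q)"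

definition source_norm :: "real \<Rightarrow> ('a::euclidean_space \<Rightarrow> real) \<times> ('a \<Rightarrow> real) \<Rightarrow> real" where
  "source_norm Q = (\<lambda>h. Lp_norm lebesgue 1 (fst h) + Lp_norm lebesgue (ennreal Q) (snd h))"

text \<open>Both norms are needed: the \<open>L^1\<close> part of a source meets the kernel in
  \<open>L^Q\<close>, the \<open>L^Q\<close> part meets it in \<open>L^1\<close>.\<close>

definition kernel_norm :: "real \<Rightarrow> ('a::euclidean_space \<Rightarrow> 'b::euclidean_space) \<Rightarrow> real" where
  "kernel_norm Q k = Lp_norm lebesgue 1 k + Lp_norm lebesgue (ennreal Q) k"

definition kernel_space :: "real \<Rightarrow> ('a::euclidean_space \<Rightarrow> 'b::euclidean_space) set" where
  "kernel_space Q = {k \<in> borel_measurable borel. k \<in> Lp_space lebesgue 1 \<and> k \<in> Lp_space lebesgue (ennreal Q)}"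

definition W1_kernels :: "real \<Rightarrow> ('a::euclidean_space \<Rightarrow> real \<times> 'a) set" where
  "W1_kernels Q = {k \<in> kernel_space Q. weak_gradient (\<lambda>x. fst (k x)) (\<lambda>x. snd (k x))}"

lemma seminormed_space_source: "1 \<le> Q \<Longrightarrow> seminormed_space (source_space Q) (source_norm Q)"
  unfolding source_space_def source_norm_def
  by (intro seminormed_space_prod seminormed_space_Lp_lebesgue) auto

lemma seminormed_space_kernel:
  assumes Q: "1 \<le> Q"
  shows "seminormed_space (kernel_space Q :: ('a::euclidean_space \<Rightarrow> 'b::euclidean_space) set) (kernel_norm Q)"
proof -
  interpret A: seminormed_space "Lp_space lebesgue 1 :: ('a \<Rightarrow> 'b) set" "Lp_norm lebesgue 1"
    by (rule seminormed_space_Lp_lebesgue) simp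
  interpret B: seminormed_space "Lp_space lebesgue (ennreal Q) :: ('a \<Rightarrow> 'b) set" "Lp_norm lebesgue (ennreal Q)"
    using Q by (intro seminormed_space_Lp_lebesgue) auto
  show ?thesis
  proof
    show "subspace (kernel_space Q :: ('a \<Rightarrow> 'b) set)"
      unfolding subspace_def
    proof (intro conjI ballI allI)
      show "(0 :: 'a \<Rightarrow> 'b) \<in> kernel_space Q"
        using A.zero_mem B.zero_mem by (simp add: kernel_space_def zero_fun_def)
    next
      fix x y :: "'a \<Rightarrow> 'b" assume xy: "x \<in> kernel_space Q" "y \<in> kernel_space Q"
      then have "x + y \<in> borel_measurable borel"
        unfolding kernel_space_def plus_fun_def by (intro borel_measurable_add) auto
      with xy show "x + y \<in> kernel_space Q"
        unfolding kernel_space_def mem_Collect_eq by (blast intro: A.add_mem B.add_mem)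
    next
      fix x :: "'a \<Rightarrow> 'b" and c assume x: "x \<in> kernel_space Q"
      then have "c *\<^sub>R x \<in> borel_measurable borel"
        unfolding kernel_space_def scaleR_fun_def by (intro borel_measurable_scaleR) auto
      with x show "c *\<^sub>R x \<in> kernel_space Q"
        unfolding kernel_space_def mem_Collect_eq by (blast intro: A.scale_mem B.scale_mem)
    qed
  next
    fix x y :: "'a \<Rightarrow> 'b" assume "x \<in> kernel_space Q" "y \<in> kernel_space Q"
    then have "Lp_norm lebesgue 1 (x + y) \<le> Lp_norm lebesgue 1 x + Lp_norm lebesgue 1 y"
      "Lp_norm lebesgue (ennreal Q) (x + y) \<le> Lp_norm lebesgue (ennreal Q) x + Lp_norm lebesgue (ennreal Q) y"
      unfolding kernel_space_def by (blast intro: A.triangle B.triangle)+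
    then show "kernel_norm Q (x + y) \<le> kernel_norm Q x + kernel_norm Q y"
      unfolding kernel_norm_def by linarith
  next
    fix x :: "'a \<Rightarrow> 'b" and c assume "x \<in> kernel_space Q"
    then have "Lp_norm lebesgue 1 (c *\<^sub>R x) = \<bar>c\<bar> * Lp_norm lebesgue 1 x"
      "Lp_norm lebesgue (ennreal Q) (c *\<^sub>R x) = \<bar>c\<bar> * Lp_norm lebesgue (ennreal Q) x"
      unfolding kernel_space_def by (blast intro: A.scale B.scale)+
    then show "kernel_norm Q (c *\<^sub>R x) = \<bar>c\<bar> * kernel_norm Q x"
      unfolding kernel_norm_def by (simp only: distrib_left)
  qed
qed

lemma seminormed_space_W1_kernels:
  assumes Q: "1 \<le> Q"
  shows "seminormed_space (W1_kernels Q :: ('a::euclidean_space \<Rightarrow> real \<times> 'a) set) (kernel_norm Q)"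
proof -
  interpret seminormed_space "kernel_space Q :: ('a \<Rightarrow> real \<times> 'a) set" "kernel_norm Q"
    using Q by (rule seminormed_space_kernel)
  have "subspace (W1_kernels Q :: ('a \<Rightarrow> real \<times> 'a) set)"
    using weak_gradient_zero weak_gradient_add weak_gradient_scaleR
    unfolding subspace_def by (auto simp: W1_kernels_def add_mem scale_mem)
  then show ?thesis
    by unfold_locales (auto simp: W1_kernels_def triangle scale)
qed

text \<open>Young's inequality for each part; the product of the two sums of norms dominates the two
  cross terms.\<close>

lemma conv2_bound:
  fixes k :: "'a::euclidean_space \<Rightarrow> 'b::euclidean_space"
  assumes Q: "1 \<le> Q" and k: "k \<in> kernel_space Q" and h: "h \<in> source_space Q"
  shows "conv_ok k (fst h)" "conv_ok k (snd h)" "conv2 k h \<in> Lp_space lebesgue (ennreal Q)"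
    "Lp_norm lebesgue (ennreal Q) (conv2 k h) \<le> kernel_norm Q k * source_norm Q h"
proof -
  interpret B: seminormed_space "Lp_space lebesgue (ennreal Q) :: ('a \<Rightarrow> 'b) set" "Lp_norm lebesgue (ennreal Q)"
    using Q by (intro seminormed_space_Lp_lebesgue) auto
  have kb: "k \<in> borel_measurable borel" "k \<in> Lp_space lebesgue 1" "k \<in> Lp_space lebesgue (ennreal Q)"
    and hb: "fst h \<in> Lp_space lebesgue 1" "snd h \<in> Lp_space lebesgue (ennreal Q)"
    using k h by (auto simp: kernel_space_def source_space_def)
  note Y1 = conv_Young[OF Q kb(1), of "fst h" "Lp_norm lebesgue (ennreal Q) k * Lp_norm lebesgue 1 (fst h)"]
  note Y2 = conv_Young[OF Q kb(1), of "snd h" "Lp_norm lebesgue 1 k * Lp_norm lebesgue (ennreal Q) (snd h)"]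
  show "conv_ok k (fst h)" "conv_ok k (snd h)"
    using Y1(1) Y2(1) kb hb by auto
  show "conv2 k h \<in> Lp_space lebesgue (ennreal Q)"
    unfolding conv2_def using Y1(2) Y2(2) kb hb by (intro B.add_mem) auto
  have nn: "0 \<le> Lp_norm lebesgue 1 k" "0 \<le> Lp_norm lebesgue 1 (fst h)" "0 \<le> Lp_norm lebesgue (ennreal Q) k" "0 \<le> Lp_norm lebesgue (ennreal Q) (snd h)"
    using Q Lp_norm_ennreal_nonneg[of 1 lebesgue k] Lp_norm_ennreal_nonneg[of 1 lebesgue "fst h"] by auto
  have "Lp_norm lebesgue (ennreal Q) (conv2 k h) \<le> Lp_norm lebesgue (ennreal Q) (conv k (fst h)) + Lp_norm lebesgue (ennreal Q) (conv k (snd h))"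
    unfolding conv2_def using Y1(2) Y2(2) kb hb by (intro B.triangle) auto
  also have "\<dots> \<le> Lp_norm lebesgue (ennreal Q) k * Lp_norm lebesgue 1 (fst h) + Lp_norm lebesgue 1 k * Lp_norm lebesgue (ennreal Q) (snd h)"
    using Y1(3) Y2(3) kb hb by (intro add_mono) auto
  also have "\<dots> \<le> kernel_norm Q k * source_norm Q h"
  proof -
    have "0 \<le> Lp_norm lebesgue 1 k * Lp_norm lebesgue 1 (fst h)" "0 \<le> Lp_norm lebesgue (ennreal Q) k * Lp_norm lebesgue (ennreal Q) (snd h)"
      using nn by auto
    then show ?thesis
      by (simp add: kernel_norm_def source_norm_def distrib_left distrib_right)
  qed
  finally show "Lp_norm lebesgue (ennreal Q) (conv2 k h) \<le> kernel_norm Q k * source_norm Q h" .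
qed

lemma conv2_W1:
  assumes Q: "1 \<le> Q" and k: "k \<in> W1_kernels Q" and h: "h \<in> source_space Q"
  shows "conv2 k h \<in> W1_pairs (ennreal Q)"
proof -
  interpret seminormed_space "W1_pairs (ennreal Q) :: ('a \<Rightarrow> real \<times> 'a) set" "Lp_norm lebesgue (ennreal Q)"
    using Q by (intro seminormed_space_W1_pairs) auto
  have kb: "k \<in> borel_measurable borel" "k \<in> Lp_space lebesgue 1" "k \<in> Lp_space lebesgue (ennreal Q)"
    "weak_gradient (\<lambda>x. fst (k x)) (\<lambda>x. snd (k x))"
    and hb: "fst h \<in> Lp_space lebesgue 1" "snd h \<in> Lp_space lebesgue (ennreal Q)"
    using k h by (auto simp: W1_kernels_def kernel_space_def source_space_def)
  show ?thesis
    unfolding conv2_def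
    using conv_weak_gradient[OF Q kb(1,4), of "fst h" "Lp_norm lebesgue (ennreal Q) k * Lp_norm lebesgue 1 (fst h)"]
      conv_weak_gradient[OF Q kb(1,4), of "snd h" "Lp_norm lebesgue 1 k * Lp_norm lebesgue (ennreal Q) (snd h)"] kb hb
    by (intro add_mem) auto
qed

text \<open>\<open>conv2 k h - conv2 k' h'\<close> is
  \<open>conv2 (k - k') h + conv2 k' (h - h')\<close> almost everywhere. It yields continuity in
  time (same source), the contraction (same kernel) and strong measurability.\<close>

lemma conv2_diff_bound:
  fixes k k' :: "'a::euclidean_space \<Rightarrow> 'b::euclidean_space"
  assumes Q: "1 \<le> Q" and k: "k \<in> kernel_space Q" "k' \<in> kernel_space Q" and h: "h \<in> source_space Q" "h' \<in> source_space Q"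
  shows "Lp_norm lebesgue (ennreal Q) (conv2 k h - conv2 k' h') \<le>
    kernel_norm Q (k - k') * source_norm Q h + kernel_norm Q k' * source_norm Q (h - h')"
proof -
  interpret B: seminormed_space "Lp_space lebesgue (ennreal Q) :: ('a \<Rightarrow> 'b) set" "Lp_norm lebesgue (ennreal Q)"
    using Q by (intro seminormed_space_Lp_lebesgue) auto
  interpret K: seminormed_space "kernel_space Q :: ('a \<Rightarrow> 'b) set" "kernel_norm Q"
    using Q by (rule seminormed_space_kernel)
  interpret H: seminormed_space "source_space Q :: (('a \<Rightarrow> real) \<times> ('a \<Rightarrow> real)) set" "source_norm Q"
    using Q by (rule seminormed_space_source)
  have kk: "k - k' \<in> kernel_space Q" and hh: "h - h' \<in> source_space Q"
    using k h by (auto intro: K.diff_mem H.diff_mem)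
  note b = conv2_bound[OF Q]
  have sum_mem: "conv2 (k - k') h + conv2 k' (h - h') \<in> Lp_space lebesgue (ennreal Q)"
    by (intro B.add_mem b kk hh k h)
  have ae: "AE x in lebesgue. (conv2 (k - k') h + conv2 k' (h - h')) x = (conv2 k h - conv2 k' h') x"
    using conv_diff_left[OF b(1)[OF k(1) h(1)] b(1)[OF k(2) h(1)]] conv_diff_left[OF b(2)[OF k(1) h(1)] b(2)[OF k(2) h(1)]]
      conv_diff_right[OF b(1)[OF k(2) h(1)] b(1)[OF k(2) h(2)]] conv_diff_right[OF b(2)[OF k(2) h(1)] b(2)[OF k(2) h(2)]]
    by eventually_elim (simp add: conv2_def fst_diff snd_diff)
  have "Lp_norm lebesgue (ennreal Q) (conv2 k h - conv2 k' h') = Lp_norm lebesgue (ennreal Q) (conv2 (k - k') h + conv2 k' (h - h'))"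
    by (rule Lp_space_AE_eq(2)[OF sum_mem ae]) (use Q in simp)
  also have "\<dots> \<le> Lp_norm lebesgue (ennreal Q) (conv2 (k - k') h) + Lp_norm lebesgue (ennreal Q) (conv2 k' (h - h'))"
    by (intro B.triangle b kk hh k h)
  also have "\<dots> \<le> kernel_norm Q (k - k') * source_norm Q h + kernel_norm Q k' * source_norm Q (h - h')"
    by (intro add_mono b kk hh k h)
  finally show ?thesis .
qed

section \<open>The nonlinearity as a map of controls and state\<close>

text \<open>Acts on the values at a single time, \<open>c\<close> being the pair of controls and
  \<open>Z\<close> a function with its gradient, so that measurability in time follows by
  composition.\<close>

definition source_op :: "real \<Rightarrow> ('v \<Rightarrow> 'a::euclidean_space \<Rightarrow> 'a) \<Rightarrow> ('a \<Rightarrow> real) \<times> 'v \<Rightarrow> ('a \<Rightarrow> real \<times> 'a) \<Rightarrow> ('a \<Rightarrow> real) \<times> ('a \<Rightarrow> real)" where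
  "source_op W emb c Z = (\<lambda>x. fst c x * norm (snd (Z x)), \<lambda>x. reaction W (fst (Z x)) - emb (snd c) x \<bullet> snd (Z x))"

text \<open>The controls are changed first and the state second. Hoelder handles the part with
  \<open>u\<close>; the sup bound on the fields and the Lipschitz constant of the reaction handle
  the other. The right-hand side has the shape required by
  \<open>strongly_measurable_in_bilinear\<close>.\<close>

lemma source_op_bounds:
  fixes emb :: "'v::real_normed_vector \<Rightarrow> 'a::euclidean_space \<Rightarrow> 'a"
  assumes Q: "1 \<le> Q" and r: "r > 1" "conj_exponent r = ennreal Q"
    and lin: "\<And>x. linear (\<lambda>w. emb w x)" and eb: "\<And>w. emb w \<in> borel_measurable borel"
    and Cv: "Cv \<ge> 0" "\<And>w x. norm (emb w x) \<le> Cv * norm w"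
    and L: "L \<ge> 0" "\<And>x y. \<bar>reaction W x - reaction W y\<bar> \<le> L * \<bar>x - y\<bar>"
    and u: "u \<in> Lp_space lebesgue r" "u' \<in> Lp_space lebesgue r"
    and Z: "Z \<in> Lp_space lebesgue (ennreal Q)" "Z' \<in> Lp_space lebesgue (ennreal Q)"
  shows "source_op W emb (u, v) Z \<in> source_space Q"
    "source_norm Q (source_op W emb (u, v) Z - source_op W emb (u', v') Z') \<le>
      (Lp_norm lebesgue r (u - u') + Cv * norm (v - v')) * Lp_norm lebesgue (ennreal Q) Z
      + (L + (Lp_norm lebesgue r u' + Cv * norm v')) * Lp_norm lebesgue (ennreal Q) (Z - Z')"
proof -
  let ?N = "Lp_norm lebesgue (ennreal Q) :: ('a \<Rightarrow> real \<times> 'a) \<Rightarrow> real"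
  let ?X = "Lp_space lebesgue (ennreal Q) :: ('a \<Rightarrow> real \<times> 'a) set"
  interpret B: seminormed_space ?X ?N
    using Q by (intro seminormed_space_Lp_lebesgue) auto
  interpret S: seminormed_space "Lp_space lebesgue (ennreal Q) :: ('a \<Rightarrow> real) set" "Lp_norm lebesgue (ennreal Q)"
    using Q by (intro seminormed_space_Lp_lebesgue) auto
  interpret I: seminormed_space "Lp_space lebesgue 1 :: ('a \<Rightarrow> real) set" "Lp_norm lebesgue 1"
    by (rule seminormed_space_Lp_lebesgue) simp
  interpret R: seminormed_space "Lp_space lebesgue r :: ('a \<Rightarrow> real) set" "Lp_norm lebesgue r"
    using r by (intro seminormed_space_Lp_lebesgue) auto
  have Q0: "0 < Q" using Q by simp
  have leb0: "emeasure lebesgue (space (lebesgue :: 'a measure)) \<noteq> 0" by simp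
  have embd: "emb w x - emb w' x = emb (w - w') x" for w w' x
    using linear_diff[OF lin] by metis
  have emb0: "emb 0 x = 0" for x
    using linear_0[OF lin] by metis
  have ebl: "emb w \<in> borel_measurable lebesgue" for w
    using eb by (simp add: measurable_completion)
  have fs: "(\<lambda>x. fst (Z x)) \<in> borel_measurable lebesgue" "(\<lambda>x. snd (Z x)) \<in> borel_measurable lebesgue" if "Z \<in> ?X" for Z
    using Lp_fst_snd[OF that Q0] by (auto intro: Lp_space_measurable)
  have "continuous_on UNIV (reaction W)"
  proof (rule continuous_onI)
    fix x e :: real assume e: "e > 0"
    have "dist (reaction W y) (reaction W x) \<le> e" if "dist y x < e / (L + 1)" for y
    proof -
      have "\<bar>y - x\<bar> * (L + 1) < e"
        using that L(1) by (simp add: dist_real_def less_divide_eq)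
      moreover have "L * \<bar>y - x\<bar> \<le> \<bar>y - x\<bar> * (L + 1)" by (simp add: algebra_simps)
      ultimately show ?thesis
        using L(2)[of y x] unfolding dist_real_def by linarith
    qed
    then show "\<exists>d>0. \<forall>y\<in>UNIV. dist y x < d \<longrightarrow> dist (reaction W y) (reaction W x) \<le> e"
      using e L(1) by (intro exI[of _ "e / (L + 1)"]) auto
  qed
  then have [measurable]: "reaction W \<in> borel_measurable borel"
    by (rule borel_measurable_continuous_onI)
  define A where "A u Z = (\<lambda>x. u x * norm (snd (Z x)))" for u :: "'a \<Rightarrow> real" and Z :: "'a \<Rightarrow> real \<times> 'a"
  define E where "E v Z = (\<lambda>x. reaction W (fst (Z x)) - emb v x \<bullet> snd (Z x))" for v and Z :: "'a \<Rightarrow> real \<times> 'a"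
  have op: "source_op W emb (u, v) Z = (A u Z, E v Z)" for u v Z
    by (simp add: source_op_def A_def E_def)
  have A1: "A u Z \<in> Lp_space lebesgue 1" "Lp_norm lebesgue 1 (A u Z) \<le> Lp_norm lebesgue r u * ?N Z"
    if u: "u \<in> Lp_space lebesgue r" and Z: "Z \<in> ?X" for u Z
  proof -
    note s = Lp_fst_snd(3,4)[OF Z Q0]
    have "Lp_norm lebesgue 1 (A u Z) \<le> Lp_norm lebesgue r u * Lp_norm lebesgue (ennreal Q) (\<lambda>x. snd (Z x))"
      using Lp_Holder(2)[OF r(1) leb0 u, of "\<lambda>x. snd (Z x)"] s r(2) by (simp add: A_def)
    also have "\<dots> \<le> Lp_norm lebesgue r u * ?N Z"
      using s(2) R.N_nonneg[OF u] by (rule mult_left_mono)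
    finally show "Lp_norm lebesgue 1 (A u Z) \<le> Lp_norm lebesgue r u * ?N Z" .
    show "A u Z \<in> Lp_space lebesgue 1"
      using Lp_Holder(1)[OF r(1) leb0 u, of "\<lambda>x. snd (Z x)"] s r(2) by (simp add: A_def)
  qed
  have Em: "E v Z \<in> borel_measurable lebesgue" if "Z \<in> ?X" for v Z
    unfolding E_def using fs[OF that] ebl[of v] by measurable
  have Ebd: "\<bar>E v Z x - E v' Z' x\<bar> \<le> Cv * norm (v - v') * norm (Z x) + (L + Cv * norm v') * norm (Z x - Z' x)" for v v' Z Z' x
  proof -
    have "E v Z x - E v' Z' x = (reaction W (fst (Z x)) - reaction W (fst (Z' x))) - emb (v - v') x \<bullet> snd (Z x) - emb v' x \<bullet> snd (Z x - Z' x)"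
      by (simp add: E_def embd[symmetric] inner_diff_left inner_diff_right)
    then have "\<bar>E v Z x - E v' Z' x\<bar> \<le> \<bar>reaction W (fst (Z x)) - reaction W (fst (Z' x))\<bar> + \<bar>emb (v - v') x \<bullet> snd (Z x)\<bar> + \<bar>emb v' x \<bullet> snd (Z x - Z' x)\<bar>"
      by linarith
    also have "\<bar>reaction W (fst (Z x)) - reaction W (fst (Z' x))\<bar> \<le> L * norm (Z x - Z' x)"
      using L(2)[of "fst (Z x)" "fst (Z' x)"] norm_fst_snd_le(1)[of "Z x - Z' x"] L(1)
      by (intro order_trans[OF L(2)] mult_left_mono) auto
    also have "\<bar>emb (v - v') x \<bullet> snd (Z x)\<bar> \<le> (Cv * norm (v - v')) * norm (Z x)"
      by (intro order_trans[OF Cauchy_Schwarz_ineq2] mult_mono Cv norm_fst_snd_le mult_nonneg_nonneg) auto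
    also have "\<bar>emb v' x \<bullet> snd (Z x - Z' x)\<bar> \<le> (Cv * norm v') * norm (Z x - Z' x)"
      by (intro order_trans[OF Cauchy_Schwarz_ineq2] mult_mono Cv norm_fst_snd_le mult_nonneg_nonneg) auto
    finally show ?thesis by (simp add: algebra_simps)
  qed
  have nL: "(\<lambda>x. norm (Z x)) \<in> Lp_space lebesgue (ennreal Q)" "Lp_norm lebesgue (ennreal Q) (\<lambda>x. norm (Z x)) = ?N Z" if "Z \<in> ?X" for Z
  proof -
    show "(\<lambda>x. norm (Z x)) \<in> Lp_space lebesgue (ennreal Q)"
      by (rule Lp_space_dominated_finite(1)[OF that _ Q0, of _ 1]) (use Lp_space_measurable[OF that] in auto)
    show "Lp_norm lebesgue (ennreal Q) (\<lambda>x. norm (Z x)) = ?N Z"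
      using Q0 by (simp add: Lp_norm_ennreal)
  qed
  have E2: "E v Z - E v' Z' \<in> Lp_space lebesgue (ennreal Q)"
    "Lp_norm lebesgue (ennreal Q) (E v Z - E v' Z') \<le> Cv * norm (v - v') * ?N Z + (L + Cv * norm v') * ?N (Z - Z')"
    if Z: "Z \<in> ?X" "Z' \<in> ?X" for v v' Z Z'
  proof -
    have d: "Z - Z' \<in> ?X" using Z by (rule B.diff_mem)
    let ?w = "(Cv * norm (v - v')) *\<^sub>R (\<lambda>x. norm (Z x)) + (L + Cv * norm v') *\<^sub>R (\<lambda>x. norm ((Z - Z') x))"
    have wL: "?w \<in> Lp_space lebesgue (ennreal Q)"
      using nL(1)[OF Z(1)] nL(1)[OF d] by (intro S.add_mem S.scale_mem) auto
    have wN: "Lp_norm lebesgue (ennreal Q) ?w \<le> Cv * norm (v - v') * ?N Z + (L + Cv * norm v') * ?N (Z - Z')"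
      using S.triangle[OF S.scale_mem[OF nL(1)[OF Z(1)], of "Cv * norm (v - v')"] S.scale_mem[OF nL(1)[OF d], of "L + Cv * norm v'"]]
        S.scale[OF nL(1)[OF Z(1)], of "Cv * norm (v - v')"] S.scale[OF nL(1)[OF d], of "L + Cv * norm v'"] nL(2)[OF Z(1)] nL(2)[OF d]
        Cv(1) L(1) by simp
    have m: "E v Z - E v' Z' \<in> borel_measurable lebesgue"
      unfolding fun_diff_def by (intro borel_measurable_diff Em Z)
    have ae: "AE x in lebesgue. norm ((E v Z - E v' Z') x) \<le> 1 * norm (?w x)"
      using Ebd[of v Z _ v' Z'] by (intro AE_I2) (auto intro: order_trans[OF _ abs_ge_self])
    show "E v Z - E v' Z' \<in> Lp_space lebesgue (ennreal Q)"
      by (rule Lp_space_dominated_finite(1)[OF wL m Q0 ae]) simp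
    show "Lp_norm lebesgue (ennreal Q) (E v Z - E v' Z') \<le> Cv * norm (v - v') * ?N Z + (L + Cv * norm v') * ?N (Z - Z')"
      by (rule order_trans[OF Lp_space_dominated_finite(2)[OF wL m Q0 ae]]) (use wN in \<open>simp_all only: mult_1 zero_le_one\<close>)
  qed
  \<comment> \<open>The reaction vanishes at 0, so membership in \<open>L^Q\<close> is the
    difference estimate against zero control and zero state.\<close>
  have E0: "E 0 0 = 0"
    by (simp add: E_def fun_eq_iff emb0)
  have EL: "E v Z \<in> Lp_space lebesgue (ennreal Q)" if "Z \<in> ?X" for v Z
    using E2(1)[OF that B.zero_mem, of v 0] E0 by simp
  show "source_op W emb (u, v) Z \<in> source_space Q"
    unfolding op source_space_def using A1(1)[OF u(1) Z(1)] EL[OF Z(1)] by auto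
  have d: "Z - Z' \<in> ?X" and ud: "u - u' \<in> Lp_space lebesgue r"
    using Z u by (auto intro: B.diff_mem R.diff_mem)
  have "Lp_norm lebesgue 1 (A u Z - A u' Z') \<le> Lp_norm lebesgue r (u - u') * ?N Z + Lp_norm lebesgue r u' * ?N (Z - Z')"
  proof -
    \<comment> \<open>The norm of the gradient is not linear; the last term is dominated by
      \<open>A u' (Z - Z')\<close> through the reverse triangle inequality.\<close>
    have eq: "A u Z - A u' Z' = A (u - u') Z + (\<lambda>x. u' x * (norm (snd (Z x)) - norm (snd (Z' x))))"
      by (simp add: A_def fun_eq_iff algebra_simps)
    have m: "(\<lambda>x. u' x * (norm (snd (Z x)) - norm (snd (Z' x)))) \<in> borel_measurable lebesgue"
      using fs[OF Z(1)] fs[OF Z(2)] Lp_space_measurable[OF u(2)] by measurable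
    have ae: "AE x in lebesgue. norm (u' x * (norm (snd (Z x)) - norm (snd (Z' x)))) \<le> 1 * norm (A u' (Z - Z') x)"
      by (intro AE_I2) (auto simp: A_def abs_mult snd_diff intro!: mult_left_mono norm_triangle_ineq3)
    have "ennreal 1 = 1" by simp
    note dom = Lp_space_dominated_finite[of "A u' (Z - Z')" lebesgue 1, unfolded this, OF A1(1)[OF u(2) d] m _ ae]
    have "Lp_norm lebesgue 1 (A u Z - A u' Z') \<le> Lp_norm lebesgue 1 (A (u - u') Z) + Lp_norm lebesgue 1 (\<lambda>x. u' x * (norm (snd (Z x)) - norm (snd (Z' x))))"
      unfolding eq using dom(1) A1(1)[OF ud Z(1)] by (intro I.triangle) auto
    also have "\<dots> \<le> Lp_norm lebesgue r (u - u') * ?N Z + Lp_norm lebesgue r u' * ?N (Z - Z')"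
      using dom(2) A1(2)[OF ud Z(1)] A1(2)[OF u(2) d] by (intro add_mono) auto
    finally show ?thesis .
  qed
  with E2(2)[OF Z, of v v'] show "source_norm Q (source_op W emb (u, v) Z - source_op W emb (u', v') Z') \<le>
      (Lp_norm lebesgue r (u - u') + Cv * norm (v - v')) * ?N Z + (L + (Lp_norm lebesgue r u' + Cv * norm v')) * ?N (Z - Z')"
    unfolding op source_norm_def by (simp add: algebra_simps)
qed

section \<open>The fixed point equation\<close>

lemma AE_lebesgue_on_neq: "AE s in lebesgue_on {a..b}. s \<noteq> (c::real)"
proof -
  have "AE s in lebesgue. s \<noteq> c"
    by (rule AE_completion) (rule AE_lborel_singleton)
  then show ?thesis
    by (subst AE_restrict_space_iff) auto
qed

lemma AE_lebesgue_on_subset: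
  assumes "AE s in lebesgue_on {0..1 :: real}. Pr s" "0 \<le> t" "t \<le> 1"
  shows "AE s in lebesgue_on {0..t}. Pr s"
proof -
  have "AE s in lebesgue. s \<in> {0..1} \<longrightarrow> Pr s"
    using assms(1) by (subst (asm) AE_restrict_space_iff) auto
  then have "AE s in lebesgue. s \<in> {0..t} \<longrightarrow> Pr s"
    by eventually_elim (use assms in auto)
  then show ?thesis
    by (subst AE_restrict_space_iff) auto
qed

lemma conv_zero [simp]: "conv 0 h = 0"
  by (simp add: conv_def fun_eq_iff)

lemma conv2_zero [simp]: "conv2 0 h = 0"
  by (simp add: conv2_def)

text \<open>All exponents but \<open>r\<close> are real: \<open>Q\<close> is conjugate to
  \<open>r\<close>, and \<open>P\<close> is a finite time exponent for the controls. The inequality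
  \<open>exponents\<close> is \<open>a < 1 - 1 / P\<close>.\<close>

locale mild_setting =
  fixes \<sigma> W Q P Cv :: real and r :: ennreal
    and emb :: "'v::{real_inner,banach} \<Rightarrow> 'a::euclidean_space \<Rightarrow> 'a"
    and f0 :: "'a \<Rightarrow> real" and u :: "real \<Rightarrow> 'a \<Rightarrow> real" and v :: "real \<Rightarrow> 'v"
  assumes sigma: "\<sigma> > 0" and Q: "1 \<le> Q" and r: "r > 1" "conj_exponent r = ennreal Q" and P: "P > 2"
    and exponents: "1 / 2 + DIM('a) * (1 - 1 / Q) / 2 < 1 - 1 / P"
    and emb_linear: "\<And>x. linear (\<lambda>w. emb w x)" and emb_borel: "\<And>w. emb w \<in> borel_measurable borel"
    and emb_bound: "Cv \<ge> 0" "\<And>w x. norm (emb w x) \<le> Cv * norm w"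
    and f0: "f0 \<in> Lp_space lebesgue (ennreal Q)"
    and u_sm: "strongly_measurable_in (lebesgue_on {0..1}) (Lp_space lebesgue r) (Lp_norm lebesgue r) u"
    and v_sm: "strongly_measurable_in (lebesgue_on {0..1}) UNIV norm v"
    and u_P: "(\<lambda>s. Lp_norm lebesgue r (u s)) \<in> Lp_space (lebesgue_on {0..1}) (ennreal P)"
    and v_P: "(\<lambda>s. norm (v s)) \<in> Lp_space (lebesgue_on {0..1}) (ennreal P)"
begin

abbreviation "M \<equiv> lebesgue_on {0..1 :: real}"
abbreviation "X \<equiv> W1_pairs (ennreal Q) :: ('a \<Rightarrow> real \<times> 'a) set"
abbreviation "N \<equiv> Lp_norm lebesgue (ennreal Q) :: ('a \<Rightarrow> real \<times> 'a) \<Rightarrow> real"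
abbreviation "LQ \<equiv> Lp_space lebesgue (ennreal Q) :: ('a \<Rightarrow> real) set"
abbreviation "NQ \<equiv> Lp_norm lebesgue (ennreal Q) :: ('a \<Rightarrow> real) \<Rightarrow> real"

lemma Q_pos [simp]: "0 < Q" "0 \<le> Q" and one_le_ennreal_Q [simp]: "1 \<le> ennreal Q"
  using Q by auto

sublocale X: seminormed_integration X N M
  by (intro seminormed_integration_lebesgue_on seminormed_space_W1_pairs one_le_ennreal_Q)

sublocale LQ: seminormed_space LQ NQ
  by (intro seminormed_space_Lp_lebesgue one_le_ennreal_Q)

sublocale H: seminormed_space "source_space Q :: (('a \<Rightarrow> real) \<times> ('a \<Rightarrow> real)) set" "source_norm Q"
  using Q by (rule seminormed_space_source)

sublocale Ker: seminormed_space "W1_kernels Q :: ('a \<Rightarrow> real \<times> 'a) set" "kernel_norm Q"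
  using Q by (rule seminormed_space_W1_kernels)

lemma XD: "F \<in> X \<Longrightarrow> F \<in> Lp_space lebesgue (ennreal Q)"
  by (rule W1_pairsD)

definition a :: real where "a = 1 / 2 + DIM('a) * (1 - 1 / Q) / 2"
text \<open>Half of the room in the exponent condition, so that \<open>a + \<theta>\<close> is still
  admissible.\<close>

definition \<theta> :: real where "\<theta> = (1 - 1 / P - a) / 2"

lemma a_ge: "1 / 2 \<le> a"
  using Q by (simp add: a_def)

lemma \<theta>_bounds: "0 < \<theta>" "\<theta> \<le> 1" "a + \<theta> < 1 - 1 / P"
proof -
  have P': "0 < 1 / P" using P by simp
  have a': "a < 1 - 1 / P" using exponents by (simp add: a_def)
  have "2 * \<theta> = 1 - 1 / P - a" by (simp add: \<theta>_def)
  with P' a' a_ge show "0 < \<theta>" "\<theta> \<le> 1" "a + \<theta> < 1 - 1 / P"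
    by linarith+
qed

definition L :: real where "L = (SOME L. L \<ge> 0 \<and> (\<forall>x y. \<bar>reaction W x - reaction W y\<bar> \<le> L * \<bar>x - y\<bar>))"

lemma L_bound: "L \<ge> 0" "\<bar>reaction W x - reaction W y\<bar> \<le> L * \<bar>x - y\<bar>"
proof -
  have "\<exists>L. L \<ge> 0 \<and> (\<forall>x y. \<bar>reaction W x - reaction W y\<bar> \<le> L * \<bar>x - y\<bar>)"
    using reaction_lipschitz by metis
  then have "L \<ge> 0 \<and> (\<forall>x y. \<bar>reaction W x - reaction W y\<bar> \<le> L * \<bar>x - y\<bar>)"
    unfolding L_def by (rule someI_ex)
  then show "L \<ge> 0" "\<bar>reaction W x - reaction W y\<bar> \<le> L * \<bar>x - y\<bar>" by auto
qed

text \<open>The Lipschitz constant of the source at time \<open>s\<close> as a function of the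
  state; it is in \<open>L^P\<close> in time.\<close>

definition w :: "real \<Rightarrow> real" where
  "w s = L + (Lp_norm lebesgue r (u s) + Cv * norm (v s))"

lemma u_AE: "AE s in M. u s \<in> Lp_space lebesgue r"
  using u_sm by (simp add: strongly_measurable_in_def)

lemma w_AE_nonneg: "AE s in M. 0 \<le> w s"
proof -
  interpret R: seminormed_space "Lp_space lebesgue r :: ('a \<Rightarrow> real) set" "Lp_norm lebesgue r"
    using r by (intro seminormed_space_Lp_lebesgue) auto
  show ?thesis
    using u_AE by eventually_elim (auto simp: w_def intro!: add_nonneg_nonneg mult_nonneg_nonneg R.N_nonneg L_bound emb_bound)
qed

lemma M_pos: "emeasure M (space M) \<noteq> 0"
  by (simp add: emeasure_restrict_space)

lemma w_Lp: "w \<in> Lp_space M (ennreal P)"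
proof -
  have "1 \<le> ennreal P"
    using P by (simp flip: ennreal_1)
  then interpret T: seminormed_space "Lp_space M (ennreal P) :: (real \<Rightarrow> real) set" "Lp_norm M (ennreal P)"
    using M_pos by (rule seminormed_space_Lp)
  have "(\<lambda>s. L) \<in> Lp_space M (ennreal P)"
    using P by (simp add: Lp_space_ennreal)
  then have "(\<lambda>s. L) + ((\<lambda>s. Lp_norm lebesgue r (u s)) + Cv *\<^sub>R (\<lambda>s. norm (v s))) \<in> Lp_space M (ennreal P)"
    by (intro T.add_mem T.scale_mem u_P v_P)
  also have "(\<lambda>s. L) + ((\<lambda>s. Lp_norm lebesgue r (u s)) + Cv *\<^sub>R (\<lambda>s. norm (v s))) = w"
    by (simp add: w_def fun_eq_iff)
  finally show ?thesis .
qed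

lemma w_borel: "w \<in> borel_measurable M"
  using w_Lp by (rule Lp_space_measurable)

text \<open>The constant of the singular integral at the raised exponent
  \<open>a + \<theta>\<close>. It depends on the controls through \<open>w\<close>, but on no
  state.\<close>

definition D :: real where
  "D = (SOME D. D \<ge> 0 \<and> (\<forall>t. 0 < t \<longrightarrow> t \<le> 1 \<longrightarrow>
    (\<integral>\<^sup>+s. ennreal (sing (a + \<theta>) t s * s powr (- 1 / 2) * w s) \<partial>M) \<le> ennreal (D / sqrt t)))"

lemma D_bounds: "D \<ge> 0" "0 < t \<Longrightarrow> t \<le> 1 \<Longrightarrow> (\<integral>\<^sup>+s. ennreal (sing (a + \<theta>) t s * s powr (- 1 / 2) * w s) \<partial>M) \<le> ennreal (D / sqrt t)"
proof -
  have "(\<integral>\<^sup>+s. ennreal (w s powr P) \<partial>M) = (\<integral>\<^sup>+s. ennreal (norm (w s) powr P) \<partial>M)"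
    by (rule nn_integral_cong_AE) (use w_AE_nonneg in eventually_elim, simp)
  also have "\<dots> < \<infinity>"
    using nn_integral_Lp_norm[OF w_Lp] P by simp
  finally have wP: "(\<integral>\<^sup>+s. ennreal (w s powr P) \<partial>M) < \<infinity>" .
  have P1: "P > 1" and a1: "1 / 2 \<le> a + \<theta>"
    using P a_ge \<theta>_bounds(1) by linarith+
  obtain D' where "D' \<ge> 0" "\<And>t. 0 < t \<Longrightarrow> t \<le> 1 \<Longrightarrow>
      (\<integral>\<^sup>+s. ennreal (sing (a + \<theta>) t s * s powr (- 1 / 2) * w s) \<partial>M) \<le> ennreal (D' / sqrt t)"
    by (rule singular_integral_bound[OF P1 a1 \<theta>_bounds(3) w_borel w_AE_nonneg wP]) (rule that)
  then have "\<exists>D. D \<ge> 0 \<and> (\<forall>t. 0 < t \<longrightarrow> t \<le> 1 \<longrightarrow>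
    (\<integral>\<^sup>+s. ennreal (sing (a + \<theta>) t s * s powr (- 1 / 2) * w s) \<partial>M) \<le> ennreal (D / sqrt t))"
    by blast
  then have "D \<ge> 0 \<and> (\<forall>t. 0 < t \<longrightarrow> t \<le> 1 \<longrightarrow>
    (\<integral>\<^sup>+s. ennreal (sing (a + \<theta>) t s * s powr (- 1 / 2) * w s) \<partial>M) \<le> ennreal (D / sqrt t))"
    unfolding D_def by (rule someI_ex)
  then show "D \<ge> 0" "0 < t \<Longrightarrow> t \<le> 1 \<Longrightarrow> (\<integral>\<^sup>+s. ennreal (sing (a + \<theta>) t s * s powr (- 1 / 2) * w s) \<partial>M) \<le> ennreal (D / sqrt t)"
    by auto
qed

text \<open>The kernel indexed by elapsed time instead of width. It is 0 for nonpositive times, so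
  the Duhamel integrand vanishes after time \<open>t\<close> and all integrals are over the fixed
  measure \<open>M\<close>.\<close>

definition hk :: "real \<Rightarrow> 'a \<Rightarrow> real \<times> 'a" where
  "hk x = (if x > 0 then heat_kernel (\<sigma> * sqrt x) else 0)"

lemma hk_mem: "hk x \<in> W1_kernels Q"
proof (cases "x > 0")
  case True
  then have s: "\<sigma> * sqrt x > 0" using sigma by simp
  obtain C where "(heat_kernel (\<sigma> * sqrt x) :: 'a \<Rightarrow> real \<times> 'a) \<in> Lp_space lebesgue (ennreal Q)"
    using heat_kernel_Lp[OF Q sigma, where 'a='a] s by metis
  moreover obtain C where "(heat_kernel (\<sigma> * sqrt x) :: 'a \<Rightarrow> real \<times> 'a) \<in> Lp_space lebesgue (ennreal 1)"
    using heat_kernel_Lp[OF order_refl sigma, where 'a='a] s by metis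
  ultimately show ?thesis
    using True heat_kernel_borel[OF s] heat_kernel_weak_gradient[OF s]
    by (simp add: hk_def W1_kernels_def kernel_space_def)
qed (simp add: hk_def Ker.zero_mem)

lemma hk_kernel: "hk x \<in> kernel_space Q" "hk x \<in> borel_measurable borel"
  "hk x \<in> Lp_space lebesgue 1" "hk x \<in> Lp_space lebesgue (ennreal Q)" "weak_gradient (\<lambda>y. fst (hk x y)) (\<lambda>y. snd (hk x y))"
  using hk_mem[of x] by (auto simp: W1_kernels_def kernel_space_def)

lemma sigma_sqrt_powr: "x > 0 \<Longrightarrow> (\<sigma> * sqrt x) powr e = \<sigma> powr e * x powr (e / 2)"
  using sigma by (simp add: powr_mult powr_half_sqrt[symmetric] powr_powr mult.commute)

text \<open>The width \<open>\<sigma> * sqrt x\<close> halves the exponents of the kernel bounds.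
  The first estimate is for the sources, the second for the initial datum, which is in
  \<open>L^Q\<close> and meets the kernel only in \<open>L^1\<close>.\<close>

lemma hk_bounds_exist: "\<exists>C>0. \<forall>x. 0 < x \<and> x \<le> 1 \<longrightarrow> kernel_norm Q (hk x) \<le> C * x powr (- a) \<and> Lp_norm lebesgue 1 (hk x) \<le> C * x powr (- 1 / 2)"
proof -
  obtain C1 where C1: "C1 > 0" "\<And>\<tau>. \<tau> > 0 \<Longrightarrow> \<tau> \<le> \<sigma> \<Longrightarrow> Lp_norm lebesgue (ennreal 1) (heat_kernel \<tau> :: 'a \<Rightarrow> real \<times> 'a) \<le> C1 * \<tau> powr (- 1 - DIM('a) * (1 - 1 / 1))"
    by (rule heat_kernel_Lp[OF order_refl sigma]) (rule that)
  obtain C2 where C2: "C2 > 0" "\<And>\<tau>. \<tau> > 0 \<Longrightarrow> \<tau> \<le> \<sigma> \<Longrightarrow> Lp_norm lebesgue (ennreal Q) (heat_kernel \<tau> :: 'a \<Rightarrow> real \<times> 'a) \<le> C2 * \<tau> powr (- 1 - DIM('a) * (1 - 1 / Q))"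
    by (rule heat_kernel_Lp[OF Q sigma]) (rule that)
  define A B where "A = C1 * \<sigma> powr (- 1)" and "B = C2 * \<sigma> powr (- 1 - DIM('a) * (1 - 1 / Q))"
  have AB: "A > 0" "B > 0"
    using C1 C2 sigma by (auto simp: A_def B_def)
  have "kernel_norm Q (hk x) \<le> (A + B) * x powr (- a) \<and> Lp_norm lebesgue 1 (hk x) \<le> (A + B) * x powr (- 1 / 2)"
    if x: "0 < x" "x \<le> 1" for x
  proof -
    have s: "\<sigma> * sqrt x > 0" "\<sigma> * sqrt x \<le> \<sigma>"
      using x sigma mult_left_mono[of "sqrt x" 1 \<sigma>] by auto
    have 1: "Lp_norm lebesgue 1 (hk x) \<le> A * x powr (- 1 / 2)"
      using C1(2)[OF s] x unfolding sigma_sqrt_powr[OF x(1)] by (simp add: hk_def A_def)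
    have e: "(- 1 - DIM('a) * (1 - 1 / Q)) / 2 = - a"
      by (simp add: a_def field_simps)
    have 2: "Lp_norm lebesgue (ennreal Q) (hk x) \<le> B * x powr (- a)"
      using C2(2)[OF s] x unfolding sigma_sqrt_powr[OF x(1)] e by (simp add: hk_def B_def mult.assoc)
    have 3: "x powr (- 1 / 2) \<le> x powr (- a)"
      using x a_ge by (intro powr_mono') auto
    have "kernel_norm Q (hk x) \<le> A * x powr (- a) + B * x powr (- a)"
      unfolding kernel_norm_def using 1 2 3 AB by (intro add_mono order_trans[OF 1] mult_left_mono) auto
    moreover have "A * x powr (- 1 / 2) \<le> (A + B) * x powr (- 1 / 2)"
      using AB by (intro mult_right_mono) auto
    ultimately show ?thesis
      using 1 by (simp add: distrib_right)
  qed
  then show ?thesis using AB by (intro exI[of _ "A + B"]) auto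
qed

definition C :: real where
  "C = (SOME C. C > 0 \<and> (\<forall>x. 0 < x \<and> x \<le> 1 \<longrightarrow> kernel_norm Q (hk x) \<le> C * x powr (- a) \<and> Lp_norm lebesgue 1 (hk x) \<le> C * x powr (- 1 / 2)))"

lemma C_bounds: "C > 0" "0 < x \<Longrightarrow> x \<le> 1 \<Longrightarrow> kernel_norm Q (hk x) \<le> C * x powr (- a)"
  "0 < x \<Longrightarrow> x \<le> 1 \<Longrightarrow> Lp_norm lebesgue 1 (hk x) \<le> C * x powr (- 1 / 2)"
  using someI_ex[OF hk_bounds_exist, folded C_def] by auto

lemma hk_sing: "t - s \<le> 1 \<Longrightarrow> kernel_norm Q (hk (t - s)) \<le> C * sing a t s"
  using C_bounds(2)[of "t - s"] by (auto simp: sing_def) (simp add: hk_def)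

text \<open>Time 0 is excluded because the kernel is singular there; at negative times it is locally
  constant.\<close>

lemma hk_continuous:
  assumes x: "x \<noteq> 0" and lim: "y \<longlonglongrightarrow> x"
  shows "(\<lambda>n. kernel_norm Q (hk (y n) - hk x)) \<longlonglongrightarrow> 0"
proof (cases "x > 0")
  case True
  define z where "z n = (if y n > 0 then y n else x)" for n
  have ev: "eventually (\<lambda>n. y n = z n) sequentially"
    using order_tendstoD(1)[OF lim True] by eventually_elim (simp add: z_def)
  have z: "z n > 0" for n
    using True by (simp add: z_def)
  have "z \<longlonglongrightarrow> x"
    using lim ev by (rule Lim_transform_eventually)
  then have zl: "(\<lambda>n. \<sigma> * sqrt (z n)) \<longlonglongrightarrow> \<sigma> * sqrt x"
    by (intro tendsto_intros)
  have pos: "\<sigma> * sqrt x > 0" "\<And>n. \<sigma> * sqrt (z n) > 0"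
    using True z sigma by auto
  have "(\<lambda>n. Lp_norm lebesgue (ennreal 1) (heat_kernel (\<sigma> * sqrt (z n)) - heat_kernel (\<sigma> * sqrt x) :: 'a \<Rightarrow> real \<times> 'a)
      + Lp_norm lebesgue (ennreal Q) (heat_kernel (\<sigma> * sqrt (z n)) - heat_kernel (\<sigma> * sqrt x) :: 'a \<Rightarrow> real \<times> 'a)) \<longlonglongrightarrow> 0 + 0"
    by (intro tendsto_add heat_kernel_continuous_Lp Q zl pos order_refl)
  then have "(\<lambda>n. kernel_norm Q (hk (z n) - hk x)) \<longlonglongrightarrow> 0"
    using True z by (simp add: kernel_norm_def hk_def)
  moreover have "eventually (\<lambda>n. kernel_norm Q (hk (z n) - hk x) = kernel_norm Q (hk (y n) - hk x)) sequentially"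
    using ev by eventually_elim simp
  ultimately show ?thesis
    by (rule Lim_transform_eventually)
next
  case False
  then have "eventually (\<lambda>n. kernel_norm Q (hk (y n) - hk x) = 0) sequentially"
    using order_tendstoD(2)[OF lim, of 0] x by (auto elim!: eventually_mono simp: hk_def)
  then show ?thesis
    by (rule tendsto_eventually)
qed

definition src :: "(real \<Rightarrow> 'a \<Rightarrow> real \<times> 'a) \<Rightarrow> real \<Rightarrow> ('a \<Rightarrow> real) \<times> ('a \<Rightarrow> real)" where
  "src Z s = source_op W emb (u s, v s) (Z s)"

definition integrand :: "(real \<Rightarrow> 'a \<Rightarrow> real \<times> 'a) \<Rightarrow> real \<Rightarrow> real \<Rightarrow> 'a \<Rightarrow> real \<times> 'a" where
  "integrand Z t s = conv2 (hk (t - s)) (src Z s)"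

text \<open>A solution need not have a gradient at time 0, so the value there is fixed as 0; being a
  single time it does not affect any integral.\<close>

definition states :: "(real \<Rightarrow> 'a \<Rightarrow> real \<times> 'a) set" where
  "states = {Z. continuous_on_in {0<..1} X N Z \<and> Z 0 = 0 \<and> (\<exists>R. \<forall>t\<in>{0<..1}. sqrt t * N (Z t) \<le> R)}"

lemma statesD:
  assumes "Z \<in> states"
  shows "continuous_on_in {0<..1} X N Z" "Z 0 = 0" "t \<in> {0..1} \<Longrightarrow> Z t \<in> X"
proof -
  show c: "continuous_on_in {0<..1} X N Z" and z: "Z 0 = 0"
    using assms by (auto simp: states_def)
  show "Z t \<in> X" if "t \<in> {0..1}"
    using c z that by (cases "t = 0") (auto simp: continuous_on_in_def)
qed

lemma states_bound:
  assumes "Z \<in> states"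
  obtains R where "R \<ge> 0" "\<And>t. t \<in> {0<..1} \<Longrightarrow> sqrt t * N (Z t) \<le> R"
proof -
  obtain R where R: "\<forall>t\<in>{0<..1}. sqrt t * N (Z t) \<le> R"
    using assms by (auto simp: states_def)
  have "0 \<le> N (Z 1)"
    using statesD(3)[OF assms, of 1] by (intro X.N_nonneg) auto
  moreover have "N (Z 1) \<le> R"
    using R[rule_format, of 1] by simp
  ultimately have "R \<ge> 0" by linarith
  with R show thesis by (intro that[of R]) auto
qed

lemma zero_state: "(\<lambda>t. 0) \<in> states"
  by (auto simp: states_def continuous_on_in_def)

lemma src_mem: "u s \<in> Lp_space lebesgue r \<Longrightarrow> Z s \<in> X \<Longrightarrow> src Z s \<in> source_space Q"
  unfolding src_def
  by (rule source_op_bounds(1)[OF Q r emb_linear emb_borel emb_bound L_bound, of "u s" "u s" "Z s" "Z s"]) (auto intro: XD)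

lemma src_diff:
  assumes "u s \<in> Lp_space lebesgue r" "Z s \<in> X" "Z' s \<in> X"
  shows "source_norm Q (src Z s - src Z' s) \<le> w s * N (Z s - Z' s)"
proof -
  interpret R: seminormed_space "Lp_space lebesgue r :: ('a \<Rightarrow> real) set" "Lp_norm lebesgue r"
    using r by (intro seminormed_space_Lp_lebesgue) auto
  show ?thesis
    using source_op_bounds(2)[OF Q r emb_linear emb_borel emb_bound L_bound assms(1,1) XD[OF assms(2)] XD[OF assms(3)], of "v s" "v s"]
    by (simp add: src_def w_def)
qed

lemma src_zero: "src (\<lambda>t. 0) s = 0"
  using linear_0[OF emb_linear] by (simp add: src_def source_op_def zero_prod_def zero_fun_def)

lemma src_bound: "u s \<in> Lp_space lebesgue r \<Longrightarrow> Z s \<in> X \<Longrightarrow> source_norm Q (src Z s) \<le> w s * N (Z s)"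
  using src_diff[of s Z "\<lambda>t. 0"] by (simp add: src_zero X.zero_mem)

lemma integrand_mem: "u s \<in> Lp_space lebesgue r \<Longrightarrow> Z s \<in> X \<Longrightarrow> integrand Z t s \<in> X"
  unfolding integrand_def by (intro conv2_W1 Q hk_mem src_mem)

text \<open>Continuity can fail only at time 0, a null set.\<close>

lemma state_sm:
  assumes Z: "Z \<in> states"
  shows "X.sm Z"
proof (rule strongly_measurable_in_continuous_AE)
  show "AE t in M. \<forall>s. (\<forall>n. s n \<in> {0..1}) \<and> s \<longlonglongrightarrow> t \<longrightarrow> (\<lambda>n. N (Z (s n) - Z t)) \<longlonglongrightarrow> 0"
    using AE_lebesgue_on_neq[of 0 0 1] AE_space
  proof eventually_elim
    case (elim t)
    then have t: "t \<in> {0<..1}" by auto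
    show ?case
    proof safe
      fix s assume s: "\<forall>n. s n \<in> {0..1}" "s \<longlonglongrightarrow> t"
      have "eventually (\<lambda>n. 0 < s n) sequentially"
        using s(2) t by (intro order_tendstoD(1)) auto
      then have "eventually (\<lambda>n. s n \<in> {0<..1}) sequentially"
        by eventually_elim (use s(1) in auto)
      then show "(\<lambda>n. N (Z (s n) - Z t)) \<longlonglongrightarrow> 0"
        by (rule X.continuous_on_in_sequentially[OF statesD(1)[OF Z] t s(2)])
    qed
  qed
qed (use statesD(3)[OF Z] in auto)

text \<open>Continuity can fail only at \<open>s = t\<close>, a null set.\<close>

lemma hk_sm: "strongly_measurable_in M (W1_kernels Q) (kernel_norm Q) (\<lambda>s. hk (t - s))"
proof (rule strongly_measurable_in_continuous_AE)
  show "AE s in M. \<forall>z. (\<forall>n. z n \<in> {0..1}) \<and> z \<longlonglongrightarrow> s \<longrightarrow> (\<lambda>n. kernel_norm Q (hk (t - z n) - hk (t - s))) \<longlonglongrightarrow> 0"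
    using AE_lebesgue_on_neq[of t 0 1]
  proof eventually_elim
    case (elim s)
    show ?case
    proof safe
      fix z assume "z \<longlonglongrightarrow> s"
      then show "(\<lambda>n. kernel_norm Q (hk (t - z n) - hk (t - s))) \<longlonglongrightarrow> 0"
        using elim by (intro hk_continuous tendsto_intros) auto
    qed
  qed
qed (rule hk_mem)

text \<open>Two compositions of the same type: controls with state give the source, kernel with
  source gives the integrand.\<close>

lemma integrand_sm:
  assumes Z: "Z \<in> states"
  shows "X.sm (integrand Z t)"
proof -
  let ?U = "Lp_space lebesgue r \<times> (UNIV :: 'v set)"
  let ?NU = "\<lambda>c. Lp_norm lebesgue r (fst c) + Cv * norm (snd c :: 'v)"
  have Rs: "seminormed_space (Lp_space lebesgue r :: ('a \<Rightarrow> real) set) (Lp_norm lebesgue r)"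
    using r by (intro seminormed_space_Lp_lebesgue) auto
  \<comment> \<open>The norm on the second control carries the factor \<open>Cv\<close>, which makes
    the norm of the control pair the quantity occurring in \<open>source_op_bounds\<close>.\<close>
  have Vs: "seminormed_space (UNIV :: 'v set) (\<lambda>v. Cv * norm v)"
  proof
    show "Cv * norm (x + y) \<le> Cv * norm x + Cv * norm y" for x y :: 'v
      using mult_left_mono[OF norm_triangle_ineq emb_bound(1), of x y] by (simp add: distrib_left)
  qed auto
  have v': "strongly_measurable_in M UNIV (\<lambda>v. Cv * norm v) v"
  proof -
    obtain S where S: "\<And>i::nat. simple_function M (S i)" "AE t in M. (\<lambda>i. norm (S i t - v t)) \<longlonglongrightarrow> 0"
      by (rule strongly_measurable_inE[OF v_sm]) (rule that)
    show ?thesis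
    proof (rule strongly_measurable_inI[OF S(1)])
      show "AE t in M. (\<lambda>i. Cv * norm (S i t - v t)) \<longlonglongrightarrow> 0"
        using S(2) by eventually_elim (use tendsto_mult[OF tendsto_const[of Cv]] in fastforce)
    qed auto
  qed
  have uv: "strongly_measurable_in M ?U ?NU (\<lambda>s. (u s, v s))"
    by (rule strongly_measurable_in_Pair[OF u_sm v'])
  have src: "strongly_measurable_in M (source_space Q) (source_norm Q) (\<lambda>s. src Z s)"
    unfolding src_def
  proof (rule strongly_measurable_in_bilinear[OF uv state_sm[OF Z] seminormed_space_prod[OF Rs Vs] X.seminormed_space_axioms H.seminormed_space_axioms])
    fix c c' :: "('a \<Rightarrow> real) \<times> 'v" and z z' assume *: "c \<in> ?U" "z \<in> X" "c' \<in> ?U" "z' \<in> X"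
    then have c: "fst c \<in> Lp_space lebesgue r" "fst c' \<in> Lp_space lebesgue r"
      and z: "z \<in> Lp_space lebesgue (ennreal Q)" "z' \<in> Lp_space lebesgue (ennreal Q)"
      by (auto intro: XD)
    note b = source_op_bounds[OF Q r emb_linear emb_borel emb_bound L_bound c z]
    show "source_op W emb c z \<in> source_space Q"
      using b(1)[of "snd c"] by simp
    show "source_norm Q (source_op W emb c z - source_op W emb c' z') \<le> ?NU (c - c') * N z + (L + ?NU c') * N (z - z')"
      using b(2)[of "snd c" "snd c'"] by simp
  qed
  show ?thesis
    unfolding integrand_def[abs_def]
  proof (rule strongly_measurable_in_bilinear[where L=0, OF hk_sm src Ker.seminormed_space_axioms H.seminormed_space_axioms X.seminormed_space_axioms])
    fix k k' :: "'a \<Rightarrow> real \<times> 'a" and h h' :: "('a \<Rightarrow> real) \<times> ('a \<Rightarrow> real)"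
    assume *: "k \<in> W1_kernels Q" "h \<in> source_space Q" "k' \<in> W1_kernels Q" "h' \<in> source_space Q"
    show "conv2 k h \<in> X"
      by (intro conv2_W1 Q *)
    show "N (conv2 k h - conv2 k' h') \<le> kernel_norm Q (k - k') * source_norm Q h + (0 + kernel_norm Q k') * source_norm Q (h - h')"
      using conv2_diff_bound[OF Q, of k k' h h'] * by (simp add: W1_kernels_def)
  qed
qed

lemma integrand_diff:
  assumes "u s \<in> Lp_space lebesgue r" "Z s \<in> X" "Z' s \<in> X" "t - s \<le> 1"
  shows "N (integrand Z t s - integrand Z' t s) \<le> C * sing a t s * (w s * N (Z s - Z' s))"
proof -
  have "N (integrand Z t s - integrand Z' t s) \<le> kernel_norm Q (hk (t - s)) * source_norm Q (src Z s - src Z' s)"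
    using conv2_diff_bound[OF Q hk_kernel(1) hk_kernel(1) src_mem[of s Z, OF assms(1,2)] src_mem[of s Z', OF assms(1,3)], of "t - s" "t - s"]
    by (simp add: integrand_def)
  also have "\<dots> \<le> C * sing a t s * (w s * N (Z s - Z' s))"
    using C_bounds(1) hk_sing[OF assms(4)] src_diff[of s Z Z', OF assms(1-3)]
    by (intro mult_mono) (auto intro!: H.N_nonneg H.diff_mem src_mem assms)
  finally show ?thesis .
qed

lemma integrand_zero: "integrand (\<lambda>t. 0) t s = 0"
proof -
  have "conv (hk (t - s)) 0 = 0"
    by (simp add: conv_def fun_eq_iff)
  then show ?thesis
    by (simp add: integrand_def src_zero conv2_def)
qed

text \<open>\<open>exp (\<mu> * s)\<close> is \<open>exp (\<mu> * t)\<close> times the decaying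
  factor \<open>exp (- \<mu> * (t - s))\<close>; the latter is spent on the kernel, whose exponent
  is raised by \<open>\<theta>\<close> in exchange for the factor \<open>K\<close>.\<close>

lemma sing_exp_le:
  assumes K: "\<And>x. 0 < x \<Longrightarrow> x \<le> 1 \<Longrightarrow> x powr (- a) * exp (- \<mu> * x) \<le> K * x powr (- (a + \<theta>))" and ts: "t - s \<le> 1"
  shows "sing a t s * exp (\<mu> * s) \<le> exp (\<mu> * t) * K * sing (a + \<theta>) t s"
proof (cases "s < t")
  case True
  have "(t - s) powr (- a) * exp (\<mu> * s) = exp (\<mu> * t) * ((t - s) powr (- a) * exp (- \<mu> * (t - s)))"
    by (simp add: algebra_simps flip: exp_add)
  also have "\<dots> \<le> exp (\<mu> * t) * (K * (t - s) powr (- (a + \<theta>)))"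
    using K[of "t - s"] True ts by (intro mult_left_mono) auto
  finally show ?thesis using True by (simp add: sing_def mult.assoc)
qed (simp add: sing_def)

text \<open>Stated for any \<open>\<mu>\<close> and \<open>K\<close> with the exchange property
  because it is used twice: with \<open>\<mu> = 0\<close>, \<open>K = 1\<close> for plain bounds,
  and with large \<open>\<mu>\<close>, small \<open>K\<close> for the contraction.\<close>

lemma integral_diff_bound:
  assumes Z: "Z \<in> states" "Z' \<in> states" and t: "0 < t" "t \<le> 1"
    and m: "\<And>s. s \<in> {0<..1} \<Longrightarrow> sqrt s * exp (- \<mu> * s) * N (Z s - Z' s) \<le> m" "0 \<le> m"
    and K: "\<And>x. 0 < x \<Longrightarrow> x \<le> 1 \<Longrightarrow> x powr (- a) * exp (- \<mu> * x) \<le> K * x powr (- (a + \<theta>))" "0 \<le> K"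
  shows "(\<integral>\<^sup>+s. ennreal (N (integrand Z t s - integrand Z' t s)) \<partial>M) \<le> ennreal (C * m * exp (\<mu> * t) * K * (D / sqrt t))"
proof -
  let ?c = "C * m * exp (\<mu> * t) * K"
  have c: "0 \<le> ?c" using C_bounds(1) m K by simp
  have "(\<integral>\<^sup>+s. ennreal (N (integrand Z t s - integrand Z' t s)) \<partial>M) \<le>
      (\<integral>\<^sup>+s. ennreal ?c * ennreal (sing (a + \<theta>) t s * s powr (- 1 / 2) * w s) \<partial>M)"
  proof (rule nn_integral_mono_AE)
    show "AE s in M. ennreal (N (integrand Z t s - integrand Z' t s)) \<le> ennreal ?c * ennreal (sing (a + \<theta>) t s * s powr (- 1 / 2) * w s)"
      using u_AE w_AE_nonneg AE_lebesgue_on_neq[of 0 0 1] AE_space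
    proof eventually_elim
      case (elim s)
      then have s: "0 < s" "s \<le> 1" by auto
      have ZX: "Z s \<in> X" "Z' s \<in> X"
        using statesD(3) Z s by auto
      have d: "N (Z s - Z' s) \<le> m * exp (\<mu> * s) * s powr (- 1 / 2)"
      proof -
        have "N (Z s - Z' s) = sqrt s * exp (- \<mu> * s) * N (Z s - Z' s) * (exp (\<mu> * s) * s powr (- 1 / 2))"
          using s by (simp add: powr_minus_divide powr_half_sqrt exp_minus field_simps)
        also have "\<dots> \<le> m * (exp (\<mu> * s) * s powr (- 1 / 2))"
          using m(1)[of s] s by (intro mult_right_mono) auto
        finally show ?thesis by simp
      qed
      have "N (integrand Z t s - integrand Z' t s) \<le> C * sing a t s * (w s * N (Z s - Z' s))"
        using elim ZX t s by (intro integrand_diff) auto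
      also have "\<dots> \<le> C * sing a t s * (w s * (m * exp (\<mu> * s) * s powr (- 1 / 2)))"
        using d C_bounds(1) elim by (intro mult_left_mono) auto
      also have "\<dots> = (sing a t s * exp (\<mu> * s)) * (C * m * s powr (- 1 / 2) * w s)"
        by simp
      also have "\<dots> \<le> (exp (\<mu> * t) * K * sing (a + \<theta>) t s) * (C * m * s powr (- 1 / 2) * w s)"
        using C_bounds(1) m elim t s by (intro mult_right_mono sing_exp_le K) auto
      also have "\<dots> = ?c * (sing (a + \<theta>) t s * s powr (- 1 / 2) * w s)"
        by simp
      finally have "ennreal (N (integrand Z t s - integrand Z' t s)) \<le> ennreal (?c * (sing (a + \<theta>) t s * s powr (- 1 / 2) * w s))"
        by (rule ennreal_leI)
      then show ?case
        using c by (simp add: ennreal_mult' del: mult_eq_0_iff)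
    qed
  qed
  also have "\<dots> = ennreal ?c * (\<integral>\<^sup>+s. ennreal (sing (a + \<theta>) t s * s powr (- 1 / 2) * w s) \<partial>M)"
  proof (rule nn_integral_cmult)
    have "(\<lambda>s. s powr (- 1 / 2)) \<in> borel_measurable M"
      by (rule borel_measurable_lebesgue_onI) measurable
    then show "(\<lambda>s. ennreal (sing (a + \<theta>) t s * s powr (- 1 / 2) * w s)) \<in> borel_measurable M"
      using w_borel borel_measurable_lebesgue_onI[OF sing_borel] by measurable
  qed
  also have "\<dots> \<le> ennreal ?c * ennreal (D / sqrt t)"
    using D_bounds(2)[OF t] by (rule mult_left_mono) simp
  also have "\<dots> = ennreal (?c * (D / sqrt t))"
    by (rule ennreal_mult'[OF c, symmetric])
  finally show ?thesis .
qed

lemma K_one: "0 < x \<Longrightarrow> x \<le> 1 \<Longrightarrow> x powr (- a) * exp (- 0 * x) \<le> 1 * x powr (- (a + \<theta>))"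
  using \<theta>_bounds(1) by (simp add: powr_mono')

text \<open>Since \<open>\<theta>\<close> is between 0 and 1,
  \<open>(\<mu> * x) powr \<theta> \<le> exp (\<mu> * x)\<close>. The resulting
  \<open>\<mu> powr (- \<theta>)\<close> tends to 0, which is the source of the contraction.\<close>

lemma K_exp:
  assumes "\<mu> > 0" "0 < x"
  shows "x powr (- a) * exp (- \<mu> * x) \<le> \<mu> powr (- \<theta>) * x powr (- (a + \<theta>))"
proof -
  have "(\<mu> * x) powr \<theta> \<le> exp (\<mu> * x)"
  proof (cases "\<mu> * x \<le> 1")
    case True
    then have "(\<mu> * x) powr \<theta> \<le> 1"
      using assms \<theta>_bounds(1) by (intro powr_le1) auto
    also have "1 \<le> exp (\<mu> * x)" using assms by simp
    finally show ?thesis .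
  next
    case False
    then have "(\<mu> * x) powr \<theta> \<le> (\<mu> * x) powr 1"
      using \<theta>_bounds(2) by (intro powr_mono) auto
    also have "\<dots> = \<mu> * x" using assms by simp
    also have "\<dots> \<le> exp (\<mu> * x)"
      using exp_ge_add_one_self[of "\<mu> * x"] by linarith
    finally show ?thesis .
  qed
  then have "(\<mu> * x) powr \<theta> * exp (- \<mu> * x) \<le> 1"
    by (simp add: exp_minus divide_simps)
  then have "\<mu> powr (- \<theta>) * x powr (- (a + \<theta>)) * ((\<mu> * x) powr \<theta> * exp (- \<mu> * x)) \<le> \<mu> powr (- \<theta>) * x powr (- (a + \<theta>)) * 1"
    by (intro mult_left_mono) auto
  moreover have "\<mu> powr (- \<theta>) * x powr (- (a + \<theta>)) * (\<mu> * x) powr \<theta> = x powr (- a)"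
  proof -
    have "\<mu> powr (- \<theta>) * \<mu> powr \<theta> = 1" "x powr (- (a + \<theta>)) * x powr \<theta> = x powr (- a)"
      using assms by (simp_all flip: powr_add)
    then show ?thesis
      unfolding powr_mult by (simp add: ac_simps)
  qed
  ultimately show ?thesis
    by (simp add: mult.assoc[symmetric])
qed

section \<open>The Duhamel operator\<close>

text \<open>The Duhamel term with its gradient. The integral determines it only up to seminorm 0,
  hence the choice.\<close>

definition \<Phi> :: "(real \<Rightarrow> 'a \<Rightarrow> real \<times> 'a) \<Rightarrow> real \<Rightarrow> 'a \<Rightarrow> real \<times> 'a" where
  "\<Phi> Z t = (SOME g. has_integral_in M X N (integrand Z t) g)"

text \<open>The integrand of the zero state is 0, so the difference estimate against it shows that
  the integral of the norm is finite.\<close>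

lemma has_integral_\<Phi>:
  assumes Z: "Z \<in> states" and t: "0 < t" "t \<le> 1"
  shows "has_integral_in M X N (integrand Z t) (\<Phi> Z t)"
proof -
  obtain R where R: "R \<ge> 0" "\<And>t. t \<in> {0<..1} \<Longrightarrow> sqrt t * N (Z t) \<le> R"
    using states_bound[OF Z] by metis
  have "(\<integral>\<^sup>+s. ennreal (N (integrand Z t s - integrand (\<lambda>t. 0) t s)) \<partial>M) \<le> ennreal (C * R * exp (0 * t) * 1 * (D / sqrt t))"
    using R by (intro integral_diff_bound Z zero_state t K_one) auto
  then have "(\<integral>\<^sup>+s. ennreal (N (integrand Z t s)) \<partial>M) < \<infinity>"
    by (simp add: integrand_zero le_less_trans)
  then have "\<exists>g. has_integral_in M X N (integrand Z t) g"
    using Q by (intro X.has_integral_in_exists integrand_sm Z complete_W1_pairs) auto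
  then show ?thesis
    unfolding \<Phi>_def by (rule someI_ex)
qed

lemma \<Phi>_mem: "Z \<in> states \<Longrightarrow> 0 < t \<Longrightarrow> t \<le> 1 \<Longrightarrow> \<Phi> Z t \<in> X"
  using has_integral_\<Phi> by (simp add: has_integral_in_def)

text \<open>The weight \<open>sqrt t * exp (- \<mu> * t)\<close> cancels exactly the
  \<open>1 / sqrt t\<close> and \<open>exp (\<mu> * t)\<close> of the integral bound.\<close>

lemma \<Phi>_diff_bound:
  assumes Z: "Z \<in> states" "Z' \<in> states" and t: "0 < t" "t \<le> 1"
    and m: "\<And>s. s \<in> {0<..1} \<Longrightarrow> sqrt s * exp (- \<mu> * s) * N (Z s - Z' s) \<le> m" "0 \<le> m"
    and K: "\<And>x. 0 < x \<Longrightarrow> x \<le> 1 \<Longrightarrow> x powr (- a) * exp (- \<mu> * x) \<le> K * x powr (- (a + \<theta>))" "0 \<le> K"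
  shows "sqrt t * exp (- \<mu> * t) * N (\<Phi> Z t - \<Phi> Z' t) \<le> C * K * D * m"
proof -
  have nn: "0 \<le> C * m * exp (\<mu> * t) * K * (D / sqrt t)"
    using C_bounds(1) m K D_bounds(1) t by simp
  have "ennreal (N (\<Phi> Z t - \<Phi> Z' t)) \<le> ennreal (C * m * exp (\<mu> * t) * K * (D / sqrt t))"
    by (rule order_trans[OF X.has_integral_in_bound_diff[OF has_integral_\<Phi>[OF Z(1) t] has_integral_\<Phi>[OF Z(2) t]] integral_diff_bound[OF Z t m K]])
  then have "N (\<Phi> Z t - \<Phi> Z' t) \<le> C * m * exp (\<mu> * t) * K * (D / sqrt t)"
    using nn by (simp only: ennreal_le_iff)
  then have "sqrt t * exp (- \<mu> * t) * N (\<Phi> Z t - \<Phi> Z' t) \<le> sqrt t * exp (- \<mu> * t) * (C * m * exp (\<mu> * t) * K * (D / sqrt t))"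
    using t by (intro mult_left_mono) auto
  also have "\<dots> = C * K * D * m"
    using t by (simp add: exp_minus)
  finally show ?thesis .
qed

lemma \<Phi>_zero:
  assumes t: "0 < t" "t \<le> 1"
  shows "N (\<Phi> (\<lambda>t. 0) t) = 0"
proof -
  have "N (\<Phi> (\<lambda>t. 0) t) \<le> 0"
    using X.has_integral_in_bound[OF has_integral_\<Phi>[OF zero_state t]] by (simp add: integrand_zero ennreal_eq_0_iff)
  moreover have "0 \<le> N (\<Phi> (\<lambda>t. 0) t)"
    by (intro X.N_nonneg \<Phi>_mem zero_state t)
  ultimately show ?thesis by linarith
qed

end

lemma ennreal_add_mult_add:
  assumes "0 \<le> h" "0 \<le> b" "0 \<le> x" "0 \<le> y"
  shows "ennreal (h + b * (x + y)) = ennreal h + ennreal b * (ennreal x + ennreal y)"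
  using assms by (simp add: ennreal_mult)

context mild_setting
begin

sublocale KM: seminormed_integration "W1_kernels Q :: ('a \<Rightarrow> real \<times> 'a) set" "kernel_norm Q" M
  by (intro seminormed_integration_lebesgue_on Ker.seminormed_space_axioms)

lemma weight_borel: "(\<lambda>s. s powr (- 1 / 2) * w s) \<in> borel_measurable M"
proof -
  have "(\<lambda>s. s powr (- 1 / 2)) \<in> borel_measurable M"
    by (rule borel_measurable_lebesgue_onI) measurable
  then show ?thesis
    using w_borel by measurable
qed

text \<open>The singular bound at \<open>t = 1\<close>, where the kernel is at least 1 for
  \<open>s < 1\<close>.\<close>

lemma weight_integral: "(\<integral>\<^sup>+s. ennreal (s powr (- 1 / 2) * w s) \<partial>M) \<le> ennreal D"
proof -
  have "(\<integral>\<^sup>+s. ennreal (s powr (- 1 / 2) * w s) \<partial>M) \<le> (\<integral>\<^sup>+s. ennreal (sing (a + \<theta>) 1 s * s powr (- 1 / 2) * w s) \<partial>M)"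
  proof (rule nn_integral_mono_AE)
    show "AE s in M. ennreal (s powr (- 1 / 2) * w s) \<le> ennreal (sing (a + \<theta>) 1 s * s powr (- 1 / 2) * w s)"
      using w_AE_nonneg AE_lebesgue_on_neq[of 1 0 1] AE_space
    proof eventually_elim
      case (elim s)
      then have s: "0 < 1 - s" "1 - s \<le> 1" by auto
      have "(1 - s) powr 0 \<le> (1 - s) powr (- (a + \<theta>))"
        using s a_ge \<theta>_bounds(1) by (intro powr_mono') auto
      then have "1 \<le> sing (a + \<theta>) 1 s"
        using s by (simp add: sing_def)
      then have "1 * (s powr (- 1 / 2) * w s) \<le> sing (a + \<theta>) 1 s * (s powr (- 1 / 2) * w s)"
        using elim by (intro mult_right_mono) auto
      then show ?case by (intro ennreal_leI) (simp add: mult.assoc)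
    qed
  qed
  also have "\<dots> \<le> ennreal (D / sqrt 1)"
    by (rule D_bounds(2)) auto
  finally show ?thesis by simp
qed

text \<open>Raising the exponent by \<open>\<theta>\<close> leaves
  \<open>(t - s) powr \<theta>\<close>, a small factor when \<open>s\<close> is near
  \<open>t\<close>.\<close>

lemma sing_split:
  assumes "t - s \<le> \<delta>"
  shows "sing a t s \<le> \<delta> powr \<theta> * sing (a + \<theta>) t s"
proof (cases "s < t")
  case True
  then have "(t - s) powr (- a) = (t - s) powr \<theta> * (t - s) powr (- (a + \<theta>))"
    by (simp flip: powr_add)
  also have "\<dots> \<le> \<delta> powr \<theta> * (t - s) powr (- (a + \<theta>))"
    using True assms \<theta>_bounds(1) by (intro mult_right_mono powr_mono2) auto
  finally show ?thesis using True by (simp add: sing_def)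
qed (simp add: sing_def)

lemma integrand_time_diff:
  assumes "u s \<in> Lp_space lebesgue r" "Z s \<in> X"
  shows "N (integrand Z t s - integrand Z t' s) \<le> kernel_norm Q (hk (t - s) - hk (t' - s)) * (w s * N (Z s))"
proof -
  have "N (integrand Z t s - integrand Z t' s) \<le> kernel_norm Q (hk (t - s) - hk (t' - s)) * source_norm Q (src Z s)"
    using conv2_diff_bound[OF Q hk_kernel(1) hk_kernel(1) src_mem[of s Z, OF assms] src_mem[of s Z, OF assms], of "t - s" "t' - s"]
    by (simp add: integrand_def)
  also have "\<dots> \<le> kernel_norm Q (hk (t - s) - hk (t' - s)) * (w s * N (Z s))"
    by (intro mult_left_mono src_bound assms Ker.N_nonneg Ker.diff_mem hk_mem)
  finally show ?thesis .
qed

text \<open>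
  The singularity of the kernel at \<open>s = t\<close> is cut out: away from it dominated convergence applies, and
  near it the exponent \<open>\<theta>\<close> left over in the integrability of the kernel gives a small factor.
\<close>

lemma \<Phi>_continuous:
  assumes Z: "Z \<in> states" and t: "t \<in> {0<..1}" and tn: "\<And>n. tn n \<in> {0<..1}" and lim: "tn \<longlonglongrightarrow> t"
  shows "(\<lambda>n. N (\<Phi> Z (tn n) - \<Phi> Z t)) \<longlonglongrightarrow> 0"
proof (rule LIMSEQ_I)
  fix e :: real assume e: "e > 0"
  obtain R where R: "R \<ge> 0" "\<And>t. t \<in> {0<..1} \<Longrightarrow> sqrt t * N (Z t) \<le> R"
    using states_bound[OF Z] by metis
  let ?G = "\<lambda>s. s powr (- 1 / 2) * w s"
  define c where "c n s = kernel_norm Q (hk (tn n - s) - hk (t - s))" for n s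
  have c0: "0 \<le> c n s" for n s
    unfolding c_def by (intro Ker.N_nonneg Ker.diff_mem hk_mem)
  have c_borel: "c n \<in> borel_measurable M" for n
    unfolding c_def[abs_def] by (intro KM.sm_measurable KM.sm_diff hk_sm)
  \<comment> \<open>Bounds the contribution near the singularity up to the factor
    \<open>(2 * \<delta>) powr \<theta>\<close>; the 3 collects \<open>2 * D / sqrt t\<close> from
    time \<open>tn n\<close> and \<open>D / sqrt t\<close> from time \<open>t\<close>, and the 1
    permits division by \<open>A\<close>.\<close>
  define A where "A = C * R * (3 * D / sqrt t) + 1"
  have A: "A > 0" "C * R * (3 * D / sqrt t) \<le> A"
    using C_bounds(1) R(1) D_bounds(1) t by (auto simp: A_def intro!: add_nonneg_pos)
  \<comment> \<open>Solves \<open>(2 * \<delta>) powr \<theta> * A \<le> e / 4\<close>, and keeps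
    the singular zone away from time 0.\<close>
  define \<delta> where "\<delta> = min (t / 2) ((e / (4 * A)) powr (1 / \<theta>) / 2)"
  have \<delta>: "\<delta> > 0" "\<delta> \<le> t / 2"
    using t e A by (auto simp: \<delta>_def)
  have "(2 * \<delta>) powr \<theta> \<le> ((e / (4 * A)) powr (1 / \<theta>)) powr \<theta>"
    using \<delta> \<theta>_bounds(1) by (intro powr_mono2) (auto simp: \<delta>_def)
  also have "\<dots> = e / (4 * A)"
    using e A \<theta>_bounds(1) by (simp add: powr_powr)
  finally have \<delta>_small: "(2 * \<delta>) powr \<theta> * A \<le> e / 4"
    using A by (simp add: field_simps)
  have "eventually (\<lambda>n. dist (tn n) t < \<delta> / 2) sequentially"
    using lim \<delta> by (intro tendstoD) auto
  then obtain n0 where n0: "\<And>n. n \<ge> n0 \<Longrightarrow> \<bar>tn n - t\<bar> < \<delta> / 2"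
    by (auto simp: eventually_sequentially dist_real_def)
  \<comment> \<open>The regular part of the bound. For \<open>n \<ge> n0\<close> both elapsed times
    are at least \<open>\<delta> / 2\<close> where it is nonzero, which gives the constant majorant
    of the kernels.\<close>
  define h where "h n s = (if s \<le> t - \<delta> then c n s else 0) * (R * ?G s)" for n s
  have h_borel: "h n \<in> borel_measurable M" for n
  proof -
    have "(\<lambda>s. if s \<le> t - \<delta> then c n s else 0) \<in> borel_measurable M"
    proof (intro measurable_If c_borel borel_measurable_const)
      have "(\<lambda>s. s) \<in> borel_measurable M"
        by (rule borel_measurable_lebesgue_onI) simp
      then show "{s \<in> space M. s \<le> t - \<delta>} \<in> sets M" by measurable
    qed
    then show ?thesis
      unfolding h_def[abs_def]
      by (rule borel_measurable_times[OF _ borel_measurable_times[OF borel_measurable_const weight_borel]])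
  qed
  have "(\<lambda>n. \<integral>\<^sup>+s. ennreal (h (n + n0) s) \<partial>M) \<longlonglongrightarrow> (\<integral>\<^sup>+s. 0 \<partial>M)"
  proof (rule nn_integral_dominated_convergence)
    let ?b = "2 * (C * (\<delta> / 2) powr (- a)) * R"
    show "(\<lambda>s. ennreal (h (n + n0) s)) \<in> borel_measurable M" for n
      using h_borel by measurable
    show "(\<lambda>s. ennreal ?b * ennreal (?G s)) \<in> borel_measurable M"
      by (intro borel_measurable_times_ennreal borel_measurable_const measurable_compose[OF weight_borel measurable_ennreal])
    have "(\<integral>\<^sup>+s. ennreal ?b * ennreal (?G s) \<partial>M) = ennreal ?b * (\<integral>\<^sup>+s. ennreal (?G s) \<partial>M)"
      by (intro nn_integral_cmult measurable_compose[OF weight_borel measurable_ennreal])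
    also have "\<dots> \<le> ennreal ?b * ennreal D"
      by (intro mult_left_mono weight_integral) simp
    also have "\<dots> < \<infinity>"
      by (simp add: ennreal_mult_less_top)
    finally show "(\<integral>\<^sup>+s. ennreal ?b * ennreal (?G s) \<partial>M) < \<infinity>" .
    show "AE s in M. ennreal (h (n + n0) s) \<le> ennreal ?b * ennreal (?G s)" for n
      using w_AE_nonneg AE_space
    proof eventually_elim
      case (elim s)
      then have G: "0 \<le> ?G s" and s: "0 \<le> s" by auto
      have "h (n + n0) s \<le> ?b * ?G s"
      proof (cases "s \<le> t - \<delta>")
        case True
        have k: "kernel_norm Q (hk x) \<le> C * (\<delta> / 2) powr (- a)" if "\<delta> / 2 \<le> x" "x \<le> 1" for x
        proof -
          have "kernel_norm Q (hk x) \<le> C * x powr (- a)"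
            using that \<delta> by (intro C_bounds) auto
          also have "\<dots> \<le> C * (\<delta> / 2) powr (- a)"
            using that \<delta> C_bounds(1) a_ge by (intro mult_left_mono powr_mono2') auto
          finally show ?thesis .
        qed
        have "c (n + n0) s \<le> kernel_norm Q (hk (tn (n + n0) - s)) + kernel_norm Q (hk (t - s))"
          unfolding c_def by (intro Ker.N_diff_le hk_mem)
        also have "\<dots> \<le> C * (\<delta> / 2) powr (- a) + C * (\<delta> / 2) powr (- a)"
        proof (intro add_mono k)
          have "\<bar>tn (n + n0) - t\<bar> < \<delta> / 2" by (rule n0) simp
          then show "\<delta> / 2 \<le> tn (n + n0) - s" using True by linarith
        qed (use True \<delta> s t tn[of "n + n0"] in auto)
        finally have "c (n + n0) s * (R * ?G s) \<le> (2 * (C * (\<delta> / 2) powr (- a))) * (R * ?G s)"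
          using R(1) G by (intro mult_right_mono) auto
        then show ?thesis using True by (simp add: h_def mult.assoc)
      next
        case False
        then show ?thesis
          using C_bounds(1) R(1) G by (simp add: h_def)
      qed
      then have "ennreal (h (n + n0) s) \<le> ennreal (?b * ?G s)"
        by (rule ennreal_leI)
      also have "\<dots> = ennreal ?b * ennreal (?G s)"
        using C_bounds(1) R(1) by (intro ennreal_mult') auto
      finally show ?case .
    qed
    show "AE s in M. (\<lambda>n. ennreal (h (n + n0) s)) \<longlonglongrightarrow> 0"
      using AE_space
    proof eventually_elim
      case (elim s)
      have "(\<lambda>n. h n s) \<longlonglongrightarrow> 0"
      proof (cases "s \<le> t - \<delta>")
        case True
        have "(\<lambda>n. c n s) \<longlonglongrightarrow> 0"
          unfolding c_def using True \<delta> by (intro hk_continuous tendsto_intros lim) auto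
        then have "(\<lambda>n. c n s * (R * ?G s)) \<longlonglongrightarrow> 0 * (R * ?G s)"
          by (intro tendsto_mult tendsto_const)
        then show ?thesis using True by (simp add: h_def)
      qed (simp add: h_def)
      then have "(\<lambda>n. h (n + n0) s) \<longlonglongrightarrow> 0"
        by (rule LIMSEQ_ignore_initial_segment)
      then show ?case
        by (metis ennreal_0 tendsto_ennrealI)
    qed
  qed auto
  then have "eventually (\<lambda>n. (\<integral>\<^sup>+s. ennreal (h (n + n0) s) \<partial>M) < ennreal (e / 4)) sequentially"
    using e by (intro order_tendstoD(2)) auto
  then obtain n1 where n1: "\<And>n. n \<ge> n1 \<Longrightarrow> (\<integral>\<^sup>+s. ennreal (h (n + n0) s) \<partial>M) < ennreal (e / 4)"
    by (auto simp: eventually_sequentially)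
  have "norm (N (\<Phi> Z (tn n) - \<Phi> Z t) - 0) < e" if n: "n \<ge> n0 + n1" for n
  proof -
    have nn0: "\<bar>tn n - t\<bar> < \<delta> / 2" using n0[of n] n by simp
    have hn: "(\<integral>\<^sup>+s. ennreal (h n s) \<partial>M) < ennreal (e / 4)"
      using n1[of "n - n0"] n by simp
    let ?B = "C * (2 * \<delta>) powr \<theta> * R"
    have B0: "0 \<le> ?B" using C_bounds(1) R(1) by simp
    let ?s1 = "\<lambda>s. sing (a + \<theta>) (tn n) s * s powr (- 1 / 2) * w s" and ?s2 = "\<lambda>s. sing (a + \<theta>) t s * s powr (- 1 / 2) * w s"
    have sm: "(\<lambda>s. ennreal (sing (a + \<theta>) t s * s powr (- 1 / 2) * w s)) \<in> borel_measurable M" for t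
    proof -
      have "(\<lambda>s. sing (a + \<theta>) t s * (s powr (- 1 / 2) * w s)) \<in> borel_measurable M"
        by (rule borel_measurable_times[OF borel_measurable_lebesgue_onI[OF sing_borel] weight_borel])
      then show ?thesis by (simp add: mult.assoc)
    qed
    have "ennreal (N (\<Phi> Z (tn n) - \<Phi> Z t)) \<le> (\<integral>\<^sup>+s. ennreal (N (integrand Z (tn n) s - integrand Z t s)) \<partial>M)"
      using tn[of n] t by (intro X.has_integral_in_bound_diff has_integral_\<Phi> Z) auto
    also have "\<dots> \<le> (\<integral>\<^sup>+s. ennreal (h n s) + ennreal ?B * (ennreal (?s1 s) + ennreal (?s2 s)) \<partial>M)"
    proof (rule nn_integral_mono_AE)
      show "AE s in M. ennreal (N (integrand Z (tn n) s - integrand Z t s)) \<le> ennreal (h n s) + ennreal ?B * (ennreal (?s1 s) + ennreal (?s2 s))"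
        using u_AE w_AE_nonneg AE_lebesgue_on_neq[of 0 0 1] AE_space
      proof eventually_elim
        case (elim s)
        then have s: "0 < s" "s \<le> 1" by auto
        have G: "0 \<le> ?G s" using elim by simp
        have ZX: "Z s \<in> X" using statesD(3)[OF Z, of s] s by simp
        have "N (Z s) \<le> R * s powr (- 1 / 2)"
          using R(2)[of s] s by (simp add: powr_minus_divide powr_half_sqrt field_simps)
        then have "w s * N (Z s) \<le> w s * (R * s powr (- 1 / 2))"
          using elim by (intro mult_left_mono) auto
        then have wN: "w s * N (Z s) \<le> R * ?G s" by (simp add: ac_simps)
        have "N (integrand Z (tn n) s - integrand Z t s) \<le> c n s * (w s * N (Z s))"
          unfolding c_def using elim ZX by (intro integrand_time_diff) auto
        also have "\<dots> \<le> c n s * (R * ?G s)"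
          using wN c0 by (rule mult_left_mono)
        also have "\<dots> \<le> h n s + ?B * (?s1 s + ?s2 s)"
        proof (cases "s \<le> t - \<delta>")
          case True
          have "0 \<le> ?B * (?s1 s + ?s2 s)"
            using elim by (intro mult_nonneg_nonneg[OF B0] add_nonneg_nonneg) auto
          then show ?thesis
            using True by (simp add: h_def)
        next
          case False
          then have near: "tn n - s \<le> 2 * \<delta>" "t - s \<le> 2 * \<delta>"
            using nn0 \<delta> by linarith+
          have "c n s \<le> kernel_norm Q (hk (tn n - s)) + kernel_norm Q (hk (t - s))"
            unfolding c_def by (intro Ker.N_diff_le hk_mem)
          also have "\<dots> \<le> C * sing a (tn n) s + C * sing a t s"
            using s t tn[of n] by (intro add_mono hk_sing) auto
          also have "\<dots> \<le> C * ((2 * \<delta>) powr \<theta> * sing (a + \<theta>) (tn n) s) + C * ((2 * \<delta>) powr \<theta> * sing (a + \<theta>) t s)"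
            using C_bounds(1) near by (intro add_mono mult_left_mono sing_split) auto
          finally have "c n s * (R * ?G s) \<le>
              (C * ((2 * \<delta>) powr \<theta> * sing (a + \<theta>) (tn n) s) + C * ((2 * \<delta>) powr \<theta> * sing (a + \<theta>) t s)) * (R * ?G s)"
            using R(1) G by (intro mult_right_mono) auto
          also have "\<dots> = ?B * (?s1 s + ?s2 s)"
            by (simp add: algebra_simps)
          finally show ?thesis using False by (simp add: h_def)
        qed
        finally have "ennreal (N (integrand Z (tn n) s - integrand Z t s)) \<le> ennreal (h n s + ?B * (?s1 s + ?s2 s))"
          by (rule ennreal_leI)
        also have "\<dots> = ennreal (h n s) + ennreal ?B * (ennreal (?s1 s) + ennreal (?s2 s))"
        proof -
          have "0 \<le> h n s" using c0 R(1) G by (simp add: h_def)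
          moreover have "0 \<le> ?s1 s" "0 \<le> ?s2 s" using elim by auto
          ultimately show ?thesis using B0 by (intro ennreal_add_mult_add)
        qed
        finally show ?case .
      qed
    qed
    also have "\<dots> = (\<integral>\<^sup>+s. ennreal (h n s) \<partial>M) + ennreal ?B * ((\<integral>\<^sup>+s. ennreal (?s1 s) \<partial>M) + (\<integral>\<^sup>+s. ennreal (?s2 s) \<partial>M))"
      using h_borel[of n] sm[of "tn n"] sm[of t] by (subst nn_integral_add) (auto simp: nn_integral_cmult nn_integral_add)
    also have "\<dots> \<le> ennreal (e / 4) + ennreal ?B * (ennreal (2 * D / sqrt t) + ennreal (D / sqrt t))"
    proof (intro add_mono mult_left_mono)
      \<comment> \<open>This makes \<open>1 / sqrt (tn n)\<close> at most \<open>2 / sqrt t\<close>,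
        so the singular bound at \<open>tn n\<close> is uniform in \<open>n\<close>.\<close>
      have tnt: "t / 4 \<le> tn n" using nn0 \<delta> by linarith
      then have "sqrt t / 2 \<le> sqrt (tn n)"
        using real_sqrt_le_mono[OF tnt] by (simp add: real_sqrt_divide)
      then have "D / sqrt (tn n) \<le> D / (sqrt t / 2)"
        using t D_bounds(1) tn[of n] by (intro divide_left_mono mult_pos_pos) auto
      then have "ennreal (D / sqrt (tn n)) \<le> ennreal (2 * D / sqrt t)"
        by (intro ennreal_leI) (simp add: mult.commute)
      then show "(\<integral>\<^sup>+s. ennreal (?s1 s) \<partial>M) \<le> ennreal (2 * D / sqrt t)"
        using D_bounds(2)[of "tn n"] tn[of n] by (meson greaterThanAtMost_iff order_trans)
      show "(\<integral>\<^sup>+s. ennreal (?s2 s) \<partial>M) \<le> ennreal (D / sqrt t)"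
        using t by (intro D_bounds) auto
    qed (use hn in auto)
    also have "\<dots> = ennreal (e / 4 + ?B * (2 * D / sqrt t + D / sqrt t))"
    proof -
      have "0 \<le> 2 * D / sqrt t" "0 \<le> D / sqrt t" using D_bounds(1) t by auto
      then show ?thesis
        using B0 e by (intro ennreal_add_mult_add[symmetric]) auto
    qed
    finally have le: "ennreal (N (\<Phi> Z (tn n) - \<Phi> Z t)) \<le> ennreal (e / 4 + ?B * (2 * D / sqrt t + D / sqrt t))" .
    have "?B * (2 * D / sqrt t + D / sqrt t) = (2 * \<delta>) powr \<theta> * (C * R * (3 * D / sqrt t))"
      by (simp add: add_divide_distrib[symmetric])
    also have "\<dots> \<le> (2 * \<delta>) powr \<theta> * A"
      using A(2) by (intro mult_left_mono) auto
    also note \<delta>_small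
    finally have "e / 4 + ?B * (2 * D / sqrt t + D / sqrt t) \<le> e / 2" by simp
    then have "ennreal (N (\<Phi> Z (tn n) - \<Phi> Z t)) \<le> ennreal (e / 2)"
      by (intro order_trans[OF le] ennreal_leI)
    then have "N (\<Phi> Z (tn n) - \<Phi> Z t) \<le> e / 2"
      using e by (subst (asm) ennreal_le_iff) auto
    moreover have "0 \<le> N (\<Phi> Z (tn n) - \<Phi> Z t)"
      using tn[of n] t by (intro X.N_nonneg X.diff_mem \<Phi>_mem Z) auto
    ultimately show ?thesis using e by simp
  qed
  then show "\<exists>n0. \<forall>n\<ge>n0. norm (N (\<Phi> Z (tn n) - \<Phi> Z t) - 0) < e" by blast
qed

lemma conv_f0: "conv k f0 = conv2 k (0, f0)"
proof -
  have "conv k 0 = 0"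
    by (simp add: conv_def fun_eq_iff)
  then show ?thesis by (simp add: conv2_def)
qed

lemma f0_source: "(0, f0) \<in> source_space Q" "source_norm Q (0, f0) = NQ f0"
proof -
  have z: "(0 :: 'a \<Rightarrow> real) \<in> Lp_space lebesgue 1"
    unfolding Lp_space_1 zero_fun_def by simp
  then show "(0, f0) \<in> source_space Q"
    using f0 by (simp add: source_space_def)
  show "source_norm Q (0, f0) = NQ f0"
    by (simp add: source_norm_def Lp_norm_1)
qed

lemma heat_f0_mem: "conv (hk t) f0 \<in> X"
  unfolding conv_f0 by (intro conv2_W1 Q hk_mem f0_source)

lemma heat_f0_bound:
  assumes "0 < t" "t \<le> 1"
  shows "sqrt t * N (conv (hk t) f0) \<le> C * NQ f0"
proof -
  have "N (conv (hk t) f0) \<le> Lp_norm lebesgue 1 (hk t) * NQ f0"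
    using conv_Young(3)[OF Q hk_kernel(2)[of t], of f0 "Lp_norm lebesgue 1 (hk t) * NQ f0"] hk_kernel(3)[of t] f0 by auto
  also have "\<dots> \<le> (C * t powr (- 1 / 2)) * NQ f0"
    using C_bounds(3)[OF assms] by (intro mult_right_mono LQ.N_nonneg f0) auto
  finally have "sqrt t * N (conv (hk t) f0) \<le> sqrt t * ((C * t powr (- 1 / 2)) * NQ f0)"
    using assms by (intro mult_left_mono) auto
  also have "\<dots> = C * NQ f0"
    using assms by (simp add: powr_minus_divide powr_half_sqrt)
  finally show ?thesis .
qed

section \<open>The contraction and its fixed point\<close>

definition \<Psi> :: "(real \<Rightarrow> 'a \<Rightarrow> real \<times> 'a) \<Rightarrow> real \<Rightarrow> 'a \<Rightarrow> real \<times> 'a" where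
  "\<Psi> Z t = (if 0 < t \<and> t \<le> 1 then conv (hk t) f0 + \<Phi> Z t else 0)"

text \<open>The heat term inherits continuity from the kernel at positive times; the weighted bound
  of the Duhamel term is the difference estimate against the zero state with
  \<open>\<mu> = 0\<close>.\<close>

lemma \<Psi>_state:
  assumes Z: "Z \<in> states"
  shows "\<Psi> Z \<in> states"
proof -
  obtain R where R: "R \<ge> 0" "\<And>t. t \<in> {0<..1} \<Longrightarrow> sqrt t * N (Z t) \<le> R"
    using states_bound[OF Z] by metis
  have mem: "\<Psi> Z t \<in> X" if "t \<in> {0<..1}" for t
    using that by (auto simp: \<Psi>_def intro!: X.add_mem heat_f0_mem \<Phi>_mem Z)
  have "continuous_on_in {0<..1} X N (\<Psi> Z)"
  proof (rule X.continuous_on_inI)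
    fix t :: real and s assume t: "t \<in> {0<..1}" and s: "s \<longlonglongrightarrow> t" "\<And>n. s n \<in> {0<..1}"
    have "(\<lambda>n. kernel_norm Q (hk (s n) - hk t) * NQ f0 + N (\<Phi> Z (s n) - \<Phi> Z t)) \<longlonglongrightarrow> 0 * NQ f0 + 0"
      using t s by (intro tendsto_intros hk_continuous \<Phi>_continuous Z) auto
    then have lim: "(\<lambda>n. kernel_norm Q (hk (s n) - hk t) * NQ f0 + N (\<Phi> Z (s n) - \<Phi> Z t)) \<longlonglongrightarrow> 0"
      by simp
    show "(\<lambda>n. N (\<Psi> Z (s n) - \<Psi> Z t)) \<longlonglongrightarrow> 0"
    proof (rule LIMSEQ_0_le[OF lim])
      fix n
      show "0 \<le> N (\<Psi> Z (s n) - \<Psi> Z t)"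
        using mem t s by (intro X.N_nonneg X.diff_mem) auto
      have eq: "\<Psi> Z (s n) - \<Psi> Z t = (conv (hk (s n)) f0 - conv (hk t) f0) + (\<Phi> Z (s n) - \<Phi> Z t)"
        using t s(2)[of n] by (simp add: \<Psi>_def)
      have "N (\<Psi> Z (s n) - \<Psi> Z t) \<le> N (conv (hk (s n)) f0 - conv (hk t) f0) + N (\<Phi> Z (s n) - \<Phi> Z t)"
        unfolding eq using t s(2)[of n] by (intro X.triangle X.diff_mem heat_f0_mem \<Phi>_mem Z) auto
      moreover have "N (conv (hk (s n)) f0 - conv (hk t) f0) \<le> kernel_norm Q (hk (s n) - hk t) * NQ f0"
        using conv2_diff_bound[OF Q hk_kernel(1)[of "s n"] hk_kernel(1)[of t] f0_source(1) f0_source(1)]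
        by (simp only: conv_f0 f0_source(2) diff_self H.N_zero mult_zero_right add_0_right)
      ultimately show "N (\<Psi> Z (s n) - \<Psi> Z t) \<le> kernel_norm Q (hk (s n) - hk t) * NQ f0 + N (\<Phi> Z (s n) - \<Phi> Z t)"
        by linarith
    qed
  qed (rule mem)
  moreover have "sqrt t * N (\<Psi> Z t) \<le> C * NQ f0 + C * 1 * D * R" if t: "t \<in> {0<..1}" for t
  proof -
    have t': "0 < t" "t \<le> 1" using t by auto
    have "sqrt t * exp (- 0 * t) * N (\<Phi> Z t - \<Phi> (\<lambda>t. 0) t) \<le> C * 1 * D * R"
      using R by (intro \<Phi>_diff_bound Z zero_state t' K_one) auto
    moreover have "N (\<Phi> Z t) \<le> N (\<Phi> (\<lambda>t. 0) t) + N (\<Phi> Z t - \<Phi> (\<lambda>t. 0) t)"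
      by (intro X.N_le_add_diff \<Phi>_mem Z zero_state t')
    then have "sqrt t * N (\<Phi> Z t) \<le> sqrt t * N (\<Phi> Z t - \<Phi> (\<lambda>t. 0) t)"
      using t' \<Phi>_zero[OF t'] by (intro mult_left_mono) auto
    moreover have "N (\<Psi> Z t) \<le> N (conv (hk t) f0) + N (\<Phi> Z t)"
      unfolding \<Psi>_def using t' by (auto intro!: X.triangle heat_f0_mem \<Phi>_mem Z)
    then have "sqrt t * N (\<Psi> Z t) \<le> sqrt t * N (conv (hk t) f0) + sqrt t * N (\<Phi> Z t)"
      using mult_left_mono[of _ _ "sqrt t"] t' by (fastforce simp: distrib_left[symmetric])
    ultimately show ?thesis
      using heat_f0_bound[OF t'] by simp
  qed
  moreover have "\<Psi> Z 0 = 0"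
    by (simp add: \<Psi>_def)
  ultimately show ?thesis
    unfolding states_def by blast
qed

text \<open>Chosen so that \<open>\<mu> powr (- \<theta>)\<close> is
  \<open>1 / (2 * C * D + 1)\<close>, which brings the factor
  \<open>C * \<mu> powr (- \<theta>) * D\<close> below one half.\<close>

definition \<mu> :: real where "\<mu> = (2 * C * D + 1) powr (1 / \<theta>)"

lemma contraction:
  assumes Z: "Z \<in> states" "Z' \<in> states" and t: "t \<in> {0<..1}"
    and m: "\<And>s. s \<in> {0<..1} \<Longrightarrow> sqrt s * exp (- \<mu> * s) * N (Z s - Z' s) \<le> m" "0 \<le> m"
  shows "sqrt t * exp (- \<mu> * t) * N (\<Psi> Z t - \<Psi> Z' t) \<le> m / 2"
proof -
  have CD: "0 \<le> C * D" using C_bounds(1) D_bounds(1) by simp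
  then have \<mu>: "\<mu> > 0" by (simp add: \<mu>_def)
  have \<mu>': "\<mu> powr (- \<theta>) = 1 / (2 * C * D + 1)"
    using CD \<theta>_bounds(1) by (simp add: \<mu>_def powr_powr powr_minus_divide)
  have "\<Psi> Z t - \<Psi> Z' t = \<Phi> Z t - \<Phi> Z' t"
    using t by (simp add: \<Psi>_def)
  moreover have "sqrt t * exp (- \<mu> * t) * N (\<Phi> Z t - \<Phi> Z' t) \<le> C * \<mu> powr (- \<theta>) * D * m"
    using t by (intro \<Phi>_diff_bound Z m K_exp \<mu>) auto
  moreover have "C * \<mu> powr (- \<theta>) * D * m \<le> m / 2"
  proof -
    have "C * \<mu> powr (- \<theta>) * D \<le> 1 / 2"
      unfolding \<mu>' using CD by (simp add: field_simps)
    then show ?thesis using mult_right_mono[OF _ m(2)] by fastforce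
  qed
  ultimately show ?thesis by simp
qed

lemma weight_le_zero:
  assumes t: "t \<in> {0<..1}" and x: "x \<in> X" and lim: "y \<longlonglongrightarrow> 0" and le: "\<And>n :: nat. sqrt t * exp (- \<mu> * t) * N x \<le> y n"
  shows "N x = 0"
proof -
  have "sqrt t * exp (- \<mu> * t) * N x \<le> 0"
    by (rule LIMSEQ_le_const[OF lim]) (use le in auto)
  moreover have "0 < sqrt t * exp (- \<mu> * t)" using t by simp
  ultimately have "N x \<le> 0" by (meson mult_pos_pos not_le)
  with X.N_nonneg[OF x] show ?thesis by linarith
qed

text \<open>The contraction applied \<open>n\<close> times improves the crude bound
  \<open>R + R'\<close> to \<open>(R + R') / 2 ^ n\<close>. Fixed points are such only up to
  seminorm 0, so the norms of the differences are compared, not the states.\<close>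

lemma fixed_point_unique:
  assumes Z: "Z \<in> states" "Z' \<in> states"
    and fp: "\<And>t. t \<in> {0<..1} \<Longrightarrow> N (Z t - \<Psi> Z t) = 0" "\<And>t. t \<in> {0<..1} \<Longrightarrow> N (Z' t - \<Psi> Z' t) = 0"
    and t: "t \<in> {0<..1}"
  shows "N (Z t - Z' t) = 0"
proof -
  have mem: "Z s \<in> X" "Z' s \<in> X" "\<Psi> Z s \<in> X" "\<Psi> Z' s \<in> X" if "s \<in> {0<..1}" for s
    using that statesD(3)[of _ s] Z \<Psi>_state by auto
  obtain R where R: "R \<ge> 0" "\<And>t. t \<in> {0<..1} \<Longrightarrow> sqrt t * N (Z t) \<le> R"
    using states_bound[OF Z(1)] by metis
  obtain R' where R': "R' \<ge> 0" "\<And>t. t \<in> {0<..1} \<Longrightarrow> sqrt t * N (Z' t) \<le> R'"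
    using states_bound[OF Z(2)] by metis
  have "0 \<le> \<mu>" by (simp add: \<mu>_def)
  have *: "sqrt s * exp (- \<mu> * s) * N (Z s - Z' s) \<le> (R + R') / 2 ^ n" if "s \<in> {0<..1}" for s n
    using that
  proof (induction n arbitrary: s)
    case 0
    have "N (Z s - Z' s) \<le> N (Z s) + N (Z' s)"
      by (intro X.N_diff_le mem 0)
    then have "sqrt s * N (Z s - Z' s) \<le> sqrt s * N (Z s) + sqrt s * N (Z' s)"
      using 0 by (simp add: distrib_left[symmetric])
    then have le: "sqrt s * N (Z s - Z' s) \<le> R + R'"
      using R(2)[OF 0] R'(2)[OF 0] by linarith
    have "exp (- \<mu> * s) * (sqrt s * N (Z s - Z' s)) \<le> 1 * (sqrt s * N (Z s - Z' s))"
      using 0 \<open>0 \<le> \<mu>\<close> by (intro mult_right_mono mult_nonneg_nonneg X.N_nonneg X.diff_mem mem) auto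
    then have A: "exp (- \<mu> * s) * (sqrt s * N (Z s - Z' s)) \<le> sqrt s * N (Z s - Z' s)"
      by (simp only: mult_1_left)
    have eq: "sqrt s * exp (- \<mu> * s) * N (Z s - Z' s) = exp (- \<mu> * s) * (sqrt s * N (Z s - Z' s))"
      by (simp only: ac_simps)
    show ?case
      unfolding power_0 div_by_1 eq using A le by (rule order_trans)
  next
    case (Suc n)
    have "sqrt s * exp (- \<mu> * s) * N (\<Psi> Z s - \<Psi> Z' s) \<le> (R + R') / 2 ^ n / 2"
      using R R' by (intro contraction Z Suc) auto
    moreover have "N (Z s - Z' s) = N (\<Psi> Z s - \<Psi> Z' s)"
    proof (rule X.N_cong)
      have "N (Z s - Z' s - (\<Psi> Z s - \<Psi> Z' s)) = N ((Z s - \<Psi> Z s) - (Z' s - \<Psi> Z' s))"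
        by (simp add: algebra_simps)
      also have "\<dots> \<le> N (Z s - \<Psi> Z s) + N (Z' s - \<Psi> Z' s)"
        by (intro X.N_diff_le X.diff_mem mem Suc)
      finally show "N (Z s - Z' s - (\<Psi> Z s - \<Psi> Z' s)) = 0"
        using fp[OF Suc.prems] X.N_nonneg[OF X.diff_mem[OF X.diff_mem[OF mem(1,2)] X.diff_mem[OF mem(3,4)]], OF Suc.prems Suc.prems Suc.prems Suc.prems]
        by linarith
    qed (intro X.diff_mem mem Suc)+
    ultimately show ?case by (simp only: power_Suc2 divide_divide_eq_left)
  qed
  have "(\<lambda>n. (R + R') / 2 ^ n) \<longlonglongrightarrow> 0"
    by (rule LIMSEQ_divide_realpow_zero) simp
  then show ?thesis
    by (rule weight_le_zero[OF t X.diff_mem[OF mem(1,2)[OF t]]]) (rule *[OF t])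
qed

text \<open>Banach iteration from the zero state, with the limit taken separately at each time. The
  weighted rate is uniform in time, which carries continuity and the bound over to the
  limit.\<close>

lemma fixed_point_exists:
  obtains Z where "Z \<in> states" "\<And>t. t \<in> {0<..1} \<Longrightarrow> N (Z t - \<Psi> Z t) = 0"
proof -
  define Zs where "Zs n = (\<Psi> ^^ n) (\<lambda>t. 0)" for n
  have Zs0: "Zs 0 = (\<lambda>t. 0)" and ZsS: "Zs (Suc n) = \<Psi> (Zs n)" for n
    by (simp_all add: Zs_def)
  have Zs1: "Zs 1 = \<Psi> (Zs 0)"
    using ZsS[of 0] by simp
  have st: "Zs n \<in> states" for n
  proof (induction n)
    case 0
    show ?case unfolding Zs0 by (rule zero_state)
  qed (simp add: ZsS \<Psi>_state)
  have mem: "Zs n t \<in> X" if "t \<in> {0<..1}" for n t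
    using statesD(3)[OF st, of t n] that by auto
  let ?W = "\<lambda>t. sqrt t * exp (- \<mu> * t)"
  have W: "?W t > 0" "?W t \<le> 1" if "t \<in> {0<..1}" for t
  proof -
    show "?W t > 0" using that by simp
    have "sqrt t * exp (- \<mu> * t) \<le> 1 * 1"
      using that by (intro mult_mono) (auto simp: \<mu>_def)
    then show "?W t \<le> 1" by simp
  qed
  obtain m0 where m0: "m0 \<ge> 0" "\<And>t. t \<in> {0<..1} \<Longrightarrow> sqrt t * N (Zs 1 t) \<le> m0"
    using states_bound[OF st[of 1]] by metis
  have step1: "?W t * N (Zs 1 t - Zs 0 t) \<le> m0" if t: "t \<in> {0<..1}" for t
  proof -
    have "exp (- \<mu> * t) * (sqrt t * N (Zs 1 t)) \<le> 1 * (sqrt t * N (Zs 1 t))"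
      using t by (intro mult_right_mono mult_nonneg_nonneg X.N_nonneg mem) (auto simp: \<mu>_def)
    with m0(2)[OF t] show ?thesis by (simp add: Zs0 ac_simps)
  qed
  \<comment> \<open>The geometric series with ratio \<open>1 / 2\<close> in inductive form: half of
    \<open>2 * m0\<close> from the contraction plus \<open>m0\<close> from the first step.\<close>
  have base: "?W t * N (Zs k t - Zs 0 t) \<le> 2 * m0" if "t \<in> {0<..1}" for k t
    using that
  proof (induction k arbitrary: t)
    case 0
    have "N (Zs 0 t - Zs 0 t) = 0" unfolding diff_self by (rule X.N_zero)
    then show ?case using m0(1) by (simp only: mult_zero_right)
  next
    case (Suc k)
    have "?W t * N (Zs (Suc k) t - Zs 1 t) \<le> (2 * m0) / 2"
      unfolding ZsS Zs1 using m0(1) by (intro contraction st Suc) auto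
    moreover have "N (Zs (Suc k) t - Zs 0 t) \<le> N (Zs (Suc k) t - Zs 1 t) + N (Zs 1 t - Zs 0 t)"
      by (intro X.N_diff_triangle mem Suc)
    then have "?W t * N (Zs (Suc k) t - Zs 0 t) \<le> ?W t * (N (Zs (Suc k) t - Zs 1 t) + N (Zs 1 t - Zs 0 t))"
      using W(1)[OF Suc.prems] by (intro mult_left_mono) auto
    ultimately show ?case
      using step1[OF Suc.prems] unfolding distrib_left by linarith
  qed
  have diff: "?W t * N (Zs (n + k) t - Zs n t) \<le> 2 * m0 / 2 ^ n" if "t \<in> {0<..1}" for n k t
    using that
  proof (induction n arbitrary: t)
    case 0
    show ?case using base[OF 0, of k] by (simp only: power_0 div_by_1 add_0)
  next
    case (Suc n)
    have "?W t * N (\<Psi> (Zs (n + k)) t - \<Psi> (Zs n) t) \<le> (2 * m0 / 2 ^ n) / 2"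
      using m0(1) by (intro contraction st Suc) auto
    then show ?case by (simp only: add_Suc ZsS power_Suc2 divide_divide_eq_left)
  qed
  have lim0: "(\<lambda>n. c / 2 ^ n) \<longlonglongrightarrow> 0" for c :: real
    by (rule LIMSEQ_divide_realpow_zero) simp
  have ex: "\<exists>x\<in>X. (\<lambda>n. N (Zs n t - x)) \<longlonglongrightarrow> 0" if t: "t \<in> {0<..1}" for t
  proof -
    have "\<exists>k. \<forall>m\<ge>k. \<forall>n\<ge>k. N (Zs m t - Zs n t) < e" if e: "e > 0" for e
    proof -
      have "eventually (\<lambda>n. (4 * m0 / ?W t) / 2 ^ n < e) sequentially"
        using lim0 e by (rule order_tendstoD)
      then obtain k where k: "(4 * m0 / ?W t) / 2 ^ k < e"
        by (auto simp: eventually_sequentially)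
      have "N (Zs m t - Zs n t) < e" if mn: "m \<ge> k" "n \<ge> k" for m n
      proof -
        have b: "N (Zs j t - Zs k t) \<le> (2 * m0 / ?W t) / 2 ^ k" if "j \<ge> k" for j
        proof -
          have "?W t * N (Zs j t - Zs k t) \<le> 2 * m0 / 2 ^ k"
            using diff[OF t, of k "j - k"] that by simp
          then have "N (Zs j t - Zs k t) \<le> 2 * m0 / 2 ^ k / ?W t"
            unfolding pos_le_divide_eq[OF W(1)[OF t]] by (simp only: mult.commute)
          then show ?thesis by (simp only: divide_divide_eq_left mult.commute)
        qed
        have "N (Zs m t - Zs n t) \<le> N (Zs m t - Zs k t) + N (Zs k t - Zs n t)"
          by (intro X.N_diff_triangle mem t)
        also have "\<dots> \<le> (2 * m0 / ?W t) / 2 ^ k + (2 * m0 / ?W t) / 2 ^ k"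
          using b[OF mn(1)] b[OF mn(2)] X.N_diff_commute[OF mem[OF t] mem[OF t], of k n] by linarith
        also have "\<dots> = (4 * m0 / ?W t) / 2 ^ k" by simp
        finally show ?thesis using k by linarith
      qed
      then show ?thesis by blast
    qed
    then show ?thesis
      using complete_W1_pairs[OF Q, where 'a='a, unfolded complete_seminorm_def, rule_format, of "\<lambda>n. Zs n t"] mem[OF t] by blast
  qed
  define Z where "Z t = (if t \<in> {0<..1} then (SOME x. x \<in> X \<and> (\<lambda>n. N (Zs n t - x)) \<longlonglongrightarrow> 0) else 0)" for t
  have Z: "Z t \<in> X" "(\<lambda>n. N (Zs n t - Z t)) \<longlonglongrightarrow> 0" if t: "t \<in> {0<..1}" for t
  proof -
    have "\<exists>x. x \<in> X \<and> (\<lambda>n. N (Zs n t - x)) \<longlonglongrightarrow> 0"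
      using ex[OF t] by blast
    then have "Z t \<in> X \<and> (\<lambda>n. N (Zs n t - Z t)) \<longlonglongrightarrow> 0"
      unfolding Z_def if_P[OF t] by (rule someI_ex)
    then show "Z t \<in> X" "(\<lambda>n. N (Zs n t - Z t)) \<longlonglongrightarrow> 0" by auto
  qed
  \<comment> \<open>The Cauchy rate survives letting the later index tend to infinity.\<close>
  have ZZ: "?W t * N (Zs n t - Z t) \<le> 2 * m0 / 2 ^ n" if t: "t \<in> {0<..1}" for n t
  proof -
    have "(\<lambda>k. 2 * m0 / 2 ^ n + ?W t * N (Zs (k + n) t - Z t)) \<longlonglongrightarrow> 2 * m0 / 2 ^ n + ?W t * 0"
      by (intro tendsto_intros LIMSEQ_ignore_initial_segment Z t)
    moreover have "?W t * N (Zs n t - Z t) \<le> 2 * m0 / 2 ^ n + ?W t * N (Zs (k + n) t - Z t)" for k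
    proof -
      have "N (Zs n t - Z t) \<le> N (Zs n t - Zs (k + n) t) + N (Zs (k + n) t - Z t)"
        by (intro X.N_diff_triangle mem Z t)
      also have "N (Zs n t - Zs (k + n) t) = N (Zs (n + k) t - Zs n t)"
        using X.N_diff_commute[OF mem[OF t] mem[OF t]] by (simp add: add.commute)
      finally have "?W t * N (Zs n t - Z t) \<le> ?W t * (N (Zs (n + k) t - Zs n t) + N (Zs (k + n) t - Z t))"
        by (rule mult_left_mono[OF _ order.strict_implies_order[OF W(1)[OF t]]])
      then show ?thesis using diff[OF t, of n k] unfolding distrib_left by linarith
    qed
    ultimately show ?thesis
      using LIMSEQ_le_const[of "\<lambda>k. 2 * m0 / 2 ^ n + ?W t * N (Zs (k + n) t - Z t)" _ "?W t * N (Zs n t - Z t)"] by auto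
  qed
  have "continuous_on_in {0<..1} X N Z"
  proof (rule X.continuous_on_inI)
    fix t :: real and s assume t: "t \<in> {0<..1}" and s: "s \<longlonglongrightarrow> t" "\<And>n. s n \<in> {0<..1}"
    show "(\<lambda>n. N (Z (s n) - Z t)) \<longlonglongrightarrow> 0"
    proof (rule LIMSEQ_I)
      fix e :: real assume e: "e > 0"
      \<comment> \<open>A lower bound of the weight on \<open>[t / 2, 1]\<close>; there the
        convergence is uniform also without the weight.\<close>
      define \<omega> where "\<omega> = sqrt (t / 2) * exp (- \<mu>)"
      have \<omega>: "\<omega> > 0" using t by (simp add: \<omega>_def)
      have \<omega>_le: "\<omega> \<le> ?W x" if "t / 2 \<le> x" "x \<le> 1" for x
      proof -
        have "\<mu> * x \<le> \<mu> * 1" using that by (intro mult_left_mono) (auto simp: \<mu>_def)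
        then show ?thesis
          unfolding \<omega>_def using that t by (intro mult_mono) auto
      qed
      have "eventually (\<lambda>n. (2 * m0 / \<omega>) / 2 ^ n < e / 3) sequentially"
        using lim0 by (rule order_tendstoD) (use e in simp)
      then obtain k where k: "(2 * m0 / \<omega>) / 2 ^ k < e / 3"
        by (auto simp: eventually_sequentially)
      have app: "N (Zs k x - Z x) < e / 3" if "t / 2 \<le> x" "x \<le> 1" for x
      proof -
        have x: "x \<in> {0<..1}" using that t by auto
        have "\<omega> * N (Zs k x - Z x) \<le> ?W x * N (Zs k x - Z x)"
          using \<omega>_le[OF that] by (intro mult_right_mono X.N_nonneg X.diff_mem mem Z x)
        also note ZZ[OF x]
        finally have "N (Zs k x - Z x) \<le> (2 * m0 / \<omega>) / 2 ^ k"
          using \<omega> by (simp add: field_simps)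
        with k show ?thesis by linarith
      qed
      have "eventually (\<lambda>n. t / 2 < s n) sequentially"
        using s(1) t by (intro order_tendstoD(1)) auto
      moreover have "(\<lambda>n. N (Zs k (s n) - Zs k t)) \<longlonglongrightarrow> 0"
        by (rule X.continuous_on_in_sequentially[OF statesD(1)[OF st] t s(1)]) (simp add: s(2)[simplified])
      then have "eventually (\<lambda>n. N (Zs k (s n) - Zs k t) < e / 3) sequentially"
        using e by (intro order_tendstoD(2)) auto
      ultimately have "eventually (\<lambda>n. norm (N (Z (s n) - Z t) - 0) < e) sequentially"
      proof eventually_elim
        case (elim n)
        have sn: "s n \<le> 1" using s(2)[of n] by simp
        have "N (Z (s n) - Z t) \<le> N (Z (s n) - Zs k (s n)) + N (Zs k (s n) - Z t)"
          by (intro X.N_diff_triangle mem Z t s)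
        also have "N (Zs k (s n) - Z t) \<le> N (Zs k (s n) - Zs k t) + N (Zs k t - Z t)"
          by (intro X.N_diff_triangle mem Z t s)
        finally have "N (Z (s n) - Z t) < e"
          using app[OF _ sn] app[of t] elim t X.N_diff_commute[OF Z(1)[OF s(2)] mem[OF s(2)], of n k n] by fastforce
        then show ?case
          using X.N_nonneg[OF X.diff_mem[OF Z(1)[OF s(2)] Z(1)[OF t]], of n] by simp
      qed
      then show "\<exists>n0. \<forall>n\<ge>n0. norm (N (Z (s n) - Z t) - 0) < e"
        by (simp add: eventually_sequentially)
    qed
  qed (rule Z)
  moreover have "sqrt t * N (Z t) \<le> exp \<mu> * (2 * m0)" if t: "t \<in> {0<..1}" for t
  proof -
    have "?W t * N (Z t) \<le> 2 * m0"
      using ZZ[OF t, of 0] X.N_minus[OF Z(1)[OF t]] by (simp add: Zs0)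
    then have "exp (\<mu> * t) * (?W t * N (Z t)) \<le> exp (\<mu> * t) * (2 * m0)"
      by (intro mult_left_mono) auto
    also have "exp (\<mu> * t) * (?W t * N (Z t)) = sqrt t * N (Z t)"
      by (simp add: exp_minus)
    also have "exp (\<mu> * t) * (2 * m0) \<le> exp \<mu> * (2 * m0)"
      using t m0(1) mult_left_mono[of t 1 \<mu>] by (intro mult_right_mono) (auto simp: \<mu>_def)
    finally show ?thesis .
  qed
  moreover have "Z 0 = 0"
    by (simp add: Z_def)
  ultimately have Zst: "Z \<in> states"
    unfolding states_def by blast
  moreover have "N (Z t - \<Psi> Z t) = 0" if t: "t \<in> {0<..1}" for t
  proof (rule weight_le_zero[OF t])
    have \<Psi>X: "\<Psi> Z t \<in> X" using statesD(3)[OF \<Psi>_state[OF Zst], of t] t by auto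
    then show "Z t - \<Psi> Z t \<in> X" by (intro X.diff_mem Z t)
    show "(\<lambda>n. 2 * m0 / 2 ^ n) \<longlonglongrightarrow> 0" by (rule lim0)
    fix n
    have "?W t * N (\<Psi> (Zs n) t - \<Psi> Z t) \<le> (2 * m0 / 2 ^ n) / 2"
      using m0(1) by (intro contraction st Zst t ZZ) auto
    moreover have "?W t * N (Zs (Suc n) t - Z t) \<le> 2 * m0 / 2 ^ Suc n"
      by (rule ZZ[OF t])
    moreover have "N (Z t - \<Psi> Z t) \<le> N (Z t - Zs (Suc n) t) + N (Zs (Suc n) t - \<Psi> Z t)"
      by (intro X.N_diff_triangle mem Z t \<Psi>X)
    then have "?W t * N (Z t - \<Psi> Z t) \<le> ?W t * N (Zs (Suc n) t - Z t) + ?W t * N (\<Psi> (Zs n) t - \<Psi> Z t)"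
      unfolding X.N_diff_commute[OF Z(1)[OF t] mem[OF t], of "Suc n"] unfolding ZsS distrib_left[symmetric]
      by (rule mult_left_mono[OF _ order.strict_implies_order[OF W(1)[OF t]]])
    ultimately show "?W t * N (Z t - \<Psi> Z t) \<le> 2 * m0 / 2 ^ n" by simp
  qed
  ultimately show thesis by (rule that)
qed

end

section \<open>Mild solutions\<close>

lemma gauss_conv_eq: "\<tau> \<noteq> 0 \<Longrightarrow> gauss_conv \<tau> h = conv (gaussian \<tau>) h"
  by (simp add: gauss_conv_def conv_def mult.commute fun_eq_iff)

lemma fst_fun_diff: "(\<lambda>x. fst ((F - G) x)) = (\<lambda>x. fst (F x)) - (\<lambda>x. fst (G x))"
  by (simp add: fun_eq_iff)

context mild_setting
begin

section \<open>Transfer between pairs and functions\<close>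

lemma fst_linear: "linear (\<lambda>(F :: 'a \<Rightarrow> real \<times> 'a) x. fst (F x))"
  by unfold_locales (auto simp: fun_eq_iff)

lemma fst_mem: "F \<in> X \<Longrightarrow> (\<lambda>x. fst (F x)) \<in> LQ" and fst_le: "F \<in> X \<Longrightarrow> NQ (\<lambda>x. fst (F x)) \<le> N F"
  using Lp_fst_snd[OF XD Q_pos(1)] by auto

text \<open>The second component of a pair agrees almost everywhere with \<open>grad\<close> of the
  first, so \<open>N\<close> and the Sobolev norm are equivalent with factor 2. This is the only
  link needed between the two norms, for solutions and for their differences alike.\<close>

lemma W1_fst:
  assumes F: "F \<in> X"
  shows "(\<lambda>x. fst (F x)) \<in> W1_space (ennreal Q)" "N F \<le> W1_norm (ennreal Q) (\<lambda>x. fst (F x))"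
    "W1_norm (ennreal Q) (\<lambda>x. fst (F x)) \<le> 2 * N F"
proof -
  note fs = Lp_fst_snd[OF XD[OF F] Q_pos(1)]
  note wg = W1_pairsD(2)[OF F]
  show "(\<lambda>x. fst (F x)) \<in> W1_space (ennreal Q)"
    using fs wg by (auto simp: W1_space_def)
  have "AE x in lebesgue. snd (F x) = grad (\<lambda>x. fst (F x)) x"
    using grad_AE_eq[OF wg] by eventually_elim simp
  then have "Lp_norm lebesgue (ennreal Q) (grad (\<lambda>x. fst (F x))) = Lp_norm lebesgue (ennreal Q) (\<lambda>x. snd (F x))"
    by (rule Lp_space_AE_eq(2)[OF fs(3) _ Q_pos(1)])
  then show "N F \<le> W1_norm (ennreal Q) (\<lambda>x. fst (F x))" "W1_norm (ennreal Q) (\<lambda>x. fst (F x)) \<le> 2 * N F"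
    using Lp_Pair(2)[OF fs(1,3) Q] fs(2,4) by (auto simp: W1_norm_def)
qed

lemma gaussian_kernel:
  assumes "x > 0"
  shows "gaussian (\<sigma> * sqrt x) \<in> (kernel_space Q :: ('a \<Rightarrow> real) set)"
proof -
  have s: "\<sigma> * sqrt x > 0" using assms sigma by simp
  obtain C where "(gaussian (\<sigma> * sqrt x) :: 'a \<Rightarrow> real) \<in> Lp_space lebesgue (ennreal Q)"
    using gaussian_Lp[OF Q, where 'a='a] s by metis
  then show ?thesis
    using gaussian_borel[OF s] gaussian_L1(1)[OF s] by (simp add: kernel_space_def)
qed

text \<open>\<open>1 / 2 - a\<close> is \<open>- DIM('a) * (1 - 1 / Q) / 2\<close>, the scaling of
  the Gaussian without its gradient. It is not positive, so the constant \<open>L^1\<close> norm is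
  absorbed for \<open>x \<le> 1\<close>.\<close>

lemma gaussian_kernel_bound:
  obtains B where "B > 0"
    "\<And>x. 0 < x \<Longrightarrow> x \<le> 1 \<Longrightarrow> kernel_norm Q (gaussian (\<sigma> * sqrt x) :: 'a \<Rightarrow> real) \<le> B * x powr (1 / 2 - a)"
proof -
  let ?e = "- (DIM('a) * (1 - 1 / Q))"
  obtain A where A: "A > 0" "\<And>\<tau>. \<tau> > 0 \<Longrightarrow> Lp_norm lebesgue (ennreal Q) (gaussian \<tau> :: 'a \<Rightarrow> real) \<le> A * \<tau> powr ?e"
    by (rule gaussian_Lp[OF Q, where 'a='a]) (rule that)
  have "kernel_norm Q (gaussian (\<sigma> * sqrt x) :: 'a \<Rightarrow> real) \<le> (1 + A * \<sigma> powr ?e) * x powr (1 / 2 - a)"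
    if x: "0 < x" "x \<le> 1" for x
  proof -
    have s: "\<sigma> * sqrt x > 0" using x sigma by simp
    have e: "?e / 2 = 1 / 2 - a" by (simp add: a_def)
    have 1: "Lp_norm lebesgue (ennreal Q) (gaussian (\<sigma> * sqrt x) :: 'a \<Rightarrow> real) \<le> A * \<sigma> powr ?e * x powr (1 / 2 - a)"
      using A(2)[OF s] unfolding sigma_sqrt_powr[OF x(1)] e by (simp only: mult.assoc)
    have "x powr 0 \<le> x powr (1 / 2 - a)"
      using x a_ge by (intro powr_mono') auto
    then have "1 \<le> x powr (1 / 2 - a)" using x by simp
    with 1 show ?thesis
      unfolding kernel_norm_def gaussian_L1(2)[OF s] distrib_right by linarith
  qed
  moreover have "1 + A * \<sigma> powr ?e > 0"
    using A(1) by (intro add_pos_nonneg) auto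
  ultimately show thesis by (rule that[rotated])
qed

lemma fst_integrand:
  assumes "u s \<in> Lp_space lebesgue r" "Z s \<in> X" "s < t"
  shows "AE x in lebesgue. fst (integrand Z t s x) = conv2 (gaussian (\<sigma> * sqrt (t - s))) (src Z s) x"
proof -
  have hk: "hk (t - s) = heat_kernel (\<sigma> * sqrt (t - s))"
    using assms(3) by (simp add: hk_def)
  note ok = conv2_bound(1,2)[OF Q hk_kernel(1)[of "t - s"] src_mem[of s Z, OF assms(1,2)]]
  from conv_fst[OF ok(1)] conv_fst[OF ok(2)] show ?thesis
    by eventually_elim (simp add: integrand_def conv2_def hk heat_kernel_def fst_add, simp add: conv_def)
qed

lemma integrand_future: "t \<le> s \<Longrightarrow> integrand Z t s = 0"
  by (simp add: integrand_def hk_def)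

text \<open>For the function without its gradient the kernel gains
  \<open>(t - s) powr (1 / 2 + \<theta>)\<close> over the exponent \<open>a + \<theta>\<close>.
  Bounded by \<open>t powr (1 / 2 + \<theta>)\<close>, this more than compensates
  \<open>D / sqrt t\<close> and leaves \<open>t powr \<theta>\<close>.\<close>

lemma small_time:
  assumes Z: "Z \<in> states"
  obtains K where "K \<ge> 0" "\<And>t. t \<in> {0<..1} \<Longrightarrow> NQ (\<lambda>x. fst (\<Phi> Z t x)) \<le> K * t powr \<theta>"
proof -
  obtain R where R: "R \<ge> 0" "\<And>t. t \<in> {0<..1} \<Longrightarrow> sqrt t * N (Z t) \<le> R"
    using states_bound[OF Z] by metis
  obtain B where B: "B > 0" "\<And>x. 0 < x \<Longrightarrow> x \<le> 1 \<Longrightarrow> kernel_norm Q (gaussian (\<sigma> * sqrt x) :: 'a \<Rightarrow> real) \<le> B * x powr (1 / 2 - a)"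
    by (rule gaussian_kernel_bound) (rule that)
  have "NQ (\<lambda>x. fst (\<Phi> Z t x)) \<le> B * R * D * t powr \<theta>" if t: "t \<in> {0<..1}" for t
  proof -
    have t': "0 < t" "t \<le> 1" using t by auto
    let ?w = "\<lambda>s. sing (a + \<theta>) t s * s powr (- 1 / 2) * w s"
    let ?c = "B * R * t powr (1 / 2 + \<theta>)"
    have c: "0 \<le> ?c" using B(1) R(1) by simp
    interpret F: seminormed_integration LQ NQ M
      by (intro seminormed_integration_lebesgue_on LQ.seminormed_space_axioms)
    have int: "has_integral_in M LQ NQ (\<lambda>s x. fst (integrand Z t s x)) (\<lambda>x. fst (\<Phi> Z t x))"
      by (rule X.has_integral_in_linear[where T="\<lambda>F x. fst (F x)", OF has_integral_\<Phi>[OF Z t'] LQ.seminormed_space_axioms fst_linear fst_mem fst_le])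
    have "ennreal (NQ (\<lambda>x. fst (\<Phi> Z t x))) \<le> (\<integral>\<^sup>+s. ennreal (NQ (\<lambda>x. fst (integrand Z t s x))) \<partial>M)"
      by (rule F.has_integral_in_bound[OF int])
    also have "\<dots> \<le> (\<integral>\<^sup>+s. ennreal ?c * ennreal (?w s) \<partial>M)"
    proof (rule nn_integral_mono_AE)
      show "AE s in M. ennreal (NQ (\<lambda>x. fst (integrand Z t s x))) \<le> ennreal ?c * ennreal (?w s)"
        using u_AE w_AE_nonneg AE_lebesgue_on_neq[of 0 0 1] AE_space
      proof eventually_elim
        case (elim s)
        then have s: "0 < s" "s \<le> 1" by auto
        have ZX: "Z s \<in> X" using statesD(3)[OF Z, of s] s by simp
        show ?case
        proof (cases "s < t")
          case True
          let ?g = "gaussian (\<sigma> * sqrt (t - s)) :: 'a \<Rightarrow> real"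
          have g: "?g \<in> kernel_space Q" using True by (intro gaussian_kernel) simp
          have h: "src Z s \<in> source_space Q" using elim ZX by (intro src_mem)
          have "AE x in lebesgue. conv2 ?g (src Z s) x = fst (integrand Z t s x)"
            using fst_integrand[of s Z t, OF elim(1) ZX True] by eventually_elim simp
          then have "NQ (\<lambda>x. fst (integrand Z t s x)) = NQ (conv2 ?g (src Z s))"
            by (rule Lp_space_AE_eq(2)[OF conv2_bound(3)[OF Q g h] _ Q_pos(1)])
          also have "\<dots> \<le> kernel_norm Q ?g * source_norm Q (src Z s)"
            by (rule conv2_bound(4)[OF Q g h])
          also have "\<dots> \<le> (B * (t - s) powr (1 / 2 - a)) * (w s * N (Z s))"
            using B(1) True s t' elim ZX by (intro mult_mono B(2) src_bound H.N_nonneg h) auto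
          also have "\<dots> \<le> (B * (t powr (1 / 2 + \<theta>) * sing (a + \<theta>) t s)) * (w s * (R * s powr (- 1 / 2)))"
          proof (intro mult_mono)
            have "(t - s) powr (1 / 2 - a) = (t - s) powr (1 / 2 + \<theta>) * (t - s) powr (- (a + \<theta>))"
              using True by (simp flip: powr_add)
            also have "\<dots> \<le> t powr (1 / 2 + \<theta>) * (t - s) powr (- (a + \<theta>))"
              using True s \<theta>_bounds(1) by (intro mult_right_mono powr_mono2) auto
            finally show "(t - s) powr (1 / 2 - a) \<le> t powr (1 / 2 + \<theta>) * sing (a + \<theta>) t s"
              using True by (simp add: sing_def)
            show "N (Z s) \<le> R * s powr (- 1 / 2)"
              using R(2)[of s] s by (simp add: powr_minus_divide powr_half_sqrt field_simps)
          qed (use B(1) elim ZX in \<open>auto intro!: X.N_nonneg mult_nonneg_nonneg\<close>)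
          also have "\<dots> = ?c * ?w s" by simp
          finally have "ennreal (NQ (\<lambda>x. fst (integrand Z t s x))) \<le> ennreal (?c * ?w s)"
            by (rule ennreal_leI)
          also have "\<dots> = ennreal ?c * ennreal (?w s)" by (rule ennreal_mult'[OF c])
          finally show ?thesis .
        next
          case False
          then have "(\<lambda>x. fst (integrand Z t s x)) = 0"
            by (simp add: integrand_future fun_eq_iff)
          then show ?thesis by simp
        qed
      qed
    qed
    also have "\<dots> = ennreal ?c * (\<integral>\<^sup>+s. ennreal (?w s) \<partial>M)"
    proof (intro nn_integral_cmult)
      have "(\<lambda>s. sing (a + \<theta>) t s * (s powr (- 1 / 2) * w s)) \<in> borel_measurable M"
        by (rule borel_measurable_times[OF borel_measurable_lebesgue_onI[OF sing_borel] weight_borel])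
      then show "(\<lambda>s. ennreal (?w s)) \<in> borel_measurable M" by (simp add: mult.assoc)
    qed
    also have "\<dots> \<le> ennreal ?c * ennreal (D / sqrt t)"
      using D_bounds(2)[OF t'] by (rule mult_left_mono) simp
    also have "\<dots> = ennreal (?c * (D / sqrt t))"
      by (rule ennreal_mult'[OF c, symmetric])
    also have "?c * (D / sqrt t) = B * R * D * t powr \<theta>"
      using t' by (simp add: powr_add powr_half_sqrt)
    finally show ?thesis
      using B(1) R(1) D_bounds(1) by (subst (asm) ennreal_le_iff) auto
  qed
  moreover have "B * R * D \<ge> 0" using B(1) R(1) D_bounds(1) by simp
  ultimately show thesis by (rule that[rotated])
qed

text \<open>Three changes turn the internal integral into that of the equation: the interval is
  shortened to \<open>[0,t]\<close>, the second component of the state is replaced by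
  \<open>grad (f s)\<close>, and the two source parts are added up to the nonlinearity. Agreement of
  \<open>f\<close> with the state at positive times is enough.\<close>

lemma mild_integral:
  assumes Z: "Z \<in> states" and t: "t \<in> {0<..1}" and f: "\<And>s. s \<in> {0<..1} \<Longrightarrow> f s = (\<lambda>x. fst (Z s x))"
  shows "has_Lq_integral (lebesgue_on {0..t}) (ennreal Q)
    (\<lambda>s. gauss_conv (\<sigma> * sqrt (t - s)) (nonlinearity W u (\<lambda>t. emb (v t)) f s)) (\<lambda>x. fst (\<Phi> Z t x))"
proof -
  have t': "0 < t" "t \<le> 1" using t by auto
  interpret F: seminormed_integration LQ NQ "lebesgue_on {0..t}"
    by (intro seminormed_integration_lebesgue_on LQ.seminormed_space_axioms)
  have "has_integral_in M LQ NQ (\<lambda>s x. fst (integrand Z t s x)) (\<lambda>x. fst (\<Phi> Z t x))"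
    by (rule X.has_integral_in_linear[where T="\<lambda>F x. fst (F x)", OF has_integral_\<Phi>[OF Z t'] LQ.seminormed_space_axioms fst_linear fst_mem fst_le])
  then have int: "has_integral_in (lebesgue_on {0..t}) LQ NQ (\<lambda>s x. fst (integrand Z t s x)) (\<lambda>x. fst (\<Phi> Z t x))"
    by (rule has_integral_in_restrict[OF LQ.seminormed_space_axioms])
      (use t' in \<open>auto simp: integrand_future fun_eq_iff\<close>)
  show ?thesis
    unfolding has_Lq_integral_eq
  proof (rule F.has_integral_in_cong[OF int])
    let ?G = "\<lambda>s. gauss_conv (\<sigma> * sqrt (t - s)) (nonlinearity W u (\<lambda>t. emb (v t)) f s)"
    have "AE s in lebesgue_on {0..t}. u s \<in> Lp_space lebesgue r"
      by (rule AE_lebesgue_on_subset[OF u_AE]) (use t' in auto)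
    then show "AE s in lebesgue_on {0..t}. ?G s \<in> LQ \<and> NQ ((\<lambda>x. fst (integrand Z t s x)) - ?G s) = 0"
      using AE_lebesgue_on_neq[of 0 0 t] AE_lebesgue_on_neq[of t 0 t] AE_space
    proof eventually_elim
      case (elim s)
      then have s: "0 < s" "s < t" and s': "s \<in> {0<..1}" using t' by auto
      have ZX: "Z s \<in> X" using statesD(3)[OF Z, of s] s' by simp
      let ?g = "gaussian (\<sigma> * sqrt (t - s)) :: 'a \<Rightarrow> real"
      have \<tau>: "\<sigma> * sqrt (t - s) > 0" using s sigma by simp
      have g: "?g \<in> kernel_space Q" using s by (intro gaussian_kernel) simp
      have h: "src Z s \<in> source_space Q" using elim ZX by (intro src_mem)
      note ok = conv2_bound(1,2)[OF Q g h]
      have "AE x in lebesgue. (fst (src Z s) + snd (src Z s)) x = nonlinearity W u (\<lambda>t. emb (v t)) f s x"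
        using grad_AE_eq[OF W1_pairsD(2)[OF ZX]]
        by eventually_elim (simp add: src_def source_op_def nonlinearity_def f[OF s'])
      moreover have "fst (src Z s) + snd (src Z s) \<in> borel_measurable lebesgue"
      proof -
        have "fst (src Z s) \<in> borel_measurable lebesgue" "snd (src Z s) \<in> borel_measurable lebesgue"
          using h by (auto simp: source_space_def dest!: Lp_space_measurable)
        then show ?thesis unfolding plus_fun_def by (rule borel_measurable_add)
      qed
      ultimately have "conv ?g (fst (src Z s) + snd (src Z s)) = ?G s"
        unfolding gauss_conv_eq[OF less_imp_neq[OF \<tau>, symmetric]]
        using gaussian_borel[OF \<tau>] by (intro conv_cong_AE)
      then have ae: "AE x in lebesgue. fst (integrand Z t s x) = ?G s x"
        using fst_integrand[of s Z t, OF elim(1) ZX s(2)] conv_add_right[OF ok]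
        by (auto elim!: eventually_elim2 simp: conv2_def)
      have F: "(\<lambda>x. fst (integrand Z t s x)) \<in> LQ"
        using elim ZX by (intro fst_mem integrand_mem)
      have G: "?G s \<in> LQ"
        by (rule Lp_space_AE_eq(1)[OF F ae Q_pos(1)])
      have "AE x in lebesgue. ((\<lambda>x. fst (integrand Z t s x)) - ?G s) x = 0"
        using ae by eventually_elim simp
      then have "NQ ((\<lambda>x. fst (integrand Z t s x)) - ?G s) = 0"
        unfolding Lp_norm_eq_0_iff[OF LQ.diff_mem[OF F G] Q_pos(1)] .
      with G show ?case by simp
    qed
  qed
qed

lemma heat_initial:
  assumes "t > 0"
  shows "AE x in lebesgue. fst (conv (hk t) f0 x) = gauss_conv (\<sigma> * sqrt t) f0 x"
proof -
  have "hk t = heat_kernel (\<sigma> * sqrt t)"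
    using assms by (simp add: hk_def)
  moreover have "conv_ok (hk t) f0"
    using conv2_bound(2)[OF Q hk_kernel(1) f0_source(1)] by simp
  ultimately show ?thesis
    using conv_fst[of "hk t" f0] assms sigma
    by (auto simp: gauss_conv_def heat_kernel_def mult.commute)
qed

lemma \<Psi>_eq: "t \<in> {0<..1} \<Longrightarrow> \<Psi> Z t = conv (hk t) f0 + \<Phi> Z t"
  by (simp add: \<Psi>_def)

lemma fst_\<Psi>:
  assumes "t \<in> {0<..1}"
  shows "AE x in lebesgue. fst (\<Psi> Z t x) = gauss_conv (\<sigma> * sqrt t) f0 x + fst (\<Phi> Z t x)"
  using heat_initial[of t] assms unfolding \<Psi>_eq[OF assms] by (auto elim!: eventually_mono)

lemma N_eq_0_AE: "F \<in> X \<Longrightarrow> N F = 0 \<longleftrightarrow> (AE x in lebesgue. F x = 0)"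
  by (intro Lp_norm_eq_0_iff XD Q_pos)

text \<open>The degenerate interval is a null set, so at time 0 the integral equation only states
  the initial condition.\<close>

lemma AE_zero_time: "AE s in lebesgue_on {0..0::real}. Pr s"
  using AE_lebesgue_on_neq[of 0 0 0] AE_space by eventually_elim simp

lemma integral_at_zero:
  fixes F :: "real \<Rightarrow> 'a \<Rightarrow> real"
  shows "has_Lq_integral (lebesgue_on {0..0}) (ennreal Q) F 0"
  "has_Lq_integral (lebesgue_on {0..0}) (ennreal Q) F g \<Longrightarrow> AE x in lebesgue. g x = 0"
proof -
  interpret F: seminormed_integration LQ NQ "lebesgue_on {0..0::real}"
    by (intro seminormed_integration_lebesgue_on LQ.seminormed_space_axioms)
  show "has_Lq_integral (lebesgue_on {0..0}) (ennreal Q) F 0"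
    unfolding has_Lq_integral_eq by (rule F.has_integral_in_cong[OF F.has_integral_in_zero AE_zero_time])
  assume "has_Lq_integral (lebesgue_on {0..0}) (ennreal Q) F g"
  then have g: "has_integral_in (lebesgue_on {0..0}) LQ NQ F g"
    by (simp add: has_Lq_integral_eq)
  then have gL: "g \<in> LQ" by (simp add: has_integral_in_def)
  have "(\<integral>\<^sup>+s. ennreal (NQ (F s)) \<partial>lebesgue_on {0..0}) = (\<integral>\<^sup>+s. 0 \<partial>lebesgue_on {0..0::real})"
    by (intro nn_integral_cong_AE AE_zero_time)
  with F.has_integral_in_bound[OF g] have "NQ g \<le> 0"
    by (simp add: ennreal_eq_0_iff)
  with LQ.N_nonneg[OF gL] have "NQ g = 0" by linarith
  then show "AE x in lebesgue. g x = 0"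
    using Lp_norm_eq_0_iff[OF gL] by simp
qed

section \<open>Existence\<close>

lemma mild_exists:
  "\<exists>f. mild_solution \<sigma> W (ennreal Q) f0 u (\<lambda>t. emb (v t)) f \<and> P_norm (ennreal Q) f < \<infinity> \<and>
    ((\<lambda>t. NQ (f t - f0)) \<longlongrightarrow> 0) (at_right 0)"
proof -
  obtain Z where Z: "Z \<in> states" "\<And>t. t \<in> {0<..1} \<Longrightarrow> N (Z t - \<Psi> Z t) = 0"
    by (rule fixed_point_exists) (rule that)
  obtain R where R: "R \<ge> 0" "\<And>t. t \<in> {0<..1} \<Longrightarrow> sqrt t * N (Z t) \<le> R"
    using states_bound[OF Z(1)] by metis
  obtain K where K: "K \<ge> 0" "\<And>t. t \<in> {0<..1} \<Longrightarrow> NQ (\<lambda>x. fst (\<Phi> Z t x)) \<le> K * t powr \<theta>"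
    by (rule small_time[OF Z(1)]) (rule that)
  \<comment> \<open>The state has the placeholder 0 at time 0; the initial datum is put in its
    place.\<close>
  define f where "f t = (if t \<in> {0<..1} then (\<lambda>x. fst (Z t x)) else f0)" for t
  have f: "f t = (\<lambda>x. fst (Z t x))" if "t \<in> {0<..1}" for t
    using that by (simp add: f_def)
  have ZX: "Z t \<in> X" if "t \<in> {0<..1}" for t
    using that statesD(3)[OF Z(1), of t] by auto
  have fL: "f t \<in> LQ" for t
    by (simp add: f_def f0 fst_mem ZX)
  let ?g = "\<lambda>t. gauss_conv (\<sigma> * sqrt t) f0"
  have gL: "?g t \<in> LQ" "NQ (?g t) \<le> NQ f0" "?g t = conv (gaussian (\<sigma> * sqrt t)) f0" if "t > 0" for t
  proof -
    have s: "\<sigma> * sqrt t > 0" using that sigma by simp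
    show eq: "?g t = conv (gaussian (\<sigma> * sqrt t)) f0"
      using s by (intro gauss_conv_eq less_imp_neq[THEN not_sym])
    show "?g t \<in> LQ" "NQ (?g t) \<le> NQ f0"
      unfolding eq using conv_Young(2,3)[OF Q gaussian_borel[OF s], of f0 "NQ f0"] gaussian_L1[OF s, where 'a='a] f0 by auto
  qed
  have \<Phi>L: "(\<lambda>x. fst (\<Phi> Z t x)) \<in> LQ" if "t \<in> {0<..1}" for t
    using that by (intro fst_mem \<Phi>_mem Z) auto
  have eqn: "AE x in lebesgue. f t x = ?g t x + fst (\<Phi> Z t x)" if t: "t \<in> {0<..1}" for t
  proof -
    have "\<Psi> Z t \<in> X" using statesD(3)[OF \<Psi>_state[OF Z(1)], of t] t by auto
    then have "AE x in lebesgue. (Z t - \<Psi> Z t) x = 0"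
      using Z(2)[OF t] N_eq_0_AE X.diff_mem ZX[OF t] by blast
    with fst_\<Psi>[OF t, of Z] show ?thesis
      by eventually_elim (simp add: f[OF t])
  qed
  have NQ_eq: "NQ (f t - h) = NQ ((?g t - h) + (\<lambda>x. fst (\<Phi> Z t x)))" if t: "t \<in> {0<..1}" and h: "h \<in> LQ" for t h
  proof (rule Lp_space_AE_eq(2)[OF _ _ Q_pos(1)])
    show "(?g t - h) + (\<lambda>x. fst (\<Phi> Z t x)) \<in> LQ"
      using t h by (intro LQ.add_mem LQ.diff_mem gL \<Phi>L) auto
    show "AE x in lebesgue. ((?g t - h) + (\<lambda>x. fst (\<Phi> Z t x))) x = (f t - h) x"
      using eqn[OF t] by eventually_elim simp
  qed
  \<comment> \<open>The heat term converges by the approximate identity, the Duhamel term by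
    \<open>K * t powr \<theta>\<close>. Used both for continuity at 0 and for the limit in the
    claim.\<close>
  have lim0: "((\<lambda>t. NQ (f t - f0)) \<longlongrightarrow> 0) (at 0 within {0..1})"
    unfolding tendsto_at_iff_sequentially o_def
  proof safe
    fix s :: "nat \<Rightarrow> real" assume "\<forall>n. s n \<in> {0..1} - {0}" and lim: "s \<longlonglongrightarrow> 0"
    then have s: "s n \<in> {0<..1}" for n
      by (metis DiffE atLeastAtMost_iff greaterThanAtMost_iff insertI1 order_le_less)
    have "(\<lambda>n. NQ (conv (gaussian (\<sigma> * sqrt (s n))) f0 - f0)) \<longlonglongrightarrow> 0"
    proof (rule conv_gaussian_tendsto[OF Q f0])
      show "(\<lambda>n. \<sigma> * sqrt (s n)) \<longlonglongrightarrow> 0"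
        using tendsto_mult[OF tendsto_const tendsto_real_sqrt[OF lim], of \<sigma>] by simp
      show "0 < \<sigma> * sqrt (s n)" for n
        using s[of n] sigma by simp
    qed
    moreover have "(\<lambda>n. s n powr \<theta>) \<longlonglongrightarrow> 0"
      by (rule tendsto_zero_powrI[OF lim tendsto_const]) (use s \<theta>_bounds(1) in \<open>auto simp: less_imp_le\<close>)
    ultimately have "(\<lambda>n. NQ (conv (gaussian (\<sigma> * sqrt (s n))) f0 - f0) + K * s n powr \<theta>) \<longlonglongrightarrow> 0 + K * 0"
      by (intro tendsto_intros)
    then have l: "(\<lambda>n. NQ (conv (gaussian (\<sigma> * sqrt (s n))) f0 - f0) + K * s n powr \<theta>) \<longlonglongrightarrow> 0"
      by simp
    show "(\<lambda>n. NQ (f (s n) - f0)) \<longlonglongrightarrow> 0"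
    proof (rule LIMSEQ_0_le[OF l])
      fix n
      have sn: "s n > 0" using s[of n] by simp
      show "0 \<le> NQ (f (s n) - f0)"
        by (intro LQ.N_nonneg LQ.diff_mem fL f0)
      have "NQ (f (s n) - f0) \<le> NQ (?g (s n) - f0) + NQ (\<lambda>x. fst (\<Phi> Z (s n) x))"
        unfolding NQ_eq[OF s f0] by (intro LQ.triangle LQ.diff_mem gL sn f0 \<Phi>L s)
      then show "NQ (f (s n) - f0) \<le> NQ (conv (gaussian (\<sigma> * sqrt (s n))) f0 - f0) + K * s n powr \<theta>"
        using K(2)[OF s[of n]] unfolding gL(3)[OF sn] by linarith
    qed
  qed
  have "continuous_on_in {0..1} LQ NQ f"
    unfolding continuous_on_in_def
  proof (intro conjI ballI)
    fix t :: real assume t: "t \<in> {0..1}"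
    show "f t \<in> LQ" by (rule fL)
    show "((\<lambda>s. NQ (f s - f t)) \<longlongrightarrow> 0) (at t within {0..1})"
    proof (cases "t = 0")
      case True
      then show ?thesis using lim0 by (simp add: f_def)
    next
      case False
      then have t': "t \<in> {0<..1}" using t by auto
      show ?thesis
        unfolding tendsto_at_iff_sequentially o_def
      proof safe
        fix s :: "nat \<Rightarrow> real" assume s: "\<forall>n. s n \<in> {0..1} - {t}" and lim: "s \<longlonglongrightarrow> t"
        have "eventually (\<lambda>n. 0 < s n) sequentially"
          using lim t' by (intro order_tendstoD(1)) auto
        then have ev: "eventually (\<lambda>n. s n \<in> {0<..1}) sequentially"
          by eventually_elim (use s in auto)
        have l: "(\<lambda>n. N (Z (s n) - Z t)) \<longlonglongrightarrow> 0"
          by (rule X.continuous_on_in_sequentially[OF statesD(1)[OF Z(1)] t' lim ev])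
        have ub: "eventually (\<lambda>n. NQ (f (s n) - f t) \<le> N (Z (s n) - Z t)) sequentially"
          using ev
        proof eventually_elim
          case (elim n)
          show ?case
            unfolding f[OF elim] f[OF t'] fst_fun_diff[symmetric] by (intro fst_le X.diff_mem ZX elim t')
        qed
        have lb: "eventually (\<lambda>n. 0 \<le> NQ (f (s n) - f t)) sequentially"
          by (intro always_eventually allI LQ.N_nonneg LQ.diff_mem fL)
        show "(\<lambda>n. NQ (f (s n) - f t)) \<longlonglongrightarrow> 0"
          by (rule tendsto_sandwich[OF lb ub tendsto_const l])
      qed
    qed
  qed
  moreover have "continuous_on_in {0<..1} (W1_space (ennreal Q)) (W1_norm (ennreal Q)) f"
    unfolding continuous_on_in_def tendsto_at_iff_sequentially o_def
  proof safe
    fix t assume t: "t \<in> {0<..1::real}"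
    show "f t \<in> W1_space (ennreal Q)"
      unfolding f[OF t] by (intro W1_fst ZX t)
    fix s :: "nat \<Rightarrow> real" assume "\<forall>n. s n \<in> {0<..1} - {t}" and lim: "s \<longlonglongrightarrow> t"
    then have s: "s n \<in> {0<..1}" for n by blast
    have "(\<lambda>n. 2 * N (Z (s n) - Z t)) \<longlonglongrightarrow> 2 * 0"
      by (intro tendsto_intros X.continuous_on_in_sequentially[OF statesD(1)[OF Z(1)] t lim] always_eventually allI s)
    then have l: "(\<lambda>n. 2 * N (Z (s n) - Z t)) \<longlonglongrightarrow> 0" by simp
    show "(\<lambda>n. W1_norm (ennreal Q) (f (s n) - f t)) \<longlonglongrightarrow> 0"
    proof (rule LIMSEQ_0_le[OF l])
      fix n
      have eq: "f (s n) - f t = (\<lambda>x. fst ((Z (s n) - Z t) x))"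
        by (simp only: f[OF s] f[OF t] fst_fun_diff)
      have D: "Z (s n) - Z t \<in> X" by (intro X.diff_mem ZX s t)
      show "W1_norm (ennreal Q) (f (s n) - f t) \<le> 2 * N (Z (s n) - Z t)"
        unfolding eq by (rule W1_fst(3)[OF D])
      show "0 \<le> W1_norm (ennreal Q) (f (s n) - f t)"
        by (simp add: W1_norm_def)
    qed
  qed
  moreover have "\<forall>t\<in>{0..1}. \<exists>g.
      has_Lq_integral (lebesgue_on {0..t}) (ennreal Q)
        (\<lambda>s. gauss_conv (\<sigma> * sqrt (t - s)) (nonlinearity W u (\<lambda>t. emb (v t)) f s)) g \<and>
      (AE x in lebesgue. f t x = gauss_conv (\<sigma> * sqrt t) f0 x + g x)"
  proof
    fix t :: real assume t: "t \<in> {0..1}"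
    show "\<exists>g. has_Lq_integral (lebesgue_on {0..t}) (ennreal Q)
        (\<lambda>s. gauss_conv (\<sigma> * sqrt (t - s)) (nonlinearity W u (\<lambda>t. emb (v t)) f s)) g \<and>
      (AE x in lebesgue. f t x = gauss_conv (\<sigma> * sqrt t) f0 x + g x)"
    proof (cases "t = 0")
      case True
      show ?thesis
        unfolding True using integral_at_zero(1) by (intro exI[of _ 0] conjI) (auto simp: f_def gauss_conv_def)
    next
      case False
      then have t': "t \<in> {0<..1}" using t by auto
      show ?thesis
        using mild_integral[OF Z(1) t' f] eqn[OF t'] by blast
    qed
  qed
  ultimately have "mild_solution \<sigma> W (ennreal Q) f0 u (\<lambda>t. emb (v t)) f"
    unfolding mild_solution_def by blast
  moreover have "P_norm (ennreal Q) f < \<infinity>"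
  proof -
    have "NQ (f t) \<le> NQ f0 + K" if "t \<in> {0..1}" for t
    proof (cases "t = 0")
      case True
      then show ?thesis using K(1) by (simp add: f_def)
    next
      case False
      then have t: "t \<in> {0<..1}" "t > 0" using that by auto
      have "NQ (f t) = NQ (f t - 0)" by simp
      also have "\<dots> \<le> NQ (?g t - 0) + NQ (\<lambda>x. fst (\<Phi> Z t x))"
        unfolding NQ_eq[OF t(1) LQ.zero_mem] by (intro LQ.triangle LQ.diff_mem gL t \<Phi>L LQ.zero_mem)
      also have "\<dots> \<le> NQ f0 + K * t powr \<theta>"
        using gL(2)[OF t(2)] K(2)[OF t(1)] by simp
      also have "\<dots> \<le> NQ f0 + K * 1"
        using t K(1) \<theta>_bounds(1) by (intro add_left_mono mult_left_mono powr_le1) auto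
      finally show ?thesis by simp
    qed
    then have 1: "(SUP t\<in>{0..1}. ennreal (NQ (f t))) \<le> ennreal (NQ f0 + K)"
      by (intro SUP_least ennreal_leI)
    have "sqrt t * W1_norm (ennreal Q) (f t) \<le> 2 * R" if t: "t \<in> {0<..1}" for t
    proof -
      have "sqrt t * W1_norm (ennreal Q) (f t) \<le> sqrt t * (2 * N (Z t))"
        unfolding f[OF t] using t by (intro mult_left_mono W1_fst ZX) auto
      then show ?thesis using R(2)[OF t] by simp
    qed
    then have 2: "(SUP t\<in>{0<..1}. ennreal (sqrt t * W1_norm (ennreal Q) (f t))) \<le> ennreal (2 * R)"
      by (intro SUP_least ennreal_leI)
    show ?thesis
      unfolding P_norm_def using le_less_trans[OF 1 ennreal_less_top] le_less_trans[OF 2 ennreal_less_top] by simp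
  qed
  moreover have "((\<lambda>t. NQ (f t - f0)) \<longlongrightarrow> 0) (at_right 0)"
    using lim0 by (simp add: at_within_Icc_at_right)
  ultimately show ?thesis by blast
qed

section \<open>Uniqueness\<close>

text \<open>Adjoining \<open>grad\<close> turns a solution with finite \<open>P_norm\<close> into a
  state. The equation compares only first components; equality of the gradients then comes from
  uniqueness of weak gradients.\<close>

lemma mild_fixed_point:
  assumes mild: "mild_solution \<sigma> W (ennreal Q) f0 u (\<lambda>t. emb (v t)) g" and fin: "P_norm (ennreal Q) g < \<infinity>"
  obtains Z where "Z \<in> states" "\<And>t. t \<in> {0<..1} \<Longrightarrow> N (Z t - \<Psi> Z t) = 0"
    "\<And>t. t \<in> {0<..1} \<Longrightarrow> g t = (\<lambda>x. fst (Z t x))"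
proof -
  have gc: "continuous_on_in {0<..1} (W1_space (ennreal Q)) (W1_norm (ennreal Q)) g"
    and ge: "\<And>t. t \<in> {0..1} \<Longrightarrow> \<exists>h.
        has_Lq_integral (lebesgue_on {0..t}) (ennreal Q)
          (\<lambda>s. gauss_conv (\<sigma> * sqrt (t - s)) (nonlinearity W u (\<lambda>t. emb (v t)) g s)) h \<and>
        (AE x in lebesgue. g t x = gauss_conv (\<sigma> * sqrt t) f0 x + h x)"
    using mild by (auto simp: mild_solution_def)
  define Z where "Z t = (if t \<in> {0<..1} then (\<lambda>x. (g t x, grad (g t) x)) else 0)" for t
  have Z: "Z t = (\<lambda>x. (g t x, grad (g t) x))" if "t \<in> {0<..1}" for t
    using that by (simp add: Z_def)
  have g: "g t = (\<lambda>x. fst (Z t x))" if "t \<in> {0<..1}" for t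
    using that by (simp add: Z)
  have ZX: "Z t \<in> X" if t: "t \<in> {0<..1}" for t
  proof -
    have "g t \<in> W1_space (ennreal Q)"
      using gc t by (simp add: continuous_on_in_def)
    then obtain h where h: "g t \<in> LQ" "h \<in> Lp_space lebesgue (ennreal Q)" "weak_gradient (g t) h"
      by (auto simp: W1_space_def)
    have "AE x in lebesgue. h x = grad (g t) x"
      using grad_AE_eq[OF h(3)] by eventually_elim simp
    then have "grad (g t) \<in> Lp_space lebesgue (ennreal Q)"
      by (rule Lp_space_AE_eq(1)[OF h(2) _ Q_pos(1)])
    then show ?thesis
      using Lp_Pair(1)[OF h(1) _ Q] weak_gradient_grad[OF h(3)] by (simp add: Z[OF t] W1_pairs_def)
  qed
  have "continuous_on_in {0<..1} X N Z"
  proof (rule X.continuous_on_inI)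
    fix t :: real and s assume t: "t \<in> {0<..1}" and lim: "s \<longlonglongrightarrow> t" and s: "\<And>n. s n \<in> {0<..1}"
    have "(\<lambda>n. W1_norm (ennreal Q) (g (s n) - g t)) \<longlonglongrightarrow> 0"
    proof (rule LIMSEQ_I)
      fix e :: real assume e: "e > 0"
      have "((\<lambda>s. W1_norm (ennreal Q) (g s - g t)) \<longlongrightarrow> 0) (at t within {0<..1})"
        using gc t by (simp add: continuous_on_in_def)
      then have "eventually (\<lambda>s. dist (W1_norm (ennreal Q) (g s - g t)) 0 < e) (at t within {0<..1})"
        using e by (rule tendstoD)
      then obtain d where d: "d > 0" "\<And>s. s \<in> {0<..1} \<Longrightarrow> s \<noteq> t \<Longrightarrow> dist s t < d \<Longrightarrow> dist (W1_norm (ennreal Q) (g s - g t)) 0 < e"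
        unfolding eventually_at by blast
      \<comment> \<open>The sequence may take the value \<open>t\<close>, and the Sobolev norm of
        the zero function involves the chosen \<open>grad\<close>, so its vanishing is read off the
        zero pair.\<close>
      have "g t - g t = (\<lambda>x. fst ((0 :: 'a \<Rightarrow> real \<times> 'a) x))"
        by (simp add: fun_eq_iff)
      then have "W1_norm (ennreal Q) (g t - g t) = 0"
        using W1_fst(2,3)[OF X.zero_mem] by simp
      then have "dist (W1_norm (ennreal Q) (g (s n) - g t)) 0 < e" if "dist (s n) t < d" for n
        using d(2)[OF s[of n]] that e by (cases "s n = t") auto
      moreover have "eventually (\<lambda>n. dist (s n) t < d) sequentially"
        using lim d(1) by (rule tendstoD)
      ultimately have "eventually (\<lambda>n. dist (W1_norm (ennreal Q) (g (s n) - g t)) 0 < e) sequentially"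
        by (auto elim!: eventually_mono)
      then show "\<exists>n0. \<forall>n\<ge>n0. norm (W1_norm (ennreal Q) (g (s n) - g t) - 0) < e"
        unfolding eventually_sequentially dist_norm .
    qed
    then show "(\<lambda>n. N (Z (s n) - Z t)) \<longlonglongrightarrow> 0"
    proof (rule LIMSEQ_0_le)
      fix n
      have D: "Z (s n) - Z t \<in> X" by (intro X.diff_mem ZX s t)
      then show "0 \<le> N (Z (s n) - Z t)" by (rule X.N_nonneg)
      show "N (Z (s n) - Z t) \<le> W1_norm (ennreal Q) (g (s n) - g t)"
        using W1_fst(2)[OF D] by (simp only: fst_fun_diff g[OF s] g[OF t])
    qed
  qed (rule ZX)
  moreover have "sqrt t * N (Z t) \<le> enn2real (P_norm (ennreal Q) g)" if t: "t \<in> {0<..1}" for t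
  proof -
    have "ennreal (sqrt t * W1_norm (ennreal Q) (g t)) \<le> P_norm (ennreal Q) g"
      unfolding P_norm_def using t by (intro max.coboundedI2 SUP_upper)
    also have "\<dots> = ennreal (enn2real (P_norm (ennreal Q) g))"
      using fin by simp
    finally have "sqrt t * W1_norm (ennreal Q) (g t) \<le> enn2real (P_norm (ennreal Q) g)"
      by (simp add: ennreal_le_iff)
    moreover have "sqrt t * N (Z t) \<le> sqrt t * W1_norm (ennreal Q) (g t)"
      unfolding g[OF t] using t by (intro mult_left_mono W1_fst ZX) auto
    ultimately show ?thesis by linarith
  qed
  moreover have "Z 0 = 0" by (simp add: Z_def)
  ultimately have Zst: "Z \<in> states"
    unfolding states_def by blast
  moreover have "N (Z t - \<Psi> Z t) = 0" if t: "t \<in> {0<..1}" for t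
  proof -
    let ?G = "\<lambda>s. gauss_conv (\<sigma> * sqrt (t - s)) (nonlinearity W u (\<lambda>t. emb (v t)) g s)"
    interpret F: seminormed_integration LQ NQ "lebesgue_on {0..t}"
      by (intro seminormed_integration_lebesgue_on LQ.seminormed_space_axioms)
    obtain h where h: "has_integral_in (lebesgue_on {0..t}) LQ NQ ?G h"
      and eq: "AE x in lebesgue. g t x = gauss_conv (\<sigma> * sqrt t) f0 x + h x"
      using ge[of t] t unfolding has_Lq_integral_eq by auto
    have \<Phi>': "has_integral_in (lebesgue_on {0..t}) LQ NQ ?G (\<lambda>x. fst (\<Phi> Z t x))"
      using mild_integral[OF Zst t g] unfolding has_Lq_integral_eq .
    have D: "h - (\<lambda>x. fst (\<Phi> Z t x)) \<in> LQ"
      using h \<Phi>' by (intro LQ.diff_mem) (auto simp: has_integral_in_def)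
    have "ennreal (NQ (h - (\<lambda>x. fst (\<Phi> Z t x)))) \<le> 0"
      using F.has_integral_in_bound_diff[OF h \<Phi>'] unfolding diff_self LQ.N_zero by simp
    then have "NQ (h - (\<lambda>x. fst (\<Phi> Z t x))) = 0"
      using LQ.N_nonneg[OF D] by (simp only: le_zero_eq ennreal_eq_0_iff)
    then have "AE x in lebesgue. (h - (\<lambda>x. fst (\<Phi> Z t x))) x = 0"
      using Lp_norm_eq_0_iff[OF D Q_pos(1)] by blast
    then have fst0: "AE x in lebesgue. fst ((Z t - \<Psi> Z t) x) = 0"
      using eq fst_\<Psi>[OF t, of Z] by eventually_elim (simp add: Z[OF t])
    have X': "Z t - \<Psi> Z t \<in> X"
      using statesD(3)[OF \<Psi>_state[OF Zst], of t] t by (intro X.diff_mem ZX) auto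
    \<comment> \<open>The difference is a Sobolev pair whose first component vanishes almost
      everywhere; its second is thus a weak gradient of 0.\<close>
    have "weak_gradient (\<lambda>x. 0) (\<lambda>x. snd ((Z t - \<Psi> Z t) x))"
      by (rule weak_gradient_AE_eq[OF W1_pairsD(2)[OF X']]) (use fst0 in auto)
    then have "AE x in lebesgue. snd ((Z t - \<Psi> Z t) x) = 0"
      using weak_gradient_unique weak_gradient_zero by blast
    with fst0 have "AE x in lebesgue. (Z t - \<Psi> Z t) x = 0"
      by eventually_elim (simp add: prod_eq_iff)
    then show ?thesis
      using N_eq_0_AE[OF X'] by blast
  qed
  ultimately show thesis using g by (rule that)
qed

lemma mild_unique:
  assumes g: "mild_solution \<sigma> W (ennreal Q) f0 u (\<lambda>t. emb (v t)) g" "P_norm (ennreal Q) g < \<infinity>"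
    and f: "mild_solution \<sigma> W (ennreal Q) f0 u (\<lambda>t. emb (v t)) f" "P_norm (ennreal Q) f < \<infinity>"
    and t: "t \<in> {0..1}"
  shows "AE x in lebesgue. g t x = f t x"
proof (cases "t = 0")
  case True
  have "AE x in lebesgue. h t x = f0 x" if h: "mild_solution \<sigma> W (ennreal Q) f0 u (\<lambda>t. emb (v t)) h" for h
  proof -
    obtain k where k: "has_Lq_integral (lebesgue_on {0..0}) (ennreal Q)
          (\<lambda>s. gauss_conv (\<sigma> * sqrt (0 - s)) (nonlinearity W u (\<lambda>t. emb (v t)) h s)) k"
        "AE x in lebesgue. h 0 x = gauss_conv (\<sigma> * sqrt 0) f0 x + k x"
    proof -
      have "0 \<in> {0..1::real}" by simp
      then show ?thesis using h that unfolding mild_solution_def by blast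
    qed
    from integral_at_zero(2)[OF k(1)] k(2) show ?thesis
      by eventually_elim (simp add: True gauss_conv_def)
  qed
  from this[OF g(1)] this[OF f(1)] show ?thesis
    by eventually_elim simp
next
  case False
  then have t': "t \<in> {0<..1}" using t by auto
  obtain Y where Y: "Y \<in> states" "\<And>t. t \<in> {0<..1} \<Longrightarrow> N (Y t - \<Psi> Y t) = 0" "\<And>t. t \<in> {0<..1} \<Longrightarrow> g t = (\<lambda>x. fst (Y t x))"
    by (rule mild_fixed_point[OF g]) (rule that)
  obtain Z where Z: "Z \<in> states" "\<And>t. t \<in> {0<..1} \<Longrightarrow> N (Z t - \<Psi> Z t) = 0" "\<And>t. t \<in> {0<..1} \<Longrightarrow> f t = (\<lambda>x. fst (Z t x))"
    by (rule mild_fixed_point[OF f]) (rule that)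
  have X': "Y t - Z t \<in> X"
    using statesD(3)[OF Y(1) t] statesD(3)[OF Z(1) t] by (rule X.diff_mem)
  have "N (Y t - Z t) = 0"
    by (rule fixed_point_unique[OF Y(1) Z(1) Y(2) Z(2) t'])
  then have "AE x in lebesgue. (Y t - Z t) x = 0"
    using N_eq_0_AE[OF X'] by blast
  then show ?thesis
    by eventually_elim (simp add: Y(3)[OF t'] Z(3)[OF t'])
qed

end

section \<open>Reduction to real exponents\<close>

lemma Lp_infinity_subset:
  assumes f: "f \<in> Lp_space M \<infinity>" and M: "finite_measure M" "emeasure M (space M) \<noteq> 0" and P: "P \<ge> 0"
  shows "f \<in> Lp_space M (ennreal P)"
proof -
  interpret finite_measure M by fact
  have m [measurable]: "f \<in> borel_measurable M"
    by (rule Lp_space_measurable[OF f])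
  have "AE x in M. norm (norm (f x) powr P) \<le> Lp_norm M \<infinity> f powr P"
    using Lp_infinity_AE(2)[OF f M(2)] by eventually_elim (use P in \<open>auto intro: powr_mono2\<close>)
  then have "integrable M (\<lambda>x. norm (f x) powr P)"
    by (rule integrable_const_bound) measurable
  then show ?thesis using m P by (simp add: Lp_space_ennreal)
qed

lemma C1_fields_bound:
  fixes w :: "'a::euclidean_space \<Rightarrow> 'a"
  assumes w: "w \<in> C1_fields"
  shows "w \<in> borel_measurable borel" "norm (w x) \<le> C1_norm w"
proof -
  obtain D where "\<And>x. (w has_derivative D x) (at x)"
    using w by (auto simp: C1_fields_def)
  then have "continuous_on UNIV w"
    by (meson has_derivative_continuous continuous_at_imp_continuous_on)
  then show "w \<in> borel_measurable borel"
    by (rule borel_measurable_continuous_onI)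
  have "bounded (range w)"
    using w by (simp add: C1_fields_def)
  then have "bdd_above (range (\<lambda>x. norm (w x)))"
    by (auto simp: bounded_iff bdd_above_def)
  then have "norm (w x) \<le> (SUP x. norm (w x))"
    by (intro cSUP_upper) auto
  then show "norm (w x) \<le> C1_norm w"
    by (simp add: C1_norm_def)
qed

text \<open>The sup norm is part of \<open>C1_norm\<close>; \<open>max\<close> guards against a
  negative constant, which a trivial Hilbert space would allow.\<close>

lemma embedded_bound:
  fixes emb :: "'v::{real_inner,banach} \<Rightarrow> 'a::euclidean_space \<Rightarrow> 'a"
  assumes emb: "continuously_embedded_in_C1 emb"
  obtains C where "C \<ge> 0" "\<And>w x. norm (emb w x) \<le> C * norm w"
proof -
  obtain C where C: "\<And>w. C1_norm (emb w) \<le> C * norm w"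
    using emb by (auto simp: continuously_embedded_in_C1_def)
  have "norm (emb w x) \<le> max C 0 * norm w" for w x
  proof -
    have "emb w \<in> C1_fields"
      using emb by (auto simp: continuously_embedded_in_C1_def)
    then have "norm (emb w x) \<le> C1_norm (emb w)"
      by (rule C1_fields_bound)
    also have "\<dots> \<le> C * norm w" by (rule C)
    also have "\<dots> \<le> max C 0 * norm w" by (intro mult_right_mono) auto
    finally show ?thesis .
  qed
  then show thesis by (intro that[of "max C 0"]) auto
qed

text \<open>For \<open>p = \<infinity>\<close> any finite \<open>P\<close> that is large enough will do.\<close>

lemma real_exponents:
  fixes p r :: ennreal and d :: nat and M :: "'t measure"
  assumes d: "d \<ge> 1" and p: "p > 2" and r: "r > (if p = \<infinity> then of_nat d else of_nat d * p / (p - 2))"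
    and M: "finite_measure M" "emeasure M (space M) \<noteq> 0"
  obtains Q P where "1 \<le> Q" "r > 1" "conj_exponent r = ennreal Q" "P > 2" "1 / 2 + d * (1 - 1 / Q) / 2 < 1 - 1 / P"
    "\<And>h :: 't \<Rightarrow> real. h \<in> Lp_space M p \<Longrightarrow> h \<in> Lp_space M (ennreal P)"
proof -
  \<comment> \<open>\<open>\<kappa>\<close> is \<open>d / r\<close>, read as 0 for infinite
    \<open>r\<close>; it will turn out to be \<open>d * (1 - 1 / Q)\<close>. All cases of
    \<open>p\<close> and \<open>r\<close> meet in the condition
    \<open>\<kappa> < 1 - 2 / P\<close>.\<close>
  obtain \<kappa> P where P: "P > 2" "\<kappa> < 1 - 2 / P" "\<And>h :: 't \<Rightarrow> real. h \<in> Lp_space M p \<Longrightarrow> h \<in> Lp_space M (ennreal P)"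
    and \<kappa>: "0 \<le> \<kappa>" "\<kappa> < 1" "r = \<infinity> \<and> \<kappa> = 0 \<or> (\<exists>R. r = ennreal R \<and> R > 0 \<and> \<kappa> = d / R)"
  proof (cases "p = \<infinity>")
    case True
    have "\<exists>\<kappa>. 0 \<le> \<kappa> \<and> \<kappa> < 1 \<and> (r = \<infinity> \<and> \<kappa> = 0 \<or> (\<exists>R. r = ennreal R \<and> R > 0 \<and> \<kappa> = d / R))"
    proof (cases r)
      case (real R)
      have "ennreal (real d) < ennreal R"
        using r True real by (simp add: ennreal_of_nat_eq_real_of_nat)
      then have "real d < R" by (simp add: ennreal_less_iff)
      then show ?thesis using real d by (intro exI[of _ "d / R"]) auto
    qed auto
    then obtain \<kappa> where \<kappa>: "0 \<le> \<kappa>" "\<kappa> < 1" "r = \<infinity> \<and> \<kappa> = 0 \<or> (\<exists>R. r = ennreal R \<and> R > 0 \<and> \<kappa> = d / R)"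
      by blast
    show thesis
    proof (rule that[OF _ _ _ \<kappa>])
      \<comment> \<open>With \<open>P = 4 / (1 - \<kappa>)\<close> the number
        \<open>1 - 2 / P\<close> is the midpoint of \<open>\<kappa>\<close> and 1.\<close>
      show "2 < 4 / (1 - \<kappa>)" using \<kappa> by (simp add: field_simps)
      show "\<kappa> < 1 - 2 / (4 / (1 - \<kappa>))" using \<kappa> by (simp add: field_simps)
      show "h \<in> Lp_space M (ennreal (4 / (1 - \<kappa>)))" if "h \<in> Lp_space M p" for h :: "'t \<Rightarrow> real"
        using Lp_infinity_subset[OF that[unfolded True] M] \<kappa> by simp
    qed
  next
    case False
    then obtain P where P: "p = ennreal P" "0 \<le> P" by (cases p) auto
    have P2: "P > 2"
    proof -
      have "ennreal 2 < ennreal P" using p P by simp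
      then show ?thesis by (subst (asm) ennreal_less_iff) auto
    qed
    have thr: "of_nat d * p / (p - 2) = ennreal (d * P / (P - 2))"
    proof -
      have "of_nat d * p = ennreal (d * P)"
        using P by (simp add: ennreal_of_nat_eq_real_of_nat ennreal_mult)
      moreover have "p - 2 = ennreal (P - 2)"
        unfolding P(1) ennreal_numeral[symmetric] by (rule ennreal_minus) simp
      ultimately show ?thesis
        using P2 P(2) by (simp add: divide_ennreal)
    qed
    show thesis
    proof (cases r)
      case (real R)
      have "ennreal (d * P / (P - 2)) < ennreal R"
        using r False real thr by simp
      then have R: "d * P / (P - 2) < R"
        using P2 by (simp add: ennreal_less_iff)
      have "0 < d * P / (P - 2)" using d P2 by simp
      with R have R0: "R > 0" by linarith
      \<comment> \<open>The hypothesis \<open>d * P / (P - 2) < R\<close> solved for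
        \<open>d / R\<close>.\<close>
      have "d / R < 1 - 2 / P"
        using R R0 P2 by (simp add: field_simps)
      moreover from this have "d / R < 1" using P2 by (smt (verit) divide_pos_pos)
      then have "real d < R" using R0 by simp
      ultimately show thesis
        using P P2 R0 real by (intro that[of P "d / R"]) auto
    next
      case top
      then show thesis
        using P P2 by (intro that[of P 0]) auto
    qed
  qed
  obtain Q where Q: "1 \<le> Q" "r > 1" "conj_exponent r = ennreal Q" "d * (1 - 1 / Q) = \<kappa>"
    using \<kappa>(3)
  proof (elim disjE exE conjE)
    assume "r = \<infinity>" "\<kappa> = 0"
    then show thesis by (intro that[of 1]) (auto simp: conj_exponent_def)
  next
    fix R assume R: "r = ennreal R" "R > 0" "\<kappa> = d / R"
    have "real d < R" using \<kappa>(2) R by simp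
    then have R1: "R > 1" using d by linarith
    show thesis
    proof (rule that)
      show "1 \<le> R / (R - 1)" using R1 by simp
      show "r > 1" using R R1 by (simp add: ennreal_less_iff flip: ennreal_1)
      show "conj_exponent r = ennreal (R / (R - 1))"
        unfolding R using R1 by (rule conj_exponent_ennreal)
      show "d * (1 - 1 / (R / (R - 1))) = \<kappa>"
        using R R1 by (simp add: field_simps)
    qed
  qed
  \<comment> \<open>Half of the condition on \<open>\<kappa>\<close>, shifted by
    \<open>1 / 2\<close>.\<close>
  have "1 / 2 + d * (1 - 1 / Q) / 2 < 1 - 1 / P"
    using P(2) unfolding Q(4) by linarith
  with P Q show thesis by (intro that)
qed

theorem theorem1:
  fixes \<sigma> W :: real and p r :: ennreal
    and f0 :: "'a::euclidean_space \<Rightarrow> real"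
    and emb :: "'v::{real_inner,banach} \<Rightarrow> 'a \<Rightarrow> 'a"
    and u :: "real \<Rightarrow> 'a \<Rightarrow> real" and v :: "real \<Rightarrow> 'v"
  defines "q \<equiv> conj_exponent r"
  assumes "\<sigma> > 0" and "W > 0" and "p > 2"
    and "r > (if p = \<infinity> then of_nat DIM('a) else of_nat DIM('a) * p / (p - 2))"
    and "continuously_embedded_in_C1 emb"
    and "f0 \<in> Lp_space lebesgue q"
    and "u \<in> bochner_Lp (lebesgue_on {0..1}) p (Lp_space lebesgue r) (Lp_norm lebesgue r)"
    and "v \<in> bochner_Lp (lebesgue_on {0..1}) p UNIV norm"
  shows "\<exists>f. mild_solution \<sigma> W q f0 u (\<lambda>t. emb (v t)) f \<and> P_norm q f < \<infinity> \<and>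
           (\<forall>g. mild_solution \<sigma> W q f0 u (\<lambda>t. emb (v t)) g \<and> P_norm q g < \<infinity> \<longrightarrow>
                (\<forall>t\<in>{0..1}. AE x in lebesgue. g t x = f t x)) \<and>
           ((\<lambda>t. Lp_norm lebesgue q (f t - f0)) \<longlongrightarrow> 0) (at_right 0)"
proof -
  have M: "finite_measure (lebesgue_on {0..1::real})" "emeasure (lebesgue_on {0..1::real}) (space (lebesgue_on {0..1})) \<noteq> 0"
    by (rule finite_measure_lebesgue_on) (auto simp: emeasure_restrict_space)
  have d: "DIM('a) \<ge> 1" using DIM_positive[where 'a='a] by linarith
  obtain Q P where Q: "1 \<le> Q" "r > 1" "conj_exponent r = ennreal Q"
    and P: "P > 2" "1 / 2 + DIM('a) * (1 - 1 / Q) / 2 < 1 - 1 / P"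
      "\<And>h :: real \<Rightarrow> real. h \<in> Lp_space (lebesgue_on {0..1}) p \<Longrightarrow> h \<in> Lp_space (lebesgue_on {0..1}) (ennreal P)"
    by (rule real_exponents[OF d assms(4,5) M]) (rule that)
  obtain C where C: "C \<ge> 0" "\<And>w x. norm (emb w x) \<le> C * norm w"
    by (rule embedded_bound[OF assms(6)]) (rule that)
  have q: "q = ennreal Q"
    unfolding q_def by (rule Q)
  interpret mild_setting \<sigma> W Q P C r emb f0 u v
  proof (rule mild_setting.intro)
    show "linear (\<lambda>w. emb w x)" for x
      using assms(6) by (simp add: continuously_embedded_in_C1_def)
    show "emb w \<in> borel_measurable borel" for w
      using assms(6) by (intro C1_fields_bound(1)) (auto simp: continuously_embedded_in_C1_def)
    show "f0 \<in> Lp_space lebesgue (ennreal Q)"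
      using assms(7) by (simp add: q)
  qed (use assms Q P C in \<open>auto simp: bochner_Lp_def\<close>)
  obtain f where f: "mild_solution \<sigma> W q f0 u (\<lambda>t. emb (v t)) f" "P_norm q f < \<infinity>"
    "((\<lambda>t. Lp_norm lebesgue q (f t - f0)) \<longlongrightarrow> 0) (at_right 0)"
    using mild_exists unfolding q by blast
  show ?thesis
    using f mild_unique[OF _ _ f(1,2)[unfolded q]] unfolding q by blast
qed

end
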